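(* Let $H$ be a Hopf algebra with bijective antipode over a field $k$, and let $C$ be the base coalgebra of $H^{par}$. Then $H^{par}\cong\underline{C>\!\!\blacktriangleleft H}$ as coalgebras, where $C$ carries the partial left $H$-comodule coalgebra structure $$\lambda:C\to H\otimes C,\qquad \lambda(\overline E(x))=p(x_{(1)})S(p(x_{(3)}))\otimes\overline E(x_{(2)})\quad(x\in H^{par}).$$
   Context: $S$ denotes the antipode of $H$. A partial corepresentation of $H$ over a coalgebra $D$ is a linear map $\omega:D\to H$ with, for all $c\in D$: $\epsilon_H(\omega(c))=\epsilon_D(c)$; $\omega(c_{(1)})_{(1)}\otimes\omega(c_{(1)})_{(2)}S(\omega(c_{(2)}))=\omega(c_{(1)})\otimes\omega(c_{(2)})S(\omega(c_{(3)}))$; $\omega(c_{(1)})S(\omega(c_{(2)})_{(1)})\otimes\omega(c_{(2)})_{(2)}=\omega(c_{(1)})S(\omega(c_{(2)}))\otimes\omega(c_{(3)})$. $(C(H),p)$, $p:C(H)\to H$, is the cofree coalgebra over the vector space $H$. $H^{par}$ is the sum of all subcoalgebras $X\subseteq C(H)$ such that $p|_X$ is a partial corepresentation (the largest such subcoalgebra). Let $E:H^{par}\to H$, $E(x)=p(x_{(1)})S(p(x_{(2)}))$, let $\overline E:H^{par}\to C(H)$ be the unique coalgebra map with $p\circ\overline E=E$, and let $C=\mathrm{Im}(\overline E)$, a subcoalgebra of $C(H)$ called the base coalgebra of $H^{par}$. The map $\lambda$ in the claim is well defined and makes $C$ a (symmetric) partial left $H$-comodule coalgebra; write $\lambda(c)=c^{[-1]}\otimes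 c^{[0]}$. For such a $C$, the partial cosmash coproduct $\underline{C>\!\!\blacktriangleleft H}$ is the subspace of $C\otimes H$ spanned by the elements $c>\!\!\blacktriangleleft h=c_{(1)}\otimes {c_{(2)}}^{[-1]}\epsilon_C({c_{(2)}}^{[0]})h$ ($c\in C$, $h\in H$); it is a coalgebra with comultiplication $\underline\Delta(c>\!\!\blacktriangleleft h)=(c_{(1)}>\!\!\blacktriangleleft {c_{(2)}}^{[-1]}h_{(1)})\otimes({c_{(2)}}^{[0]}>\!\!\blacktriangleleft h_{(2)})$ and counit $\underline\epsilon(c>\!\!\blacktriangleleft h)=\epsilon_C(c)\epsilon_H(h)$. *)

theory Defs
  imports Complex_Main "HOL-Library.Poly_Mapping" "HOL-Library.FuncSet"
begin

text \<open>
  All vector spaces are subspaces \<open>vcarrier V\<close> of an ambient vector space whose underlying abelian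
  group is a type; in this way subcoalgebras are again objects of the same kind.
\<close>

record ('k, 'a) vspace =
  vcarrier :: "'a set"
  smult :: "'k \<Rightarrow> 'a \<Rightarrow> 'a"

definition is_vspace :: "('k::field, 'a::ab_group_add, 'm) vspace_scheme \<Rightarrow> bool" where
  "is_vspace V \<longleftrightarrow> vector_space (smult V) \<and> module.subspace (smult V) (vcarrier V)"

definition linear_map ::
  "('k::field, 'a::ab_group_add, 'm) vspace_scheme \<Rightarrow> ('k, 'b::ab_group_add, 'n) vspace_scheme \<Rightarrow>
    ('a \<Rightarrow> 'b) \<Rightarrow> bool" where
  "linear_map V W f \<longleftrightarrow>
     (\<forall>x\<in>vcarrier V. f x \<in> vcarrier W) \<and>
     (\<forall>x\<in>vcarrier V. \<forall>y\<in>vcarrier V. f (x + y) = f x + f y) \<and>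
     (\<forall>c. \<forall>x\<in>vcarrier V. f (smult V c x) = smult W c (f x))"

definition bilinear_map ::
  "('k::field, 'a::ab_group_add, 'm) vspace_scheme \<Rightarrow> ('k, 'b::ab_group_add, 'n) vspace_scheme \<Rightarrow>
    ('k, 'u::ab_group_add, 'o) vspace_scheme \<Rightarrow> ('a \<Rightarrow> 'b \<Rightarrow> 'u) \<Rightarrow> bool" where
  "bilinear_map V W U B \<longleftrightarrow>
     (\<forall>a\<in>vcarrier V. linear_map W U (B a)) \<and> (\<forall>b\<in>vcarrier W. linear_map V U (\<lambda>a. B a b))"

definition ground :: "('k::field, 'k) vspace" where
  "ground = \<lparr>vcarrier = UNIV, smult = (*)\<rparr>"


section \<open>Tensor products\<close>

text \<open>
  The tensor product of two vector spaces is the free vector space \<open>('a \<times> 'b) \<Rightarrow>\<^sub>0 'k\<close> on pairs modulo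
  the bilinearity relations. The quotient is realised inside the free vector space: \<open>nform\<close> is a
  linear idempotent whose kernel is the span of the relations, and a class is represented by its
  normal form. For subspaces \<open>V\<close>, \<open>W\<close> of the ambient spaces, \<open>V \<otimes> W\<close> is the span of the pure
  tensors \<open>a \<otimes> b\<close> with \<open>a \<in> V\<close>, \<open>b \<in> W\<close>; over a field this span is a tensor product of \<open>V\<close> and \<open>W\<close>
  in its own right (lemmas \<open>tlift_tens\<close> and \<open>linear_map_tlift\<close> below).
\<close>

definition fscale :: "'k::field \<Rightarrow> ('i \<Rightarrow>\<^sub>0 'k) \<Rightarrow> ('i \<Rightarrow>\<^sub>0 'k)" where
  "fscale c t = Poly_Mapping.map ((*) c) t"

abbreviation fpair :: "'a \<Rightarrow> 'b \<Rightarrow> ('a \<times> 'b) \<Rightarrow>\<^sub>0 'k::field" where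
  "fpair a b \<equiv> Poly_Mapping.single (a, b) 1"

definition tensor_rels ::
  "('k::field \<Rightarrow> 'a::ab_group_add \<Rightarrow> 'a) \<Rightarrow> ('k \<Rightarrow> 'b::ab_group_add \<Rightarrow> 'b) \<Rightarrow> ('a \<times> 'b \<Rightarrow>\<^sub>0 'k) set" where
  "tensor_rels sa sb =
     {fpair (a + a') b - fpair a b - fpair a' b | a a' b. True} \<union>
     {fpair a (b + b') - fpair a b - fpair a b' | a b b'. True} \<union>
     {fpair (sa c a) b - fscale c (fpair a b) | a b c. True} \<union>
     {fpair a (sb c b) - fscale c (fpair a b) | a b c. True}"

definition nform ::
  "('k::field \<Rightarrow> 'a::ab_group_add \<Rightarrow> 'a) \<Rightarrow> ('k \<Rightarrow> 'b::ab_group_add \<Rightarrow> 'b) \<Rightarrow>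
    ('a \<times> 'b \<Rightarrow>\<^sub>0 'k) \<Rightarrow> ('a \<times> 'b \<Rightarrow>\<^sub>0 'k)" where
  "nform sa sb = (SOME q. Vector_Spaces.linear fscale fscale q \<and> (\<forall>t. q (q t) = q t) \<and>
     {t. q t = 0} = module.span fscale (tensor_rels sa sb))"

definition tens ::
  "('k::field, 'a::ab_group_add, 'm) vspace_scheme \<Rightarrow> ('k, 'b::ab_group_add, 'n) vspace_scheme \<Rightarrow>
    'a \<Rightarrow> 'b \<Rightarrow> ('a \<times> 'b \<Rightarrow>\<^sub>0 'k)" where
  "tens V W a b = nform (smult V) (smult W) (fpair a b)"

definition tensor ::
  "('k::field, 'a::ab_group_add, 'm) vspace_scheme \<Rightarrow> ('k, 'b::ab_group_add, 'n) vspace_scheme \<Rightarrow>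
    ('k, 'a \<times> 'b \<Rightarrow>\<^sub>0 'k) vspace" where
  "tensor V W =
     \<lparr>vcarrier = module.span fscale {tens V W a b | a b. a \<in> vcarrier V \<and> b \<in> vcarrier W},
      smult = fscale\<rparr>"

text \<open>
  \<open>tlift V W U B\<close> is the linear map \<open>V \<otimes> W \<rightarrow> U\<close>, \<open>a \<otimes> b \<mapsto> B a b\<close>, for a map \<open>B\<close> that is bilinear
  on \<open>V \<times> W\<close>: it sums \<open>B\<close> over a representation of the tensor by elements of \<open>V \<times> W\<close>.
\<close>

definition feval :: "('k::field, 'u::ab_group_add, 'o) vspace_scheme \<Rightarrow> ('a \<Rightarrow> 'b \<Rightarrow> 'u) \<Rightarrow>
    ('a \<times> 'b \<Rightarrow>\<^sub>0 'k) \<Rightarrow> 'u" where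
  "feval U B s = (\<Sum>(a, b)\<in>Poly_Mapping.keys s. smult U (Poly_Mapping.lookup s (a, b)) (B a b))"

definition tlift ::
  "('k::field, 'a::ab_group_add, 'm) vspace_scheme \<Rightarrow> ('k, 'b::ab_group_add, 'n) vspace_scheme \<Rightarrow>
    ('k, 'u::ab_group_add, 'o) vspace_scheme \<Rightarrow> ('a \<Rightarrow> 'b \<Rightarrow> 'u) \<Rightarrow> ('a \<times> 'b \<Rightarrow>\<^sub>0 'k) \<Rightarrow> 'u" where
  "tlift V W U B t = feval U B
     (SOME s. Poly_Mapping.keys s \<subseteq> vcarrier V \<times> vcarrier W \<and> nform (smult V) (smult W) s = t)"

lemma lookup_fscale [simp]: "Poly_Mapping.lookup (fscale c t) k = c * Poly_Mapping.lookup t k"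
  by (simp add: fscale_def Poly_Mapping.map.rep_eq when_def)

lemma vector_space_fscale: "vector_space (fscale :: 'k::field \<Rightarrow> ('i \<Rightarrow>\<^sub>0 'k) \<Rightarrow> _)"
  by unfold_locales (auto intro!: poly_mapping_eqI simp: lookup_add algebra_simps)

interpretation fs: vector_space "fscale :: 'k::field \<Rightarrow> ('i \<Rightarrow>\<^sub>0 'k) \<Rightarrow> _"
  by (rule vector_space_fscale)

lemma ex_projection:
  assumes "vector_space (s :: 'k::field \<Rightarrow> 'v::ab_group_add \<Rightarrow> 'v)"
  shows "\<exists>q. Vector_Spaces.linear s s q \<and> (\<forall>t. q (q t) = q t) \<and> {t. q t = 0} = module.span s N"
proof -
  interpret vector_space s by (rule assms)
  interpret pp: vector_space_pair s s ..
  obtain B where B: "B \<subseteq> N" "independent B" "N \<subseteq> span B"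
    using maximal_independent_subset[of N] by blast
  have spB: "span B = span N"
    using B span_mono[of B N] span_minimal[of N "span B"] by auto
  obtain B' where B': "B \<subseteq> B'" "independent B'" "UNIV \<subseteq> span B'"
    using maximal_independent_subset_extend[of B UNIV] B(2) by auto
  define q where "q = pp.construct B' (\<lambda>b. if b \<in> B then 0 else b)"
  have lin: "Vector_Spaces.linear s s q"
    unfolding q_def by (rule pp.linear_construct[OF B'(2)])
  interpret q: Vector_Spaces.linear s s q by (rule lin)
  have qB: "q b = (if b \<in> B then 0 else b)" if "b \<in> B'" for b
    unfolding q_def using pp.construct_basis[OF B'(2) that] by simp
  have kerN: "q t = 0" if "t \<in> span B" for t
  proof (rule q.eq_0_on_span[OF _ that])
    show "q x = 0" if "x \<in> B" for x
      using qB[of x] that B'(1) by (simp add: subsetD)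
  qed
  have diff: "t - q t \<in> span B" for t
  proof -
    have "t \<in> span B'" using B'(3) by auto
    then show ?thesis
    proof (induction rule: span_induct_alt)
      case base
      then show ?case by (simp add: q.zero span_zero)
    next
      case (step c x y)
      have "x - q x \<in> span B" using qB[OF step(1)] by (auto simp: span_base span_zero)
      then have "s c (x - q x) + (y - q y) \<in> span B"
        using step by (intro span_add span_scale) auto
      moreover have "s c (x - q x) + (y - q y) = (s c x + y) - q (s c x + y)"
        by (simp add: q.add q.scale scale_right_diff_distrib algebra_simps)
      ultimately show ?case by simp
    qed
  qed
  have "q (q t) = q t" for t
    using kerN[OF diff[of t]] by (simp add: q.diff)
  moreover have "{t. q t = 0} = span N"
    using kerN diff spB by (metis (mono_tags, lifting) Collect_cong Collect_mem_eq diff_0_right)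
  ultimately show ?thesis using lin by blast
qed

lemma nform_props:
  shows linear_nform: "Vector_Spaces.linear fscale fscale (nform sa sb)"
    and nform_idem: "nform sa sb (nform sa sb t) = nform sa sb t"
    and ker_nform: "{t. nform sa sb t = 0} = module.span fscale (tensor_rels sa sb)"
proof -
  have "Vector_Spaces.linear fscale fscale (nform sa sb) \<and>
    (\<forall>t. nform sa sb (nform sa sb t) = nform sa sb t) \<and>
    {t. nform sa sb t = 0} = module.span fscale (tensor_rels sa sb)"
    using someI_ex[OF ex_projection[OF vector_space_fscale, of "tensor_rels sa sb"]]
    unfolding nform_def .
  then show "Vector_Spaces.linear fscale fscale (nform sa sb)"
    "nform sa sb (nform sa sb t) = nform sa sb t"
    "{t. nform sa sb t = 0} = module.span fscale (tensor_rels sa sb)"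
    by blast+
qed

lemma nform_eq_iff:
  "nform sa sb s = nform sa sb t \<longleftrightarrow> s - t \<in> module.span fscale (tensor_rels sa sb)"
proof -
  interpret q: Vector_Spaces.linear fscale fscale "nform sa sb" by (rule linear_nform)
  have "nform sa sb s = nform sa sb t \<longleftrightarrow> nform sa sb (s - t) = 0" by (simp add: q.diff)
  then show ?thesis using ker_nform[of sa sb] by blast
qed

lemma tens_add_left: "tens V W (a + a') b = tens V W a b + tens V W a' b"
  and tens_add_right: "tens V W a (b + b') = tens V W a b + tens V W a b'"
  and tens_smult_left: "tens V W (smult V c a) b = fscale c (tens V W a b)"
  and tens_smult_right: "tens V W a (smult W c b) = fscale c (tens V W a b)"
proof -
  interpret q: Vector_Spaces.linear fscale fscale "nform (smult V) (smult W)" by (rule linear_nform)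
  have rel: "nform (smult V) (smult W) r = 0" if "r \<in> tensor_rels (smult V) (smult W)" for r
    using ker_nform[of "smult V" "smult W"] fs.span_base[OF that] by blast
  have "fpair (a + a') b - fpair a b - fpair a' b \<in> tensor_rels (smult V) (smult W)"
    "fpair a (b + b') - fpair a b - fpair a b' \<in> tensor_rels (smult V) (smult W)"
    "fpair (smult V c a) b - fscale c (fpair a b) \<in> tensor_rels (smult V) (smult W)"
    "fpair a (smult W c b) - fscale c (fpair a b) \<in> tensor_rels (smult V) (smult W)"
    unfolding tensor_rels_def by blast+
  note this[THEN rel]
  then show "tens V W (a + a') b = tens V W a b + tens V W a' b"
    "tens V W a (b + b') = tens V W a b + tens V W a b'"
    "tens V W (smult V c a) b = fscale c (tens V W a b)"
    "tens V W a (smult W c b) = fscale c (tens V W a b)"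
    unfolding tens_def by (simp_all add: q.diff q.add q.scale diff_diff_eq)
qed

lemma feval_superset:
  assumes "vector_space (smult U)" "finite K" "Poly_Mapping.keys s \<subseteq> K"
  shows "feval U B s = (\<Sum>(a, b)\<in>K. smult U (Poly_Mapping.lookup s (a, b)) (B a b))"
proof -
  interpret vector_space "smult U" by fact
  show ?thesis unfolding feval_def
    by (rule sum.mono_neutral_left) (use assms in \<open>auto simp: in_keys_iff\<close>)
qed

lemma linear_feval:
  assumes "vector_space (smult U)"
  shows "Vector_Spaces.linear fscale (smult U) (feval U B)"
proof -
  interpret vector_space "smult U" by fact
  have "feval U B (s + t) = feval U B s + feval U B t" for s t
  proof -
    let ?K = "Poly_Mapping.keys s \<union> Poly_Mapping.keys t"
    have K: "finite ?K" "Poly_Mapping.keys (s + t) \<subseteq> ?K" using keys_add[of s t] by simp_all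
    show ?thesis
      using feval_superset[OF assms K, of B] feval_superset[OF assms K(1), of s B]
        feval_superset[OF assms K(1), of t B]
      by (auto simp: lookup_add scale_left_distrib sum.distrib case_prod_unfold)
  qed
  moreover have "feval U B (fscale c s) = smult U c (feval U B s)" for c s
  proof -
    have "Poly_Mapping.keys (fscale c s) \<subseteq> Poly_Mapping.keys s" by (auto simp: in_keys_iff)
    from feval_superset[OF assms _ this, of B] show ?thesis
      by (simp add: feval_def scale_sum_right case_prod_unfold)
  qed
  ultimately show ?thesis
    by (simp add: Vector_Spaces.linear_iff vector_space_fscale assms)
qed

lemma feval_fpair:
  assumes "vector_space (smult U)"
  shows "feval U B (fpair a b) = B a b"
proof -
  interpret vector_space "smult U" by fact
  show ?thesis by (simp add: feval_def)
qed

lemma ex_retraction: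
  assumes "is_vspace V"
  shows "\<exists>P. (\<forall>x. P x \<in> vcarrier V) \<and> (\<forall>x\<in>vcarrier V. P x = x) \<and>
    (\<forall>x y. P (x + y) = P x + P y) \<and> (\<forall>c x. P (smult V c x) = smult V c (P x))"
proof -
  interpret vector_space "smult V" using assms by (simp add: is_vspace_def)
  have sub: "subspace (vcarrier V)" using assms by (simp add: is_vspace_def)
  obtain q where q: "Vector_Spaces.linear (smult V) (smult V) q" "\<And>t. q (q t) = q t"
    "{t. q t = 0} = span (vcarrier V)"
    using ex_projection[OF vector_space_axioms, of "vcarrier V"] by blast
  interpret q: Vector_Spaces.linear "smult V" "smult V" q by (rule q)
  have ker: "q t = 0 \<longleftrightarrow> t \<in> vcarrier V" for t
    using q(3) span_eq_iff[THEN iffD2, OF sub] by blast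
  show ?thesis
    using ker by (intro exI[of _ "\<lambda>x. x - q x"])
      (auto simp: q.add q.diff q.scale scale_right_diff_distrib q(2)[simplified] ker[symmetric])
qed

lemma feval_cong_nform:
  assumes V: "is_vspace V" and W: "is_vspace W" and U: "is_vspace U"
    and B: "bilinear_map V W U B"
    and s: "Poly_Mapping.keys s \<subseteq> vcarrier V \<times> vcarrier W"
    and t: "Poly_Mapping.keys t \<subseteq> vcarrier V \<times> vcarrier W"
    and eq: "nform (smult V) (smult W) s = nform (smult V) (smult W) t"
  shows "feval U B s = feval U B t"
proof -
  obtain P where P: "\<And>x. P x \<in> vcarrier V" "\<And>x. x \<in> vcarrier V \<Longrightarrow> P x = x"
    "\<And>x y. P (x + y) = P x + P y" "\<And>c x. P (smult V c x) = smult V c (P x)"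
    using ex_retraction[OF V] by blast
  obtain Q where Q: "\<And>x. Q x \<in> vcarrier W" "\<And>x. x \<in> vcarrier W \<Longrightarrow> Q x = x"
    "\<And>x y. Q (x + y) = Q x + Q y" "\<And>c x. Q (smult W c x) = smult W c (Q x)"
    using ex_retraction[OF W] by blast
  define B' where "B' a b = B (P a) (Q b)" for a b
  have vU: "vector_space (smult U)" using U by (simp add: is_vspace_def)
  interpret e: Vector_Spaces.linear fscale "smult U" "feval U B'" by (rule linear_feval[OF vU])
  have BB: "B' (a + a') b = B' a b + B' a' b" "B' a (b + b') = B' a b + B' a b'"
    "B' (smult V c a) b = smult U c (B' a b)" "B' a (smult W c b) = smult U c (B' a b)"
    for a a' b b' c
    using B P Q unfolding bilinear_map_def linear_map_def B'_def by simp_all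
  have "feval U B' r = 0" if "r \<in> tensor_rels (smult V) (smult W)" for r
    using that unfolding tensor_rels_def
    by (auto simp: e.diff e.scale feval_fpair[OF vU] BB)
  then have "feval U B' (s - t) = 0"
    using e.eq_0_on_span eq[unfolded nform_eq_iff] by blast
  then have "feval U B' s = feval U B' t" by (simp add: e.diff)
  moreover have "feval U B' r = feval U B r"
    if "Poly_Mapping.keys r \<subseteq> vcarrier V \<times> vcarrier W" for r
    unfolding feval_def B'_def using that P(2) Q(2)
    by (intro sum.cong refl) auto
  ultimately show ?thesis using s t by simp
qed

lemma tlift_nform:
  assumes "is_vspace V" "is_vspace W" "is_vspace U" "bilinear_map V W U B"
    and s: "Poly_Mapping.keys s \<subseteq> vcarrier V \<times> vcarrier W"
  shows "tlift V W U B (nform (smult V) (smult W) s) = feval U B s"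
  unfolding tlift_def
proof (rule someI2[where a = s])
  show "Poly_Mapping.keys s \<subseteq> vcarrier V \<times> vcarrier W \<and>
    nform (smult V) (smult W) s = nform (smult V) (smult W) s" using s by simp
qed (use assms feval_cong_nform in blast)

lemma tlift_tens:
  assumes "is_vspace V" "is_vspace W" "is_vspace U" "bilinear_map V W U B"
    and "a \<in> vcarrier V" "b \<in> vcarrier W"
  shows "tlift V W U B (tens V W a b) = B a b"
  using tlift_nform[of V W U B "fpair a b"] assms feval_fpair[of U B a b]
  by (simp add: tens_def is_vspace_def)

lemma tensor_representation:
  assumes "t \<in> vcarrier (tensor V W)"
  obtains s where "Poly_Mapping.keys s \<subseteq> vcarrier V \<times> vcarrier W" "t = nform (smult V) (smult W) s"
proof -
  interpret q: Vector_Spaces.linear fscale fscale "nform (smult V) (smult W)" by (rule linear_nform)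
  have "t \<in> fs.span {tens V W a b | a b. a \<in> vcarrier V \<and> b \<in> vcarrier W}"
    using assms by (simp add: tensor_def)
  then have "\<exists>s. Poly_Mapping.keys s \<subseteq> vcarrier V \<times> vcarrier W \<and> t = nform (smult V) (smult W) s"
  proof (induction rule: fs.span_induct_alt)
    case base
    then show ?case by (intro exI[of _ 0]) (simp add: q.zero)
  next
    case (step c x y)
    obtain a b where ab: "x = tens V W a b" "a \<in> vcarrier V" "b \<in> vcarrier W" using step by blast
    obtain s where s: "Poly_Mapping.keys s \<subseteq> vcarrier V \<times> vcarrier W"
      "y = nform (smult V) (smult W) s" using step by blast
    have "Poly_Mapping.keys (fscale c (fpair a b)) \<subseteq> {(a, b)}"
      by (auto simp: in_keys_iff lookup_single when_def split: if_splits)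
    then have "Poly_Mapping.keys (fscale c (fpair a b) + s) \<subseteq> vcarrier V \<times> vcarrier W"
      using ab s keys_add[of "fscale c (fpair a b)" s] by blast
    then show ?case using ab s
      by (intro exI[of _ "fscale c (fpair a b) + s"]) (simp add: q.add q.scale tens_def)
  qed
  then show ?thesis using that by blast
qed

lemma linear_map_tlift:
  assumes "is_vspace V" "is_vspace W" "is_vspace U" "bilinear_map V W U B"
  shows "linear_map (tensor V W) U (tlift V W U B)"
proof -
  note V = assms(1) and W = assms(2) and U = assms(3) and B = assms(4)
  have vU: "vector_space (smult U)" using U by (simp add: is_vspace_def)
  interpret u: vector_space "smult U" by (rule vU)
  interpret q: Vector_Spaces.linear fscale fscale "nform (smult V) (smult W)" by (rule linear_nform)
  interpret e: Vector_Spaces.linear fscale "smult U" "feval U B" by (rule linear_feval[OF vU])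
  have subU: "u.subspace (vcarrier U)" using U by (simp add: is_vspace_def)
  note L = tlift_nform[OF assms]
  show ?thesis unfolding linear_map_def
  proof (intro conjI ballI allI)
    fix x assume "x \<in> vcarrier (tensor V W)"
    then obtain s where s: "Poly_Mapping.keys s \<subseteq> vcarrier V \<times> vcarrier W"
      "x = nform (smult V) (smult W) s" by (rule tensor_representation)
    have "feval U B s \<in> vcarrier U" unfolding feval_def
      using s(1) B by (intro u.subspace_sum[OF subU])
        (auto simp: bilinear_map_def linear_map_def intro!: u.subspace_scale[OF subU])
    then show "tlift V W U B x \<in> vcarrier U" using L[OF s(1)] s(2) by simp
    fix y assume "y \<in> vcarrier (tensor V W)"
    then obtain t where t: "Poly_Mapping.keys t \<subseteq> vcarrier V \<times> vcarrier W"
      "y = nform (smult V) (smult W) t" by (rule tensor_representation)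
    have "Poly_Mapping.keys (s + t) \<subseteq> vcarrier V \<times> vcarrier W"
      using s t keys_add[of s t] by blast
    then show "tlift V W U B (x + y) = tlift V W U B x + tlift V W U B y"
      using L[of "s + t"] L[OF s(1)] L[OF t(1)] s(2) t(2) by (simp add: q.add e.add)
  next
    fix c x assume "x \<in> vcarrier (tensor V W)"
    then obtain s where s: "Poly_Mapping.keys s \<subseteq> vcarrier V \<times> vcarrier W"
      "x = nform (smult V) (smult W) s" by (rule tensor_representation)
    have "Poly_Mapping.keys (fscale c s) \<subseteq> vcarrier V \<times> vcarrier W"
      using s(1) by (auto simp: in_keys_iff)
    then show "tlift V W U B (smult (tensor V W) c x) = smult U c (tlift V W U B x)"
      using L[of "fscale c s"] L[OF s(1)] s(2) by (simp add: q.scale e.scale tensor_def)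
  qed
qed


section \<open>Coalgebras and Hopf algebras\<close>

record (overloaded) ('k, 'a) coalg = "('k, 'a) vspace" +
  comult :: "'a \<Rightarrow> ('a \<times> 'a \<Rightarrow>\<^sub>0 'k)"
  counit :: "'a \<Rightarrow> 'k"

text \<open>
  Sweedler notation: \<open>sweedler D U x (\<lambda>x1 x2. B x1 x2)\<close> is the element \<open>B x\<^sub>(\<^sub>1\<^sub>) x\<^sub>(\<^sub>2\<^sub>)\<close> of \<open>U\<close>.
  Only the scalar multiplication of \<open>U\<close> matters.
\<close>

definition sweedler ::
  "('k::field, 'a::ab_group_add, 'm) coalg_scheme \<Rightarrow> ('k, 'u::ab_group_add, 'o) vspace_scheme \<Rightarrow>
    'a \<Rightarrow> ('a \<Rightarrow> 'a \<Rightarrow> 'u) \<Rightarrow> 'u" where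
  "sweedler D U x B = tlift D D U B (comult D x)"

definition sweedler3 ::
  "('k::field, 'a::ab_group_add, 'm) coalg_scheme \<Rightarrow> ('k, 'u::ab_group_add, 'o) vspace_scheme \<Rightarrow>
    'a \<Rightarrow> ('a \<Rightarrow> 'a \<Rightarrow> 'a \<Rightarrow> 'u) \<Rightarrow> 'u" where
  "sweedler3 D U x B = sweedler D U x (\<lambda>x1 y. sweedler D U y (\<lambda>x2 x3. B x1 x2 x3))"

definition coalgebra :: "('k::field, 'a::ab_group_add, 'm) coalg_scheme \<Rightarrow> bool" where
  "coalgebra D \<longleftrightarrow>
     is_vspace D \<and>
     linear_map D (tensor D D) (comult D) \<and>
     linear_map D ground (counit D) \<and>
     (\<forall>x\<in>vcarrier D.
        sweedler D (tensor D (tensor D D)) x (\<lambda>y x3.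
          sweedler D (tensor D (tensor D D)) y (\<lambda>x1 x2. tens D (tensor D D) x1 (tens D D x2 x3))) =
        sweedler D (tensor D (tensor D D)) x (\<lambda>x1 y. tens D (tensor D D) x1 (comult D y))) \<and>
     (\<forall>x\<in>vcarrier D. sweedler D D x (\<lambda>x1 x2. smult D (counit D x1) x2) = x) \<and>
     (\<forall>x\<in>vcarrier D. sweedler D D x (\<lambda>x1 x2. smult D (counit D x2) x1) = x)"

definition coalgebra_map ::
  "('k::field, 'a::ab_group_add, 'm) coalg_scheme \<Rightarrow> ('k, 'b::ab_group_add, 'n) coalg_scheme \<Rightarrow>
    ('a \<Rightarrow> 'b) \<Rightarrow> bool" where
  "coalgebra_map D E f \<longleftrightarrow>
     linear_map D E f \<and>
     (\<forall>x\<in>vcarrier D.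
        comult E (f x) = sweedler D (tensor E E) x (\<lambda>x1 x2. tens E E (f x1) (f x2)) \<and>
        counit E (f x) = counit D x)"

definition coalgebra_isomorphic ::
  "('k::field, 'a::ab_group_add, 'm) coalg_scheme \<Rightarrow> ('k, 'b::ab_group_add, 'n) coalg_scheme \<Rightarrow> bool" where
  "coalgebra_isomorphic D E \<longleftrightarrow>
     coalgebra D \<and> coalgebra E \<and>
     (\<exists>f. coalgebra_map D E f \<and> bij_betw f (vcarrier D) (vcarrier E))"

definition restrict_to :: "('k, 'a, 'm) vspace_scheme \<Rightarrow> 'a set \<Rightarrow> ('k, 'a, 'm) vspace_scheme" where
  "restrict_to D X = D\<lparr>vcarrier := X\<rparr>"

definition subcoalgebra :: "'a set \<Rightarrow> ('k::field, 'a::ab_group_add) coalg \<Rightarrow> bool" where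
  "subcoalgebra X D \<longleftrightarrow>
     module.subspace (smult D) X \<and> X \<subseteq> vcarrier D \<and>
     (\<forall>x\<in>X. comult D x \<in> vcarrier (tensor (restrict_to D X) (restrict_to D X)))"

text \<open>The algebra structure of a Hopf algebra is the ring structure of its underlying type.\<close>

record (overloaded) ('k, 'h) hopf = "('k, 'h) coalg" +
  antipode :: "'h \<Rightarrow> 'h"

definition hopf_algebra :: "('k::field, 'h::ring_1) hopf \<Rightarrow> bool" where
  "hopf_algebra H \<longleftrightarrow>
     coalgebra H \<and> vcarrier H = UNIV \<and>
     (\<forall>c x y. smult H c (x * y) = smult H c x * y \<and> smult H c (x * y) = x * smult H c y) \<and>
     (\<forall>x y. comult H (x * y) = sweedler H (tensor H H) x (\<lambda>x1 x2.
        sweedler H (tensor H H) y (\<lambda>y1 y2. tens H H (x1 * y1) (x2 * y2)))) \<and>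
     comult H 1 = tens H H 1 1 \<and>
     (\<forall>x y. counit H (x * y) = counit H x * counit H y) \<and>
     counit H 1 = 1 \<and>
     linear_map H H (antipode H) \<and>
     (\<forall>x. sweedler H H x (\<lambda>x1 x2. antipode H x1 * x2) = smult H (counit H x) 1) \<and>
     (\<forall>x. sweedler H H x (\<lambda>x1 x2. x1 * antipode H x2) = smult H (counit H x) 1)"


section \<open>Partial corepresentations and the universal coalgebra\<close>

definition partial_corepresentation ::
  "('k::field, 'h::ring_1) hopf \<Rightarrow> ('k, 'd::ab_group_add) coalg \<Rightarrow> ('d \<Rightarrow> 'h) \<Rightarrow> bool" where
  "partial_corepresentation H D \<omega> \<longleftrightarrow>
     linear_map D H \<omega> \<and>
     (\<forall>c\<in>vcarrier D. counit H (\<omega> c) = counit D c) \<and>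
     (\<forall>c\<in>vcarrier D.
        sweedler D (tensor H H) c (\<lambda>c1 c2. sweedler H (tensor H H) (\<omega> c1) (\<lambda>g1 g2.
          tens H H g1 (g2 * antipode H (\<omega> c2)))) =
        sweedler3 D (tensor H H) c (\<lambda>c1 c2 c3. tens H H (\<omega> c1) (\<omega> c2 * antipode H (\<omega> c3)))) \<and>
     (\<forall>c\<in>vcarrier D.
        sweedler D (tensor H H) c (\<lambda>c1 c2. sweedler H (tensor H H) (\<omega> c2) (\<lambda>g1 g2.
          tens H H (\<omega> c1 * antipode H g1) g2)) =
        sweedler3 D (tensor H H) c (\<lambda>c1 c2 c3. tens H H (\<omega> c1 * antipode H (\<omega> c2)) (\<omega> c3)))"

text \<open>
  HOL cannot quantify over types inside a formula, so the universal property of a cofree coalgebra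
  is stated for all test coalgebras whose ambient abelian group is a given type \<open>'d\<close> (with an
  arbitrary scalar multiplication and an arbitrary carrier inside \<open>'d\<close>). A cofree coalgebra in the
  usual sense satisfies this for every \<open>'d\<close>, so assuming it only for some types is the weaker hypothesis.
\<close>

definition cofree_coalgebra ::
  "'d::ab_group_add itself \<Rightarrow> ('k::field, 'v::ab_group_add, 'm) vspace_scheme \<Rightarrow>
    ('k, 'c::ab_group_add) coalg \<Rightarrow> ('c \<Rightarrow> 'v) \<Rightarrow> bool" where
  "cofree_coalgebra (TYPE('d)) V C p \<longleftrightarrow>
     coalgebra C \<and> linear_map C V p \<and>
     (\<forall>(D :: ('k, 'd) coalg) f. coalgebra D \<and> linear_map D V f \<longrightarrow>
        (\<exists>!F. coalgebra_map D C F \<and> (\<forall>x\<in>vcarrier D. p (F x) = f x) \<and>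
          F \<in> extensional (vcarrier D)))"

definition Hpar ::
  "('k::field, 'h::ring_1) hopf \<Rightarrow> ('k, 'c::ab_group_add) coalg \<Rightarrow> ('c \<Rightarrow> 'h) \<Rightarrow> ('k, 'c) coalg" where
  "Hpar H CH p = restrict_to CH (module.span (smult CH)
     (\<Union>{X. subcoalgebra X CH \<and> partial_corepresentation H (restrict_to CH X) p}))"

definition E_map ::
  "('k::field, 'h::ring_1) hopf \<Rightarrow> ('k, 'c::ab_group_add) coalg \<Rightarrow> ('c \<Rightarrow> 'h) \<Rightarrow> 'c \<Rightarrow> 'h" where
  "E_map H CH p x = sweedler (Hpar H CH p) H x (\<lambda>x1 x2. p x1 * antipode H (p x2))"

definition Ebar ::
  "('k::field, 'h::ring_1) hopf \<Rightarrow> ('k, 'c::ab_group_add) coalg \<Rightarrow> ('c \<Rightarrow> 'h) \<Rightarrow> 'c \<Rightarrow> 'c" where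
  "Ebar H CH p = (THE F. coalgebra_map (Hpar H CH p) CH F \<and>
     (\<forall>x\<in>vcarrier (Hpar H CH p). p (F x) = E_map H CH p x) \<and>
     F \<in> extensional (vcarrier (Hpar H CH p)))"

definition base_coalgebra ::
  "('k::field, 'h::ring_1) hopf \<Rightarrow> ('k, 'c::ab_group_add) coalg \<Rightarrow> ('c \<Rightarrow> 'h) \<Rightarrow> ('k, 'c) coalg" where
  "base_coalgebra H CH p = restrict_to CH (Ebar H CH p ` vcarrier (Hpar H CH p))"


section \<open>Partial comodule coalgebras and partial cosmash coproducts\<close>

text \<open>\<open>coact H C l U c (\<lambda>g d. B g d)\<close> is \<open>B c\<^sup>[\<^sup>-\<^sup>1\<^sup>] c\<^sup>[\<^sup>0\<^sup>]\<close> for the coaction \<open>l\<close>.\<close>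

definition coact ::
  "('k::field, 'h::ring_1) hopf \<Rightarrow> ('k, 'c::ab_group_add) coalg \<Rightarrow> ('c \<Rightarrow> ('h \<times> 'c \<Rightarrow>\<^sub>0 'k)) \<Rightarrow>
    ('k, 'u::ab_group_add, 'o) vspace_scheme \<Rightarrow> 'c \<Rightarrow> ('h \<Rightarrow> 'c \<Rightarrow> 'u) \<Rightarrow> 'u" where
  "coact H C l U c B = tlift H C U B (l c)"

text \<open>
  The axioms are: \<open>\<epsilon>(c\<^sup>[\<^sup>-\<^sup>1\<^sup>]) c\<^sup>[\<^sup>0\<^sup>] = c\<close>; comultiplicativity of the coaction; and partial
  coassociativity in its two forms,
  \<open>(I \<otimes> \<lambda>)\<lambda>(c) = c\<^sub>1\<^sup>[\<^sup>-\<^sup>1\<^sup>]\<epsilon>(c\<^sub>1\<^sup>[\<^sup>0\<^sup>]) c\<^sub>2\<^sup>[\<^sup>-\<^sup>1\<^sup>]\<^sub>(\<^sub>1\<^sub>) \<otimes> c\<^sub>2\<^sup>[\<^sup>-\<^sup>1\<^sup>]\<^sub>(\<^sub>2\<^sub>) \<otimes> c\<^sub>2\<^sup>[\<^sup>0\<^sup>]\<close> and (symmetry)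
  \<open>(I \<otimes> \<lambda>)\<lambda>(c) = c\<^sub>1\<^sup>[\<^sup>-\<^sup>1\<^sup>]\<^sub>(\<^sub>1\<^sub>) c\<^sub>2\<^sup>[\<^sup>-\<^sup>1\<^sup>]\<epsilon>(c\<^sub>2\<^sup>[\<^sup>0\<^sup>]) \<otimes> c\<^sub>1\<^sup>[\<^sup>-\<^sup>1\<^sup>]\<^sub>(\<^sub>2\<^sub>) \<otimes> c\<^sub>1\<^sup>[\<^sup>0\<^sup>]\<close>.
\<close>

definition symmetric_partial_comodule_coalgebra ::
  "('k::field, 'h::ring_1) hopf \<Rightarrow> ('k, 'c::ab_group_add) coalg \<Rightarrow> ('c \<Rightarrow> ('h \<times> 'c \<Rightarrow>\<^sub>0 'k)) \<Rightarrow> bool" where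
  "symmetric_partial_comodule_coalgebra H C l \<longleftrightarrow>
     coalgebra C \<and> linear_map C (tensor H C) l \<and>
     (\<forall>c\<in>vcarrier C. coact H C l C c (\<lambda>g d. smult C (counit H g) d) = c) \<and>
     (\<forall>c\<in>vcarrier C.
        coact H C l (tensor H (tensor C C)) c (\<lambda>g d. tens H (tensor C C) g (comult C d)) =
        sweedler C (tensor H (tensor C C)) c (\<lambda>c1 c2.
          coact H C l (tensor H (tensor C C)) c1 (\<lambda>g1 d1.
          coact H C l (tensor H (tensor C C)) c2 (\<lambda>g2 d2.
            tens H (tensor C C) (g1 * g2) (tens C C d1 d2))))) \<and>
     (\<forall>c\<in>vcarrier C.
        coact H C l (tensor H (tensor H C)) c (\<lambda>g d. tens H (tensor H C) g (l d)) =
        sweedler C (tensor H (tensor H C)) c (\<lambda>c1 c2.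
          coact H C l (tensor H (tensor H C)) c1 (\<lambda>g d.
          coact H C l (tensor H (tensor H C)) c2 (\<lambda>g' d'.
          sweedler H (tensor H (tensor H C)) g' (\<lambda>g1 g2.
            tens H (tensor H C) (smult H (counit C d) (g * g1)) (tens H C g2 d')))))) \<and>
     (\<forall>c\<in>vcarrier C.
        coact H C l (tensor H (tensor H C)) c (\<lambda>g d. tens H (tensor H C) g (l d)) =
        sweedler C (tensor H (tensor H C)) c (\<lambda>c1 c2.
          coact H C l (tensor H (tensor H C)) c1 (\<lambda>g d.
          coact H C l (tensor H (tensor H C)) c2 (\<lambda>g' d'.
          sweedler H (tensor H (tensor H C)) g (\<lambda>g1 g2.
            tens H (tensor H C) (smult H (counit C d') (g1 * g')) (tens H C g2 d))))))"

text \<open>The generator \<open>c >\<blacktriangleleft> h\<close> of the partial cosmash coproduct.\<close>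

definition cosmash_gen ::
  "('k::field, 'h::ring_1) hopf \<Rightarrow> ('k, 'c::ab_group_add) coalg \<Rightarrow> ('c \<Rightarrow> ('h \<times> 'c \<Rightarrow>\<^sub>0 'k)) \<Rightarrow>
    'c \<Rightarrow> 'h \<Rightarrow> ('c \<times> 'h \<Rightarrow>\<^sub>0 'k)" where
  "cosmash_gen H C l c h = sweedler C (tensor C H) c (\<lambda>c1 c2.
     coact H C l (tensor C H) c2 (\<lambda>g d. tens C H c1 (smult H (counit C d) (g * h))))"

text \<open>
  \<open>R\<close> is the partial cosmash coproduct of \<open>C\<close> and \<open>H\<close>. The structure maps are given on the spanning
  elements \<open>c >\<blacktriangleleft> h\<close>; being linear, they are determined by these values.
\<close>

definition is_partial_cosmash_coproduct ::
  "('k::field, 'h::ring_1) hopf \<Rightarrow> ('k, 'c::ab_group_add) coalg \<Rightarrow> ('c \<Rightarrow> ('h \<times> 'c \<Rightarrow>\<^sub>0 'k)) \<Rightarrow>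
    ('k, 'c \<times> 'h \<Rightarrow>\<^sub>0 'k) coalg \<Rightarrow> bool" where
  "is_partial_cosmash_coproduct H C l R \<longleftrightarrow>
     smult R = smult (tensor C H) \<and>
     vcarrier R = module.span (smult (tensor C H)) {cosmash_gen H C l c h | c h. c \<in> vcarrier C \<and> h \<in> vcarrier H} \<and>
     coalgebra R \<and>
     (\<forall>c\<in>vcarrier C. \<forall>h\<in>vcarrier H.
        comult R (cosmash_gen H C l c h) =
          sweedler C (tensor R R) c (\<lambda>c1 c2.
            coact H C l (tensor R R) c2 (\<lambda>g d.
              sweedler H (tensor R R) h (\<lambda>h1 h2.
                tens R R (cosmash_gen H C l c1 (g * h1)) (cosmash_gen H C l d h2)))) \<and>
        counit R (cosmash_gen H C l c h) = counit C c * counit H h)"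

end

theory Submission
  imports Defs
begin

text \<open>
  Write \<open>D = H\<^sup>p\<^sup>a\<^sup>r\<close> and think of the dual situation: a partial representation \<open>h \<mapsto> [h]\<close> and the
  subalgebra \<open>A\<close> generated by the elements \<open>\<epsilon>\<^sub>h = [h\<^sub>1][S h\<^sub>2]\<close>, on which \<open>H\<close> acts by \<open>h \<cdot> a = [h\<^sub>1] a [S h\<^sub>2]\<close>.
  Identities such as \<open>[h] \<epsilon>\<^sub>k = \<epsilon>\<^bsub>h\<^sub>1k\<^esub> [h\<^sub>2]\<close> dualise to Sweedler identities for \<open>p\<close>. Their extension from the
  generators \<open>\<epsilon>\<^sub>k\<close> to all of \<open>A\<close>, an induction over products, dualises to the principle that a coideal of the cofree
  coalgebra on which the projection vanishes is zero; the failure of an identity spans such a coideal. This gives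
  \<open>[h] a = (h\<^sub>1 \<cdot> a) [h\<^sub>2]\<close> and shows that the coaction is well defined.

  The map \<open>c >\<blacktriangleleft> h \<mapsto> p(c) h\<close> is a partial corepresentation of the cosmash coproduct, so it lifts to a coalgebra map
  into \<open>D\<close>. By uniqueness of lifts it is inverse to \<open>x \<mapsto> Eb x\<^sub>1 \<otimes> p x\<^sub>2\<close>, where \<open>Eb\<close> is the map onto the base coalgebra.
\<close>

section \<open>Linear and bilinear forms\<close>

text \<open>Tensors are represented by normal forms obtained by choice, so equations between them
  cannot be computed with directly. Linear functionals separate points, and every identity between
  vectors is tested by functionals and becomes one between finite sums of scalars; hence the forms
  \<open>f\<close> and \<open>G\<close> in most lemmas.

  The obstacle is well-definedness. The coaction is prescribed on \<open>Eb x\<close> and the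
  comultiplication on \<open>c >\<blacktriangleleft> h\<close>, and both kinds of elements have many
  presentations. For the coaction this concerns the kernel of \<open>Eb\<close>, where an induction
  has no generators to start from; hence the coideal principle. For the comultiplication, the
  formula is read on all of C \<otimes> H, where it is linear, and is then seen to map the span of
  the generators into its own tensor square.

  Cofreeness enters for two ambient types. For that of the cofree coalgebra itself it gives the
  coideal principle, the map \<open>Eb\<close> and the rigidity of H^par over \<open>p\<close>; for
  that of C \<otimes> H it lifts the partial corepresentation of the cosmash coproduct and makes its
  maps into the cofree coalgebra unique.\<close>

definition lform :: "('k::field, 'a::ab_group_add, 'm) vspace_scheme \<Rightarrow> ('a \<Rightarrow> 'k) \<Rightarrow> bool" where
  "lform V f \<longleftrightarrow> linear_map V ground f"

definition biform :: "('k::field, 'a::ab_group_add, 'm) vspace_scheme \<Rightarrow>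
    ('k, 'b::ab_group_add, 'n) vspace_scheme \<Rightarrow> ('a \<Rightarrow> 'b \<Rightarrow> 'k) \<Rightarrow> bool" where
  "biform V W B \<longleftrightarrow> bilinear_map V W ground B"

text \<open>Linearity is required on the whole ambient type, not only on the carrier: such an
  \<open>f\<close> commutes with the finite sum \<open>feval\<close> even when the summands are not
  known to lie in \<open>vcarrier U\<close>.\<close>

definition functional :: "('k::field, 'a::ab_group_add, 'm) vspace_scheme \<Rightarrow> ('a \<Rightarrow> 'k) \<Rightarrow> bool" where
  "functional U f \<longleftrightarrow> (\<forall>x y. f (x + y) = f x + f y) \<and> (\<forall>c x. f (smult U c x) = c * f x)"

lemma lform_iff: "lform V f \<longleftrightarrow> (\<forall>x\<in>vcarrier V. \<forall>y\<in>vcarrier V. f (x + y) = f x + f y) \<and>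
    (\<forall>c. \<forall>x\<in>vcarrier V. f (smult V c x) = c * f x)"
  by (simp add: lform_def linear_map_def ground_def)

lemma biform_iff: "biform V W B \<longleftrightarrow> (\<forall>a\<in>vcarrier V. lform W (B a)) \<and>
    (\<forall>b\<in>vcarrier W. lform V (\<lambda>a. B a b))"
  by (simp add: biform_def bilinear_map_def lform_def)

lemma lform_cong:
  assumes "is_vspace V" "\<And>x. x \<in> vcarrier V \<Longrightarrow> f x = g x"
  shows "lform V f \<longleftrightarrow> lform V g"
proof -
  interpret vector_space "smult V" using assms by (simp add: is_vspace_def)
  have "x + y \<in> vcarrier V" "smult V c x \<in> vcarrier V" if "x \<in> vcarrier V" "y \<in> vcarrier V" for c x y
    using assms that by (auto simp: is_vspace_def intro: subspace_add subspace_scale)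
  then show ?thesis using assms by (auto simp: lform_iff)
qed

lemma vs_add: "is_vspace V \<Longrightarrow> x \<in> vcarrier V \<Longrightarrow> y \<in> vcarrier V \<Longrightarrow> x + y \<in> vcarrier V"
  and vs_scale: "is_vspace V \<Longrightarrow> x \<in> vcarrier V \<Longrightarrow> smult V c x \<in> vcarrier V"
  and vs_zero: "is_vspace V \<Longrightarrow> 0 \<in> vcarrier V"
  and vs_diff: "is_vspace V \<Longrightarrow> x \<in> vcarrier V \<Longrightarrow> y \<in> vcarrier V \<Longrightarrow> x - y \<in> vcarrier V"
  using module.subspace_add module.subspace_scale module.subspace_0 module.subspace_diff
  unfolding is_vspace_def vector_space_def module_def[symmetric]
  by (metis module_def)+

lemma vs_vector_space: "is_vspace V \<Longrightarrow> vector_space (smult V)"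
  by (simp add: is_vspace_def)

lemma is_vspace_ground: "is_vspace (ground :: ('k::field, 'k) vspace)"
proof -
  have v: "vector_space ((*) :: 'k \<Rightarrow> _)" by unfold_locales (auto simp: algebra_simps)
  then interpret vector_space "(*) :: 'k \<Rightarrow> _" .
  show ?thesis by (simp add: is_vspace_def ground_def v)
qed

lemma is_vspace_tensor: "is_vspace (tensor V W)"
  by (simp add: is_vspace_def tensor_def vector_space_fscale fs.subspace_span)

lemma smult_tensor [simp]: "smult (tensor V W) = fscale"
  by (simp add: tensor_def)

lemma smult_ground [simp]: "smult ground = (*)" and vcarrier_ground [simp]: "vcarrier ground = UNIV"
  by (simp_all add: ground_def)

lemma functional_lform: "functional U f \<Longrightarrow> lform U f"
  by (simp add: functional_def lform_iff)

lemma functional_sum: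
  assumes "functional U f"
  shows "f (\<Sum>i\<in>I. g i) = (\<Sum>i\<in>I. f (g i))"
proof (cases "finite I")
  case True
  have "f 0 = 0" using assms by (metis add_cancel_right_right functional_def)
  with True show ?thesis using assms by (induction rule: finite_induct) (auto simp: functional_def)
next
  case False
  have "f 0 = 0" using assms by (metis add_cancel_right_right functional_def)
  then show ?thesis using False by simp
qed

lemma functional_diff: "functional U f \<Longrightarrow> f (x - y) = f x - f y"
  by (metis add_diff_cancel_right' diff_add_cancel functional_def)

text \<open>A nonzero \<open>x - y\<close> is linearly independent, so some linear functional takes
  the value 1 on it. Through this separation of points, equalities of vectors and tensors are
  reduced to equalities of scalars.\<close>

lemma functional_eqI:
  assumes "vector_space (smult U)" "\<And>f. functional U f \<Longrightarrow> f x = f y"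
  shows "x = y"
proof (rule ccontr)
  assume "x \<noteq> y"
  interpret vector_space "smult U" by fact
  interpret g: vector_space "(*) :: 'a \<Rightarrow> _" using vs_vector_space[OF is_vspace_ground, where 'a='a] by simp
  interpret pp: vector_space_pair "smult U" "(*) :: 'a \<Rightarrow> _" ..
  have ind: "independent {x - y}" using \<open>x \<noteq> y\<close> by simp
  obtain f where f: "Vector_Spaces.linear (smult U) (*) f" "\<forall>v\<in>{x - y}. f v = 1"
    using pp.linear_independent_extend[OF ind, of "\<lambda>_. 1"] by auto
  then have fct: "functional U f" by (simp add: functional_def Vector_Spaces.linear_iff)
  then have "f (x - y) = 0" using assms(2)[OF fct] functional_diff[OF fct] by simp
  then show False using f by simp
qed

lemma lform_0: "is_vspace V \<Longrightarrow> lform V f \<Longrightarrow> f 0 = 0"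
  using vs_zero[of V] unfolding lform_iff by (metis add_cancel_right_right add_0)

lemma lform_diff: "is_vspace V \<Longrightarrow> lform V f \<Longrightarrow> x \<in> vcarrier V \<Longrightarrow> y \<in> vcarrier V \<Longrightarrow>
    f (x - y) = f x - f y"
  unfolding lform_iff by (metis add_diff_cancel_right' diff_add_cancel vs_diff)

lemma lform_const_mult: "lform V f \<Longrightarrow> lform V (\<lambda>x. c * f x)"
  and lform_mult_const: "lform V f \<Longrightarrow> lform V (\<lambda>x. f x * c)"
  and lform_minus: "lform V f \<Longrightarrow> lform V g \<Longrightarrow> lform V (\<lambda>x. f x - g x)"
  by (auto simp: lform_iff algebra_simps)

lemma lform_big_sum: "(\<And>i. i \<in> I \<Longrightarrow> lform V (\<lambda>x. f i x)) \<Longrightarrow> lform V (\<lambda>x. \<Sum>i\<in>I. f i x)"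
  by (auto simp: lform_iff sum.distrib sum_distrib_left)

lemma lform_comp: "linear_map V W g \<Longrightarrow> lform W f \<Longrightarrow> lform V (\<lambda>x. f (g x))"
  by (auto simp: lform_iff linear_map_def)

text \<open>Additivity and homogeneity are equalities of vectors, hence can be tested by the
  functionals on the target.\<close>

lemma linear_mapI:
  assumes "is_vspace V" "is_vspace W" "\<And>x. x \<in> vcarrier V \<Longrightarrow> g x \<in> vcarrier W"
    "\<And>f. functional W f \<Longrightarrow> lform V (\<lambda>x. f (g x))"
  shows "linear_map V W g"
  unfolding linear_map_def
proof (intro conjI ballI allI)
  fix x y assume "x \<in> vcarrier V" "y \<in> vcarrier V"
  then show "g (x + y) = g x + g y"
    using assms(4) by (intro functional_eqI[OF vs_vector_space[OF assms(2)]]) (simp add: lform_iff functional_def)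
next
  fix c x assume "x \<in> vcarrier V"
  then show "g (smult V c x) = smult W c (g x)"
    using assms(4) by (intro functional_eqI[OF vs_vector_space[OF assms(2)]]) (simp add: lform_iff functional_def)
qed (use assms in auto)

subsection \<open>Forms on tensor products\<close>

definition tform :: "('k::field, 'a::ab_group_add, 'm) vspace_scheme \<Rightarrow>
    ('k, 'b::ab_group_add, 'n) vspace_scheme \<Rightarrow> ('a \<Rightarrow> 'b \<Rightarrow> 'k) \<Rightarrow> ('a \<times> 'b \<Rightarrow>\<^sub>0 'k) \<Rightarrow> 'k" where
  "tform V W G t = tlift V W ground G t"

lemma lform_tform: "is_vspace V \<Longrightarrow> is_vspace W \<Longrightarrow> biform V W G \<Longrightarrow> lform (tensor V W) (tform V W G)"
  unfolding lform_def biform_def tform_def[abs_def]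
  by (rule linear_map_tlift[OF _ _ is_vspace_ground])

lemma tform_tens: "is_vspace V \<Longrightarrow> is_vspace W \<Longrightarrow> biform V W G \<Longrightarrow> a \<in> vcarrier V \<Longrightarrow> b \<in> vcarrier W \<Longrightarrow>
    tform V W G (tens V W a b) = G a b"
  unfolding biform_def tform_def by (rule tlift_tens[OF _ _ is_vspace_ground])

lemma tform_nform: "is_vspace V \<Longrightarrow> is_vspace W \<Longrightarrow> biform V W G \<Longrightarrow>
    Poly_Mapping.keys s \<subseteq> vcarrier V \<times> vcarrier W \<Longrightarrow>
    tform V W G (nform (smult V) (smult W) s) = feval ground G s"
  unfolding biform_def tform_def by (rule tlift_nform[OF _ _ is_vspace_ground])

lemma tens_in_tensor: "a \<in> vcarrier V \<Longrightarrow> b \<in> vcarrier W \<Longrightarrow> tens V W a b \<in> vcarrier (tensor V W)"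
  by (auto simp: tensor_def intro: fs.span_base)

lemma tensor_induct [consumes 1, case_names zero step]:
  assumes "t \<in> vcarrier (tensor V W)" "P 0"
    "\<And>c a b t. a \<in> vcarrier V \<Longrightarrow> b \<in> vcarrier W \<Longrightarrow> t \<in> vcarrier (tensor V W) \<Longrightarrow> P t \<Longrightarrow>
      P (fscale c (tens V W a b) + t)"
  shows "P t"
proof -
  have "t \<in> fs.span {tens V W a b | a b. a \<in> vcarrier V \<and> b \<in> vcarrier W}"
    using assms(1) by (simp add: tensor_def)
  then have "t \<in> vcarrier (tensor V W) \<and> P t"
  proof (induction rule: fs.span_induct_alt)
    case base
    then show ?case using assms vs_zero[OF is_vspace_tensor] by simp
  next
    case (step c x y)
    then obtain a b where ab: "x = tens V W a b" "a \<in> vcarrier V" "b \<in> vcarrier W" by blast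
    have "fscale c x \<in> vcarrier (tensor V W)"
      using vs_scale[OF is_vspace_tensor tens_in_tensor[OF ab(2,3)], of c] ab(1) by simp
    then show ?case using step ab assms(3)[OF ab(2,3)] vs_add[OF is_vspace_tensor] by auto
  qed
  then show ?thesis ..
qed

lemma lform_tensor_eqI:
  assumes "lform (tensor V W) f" "lform (tensor V W) g"
    "\<And>a b. a \<in> vcarrier V \<Longrightarrow> b \<in> vcarrier W \<Longrightarrow> f (tens V W a b) = g (tens V W a b)"
    "t \<in> vcarrier (tensor V W)"
  shows "f t = g t"
  using assms(4)
proof (induction rule: tensor_induct)
  case zero
  then show ?case using lform_0[OF is_vspace_tensor] assms by metis
next
  case (step c a b t)
  have "fscale c (tens V W a b) \<in> vcarrier (tensor V W)"
    using vs_scale[OF is_vspace_tensor tens_in_tensor[OF step(1,2)]] by simp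
  then show ?case using assms step tens_in_tensor[OF step(1,2)]
    by (simp add: lform_iff)
qed

lemma biform_functional_tens:
  assumes "functional (tensor V W) f"
  shows "biform V W (\<lambda>a b. f (tens V W a b))"
  using assms by (simp add: biform_iff lform_iff functional_def tens_add_left tens_add_right
      tens_smult_left tens_smult_right)

lemma tform_functional:
  assumes "is_vspace V" "is_vspace W" "functional (tensor V W) f" "t \<in> vcarrier (tensor V W)"
  shows "tform V W (\<lambda>a b. f (tens V W a b)) t = f t"
  by (rule lform_tensor_eqI[OF _ _ _ assms(4)])
    (simp_all add: assms lform_tform biform_functional_tens functional_lform tform_tens)

lemma functional_feval:
  assumes "functional U f"
  shows "f (feval U B s) = feval ground (\<lambda>a b. f (B a b)) s"
  using assms by (auto simp: feval_def functional_sum[OF assms] functional_def intro!: sum.cong)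

lemma feval_cong: "(\<And>a b. (a, b) \<in> Poly_Mapping.keys s \<Longrightarrow> B a b = B' a b) \<Longrightarrow> feval U B s = feval U B' s"
  unfolding feval_def by (intro sum.cong) auto

text \<open>Only the composite of \<open>f\<close> with \<open>B\<close> has to be bilinear on the
  carriers, not \<open>B\<close> itself: \<open>tlift\<close> is a sum over some representing
  element supported on the carriers, \<open>f\<close> passes inside that sum, and the value of the
  resulting biform does not depend on the representative.\<close>

lemma functional_tlift:
  assumes "is_vspace V" "is_vspace W" "functional U f" "biform V W G"
    "\<And>a b. a \<in> vcarrier V \<Longrightarrow> b \<in> vcarrier W \<Longrightarrow> f (B a b) = G a b"
    "t \<in> vcarrier (tensor V W)"
  shows "f (tlift V W U B t) = tform V W G t"
proof -
  define s where "s = (SOME s. Poly_Mapping.keys s \<subseteq> vcarrier V \<times> vcarrier W \<and> nform (smult V) (smult W) s = t)"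
  have ex: "\<exists>s. Poly_Mapping.keys s \<subseteq> vcarrier V \<times> vcarrier W \<and> nform (smult V) (smult W) s = t"
    using tensor_representation[OF assms(6)] by metis
  have s: "Poly_Mapping.keys s \<subseteq> vcarrier V \<times> vcarrier W" "nform (smult V) (smult W) s = t"
    using someI_ex[OF ex] unfolding s_def by auto
  have "f (tlift V W U B t) = feval ground (\<lambda>a b. f (B a b)) s"
    unfolding tlift_def s_def[symmetric] by (rule functional_feval[OF assms(3)])
  also have "\<dots> = feval ground G s"
    by (rule feval_cong) (use s assms in blast)
  also have "\<dots> = tform V W G t"
    using tform_nform[OF assms(1,2,4) s(1)] s(2) by simp
  finally show ?thesis .
qed

text \<open>The form is composed with a linear retraction of the ambient space onto the
  carrier.\<close>

lemma functional_extend: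
  assumes "is_vspace V" "lform V f"
  obtains g where "functional V g" "\<And>x. x \<in> vcarrier V \<Longrightarrow> g x = f x"
proof -
  obtain P where P: "\<forall>x. P x \<in> vcarrier V" "\<forall>x\<in>vcarrier V. P x = x"
    "\<forall>x y. P (x + y) = P x + P y" "\<forall>c x. P (smult V c x) = smult V c (P x)"
    using ex_retraction[OF assms(1)] by blast
  show ?thesis using that[of "\<lambda>x. f (P x)"] P assms(2) by (simp add: functional_def lform_iff)
qed

lemma lform_eqI:
  assumes "is_vspace V" "x \<in> vcarrier V" "y \<in> vcarrier V" "\<And>f. lform V f \<Longrightarrow> f x = f y"
  shows "x = y"
  using assms(4) functional_lform by (intro functional_eqI[OF vs_vector_space[OF assms(1)]]) blast

section \<open>Sweedler calculus with forms\<close>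

definition basis_of :: "('k::field, 'a::ab_group_add, 'm) vspace_scheme \<Rightarrow> 'a set" where
  "basis_of V = (SOME B. B \<subseteq> vcarrier V \<and> \<not> module.dependent (smult V) B \<and>
     module.span (smult V) B = vcarrier V)"

lemma basis_of:
  assumes "is_vspace V"
  shows "basis_of V \<subseteq> vcarrier V" "\<not> module.dependent (smult V) (basis_of V)"
    "module.span (smult V) (basis_of V) = vcarrier V"
proof -
  interpret vector_space "smult V" using assms by (simp add: is_vspace_def)
  obtain B where B: "B \<subseteq> vcarrier V" "independent B" "vcarrier V \<subseteq> span B"
    using maximal_independent_subset[of "vcarrier V"] by blast
  have "span B = vcarrier V"
    using B span_minimal[of B "vcarrier V"] assms by (auto simp: is_vspace_def)
  then have "\<exists>B. B \<subseteq> vcarrier V \<and> independent B \<and> span B = vcarrier V" using B by blast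
  from someI_ex[OF this] show "basis_of V \<subseteq> vcarrier V" "independent (basis_of V)"
    "span (basis_of V) = vcarrier V"
    unfolding basis_of_def by auto
qed

text \<open>The linear form whose values on \<open>basis_of V\<close> are prescribed by
  \<open>F\<close>. Elsewhere \<open>F\<close> is never consulted, so an arbitrary function can be
  made linear without changing it on basis vectors.\<close>

definition lin_ext :: "('k::field, 'a::ab_group_add, 'm) vspace_scheme \<Rightarrow> ('a \<Rightarrow> 'k) \<Rightarrow> 'a \<Rightarrow> 'k" where
  "lin_ext V F x = (\<Sum>b | module.representation (smult V) (basis_of V) x b \<noteq> 0.
     module.representation (smult V) (basis_of V) x b * F b)"

lemma lform_lin_ext:
  assumes "is_vspace V"
  shows "lform V (lin_ext V F)"
proof -
  interpret vector_space "smult V" using assms by (simp add: is_vspace_def)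
  note B = basis_of[OF assms]
  let ?r = "representation (basis_of V)"
  have sup: "lin_ext V F x = (\<Sum>b\<in>K. ?r x b * F b)" if "finite K" "{b. ?r x b \<noteq> 0} \<subseteq> K" for x K
    unfolding lin_ext_def using that by (intro sum.mono_neutral_left) auto
  have "lin_ext V F (x + y) = lin_ext V F x + lin_ext V F y" if "x \<in> vcarrier V" "y \<in> vcarrier V" for x y
  proof -
    let ?K = "{b. ?r x b \<noteq> 0} \<union> {b. ?r y b \<noteq> 0}"
    have K: "finite ?K" by (simp add: finite_representation)
    have add: "?r (x + y) b = ?r x b + ?r y b" for b
      using representation_add[OF B(2), of y x] that B(3) by simp
    have "{b. ?r (x + y) b \<noteq> 0} \<subseteq> ?K" by (auto simp: add)
    then show ?thesis using sup[OF K, of "x + y"] sup[OF K, of x] sup[OF K, of y]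
      by (simp add: add algebra_simps sum.distrib)
  qed
  moreover have "lin_ext V F (smult V c x) = c * lin_ext V F x" if "x \<in> vcarrier V" for c x
  proof -
    let ?K = "{b. ?r x b \<noteq> 0}"
    have K: "finite ?K" by (simp add: finite_representation)
    have sc: "?r (smult V c x) b = c * ?r x b" for b
      using representation_scale[OF B(2), of x c] that B(3) by simp
    show ?thesis using sup[OF K, of "smult V c x"] sup[OF K, of x]
      by (simp add: sc sum_distrib_left mult.assoc subset_iff)
  qed
  ultimately show ?thesis by (simp add: lform_iff)
qed

lemma lin_ext_basis:
  assumes "is_vspace V" "b \<in> basis_of V"
  shows "lin_ext V F b = F b"
proof -
  interpret vector_space "smult V" using assms by (simp add: is_vspace_def)
  have r: "representation (basis_of V) b = (\<lambda>v. if v = b then 1 else 0)"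
    using representation_basis[OF basis_of(2)[OF assms(1)] assms(2)] by blast
  then have "{v. representation (basis_of V) b v \<noteq> 0} = {b}" by auto
  then show ?thesis by (simp add: lin_ext_def r)
qed

lemma lform_lin_ext_arg:
  assumes "is_vspace V" "\<And>b. b \<in> vcarrier V \<Longrightarrow> lform W (\<lambda>y. F y b)"
  shows "lform W (\<lambda>y. lin_ext V (F y) x)"
proof -
  interpret vector_space "smult V" using assms by (simp add: is_vspace_def)
  show ?thesis unfolding lin_ext_def
  proof (intro lform_big_sum lform_const_mult assms(2))
    fix b assume "b \<in> {b. representation (basis_of V) x b \<noteq> 0}"
    then show "b \<in> vcarrier V" using representation_ne_zero basis_of(1)[OF assms(1)] by blast
  qed
qed

lemma basis_of_in: "is_vspace V \<Longrightarrow> b \<in> basis_of V \<Longrightarrow> b \<in> vcarrier V"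
  using basis_of by blast

text \<open>The structure maps without the axioms. Most of the calculus of \<open>sw\<close> needs
  no more than this, so it is available for a coalgebra under construction, while coassociativity
  and the counit laws are still to be proved.\<close>

definition precoalgebra :: "('k::field, 'a::ab_group_add, 'm) coalg_scheme \<Rightarrow> bool" where
  "precoalgebra D \<longleftrightarrow> is_vspace D \<and> linear_map D (tensor D D) (comult D) \<and> lform D (counit D)"

lemma coalgebra_precoalgebra: "coalgebra D \<Longrightarrow> precoalgebra D"
  by (simp add: coalgebra_def precoalgebra_def lform_def)

text \<open>
  \<open>sw D x F\<close> is \<open>F x\<^sub>(\<^sub>1\<^sub>) x\<^sub>(\<^sub>2\<^sub>)\<close> for a scalar-valued \<open>F\<close>. Expanding \<open>comult D x\<close> in a fixed basis makes
  this linear in \<open>x\<close>, and coassociative, for every function \<open>F\<close>, without bilinearity conditions; outside the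
  carrier its value is \<open>0\<close>.
\<close>

definition comult_rep :: "('k::field, 'a::ab_group_add, 'm) coalg_scheme \<Rightarrow> 'a \<Rightarrow> ('a \<times> 'a \<Rightarrow>\<^sub>0 'k)" where
  "comult_rep D x = (if x \<in> vcarrier D then SOME r. Poly_Mapping.keys r \<subseteq> basis_of D \<times> basis_of D \<and>
     nform (smult D) (smult D) r = comult D x else 0)"

definition sw :: "('k::field, 'a::ab_group_add, 'm) coalg_scheme \<Rightarrow> 'a \<Rightarrow> ('a \<Rightarrow> 'a \<Rightarrow> 'k) \<Rightarrow> 'k" where
  "sw D x F = feval ground F (comult_rep D x)"

definition swv :: "('k::field, 'u::ab_group_add, 'o) vspace_scheme \<Rightarrow> ('k, 'a::ab_group_add, 'm) coalg_scheme \<Rightarrow>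
    'a \<Rightarrow> ('a \<Rightarrow> 'a \<Rightarrow> 'u) \<Rightarrow> 'u" where
  "swv U D x F = feval U F (comult_rep D x)"

text \<open>The elements with such a representation form a subspace. It contains the pure tensors of
  basis vectors, hence all pure tensors, by expanding one factor at a time.\<close>

lemma tensor_basis_rep:
  assumes "is_vspace V" "is_vspace W" "t \<in> vcarrier (tensor V W)"
  shows "\<exists>r. Poly_Mapping.keys r \<subseteq> basis_of V \<times> basis_of W \<and> nform (smult V) (smult W) r = t"
proof -
  interpret v: vector_space "smult V" using assms by (simp add: is_vspace_def)
  interpret w: vector_space "smult W" using assms by (simp add: is_vspace_def)
  interpret q: Vector_Spaces.linear fscale fscale "nform (smult V) (smult W)" by (rule linear_nform)
  define Z where "Z = {t. \<exists>r. Poly_Mapping.keys r \<subseteq> basis_of V \<times> basis_of W \<and> nform (smult V) (smult W) r = t}"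
  have Z0: "0 \<in> Z" unfolding Z_def by (intro CollectI exI[of _ 0]) (simp add: q.zero)
  have Za: "s + t \<in> Z" if "s \<in> Z" "t \<in> Z" for s t
  proof -
    obtain r r' where r: "Poly_Mapping.keys r \<subseteq> basis_of V \<times> basis_of W" "nform (smult V) (smult W) r = s"
      "Poly_Mapping.keys r' \<subseteq> basis_of V \<times> basis_of W" "nform (smult V) (smult W) r' = t"
      using \<open>s \<in> Z\<close> \<open>t \<in> Z\<close> unfolding Z_def by blast
    have "Poly_Mapping.keys (r + r') \<subseteq> basis_of V \<times> basis_of W" using keys_add[of r r'] r by blast
    then show ?thesis unfolding Z_def using r by (intro CollectI exI[of _ "r + r'"]) (simp add: q.add)
  qed
  have Zs: "fscale c s \<in> Z" if "s \<in> Z" for c s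
  proof -
    obtain r where r: "Poly_Mapping.keys r \<subseteq> basis_of V \<times> basis_of W" "nform (smult V) (smult W) r = s"
      using \<open>s \<in> Z\<close> unfolding Z_def by blast
    have "Poly_Mapping.keys (fscale c r) \<subseteq> basis_of V \<times> basis_of W"
      using r by (auto simp: in_keys_iff)
    then show ?thesis unfolding Z_def using r by (intro CollectI exI[of _ "fscale c r"]) (simp add: q.scale)
  qed
  have bb: "tens V W i j \<in> Z" if "i \<in> basis_of V" "j \<in> basis_of W" for i j
    unfolding Z_def using that by (intro CollectI exI[of _ "fpair i j"]) (simp add: tens_def)
  have t0: "tens V W 0 b = 0" "tens V W a 0 = 0" for a b
    using tens_add_left[of V W 0 0 b] tens_add_right[of V W a 0 0] by simp_all
  have bv: "tens V W i b \<in> Z" if "i \<in> basis_of V" "b \<in> vcarrier W" for i b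
  proof -
    have "b \<in> w.span (basis_of W)" using basis_of(3)[OF assms(2)] that by simp
    then show ?thesis
      by (induction rule: w.span_induct_alt)
        (auto simp: t0 Z0 tens_add_right tens_smult_right intro: Za Zs bb that)
  qed
  have vv: "tens V W a b \<in> Z" if "a \<in> vcarrier V" "b \<in> vcarrier W" for a b
  proof -
    have "a \<in> v.span (basis_of V)" using basis_of(3)[OF assms(1)] that by simp
    then show ?thesis
      by (induction rule: v.span_induct_alt)
        (auto simp: t0 Z0 tens_add_left tens_smult_left intro: Za Zs bv that)
  qed
  from assms(3) have "t \<in> Z"
    by (induction rule: tensor_induct) (auto intro: Z0 Za Zs vv)
  then show ?thesis by (simp add: Z_def)
qed

lemma linear_map_in: "linear_map V W g \<Longrightarrow> x \<in> vcarrier V \<Longrightarrow> g x \<in> vcarrier W"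
  by (simp add: linear_map_def)

lemma precoalgebraD:
  assumes "precoalgebra D"
  shows "is_vspace D" "linear_map D (tensor D D) (comult D)" "lform D (counit D)"
    "x \<in> vcarrier D \<Longrightarrow> comult D x \<in> vcarrier (tensor D D)"
  using assms by (auto simp: precoalgebra_def linear_map_in)

lemma comult_rep:
  assumes "precoalgebra D"
  shows "Poly_Mapping.keys (comult_rep D x) \<subseteq> basis_of D \<times> basis_of D"
    and "x \<in> vcarrier D \<Longrightarrow> nform (smult D) (smult D) (comult_rep D x) = comult D x"
proof -
  note D = precoalgebraD[OF assms]
  show "Poly_Mapping.keys (comult_rep D x) \<subseteq> basis_of D \<times> basis_of D"
    using someI_ex[OF tensor_basis_rep[OF D(1) D(1) D(4)[of x]]] by (auto simp: comult_rep_def)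
  show "nform (smult D) (smult D) (comult_rep D x) = comult D x" if "x \<in> vcarrier D"
    using someI_ex[OF tensor_basis_rep[OF D(1) D(1) D(4)[of x]]] that by (simp add: comult_rep_def)
qed

lemma sw_cong:
  assumes "precoalgebra D" "\<And>a b. a \<in> vcarrier D \<Longrightarrow> b \<in> vcarrier D \<Longrightarrow> F a b = G a b"
  shows "sw D x F = sw D x G"
  unfolding sw_def using comult_rep(1)[OF assms(1), of x] basis_of_in[OF precoalgebraD(1)[OF assms(1)]]
  by (intro feval_cong assms(2)) auto

lemma sw_cong_basis:
  assumes "precoalgebra D" "\<And>a b. a \<in> basis_of D \<Longrightarrow> b \<in> basis_of D \<Longrightarrow> F a b = G a b"
  shows "sw D x F = sw D x G"
  unfolding sw_def using comult_rep(1)[OF assms(1), of x]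
  by (intro feval_cong assms(2)) auto

lemma sw_notin: "x \<notin> vcarrier D \<Longrightarrow> sw D x F = 0"
  by (simp add: sw_def comult_rep_def feval_def)

text \<open>A bilinear form takes the same value on every representation of a tensor, so for biforms
  the basis expansion hidden in \<open>sw\<close> does not matter.\<close>

lemma sw_biform:
  assumes "precoalgebra D" "biform D D F" "x \<in> vcarrier D"
  shows "sw D x F = tform D D F (comult D x)"
proof -
  note D = precoalgebraD(1)[OF assms(1)]
  have "Poly_Mapping.keys (comult_rep D x) \<subseteq> vcarrier D \<times> vcarrier D"
    using comult_rep(1)[OF assms(1)] basis_of(1)[OF D] by blast
  then show ?thesis
    using tform_nform[OF D D assms(2)] comult_rep(2)[OF assms(1,3)] by (metis sw_def)
qed

lemma sw_feval:
  assumes "precoalgebra D" "biform D D F" "x \<in> vcarrier D"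
    "Poly_Mapping.keys s \<subseteq> vcarrier D \<times> vcarrier D" "nform (smult D) (smult D) s = comult D x"
  shows "sw D x F = feval ground F s"
  using sw_biform[OF assms(1-3)] tform_nform[OF _ _ assms(2,4)] precoalgebraD(1)[OF assms(1)] assms(5)
  by metis

definition ext2 :: "('k::field, 'a::ab_group_add, 'm) vspace_scheme \<Rightarrow> ('a \<Rightarrow> 'a \<Rightarrow> 'k) \<Rightarrow> 'a \<Rightarrow> 'a \<Rightarrow> 'k" where
  "ext2 V F a b = lin_ext V (\<lambda>i. lin_ext V (F i) b) a"

lemma biform_ext2: "is_vspace V \<Longrightarrow> biform V V (ext2 V F)"
  unfolding biform_iff ext2_def[abs_def] by (auto intro!: lform_lin_ext lform_lin_ext_arg)

lemma ext2_basis: "is_vspace V \<Longrightarrow> a \<in> basis_of V \<Longrightarrow> b \<in> basis_of V \<Longrightarrow> ext2 V F a b = F a b"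
  by (simp add: ext2_def lin_ext_basis)

text \<open>\<open>comult_rep\<close> involves pairs of basis vectors only, and there
  \<open>F\<close> agrees with its bilinear extension. This is what lets \<open>sw\<close> accept
  arbitrary functions.\<close>

lemma sw_ext2: "precoalgebra D \<Longrightarrow> sw D x F = sw D x (ext2 D F)"
  by (rule sw_cong_basis) (simp_all add: ext2_basis precoalgebraD)

lemma lform_sw:
  assumes "precoalgebra D"
  shows "lform D (\<lambda>x. sw D x F)"
proof -
  note D = precoalgebraD[OF assms] and bf = biform_ext2[OF precoalgebraD(1)[OF assms], of F]
  have "lform D (\<lambda>x. tform D D (ext2 D F) (comult D x))"
    by (rule lform_comp[OF D(2)]) (rule lform_tform[OF D(1) D(1) bf])
  then show ?thesis
    using lform_cong[OF D(1), of "\<lambda>x. sw D x F" "\<lambda>x. tform D D (ext2 D F) (comult D x)"]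
      sw_biform[OF assms bf] sw_ext2[OF assms, of _ F] by simp
qed

lemma sw_const_mult: "sw D x (\<lambda>a b. c * F a b) = c * sw D x F"
  and sw_mult_const: "sw D x (\<lambda>a b. F a b * c) = sw D x F * c"
  and sw_0: "sw D x (\<lambda>a b. 0) = 0"
  by (simp_all add: sw_def feval_def sum_distrib_left sum_distrib_right algebra_simps case_prod_unfold)

lemma sw_swap: "sw D x (\<lambda>a b. sw E y (\<lambda>c d. F a b c d)) = sw E y (\<lambda>c d. sw D x (\<lambda>a b. F a b c d))"
  unfolding sw_def feval_def
  by (simp add: case_prod_unfold sum_distrib_left) (subst sum.swap, simp add: ac_simps)

lemma lform_sw_arg:
  assumes "precoalgebra D" "\<And>a b. a \<in> vcarrier D \<Longrightarrow> b \<in> vcarrier D \<Longrightarrow> lform V (\<lambda>y. F y a b)"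
  shows "lform V (\<lambda>y. sw D x (F y))"
  unfolding sw_def feval_def
proof (rule lform_big_sum)
  fix i assume i: "i \<in> Poly_Mapping.keys (comult_rep D x)"
  then have "fst i \<in> vcarrier D" "snd i \<in> vcarrier D"
    using comult_rep(1)[OF assms(1), of x] basis_of_in[OF precoalgebraD(1)[OF assms(1)]] by auto
  from lform_const_mult[OF assms(2)[OF this]]
  show "lform V (\<lambda>y. case i of (a, b) \<Rightarrow> smult ground (Poly_Mapping.lookup (comult_rep D x) (a, b)) (F y a b))"
    by (simp add: case_prod_unfold)
qed

section \<open>Vector-valued Sweedler sums and their reduction to scalar ones\<close>

lemma functional_swv: "functional U f \<Longrightarrow> f (swv U D x F) = sw D x (\<lambda>a b. f (F a b))"
  unfolding swv_def sw_def by (rule functional_feval)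

lemma swv_in:
  assumes "precoalgebra D" "is_vspace U" "\<And>a b. a \<in> vcarrier D \<Longrightarrow> b \<in> vcarrier D \<Longrightarrow> F a b \<in> vcarrier U"
  shows "swv U D x F \<in> vcarrier U"
proof -
  interpret vector_space "smult U" using assms by (simp add: is_vspace_def)
  have "(a, b) \<in> Poly_Mapping.keys (comult_rep D x) \<Longrightarrow> F a b \<in> vcarrier U" for a b
    using comult_rep(1)[OF assms(1), of x] basis_of_in[OF precoalgebraD(1)[OF assms(1)]] assms(3) by auto
  then show ?thesis unfolding swv_def feval_def using assms(2)
    by (intro subspace_sum) (auto simp: is_vspace_def intro: subspace_scale)
qed

lemma lform_swv:
  assumes "precoalgebra D" "is_vspace U" "\<And>a b. a \<in> vcarrier D \<Longrightarrow> b \<in> vcarrier D \<Longrightarrow> F a b \<in> vcarrier U"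
    "lform U f"
  shows "f (swv U D x F) = sw D x (\<lambda>a b. f (F a b))"
proof -
  obtain g where g: "functional U g" "\<And>x. x \<in> vcarrier U \<Longrightarrow> g x = f x"
    by (rule functional_extend[OF assms(2,4)]) blast
  have "f (swv U D x F) = g (swv U D x F)" using swv_in[OF assms(1-3)] g by simp
  also have "\<dots> = sw D x (\<lambda>a b. g (F a b))" by (rule functional_swv[OF g(1)])
  also have "\<dots> = sw D x (\<lambda>a b. f (F a b))"
    by (rule sw_cong[OF assms(1)]) (use g assms in auto)
  finally show ?thesis .
qed

text \<open>The bridge from the \<open>sweedler\<close> of the definitions to \<open>sw\<close>:
  after a functional, both become the same bilinear form evaluated at \<open>comult D x\<close>. As
  in \<open>functional_tlift\<close>, bilinearity is needed for the composite \<open>G\<close>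
  alone.\<close>

lemma functional_sweedler:
  assumes "precoalgebra D" "x \<in> vcarrier D" "functional U f" "biform D D G"
    "\<And>a b. a \<in> vcarrier D \<Longrightarrow> b \<in> vcarrier D \<Longrightarrow> f (B a b) = G a b"
  shows "f (sweedler D U x B) = sw D x G"
  unfolding sweedler_def sw_biform[OF assms(1,4,2)]
  using functional_tlift[OF _ _ assms(3,4,5) precoalgebraD(4)[OF assms(1,2)]] precoalgebraD(1)[OF assms(1)]
  by blast

lemma sweedler_swv:
  assumes "precoalgebra D" "x \<in> vcarrier D" "vector_space (smult U)"
    "\<And>f. functional U f \<Longrightarrow> biform D D (\<lambda>a b. f (B a b))"
  shows "sweedler D U x B = swv U D x B"
  by (rule functional_eqI[OF assms(3)])
    (simp add: functional_swv functional_sweedler[OF assms(1,2) _ assms(4)])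

lemma functional_tensE:
  assumes "is_vspace V" "is_vspace W" "biform V W G"
  obtains f where "functional (tensor V W) f"
    "\<And>a b. a \<in> vcarrier V \<Longrightarrow> b \<in> vcarrier W \<Longrightarrow> f (tens V W a b) = G a b"
    "\<And>t. t \<in> vcarrier (tensor V W) \<Longrightarrow> f t = tform V W G t"
proof -
  obtain f where f: "functional (tensor V W) f" "\<And>t. t \<in> vcarrier (tensor V W) \<Longrightarrow> f t = tform V W G t"
    by (rule functional_extend[OF is_vspace_tensor lform_tform[OF assms]]) blast
  show ?thesis
    by (rule that[OF f(1) _ f(2)]) (simp_all add: f(2) tens_in_tensor tform_tens[OF assms])
qed

lemma functional_comp_tens_right: "functional (tensor U (tensor V W)) f \<Longrightarrow> functional (tensor V W) (\<lambda>s. f (tens U (tensor V W) a s))"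
  by (simp add: functional_def tens_add_right tens_smult_right[of U "tensor V W", simplified])

lemma sw_comult_functional:
  assumes "precoalgebra D" "functional (tensor D D) f" "x \<in> vcarrier D"
  shows "f (comult D x) = sw D x (\<lambda>a b. f (tens D D a b))"
  using sw_biform[OF assms(1) biform_functional_tens[OF assms(2)] assms(3)]
    tform_functional[OF _ _ assms(2)] precoalgebraD[OF assms(1)] assms(3) by simp

section \<open>Trilinear forms, coassociativity and the counit laws\<close>

definition triform :: "('k::field, 'a::ab_group_add, 'm) vspace_scheme \<Rightarrow> ('k, 'b::ab_group_add, 'n) vspace_scheme \<Rightarrow>
    ('k, 'c::ab_group_add, 'o) vspace_scheme \<Rightarrow> ('a \<Rightarrow> 'b \<Rightarrow> 'c \<Rightarrow> 'k) \<Rightarrow> bool" where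
  "triform U V W F \<longleftrightarrow> (\<forall>a\<in>vcarrier U. biform V W (F a)) \<and>
     (\<forall>b\<in>vcarrier V. \<forall>c\<in>vcarrier W. lform U (\<lambda>a. F a b c))"

lemma triformD:
  assumes "triform U V W F"
  shows "b \<in> vcarrier V \<Longrightarrow> c \<in> vcarrier W \<Longrightarrow> lform U (\<lambda>a. F a b c)"
    "a \<in> vcarrier U \<Longrightarrow> c \<in> vcarrier W \<Longrightarrow> lform V (\<lambda>b. F a b c)"
    "a \<in> vcarrier U \<Longrightarrow> b \<in> vcarrier V \<Longrightarrow> lform W (\<lambda>c. F a b c)"
    "a \<in> vcarrier U \<Longrightarrow> biform V W (F a)"
  using assms by (auto simp: triform_def biform_iff)

lemma lform_tform_arg:
  assumes "\<And>a b. a \<in> vcarrier V \<Longrightarrow> b \<in> vcarrier W \<Longrightarrow> lform U (\<lambda>x. F x a b)" "is_vspace V" "is_vspace W" "is_vspace U"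
    "\<And>x. x \<in> vcarrier U \<Longrightarrow> biform V W (F x)" "t \<in> vcarrier (tensor V W)"
  shows "lform U (\<lambda>x. tform V W (F x) t)"
proof -
  obtain s where s: "Poly_Mapping.keys s \<subseteq> vcarrier V \<times> vcarrier W" "t = nform (smult V) (smult W) s"
    by (rule tensor_representation[OF assms(6)]) blast
  have "lform U (\<lambda>x. feval ground (F x) s)"
    unfolding feval_def using assms(1) s(1)
    by (intro lform_big_sum) (auto simp: case_prod_unfold intro!: lform_const_mult)
  moreover have "tform V W (F x) t = feval ground (F x) s" if "x \<in> vcarrier U" for x
    using tform_nform[OF assms(2,3) assms(5)[OF that] s(1)] s(2) by simp
  ultimately show ?thesis
    using lform_cong[OF assms(4), of "\<lambda>x. feval ground (F x) s" "\<lambda>x. tform V W (F x) t"] by simp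
qed

lemma functional_tens3E:
  assumes "is_vspace U" "is_vspace V" "is_vspace W" "triform U V W G"
  obtains f where "functional (tensor U (tensor V W)) f"
    "\<And>a b c. a \<in> vcarrier U \<Longrightarrow> b \<in> vcarrier V \<Longrightarrow> c \<in> vcarrier W \<Longrightarrow>
      f (tens U (tensor V W) a (tens V W b c)) = G a b c"
    "\<And>a t. a \<in> vcarrier U \<Longrightarrow> t \<in> vcarrier (tensor V W) \<Longrightarrow>
      f (tens U (tensor V W) a t) = tform V W (G a) t"
proof -
  have "biform U (tensor V W) (\<lambda>a t. tform V W (G a) t)"
    unfolding biform_iff using assms(1-3) triformD[OF assms(4)]
    by (auto intro!: lform_tform lform_tform_arg)
  then obtain f where
    f: "functional (tensor U (tensor V W)) f" "\<And>a t. a \<in> vcarrier U \<Longrightarrow> t \<in> vcarrier (tensor V W) \<Longrightarrow>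
      f (tens U (tensor V W) a t) = tform V W (G a) t"
    by (rule functional_tensE[OF assms(1) is_vspace_tensor]) blast
  show ?thesis
    by (rule that[OF f(1) _ f(2)])
      (simp_all add: f(2) tens_in_tensor tform_tens[OF assms(2,3) triformD(4)[OF assms(4)]])
qed

lemma biform_sw_left:
  assumes "precoalgebra D" "\<And>a b. a \<in> vcarrier D \<Longrightarrow> b \<in> vcarrier D \<Longrightarrow> lform V (\<lambda>v. F a b v)"
  shows "biform D V (\<lambda>u v. sw D u (\<lambda>a b. F a b v))"
  unfolding biform_iff using assms lform_sw[OF assms(1)]
  by (auto intro!: lform_sw_arg)

lemma biform_sw_right:
  assumes "precoalgebra D" "\<And>b c. b \<in> vcarrier D \<Longrightarrow> c \<in> vcarrier D \<Longrightarrow> lform V (\<lambda>v. F v b c)"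
  shows "biform V D (\<lambda>a w. sw D w (\<lambda>b c. F a b c))"
  unfolding biform_iff using assms lform_sw[OF assms(1)]
  by (auto intro!: lform_sw_arg)

text \<open>The coassociativity axiom is an equation in the triple tensor product; the functional
  that corresponds to the trilinear \<open>F\<close> is applied to it. Outside the carrier both
  sides are 0.\<close>

lemma coassoc_triform:
  assumes "coalgebra D" "triform D D D F"
  shows "sw D x (\<lambda>u v. sw D u (\<lambda>a b. F a b v)) = sw D x (\<lambda>a w. sw D w (\<lambda>b v. F a b v))"
proof (cases "x \<in> vcarrier D")
  case True
  have pre: "precoalgebra D" by (rule coalgebra_precoalgebra[OF assms(1)])
  note V = precoalgebraD(1)[OF pre]
  obtain f where f: "functional (tensor D (tensor D D)) f"
    "\<And>a b c. a \<in> vcarrier D \<Longrightarrow> b \<in> vcarrier D \<Longrightarrow> c \<in> vcarrier D \<Longrightarrow>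
      f (tens D (tensor D D) a (tens D D b c)) = F a b c"
    "\<And>a t. a \<in> vcarrier D \<Longrightarrow> t \<in> vcarrier (tensor D D) \<Longrightarrow>
      f (tens D (tensor D D) a t) = tform D D (F a) t"
    by (rule functional_tens3E[OF V V V assms(2)]) blast
  have "f (sweedler D (tensor D (tensor D D)) x (\<lambda>y x3.
          sweedler D (tensor D (tensor D D)) y (\<lambda>x1 x2. tens D (tensor D D) x1 (tens D D x2 x3)))) =
    sw D x (\<lambda>u v. sw D u (\<lambda>a b. F a b v))"
    using triformD[OF assms(2)]
    by (intro functional_sweedler[OF pre True f(1)] functional_sweedler[OF pre _ f(1)] biform_sw_left[OF pre] f(2))
      (auto simp: biform_iff)
  moreover have "f (sweedler D (tensor D (tensor D D)) x (\<lambda>x1 y. tens D (tensor D D) x1 (comult D y))) =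
    sw D x (\<lambda>a w. sw D w (\<lambda>b v. F a b v))"
    using triformD[OF assms(2)]
    by (intro functional_sweedler[OF pre True f(1)] biform_sw_right[OF pre])
      (simp_all add: f(3) precoalgebraD(4)[OF pre] sw_biform[OF pre])
  ultimately show ?thesis using assms(1) True unfolding coalgebra_def by simp
qed (simp add: sw_notin)

text \<open>All arguments that reach \<open>F\<close> in either iterated sum are basis vectors, so
  \<open>F\<close> may be replaced by a trilinear \<open>F'\<close> with the same values there. The
  law thus has no side conditions on \<open>F\<close> and can serve as a rewrite rule.\<close>

lemma coassoc:
  assumes "coalgebra D"
  shows "sw D x (\<lambda>u v. sw D u (\<lambda>a b. F a b v)) = sw D x (\<lambda>a w. sw D w (\<lambda>b v. F a b v))"
proof -
  have pre: "precoalgebra D" by (rule coalgebra_precoalgebra[OF assms])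
  note V = precoalgebraD(1)[OF pre]
  define F' where "F' a b c = lin_ext D (\<lambda>i. ext2 D (F i) b c) a" for a b c
  have "biform D D (ext2 D (F i))" for i by (rule biform_ext2[OF V])
  then have tri: "triform D D D F'" unfolding triform_def F'_def[abs_def]
    by (auto simp: biform_iff intro!: lform_lin_ext lform_lin_ext_arg V)
  have F': "F' a b c = F a b c" if "a \<in> basis_of D" "b \<in> basis_of D" "c \<in> basis_of D" for a b c
    using that by (simp add: F'_def lin_ext_basis ext2_basis V)
  have "sw D x (\<lambda>u v. sw D u (\<lambda>a b. F a b v)) = sw D x (\<lambda>u v. sw D u (\<lambda>a b. F' a b v))"
    by (intro sw_cong_basis[OF pre]) (simp add: F')
  also have "\<dots> = sw D x (\<lambda>a w. sw D w (\<lambda>b v. F' a b v))" by (rule coassoc_triform[OF assms tri])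
  also have "\<dots> = sw D x (\<lambda>a w. sw D w (\<lambda>b v. F a b v))"
    by (intro sw_cong_basis[OF pre]) (simp add: F')
  finally show ?thesis .
qed

lemma sw_counit:
  assumes "coalgebra D" "lform D f" "x \<in> vcarrier D"
  shows "sw D x (\<lambda>a b. counit D a * f b) = f x" "sw D x (\<lambda>a b. counit D b * f a) = f x"
proof -
  have pre: "precoalgebra D" by (rule coalgebra_precoalgebra[OF assms(1)])
  note V = precoalgebraD(1,3)[OF pre]
  obtain g where g: "functional D g" "\<And>x. x \<in> vcarrier D \<Longrightarrow> g x = f x"
    by (rule functional_extend[OF V(1) assms(2)]) blast
  have "g (sweedler D D x (\<lambda>x1 x2. smult D (counit D x1) x2)) = sw D x (\<lambda>a b. counit D a * f b)"
    by (rule functional_sweedler[OF pre assms(3) g(1)])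
      (use g V assms(2) in \<open>auto simp: biform_iff functional_def lform_mult_const lform_const_mult\<close>)
  then show "sw D x (\<lambda>a b. counit D a * f b) = f x"
    using assms(1,3) g by (simp add: coalgebra_def)
  have "g (sweedler D D x (\<lambda>x1 x2. smult D (counit D x2) x1)) = sw D x (\<lambda>a b. counit D b * f a)"
    by (rule functional_sweedler[OF pre assms(3) g(1)])
      (use g V assms(2) in \<open>auto simp: biform_iff functional_def lform_mult_const lform_const_mult\<close>)
  then show "sw D x (\<lambda>a b. counit D b * f a) = f x"
    using assms(1,3) g by (simp add: coalgebra_def)
qed

text \<open>Converse to \<open>coassoc_triform\<close> and \<open>sw_counit\<close>: since
  functionals separate points, the axioms need only be checked after applying multilinear forms.
  Subcoalgebras, the quotient by a coideal and the cosmash coproduct are all obtained in this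
  way.\<close>

lemma coalgebraI:
  assumes pre: "precoalgebra D"
    and co: "\<And>F x. triform D D D F \<Longrightarrow> x \<in> vcarrier D \<Longrightarrow>
      sw D x (\<lambda>u v. sw D u (\<lambda>a b. F a b v)) = sw D x (\<lambda>a w. sw D w (\<lambda>b v. F a b v))"
    and cl: "\<And>f x. lform D f \<Longrightarrow> x \<in> vcarrier D \<Longrightarrow> sw D x (\<lambda>a b. counit D a * f b) = f x"
    and cr: "\<And>f x. lform D f \<Longrightarrow> x \<in> vcarrier D \<Longrightarrow> sw D x (\<lambda>a b. counit D b * f a) = f x"
  shows "coalgebra D"
  unfolding coalgebra_def
proof (intro conjI ballI)
  note V = precoalgebraD[OF pre] and vD = vs_vector_space[OF precoalgebraD(1)[OF pre]]
  show "is_vspace D" "linear_map D (tensor D D) (comult D)" "linear_map D ground (counit D)"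
    using V by (auto simp: lform_def)
  fix x assume x: "x \<in> vcarrier D"
  show "sweedler D (tensor D (tensor D D)) x (\<lambda>y x3.
          sweedler D (tensor D (tensor D D)) y (\<lambda>x1 x2. tens D (tensor D D) x1 (tens D D x2 x3))) =
        sweedler D (tensor D (tensor D D)) x (\<lambda>x1 y. tens D (tensor D D) x1 (comult D y))"
  proof (rule functional_eqI[of "tensor D (tensor D D)"])
    show "vector_space (smult (tensor D (tensor D D)))" by (simp add: vector_space_fscale)
    fix f assume f: "functional (tensor D (tensor D D)) f"
    define F where "F a b c = f (tens D (tensor D D) a (tens D D b c))" for a b c
    have tri: "triform D D D F"
      unfolding triform_def F_def[abs_def]
    proof (intro conjI ballI)
      show "biform D D (\<lambda>b c. f (tens D (tensor D D) a (tens D D b c)))" for a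
        by (rule biform_functional_tens[OF functional_comp_tens_right[OF f]])
      show "lform D (\<lambda>a. f (tens D (tensor D D) a (tens D D b c)))" if "b \<in> vcarrier D" "c \<in> vcarrier D" for b c
        using biform_functional_tens[OF f] tens_in_tensor[OF that] unfolding biform_iff by blast
    qed
    have "f (sweedler D (tensor D (tensor D D)) x (\<lambda>y x3.
          sweedler D (tensor D (tensor D D)) y (\<lambda>x1 x2. tens D (tensor D D) x1 (tens D D x2 x3)))) =
      sw D x (\<lambda>u v. sw D u (\<lambda>a b. F a b v))"
      using triformD[OF tri]
      by (intro functional_sweedler[OF pre x f(1)] functional_sweedler[OF pre _ f(1)] biform_sw_left[OF pre])
        (auto simp: biform_iff F_def)
    moreover have "f (sweedler D (tensor D (tensor D D)) x (\<lambda>x1 y. tens D (tensor D D) x1 (comult D y))) =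
      sw D x (\<lambda>a w. sw D w (\<lambda>b v. F a b v))"
      using triformD[OF tri]
      by (intro functional_sweedler[OF pre x f(1)] biform_sw_right[OF pre])
        (simp_all add: F_def[abs_def] sw_comult_functional[OF pre functional_comp_tens_right[OF f]])
    ultimately show "f (sweedler D (tensor D (tensor D D)) x (\<lambda>y x3.
          sweedler D (tensor D (tensor D D)) y (\<lambda>x1 x2. tens D (tensor D D) x1 (tens D D x2 x3)))) =
      f (sweedler D (tensor D (tensor D D)) x (\<lambda>x1 y. tens D (tensor D D) x1 (comult D y)))"
      using co[OF tri x] by simp
  qed
  show "sweedler D D x (\<lambda>x1 x2. smult D (counit D x1) x2) = x"
  proof (rule functional_eqI[OF vD])
    fix f assume f: "functional D f"
    have "f (sweedler D D x (\<lambda>x1 x2. smult D (counit D x1) x2)) = sw D x (\<lambda>a b. counit D a * f b)"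
      by (rule functional_sweedler[OF pre x f])
        (use f V functional_lform[OF f] in \<open>auto simp: biform_iff functional_def lform_mult_const lform_const_mult\<close>)
    then show "f (sweedler D D x (\<lambda>x1 x2. smult D (counit D x1) x2)) = f x"
      using cl[OF functional_lform[OF f] x] by simp
  qed
  show "sweedler D D x (\<lambda>x1 x2. smult D (counit D x2) x1) = x"
  proof (rule functional_eqI[OF vD])
    fix f assume f: "functional D f"
    have "f (sweedler D D x (\<lambda>x1 x2. smult D (counit D x2) x1)) = sw D x (\<lambda>a b. counit D b * f a)"
      by (rule functional_sweedler[OF pre x f])
        (use f V functional_lform[OF f] in \<open>auto simp: biform_iff functional_def lform_mult_const lform_const_mult\<close>)
    then show "f (sweedler D D x (\<lambda>x1 x2. smult D (counit D x2) x1)) = f x"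
      using cr[OF functional_lform[OF f] x] by simp
  qed
qed

section \<open>Coalgebra maps and subcoalgebras\<close>

lemma coalgebra_map_linear: "coalgebra_map D E f \<Longrightarrow> linear_map D E f"
  by (simp add: coalgebra_map_def)

lemma coalgebra_map_in: "coalgebra_map D E f \<Longrightarrow> x \<in> vcarrier D \<Longrightarrow> f x \<in> vcarrier E"
  by (simp add: coalgebra_map_def linear_map_def)

lemma biform_comp:
  assumes "linear_map D E f" "linear_map D' E' g" "biform E E' G"
  shows "biform D D' (\<lambda>a b. G (f a) (g b))"
  using assms lform_comp[OF assms(1)] lform_comp[OF assms(2)] linear_map_in[OF assms(1)] linear_map_in[OF assms(2)]
  unfolding biform_iff by blast

lemma sw_coalgebra_map:
  assumes "precoalgebra D" "precoalgebra E" "coalgebra_map D E f" "biform E E G" "x \<in> vcarrier D"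
  shows "sw E (f x) G = sw D x (\<lambda>a b. G (f a) (f b))"
proof -
  note V = precoalgebraD(1)[OF assms(2)] and lin = coalgebra_map_linear[OF assms(3)]
  obtain \<phi> where \<phi>: "functional (tensor E E) \<phi>"
    "\<And>a b. a \<in> vcarrier E \<Longrightarrow> b \<in> vcarrier E \<Longrightarrow> \<phi> (tens E E a b) = G a b"
    "\<And>t. t \<in> vcarrier (tensor E E) \<Longrightarrow> \<phi> t = tform E E G t"
    by (rule functional_tensE[OF V V assms(4)]) blast
  have fx: "f x \<in> vcarrier E" by (rule coalgebra_map_in[OF assms(3,5)])
  have "sw E (f x) G = \<phi> (comult E (f x))"
    using sw_biform[OF assms(2,4) fx] \<phi>(3) precoalgebraD(4)[OF assms(2) fx] by simp
  also have "\<dots> = \<phi> (sweedler D (tensor E E) x (\<lambda>x1 x2. tens E E (f x1) (f x2)))"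
    using assms(3,5) by (simp add: coalgebra_map_def)
  also have "\<dots> = sw D x (\<lambda>a b. G (f a) (f b))"
    by (rule functional_sweedler[OF assms(1,5) \<phi>(1) biform_comp[OF lin lin assms(4)]])
      (simp add: \<phi>(2) linear_map_in[OF lin])
  finally show ?thesis .
qed

lemma coalgebra_mapI:
  assumes "precoalgebra D" "precoalgebra E" "linear_map D E f"
    "\<And>x G. x \<in> vcarrier D \<Longrightarrow> biform E E G \<Longrightarrow> sw E (f x) G = sw D x (\<lambda>a b. G (f a) (f b))"
    "\<And>x. x \<in> vcarrier D \<Longrightarrow> counit E (f x) = counit D x"
  shows "coalgebra_map D E f"
  unfolding coalgebra_map_def
proof (intro conjI ballI)
  fix x assume x: "x \<in> vcarrier D"
  show "comult E (f x) = sweedler D (tensor E E) x (\<lambda>x1 x2. tens E E (f x1) (f x2))"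
  proof (rule functional_eqI[of "tensor E E"])
    fix \<phi> assume \<phi>: "functional (tensor E E) \<phi>"
    note bf = biform_functional_tens[OF \<phi>]
    show "\<phi> (comult E (f x)) = \<phi> (sweedler D (tensor E E) x (\<lambda>x1 x2. tens E E (f x1) (f x2)))"
      using functional_sweedler[OF assms(1) x \<phi> biform_comp[OF assms(3,3) bf]] assms(4)[OF x bf]
        sw_comult_functional[OF assms(2) \<phi> linear_map_in[OF assms(3) x]] by simp
  qed (simp add: vector_space_fscale)
qed (use assms in auto)

lemma coalgebra_map_cong:
  assumes "precoalgebra D" "precoalgebra E" "coalgebra_map D E f" "\<And>x. x \<in> vcarrier D \<Longrightarrow> g x = f x"
  shows "coalgebra_map D E g"
proof (rule coalgebra_mapI[OF assms(1,2)])
  show "linear_map D E g"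
    using coalgebra_map_linear[OF assms(3)] assms(4) precoalgebraD(1)[OF assms(1)]
    by (simp add: linear_map_def vs_add vs_scale)
  show "sw E (g x) G = sw D x (\<lambda>a b. G (g a) (g b))" if "x \<in> vcarrier D" "biform E E G" for x G
  proof -
    have "sw E (g x) G = sw D x (\<lambda>a b. G (f a) (f b))"
      using sw_coalgebra_map[OF assms(1-3) that(2,1)] assms(4) that by simp
    also have "\<dots> = sw D x (\<lambda>a b. G (g a) (g b))"
      by (rule sw_cong[OF assms(1)]) (simp add: assms(4))
    finally show ?thesis .
  qed
  show "counit E (g x) = counit D x" if "x \<in> vcarrier D" for x
    using assms(3,4) that by (simp add: coalgebra_map_def)
qed

lemma linear_map_comp: "linear_map D E f \<Longrightarrow> linear_map E F g \<Longrightarrow> linear_map D F (\<lambda>x. g (f x))"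
  by (simp add: linear_map_def)

lemma coalgebra_map_comp:
  assumes "precoalgebra D" "precoalgebra E" "precoalgebra F" "coalgebra_map D E f" "coalgebra_map E F g"
  shows "coalgebra_map D F (\<lambda>x. g (f x))"
proof (rule coalgebra_mapI[OF assms(1,3)])
  note lf = coalgebra_map_linear[OF assms(4)] and lg = coalgebra_map_linear[OF assms(5)]
  show "linear_map D F (\<lambda>x. g (f x))" by (rule linear_map_comp[OF lf lg])
  show "sw F (g (f x)) G = sw D x (\<lambda>a b. G (g (f a)) (g (f b)))" if "x \<in> vcarrier D" "biform F F G" for x G
    using sw_coalgebra_map[OF assms(2,3,5) that(2) linear_map_in[OF lf that(1)]]
      sw_coalgebra_map[OF assms(1,2,4) biform_comp[OF lg lg that(2)] that(1)] by simp
  show "counit F (g (f x)) = counit D x" if "x \<in> vcarrier D" for x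
    using assms(4,5) that linear_map_in[OF lf] by (simp add: coalgebra_map_def)
qed

section \<open>Subcoalgebras: restriction, images and sums\<close>

lemma restrict_to_simps [simp]:
  "vcarrier (restrict_to D X) = X" "smult (restrict_to D X) = smult D"
  "comult (restrict_to E X) = comult E" "counit (restrict_to E X) = counit E"
  by (simp_all add: restrict_to_def)

lemma is_vspace_restrict: "is_vspace D \<Longrightarrow> module.subspace (smult D) X \<Longrightarrow> is_vspace (restrict_to D X)"
  by (simp add: is_vspace_def)

lemma tens_cong: "smult V = smult V' \<Longrightarrow> smult W = smult W' \<Longrightarrow> tens V W = tens V' W'"
  by (intro ext) (simp add: tens_def)

lemma tensor_mono:
  assumes "smult V = smult V'" "smult W = smult W'" "vcarrier V \<subseteq> vcarrier V'" "vcarrier W \<subseteq> vcarrier W'"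
  shows "vcarrier (tensor V W) \<subseteq> vcarrier (tensor V' W')"
  unfolding tensor_def tens_cong[OF assms(1,2)] using assms(3,4) by (auto intro!: fs.span_mono)

lemma lform_mono: "lform D f \<Longrightarrow> X \<subseteq> vcarrier D \<Longrightarrow> lform (restrict_to D X) f"
  unfolding lform_iff restrict_to_simps by blast

lemma biform_mono: "biform D D f \<Longrightarrow> X \<subseteq> vcarrier D \<Longrightarrow> biform (restrict_to D X) (restrict_to D X) f"
  by (auto simp: biform_iff intro: lform_mono)

lemma subcoalgebra_precoalgebra:
  assumes "precoalgebra D" "subcoalgebra X D"
  shows "precoalgebra (restrict_to D X)"
  using assms is_vspace_restrict[of D X] lform_mono[of D "counit D" X]
  unfolding precoalgebra_def subcoalgebra_def linear_map_def
  by (auto simp: subset_iff)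

lemma subcoalgebra_subset: "subcoalgebra X D \<Longrightarrow> X \<subseteq> vcarrier D"
  by (simp add: subcoalgebra_def)

text \<open>The two sides expand the same \<open>comult D x\<close> in different bases, one of
  \<open>X\<close> and one of the whole carrier; a biform does not see the difference.\<close>

lemma sw_restrict:
  assumes "precoalgebra D" "subcoalgebra X D" "biform D D F" "x \<in> X"
  shows "sw (restrict_to D X) x F = sw D x F"
proof -
  note X = subcoalgebra_subset[OF assms(2)] and pre = subcoalgebra_precoalgebra[OF assms(1,2)]
  have "Poly_Mapping.keys (comult_rep (restrict_to D X) x) \<subseteq> vcarrier D \<times> vcarrier D"
    using comult_rep(1)[OF pre, of x] basis_of(1)[OF precoalgebraD(1)[OF pre]] X by fastforce
  then show ?thesis
    using sw_feval[OF assms(1,3), of x "comult_rep (restrict_to D X) x"] comult_rep(2)[OF pre, of x] assms(4) X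
    by (auto simp: sw_def)
qed

text \<open>A form on \<open>X\<close> need not be linear outside \<open>X\<close>, so it is
  precomposed with a linear retraction \<open>P\<close> onto \<open>X\<close>; the laws of
  \<open>D\<close> then apply and restrict to \<open>X\<close>.\<close>

lemma subcoalgebra_coalgebra:
  assumes "coalgebra D" "subcoalgebra X D"
  shows "coalgebra (restrict_to D X)"
proof -
  let ?X = "restrict_to D X"
  have preD: "precoalgebra D" by (rule coalgebra_precoalgebra[OF assms(1)])
  have pre: "precoalgebra ?X" by (rule subcoalgebra_precoalgebra[OF preD assms(2)])
  note X = subcoalgebra_subset[OF assms(2)] and V = precoalgebraD(1)[OF preD]
  obtain P where P: "\<And>x. P x \<in> X" "\<And>x. x \<in> X \<Longrightarrow> P x = x"
    "\<And>x y. P (x + y) = P x + P y" "\<And>c x. P (smult D c x) = smult D c (P x)"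
    using ex_retraction[OF precoalgebraD(1)[OF pre]] by auto
  have lP: "lform D (\<lambda>x. f (P x))" if "lform ?X f" for f
    using that P by (simp add: lform_iff)
  note swX = sw_restrict[OF preD assms(2)]
  show ?thesis
  proof (rule coalgebraI[OF pre])
    fix F x assume F: "triform ?X ?X ?X F" and x: "x \<in> vcarrier ?X"
    define F' where "F' a b c = F (P a) (P b) (P c)" for a b c
    have eq: "F a b c = F' a b c" if "a \<in> X" "b \<in> X" "c \<in> X" for a b c
      using that P by (simp add: F'_def)
    have l: "lform D (\<lambda>a. F' a b c)" "lform D (\<lambda>b. F' a b c)" "lform D (\<lambda>c. F' a b c)" for a b c
      unfolding F'_def using triformD[OF F] P(1) by (auto intro!: lP)
    have bf: "biform D D (\<lambda>a b. F' a b c)" "biform D D (\<lambda>b c. F' a b c)" for a c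
      using l by (auto simp: biform_iff)
    have "sw ?X x (\<lambda>u v. sw ?X u (\<lambda>a b. F a b v)) = sw ?X x (\<lambda>u v. sw D u (\<lambda>a b. F' a b v))"
      by (intro sw_cong[OF pre])
        (subst swX[OF bf(1), symmetric], simp, intro sw_cong[OF pre], simp_all add: eq)
    also have "\<dots> = sw D x (\<lambda>u v. sw D u (\<lambda>a b. F' a b v))"
      using x l by (intro swX biform_sw_left[OF preD]) auto
    also have "\<dots> = sw D x (\<lambda>a w. sw D w (\<lambda>b v. F' a b v))" by (rule coassoc[OF assms(1)])
    also have "\<dots> = sw ?X x (\<lambda>a w. sw D w (\<lambda>b v. F' a b v))"
      using x l by (intro swX[symmetric] biform_sw_right[OF preD]) auto
    also have "\<dots> = sw ?X x (\<lambda>a w. sw ?X w (\<lambda>b v. F a b v))"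
      by (intro sw_cong[OF pre])
        (subst swX[OF bf(2), symmetric], simp, intro sw_cong[OF pre], simp_all add: eq)
    finally show "sw ?X x (\<lambda>u v. sw ?X u (\<lambda>a b. F a b v)) = sw ?X x (\<lambda>a w. sw ?X w (\<lambda>b v. F a b v))" .
  next
    fix f x assume f: "lform ?X f" and x: "x \<in> vcarrier ?X"
    have bf: "biform D D (\<lambda>a b. counit D a * f (P b))" "biform D D (\<lambda>a b. counit D b * f (P a))"
      using lP[OF f] precoalgebraD(3)[OF preD]
      by (auto simp: biform_iff intro: lform_mult_const lform_const_mult)
    have "sw ?X x (\<lambda>a b. counit D a * f b) = sw ?X x (\<lambda>a b. counit D a * f (P b))"
      by (rule sw_cong[OF pre]) (simp add: P)
    then show "sw ?X x (\<lambda>a b. counit ?X a * f b) = f x"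
      using swX[OF bf(1)] sw_counit(1)[OF assms(1) lP[OF f]] x X P by auto
    have "sw ?X x (\<lambda>a b. counit D b * f a) = sw ?X x (\<lambda>a b. counit D b * f (P a))"
      by (rule sw_cong[OF pre]) (simp add: P)
    then show "sw ?X x (\<lambda>a b. counit ?X b * f a) = f x"
      using swX[OF bf(2)] sw_counit(2)[OF assms(1) lP[OF f]] x X P by auto
  qed
qed

lemma sweedler_coalgebra_map:
  assumes "precoalgebra D" "linear_map D E g" "x \<in> vcarrier D"
  shows "sweedler D (tensor E E) x (\<lambda>x1 x2. tens E E (g x1) (g x2)) =
    swv (tensor E E) D x (\<lambda>x1 x2. tens E E (g x1) (g x2))"
proof (rule sweedler_swv[OF assms(1,3)])
  fix \<phi> assume \<phi>: "functional (tensor E E) \<phi>"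
  note bf = biform_functional_tens[OF \<phi>]
  show "biform D D (\<lambda>a b. \<phi> (tens E E (g a) (g b)))"
    using biform_comp[OF assms(2) assms(2) bf] .
qed (simp add: vector_space_fscale)

lemma swv_smult_cong: "smult U = smult U' \<Longrightarrow> swv U = swv U'"
  by (simp add: swv_def feval_def fun_eq_iff)

lemma subspace_image:
  assumes "is_vspace D" "is_vspace E" "linear_map D E f"
  shows "module.subspace (smult E) (f ` vcarrier D)"
proof -
  interpret vector_space "smult E" using assms by (simp add: is_vspace_def)
  have f: "f (x + y) = f x + f y" "f (smult D c x) = smult E c (f x)"
    if "x \<in> vcarrier D" "y \<in> vcarrier D" for x y c
    using assms that by (auto simp: linear_map_def)
  have f0: "f 0 = 0" using f(1)[of 0 0] vs_zero[OF assms(1)] by simp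
  show ?thesis unfolding subspace_def
  proof (intro conjI ballI allI)
    show "0 \<in> f ` vcarrier D" using f0 vs_zero[OF assms(1)] by force
    show "x + y \<in> f ` vcarrier D" if "x \<in> f ` vcarrier D" "y \<in> f ` vcarrier D" for x y
    proof -
      from that obtain a b where ab: "a \<in> vcarrier D" "b \<in> vcarrier D" "x = f a" "y = f b" by blast
      show ?thesis unfolding ab f(1)[OF ab(1,2), symmetric] by (rule imageI[OF vs_add[OF assms(1) ab(1,2)]])
    qed
    show "smult E c x \<in> f ` vcarrier D" if "x \<in> f ` vcarrier D" for x c
    proof -
      from that obtain a where a: "a \<in> vcarrier D" "x = f a" by blast
      show ?thesis unfolding a f(2)[OF a(1,1), symmetric] by (rule imageI[OF vs_scale[OF assms(1) a(1)]])
    qed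
  qed
qed

lemma subcoalgebra_image:
  assumes "precoalgebra D" "precoalgebra E" "coalgebra_map D E f"
  shows "subcoalgebra (f ` vcarrier D) E"
  unfolding subcoalgebra_def
proof (intro conjI ballI)
  note lin = coalgebra_map_linear[OF assms(3)]
  show "module.subspace (smult E) (f ` vcarrier D)"
    by (rule subspace_image[OF precoalgebraD(1)[OF assms(1)] precoalgebraD(1)[OF assms(2)] lin])
  show "f ` vcarrier D \<subseteq> vcarrier E" using linear_map_in[OF lin] by blast
  let ?Y = "restrict_to E (f ` vcarrier D)"
  fix y assume "y \<in> f ` vcarrier D"
  then obtain x where x: "x \<in> vcarrier D" "y = f x" by blast
  have "comult E y = swv (tensor ?Y ?Y) D x (\<lambda>x1 x2. tens ?Y ?Y (f x1) (f x2))"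
    using assms(3) x sweedler_coalgebra_map[OF assms(1) lin x(1)]
    by (simp add: coalgebra_map_def tens_cong[of E ?Y E ?Y] swv_smult_cong[of "tensor E E" "tensor ?Y ?Y"])
  also have "\<dots> \<in> vcarrier (tensor ?Y ?Y)"
    by (rule swv_in[OF assms(1) is_vspace_tensor]) (simp add: tens_in_tensor)
  finally show "comult E y \<in> vcarrier (tensor ?Y ?Y)" .
qed

lemma subcoalgebra_span_Union:
  assumes "precoalgebra D" "\<And>X. X \<in> \<X> \<Longrightarrow> subcoalgebra X D"
  shows "subcoalgebra (module.span (smult D) (\<Union>\<X>)) D"
proof -
  note V = precoalgebraD[OF assms(1)]
  interpret vector_space "smult D" using V(1) by (simp add: is_vspace_def)
  let ?S = "span (\<Union>\<X>)"
  have sub: "?S \<subseteq> vcarrier D"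
    using assms(2) V(1) by (intro span_minimal) (auto simp: subcoalgebra_def is_vspace_def)
  have sp: "is_vspace (restrict_to D ?S)" by (rule is_vspace_restrict[OF V(1) subspace_span])
  let ?T = "vcarrier (tensor (restrict_to D ?S) (restrict_to D ?S))"
  have lin: "comult D (x + y) = comult D x + comult D y" "comult D (smult D c x) = fscale c (comult D x)"
    if "x \<in> vcarrier D" "y \<in> vcarrier D" for x y c
    using V(2) that by (auto simp: linear_map_def)
  have T: "s + t \<in> ?T" "fscale c s \<in> ?T" if "s \<in> ?T" "t \<in> ?T" for s t c
    using vs_add[OF is_vspace_tensor that] vs_scale[OF is_vspace_tensor that(1), of c] by auto
  have "x \<in> vcarrier D \<and> comult D x \<in> ?T" if "x \<in> ?S" for x
    using that
  proof (induction rule: span_induct_alt)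
    case base
    have "comult D 0 = 0" using lin(1)[of 0 0] vs_zero[OF V(1)] by simp
    then show ?case using vs_zero[OF is_vspace_tensor] vs_zero[OF V(1)] by simp
  next
    case (step c x y)
    from step(1) obtain X where X: "X \<in> \<X>" "x \<in> X" by blast
    have "comult D x \<in> vcarrier (tensor (restrict_to D X) (restrict_to D X))"
      using assms(2)[OF X(1)] X(2) by (simp add: subcoalgebra_def)
    moreover have "X \<subseteq> ?S" using X(1) span_superset[of "\<Union>\<X>"] by blast
    ultimately have x: "comult D x \<in> ?T"
      using tensor_mono[of "restrict_to D X" "restrict_to D ?S" "restrict_to D X" "restrict_to D ?S"] by auto
    have mem: "x \<in> vcarrier D" "y \<in> vcarrier D" "smult D c x \<in> vcarrier D"
      using assms(2)[OF X(1)] X(2) step(2) vs_scale[OF V(1)] by (auto simp: subcoalgebra_def)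
    show ?case using T(1)[OF T(2)[OF x x, of c], of "comult D y"] step(2) lin mem vs_add[OF V(1)] by simp
  qed
  then show ?thesis using sub subspace_span by (simp add: subcoalgebra_def)
qed

lemma sw_eqI_diff:
  assumes "precoalgebra D" "x \<in> vcarrier D" "y \<in> vcarrier D" "sw D (x - y) F = 0"
  shows "sw D x F = sw D y F"
  using lform_diff[OF precoalgebraD(1)[OF assms(1)] lform_sw[OF assms(1)] assms(2,3), of F] assms(4) by simp

section \<open>Cofree coalgebras\<close>

lemma cofree_ex:
  fixes D :: "('k::field, 'd::ab_group_add) coalg"
  assumes "cofree_coalgebra TYPE('d) V C p" "coalgebra D" "linear_map D V f"
  obtains F where "coalgebra_map D C F" "\<And>x. x \<in> vcarrier D \<Longrightarrow> p (F x) = f x"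
  using assms unfolding cofree_coalgebra_def by blast

text \<open>Uniqueness in the definition concerns functions that are extensional on the carrier, so
  both maps are first cut down by \<open>restrict\<close>.\<close>

lemma cofree_unique:
  fixes D :: "('k::field, 'd::ab_group_add) coalg"
  assumes "cofree_coalgebra TYPE('d) V C p" "coalgebra D" "coalgebra_map D C F" "coalgebra_map D C G"
    "\<And>x. x \<in> vcarrier D \<Longrightarrow> p (F x) = p (G x)" "x \<in> vcarrier D"
  shows "F x = G x"
proof -
  have C: "coalgebra C" "linear_map C V p" using assms(1) by (auto simp: cofree_coalgebra_def)
  note pre = coalgebra_precoalgebra[OF assms(2)] coalgebra_precoalgebra[OF C(1)]
  have "linear_map D V (\<lambda>x. p (F x))"
    by (rule linear_map_comp[OF coalgebra_map_linear[OF assms(3)] C(2)])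
  then have ex1: "\<exists>!F'. coalgebra_map D C F' \<and> (\<forall>x\<in>vcarrier D. p (F' x) = p (F x)) \<and> F' \<in> extensional (vcarrier D)"
    using assms(1,2) unfolding cofree_coalgebra_def by blast
  have "coalgebra_map D C (restrict F (vcarrier D))" "coalgebra_map D C (restrict G (vcarrier D))"
    by (rule coalgebra_map_cong[OF pre assms(3)], simp) (rule coalgebra_map_cong[OF pre assms(4)], simp)
  then have "restrict F (vcarrier D) = restrict G (vcarrier D)"
    using ex1 assms(5) by (metis (mono_tags, lifting) restrict_apply' restrict_extensional)
  then show ?thesis using assms(6) by (metis restrict_apply')
qed

text \<open>The quotient by the coideal is realised on a complement \<open>\<pi>(C)\<close>, which maps back to \<open>C\<close> over \<open>V\<close>;
  by uniqueness the composite with \<open>\<pi>\<close> is the identity.\<close>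

lemma cofree_coideal_zero:
  fixes C :: "('k::field, 'c::ab_group_add) coalg"
  assumes cof: "cofree_coalgebra TYPE('c) V C p"
    and N: "module.subspace (smult C) N" "N \<subseteq> vcarrier C"
    and co: "\<And>n. n \<in> N \<Longrightarrow> counit C n = 0" "\<And>n. n \<in> N \<Longrightarrow> p n = 0"
    "\<And>n G. n \<in> N \<Longrightarrow> biform C C G \<Longrightarrow> (\<And>m y. m \<in> N \<Longrightarrow> y \<in> vcarrier C \<Longrightarrow> G m y = 0 \<and> G y m = 0) \<Longrightarrow>
      sw C n G = 0"
    and n: "n \<in> N"
  shows "n = 0"
proof -
  have C: "coalgebra C" "linear_map C V p" using cof by (auto simp: cofree_coalgebra_def)
  have pre: "precoalgebra C" by (rule coalgebra_precoalgebra[OF C(1)])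
  note VC = precoalgebraD[OF pre]
  interpret vector_space "smult C" using VC(1) by (simp add: is_vspace_def)
  obtain P where P: "\<And>x. P x \<in> N" "\<And>x. x \<in> N \<Longrightarrow> P x = x"
    "\<And>x y. P (x + y) = P x + P y" "\<And>c x. P (smult C c x) = smult C c (P x)"
    using ex_retraction[OF is_vspace_restrict[OF VC(1) N(1)]] by auto
  \<comment> \<open>\<open>\<pi>\<close> projects along \<open>N\<close> onto a complement. It
    models the quotient map with values in the type of \<open>C\<close> itself, which is what makes
    cofreeness for that type applicable to the quotient.\<close>
  define \<pi> where "\<pi> x = x - P x" for x
  have \<pi>C: "\<pi> x \<in> vcarrier C" if "x \<in> vcarrier C" for x
    unfolding \<pi>_def using that P(1) N(2) by (intro vs_diff[OF VC(1)]) auto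
  have \<pi>lin: "\<pi> (x + y) = \<pi> x + \<pi> y" "\<pi> (smult C c x) = smult C c (\<pi> x)" for x y c
    by (simp_all add: \<pi>_def P(3,4) scale_right_diff_distrib)
  have \<pi>N: "\<pi> x = 0" if "x \<in> N" for x using that P(2) by (simp add: \<pi>_def)
  have \<pi>d: "x - \<pi> x \<in> N" for x using P(1) by (simp add: \<pi>_def)
  have \<pi>\<pi>: "\<pi> (\<pi> x) = \<pi> x" for x
    using \<pi>N[OF \<pi>d[of x]] \<pi>lin(1)[of "x - \<pi> x" "\<pi> x"] by simp
  have \<pi>lm: "linear_map C C \<pi>" using \<pi>C \<pi>lin by (simp add: linear_map_def)
  define W where "W = restrict_to C (\<pi> ` vcarrier C)"
  define Q where "Q = W\<lparr>comult := (\<lambda>w. swv (tensor W W) C w (\<lambda>a b. tens W W (\<pi> a) (\<pi> b)))\<rparr>"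
  have Qs [simp]: "smult Q = smult C" "vcarrier Q = \<pi> ` vcarrier C" "counit Q = counit C"
    "comult Q = (\<lambda>w. swv (tensor W W) C w (\<lambda>a b. tens W W (\<pi> a) (\<pi> b)))"
    "smult W = smult C" by (simp_all add: Q_def W_def restrict_to_def)
  have tQ: "tens W W = tens Q Q" "swv (tensor W W) = swv (tensor Q Q)"
    by (simp_all add: tens_cong[of W Q W Q] swv_smult_cong)
  have QC: "vcarrier Q \<subseteq> vcarrier C" using \<pi>C by auto
  have \<pi>Q: "\<pi> x \<in> vcarrier Q" if "x \<in> vcarrier C" for x using that by simp
  have \<pi>id: "\<pi> x = x" if "x \<in> vcarrier Q" for x using that \<pi>\<pi> by auto
  have vQ: "is_vspace Q"
    using subspace_image[OF VC(1) VC(1) \<pi>lm] VC(1) by (simp add: is_vspace_def)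
  have lQ: "lform Q f" if "lform C f" for f using that QC unfolding lform_iff Qs(1) by blast
  have \<pi>lmQ: "linear_map C Q \<pi>" using \<pi>lin by (simp add: linear_map_def)
  have preQ: "precoalgebra Q"
    unfolding precoalgebra_def
  proof (intro conjI vQ)
    show "lform Q (counit Q)" using lQ[OF VC(3)] by simp
    show "linear_map Q (tensor Q Q) (comult Q)"
    proof (rule linear_mapI[OF vQ is_vspace_tensor])
      show "comult Q x \<in> vcarrier (tensor Q Q)" if "x \<in> vcarrier Q" for x
        unfolding Qs(4) tQ by (rule swv_in[OF pre is_vspace_tensor]) (use \<pi>Q in \<open>auto intro: tens_in_tensor\<close>)
      show "lform Q (\<lambda>x. f (comult Q x))" if "functional (tensor Q Q) f" for f
        unfolding Qs(4) tQ functional_swv[OF that] by (rule lQ[OF lform_sw[OF pre]])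
    qed
  qed
  have swQ: "sw Q w F = sw C w (\<lambda>a b. F (\<pi> a) (\<pi> b))" if "biform Q Q F" "w \<in> vcarrier Q" for w F
  proof -
    have "sw Q w F = tform Q Q F (swv (tensor Q Q) C w (\<lambda>a b. tens Q Q (\<pi> a) (\<pi> b)))"
      using sw_biform[OF preQ that] by (simp add: tQ)
    also have "\<dots> = sw C w (\<lambda>a b. tform Q Q F (tens Q Q (\<pi> a) (\<pi> b)))"
      by (rule lform_swv[OF pre is_vspace_tensor _ lform_tform[OF vQ vQ that(1)]])
        (use \<pi>Q in \<open>auto intro: tens_in_tensor\<close>)
    also have "\<dots> = sw C w (\<lambda>a b. F (\<pi> a) (\<pi> b))"
      by (rule sw_cong[OF pre]) (use \<pi>Q tform_tens[OF vQ vQ that(1)] in auto)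
    finally show ?thesis .
  qed
  \<comment> \<open>Replacing \<open>x\<close> by \<open>\<pi> x\<close> changes the coproduct by
    that of an element of \<open>N\<close>, and the form vanishes as soon as one argument lies in
    \<open>N\<close>. So the comultiplication induced on the quotient does not depend on
    representatives, and its coassociativity reduces to that of \<open>C\<close>.\<close>
  have swpi: "sw C (\<pi> x) (\<lambda>a b. F (\<pi> a) (\<pi> b)) = sw C x (\<lambda>a b. F (\<pi> a) (\<pi> b))"
    if F: "biform Q Q F" and x: "x \<in> vcarrier C" for x F
  proof (rule sw_eqI_diff[OF pre x \<pi>C[OF x], symmetric])
    have bf: "biform C C (\<lambda>a b. F (\<pi> a) (\<pi> b))" by (rule biform_comp[OF \<pi>lmQ \<pi>lmQ F])
    show "sw C (x - \<pi> x) (\<lambda>a b. F (\<pi> a) (\<pi> b)) = 0"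
    proof (rule co(3)[OF \<pi>d bf])
      fix m y assume my: "m \<in> N" "y \<in> vcarrier C"
      then show "F (\<pi> m) (\<pi> y) = 0 \<and> F (\<pi> y) (\<pi> m) = 0"
        using F \<pi>N[OF my(1)] \<pi>Q[OF my(2)] lform_0[OF vQ] unfolding biform_iff by (metis (no_types, lifting))
    qed
  qed
  have \<epsilon>\<pi>: "counit C (\<pi> x) = counit C x" if "x \<in> vcarrier C" for x
    using lform_diff[OF VC(1,3) that \<pi>C[OF that]] co(1)[OF \<pi>d[of x]] by simp
  have coQ: "coalgebra Q"
  proof (rule coalgebraI[OF preQ])
    fix F x assume F: "triform Q Q Q F" and x: "x \<in> vcarrier Q"
    have l: "lform C (\<lambda>a. F (\<pi> a) b c)" if "b \<in> vcarrier Q" "c \<in> vcarrier Q" for b c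
      by (rule lform_comp[OF \<pi>lmQ triformD(1)[OF F that]])
    have bfl: "biform Q Q (\<lambda>a b. F a b v)" if "v \<in> vcarrier Q" for v
      using triformD[OF F] that by (auto simp: biform_iff)
    have bfr: "biform Q Q (F v)" if "v \<in> vcarrier Q" for v
      using triformD[OF F] that by (auto simp: biform_iff)
    have "sw Q x (\<lambda>u v. sw Q u (\<lambda>a b. F a b v)) = sw C x (\<lambda>u v. sw Q (\<pi> u) (\<lambda>a b. F a b (\<pi> v)))"
      using triformD[OF F] by (intro swQ[OF _ x] biform_sw_left[OF preQ])
    also have "\<dots> = sw C x (\<lambda>u v. sw C u (\<lambda>a b. F (\<pi> a) (\<pi> b) (\<pi> v)))"
      by (intro sw_cong[OF pre]) (simp only: swQ[OF bfl[OF \<pi>Q] \<pi>Q] swpi[OF bfl[OF \<pi>Q]])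
    also have "\<dots> = sw C x (\<lambda>a w. sw C w (\<lambda>b v. F (\<pi> a) (\<pi> b) (\<pi> v)))" by (rule coassoc[OF C(1)])
    also have "\<dots> = sw C x (\<lambda>a w. sw Q (\<pi> w) (\<lambda>b v. F (\<pi> a) b v))"
      by (intro sw_cong[OF pre]) (simp only: swQ[OF bfr[OF \<pi>Q] \<pi>Q] swpi[OF bfr[OF \<pi>Q]])
    also have "\<dots> = sw Q x (\<lambda>a w. sw Q w (\<lambda>b v. F a b v))"
      using triformD[OF F] by (intro swQ[OF _ x, symmetric] biform_sw_right[OF preQ])
    finally show "sw Q x (\<lambda>u v. sw Q u (\<lambda>a b. F a b v)) = sw Q x (\<lambda>a w. sw Q w (\<lambda>b v. F a b v))" .
  next
    fix f x assume f: "lform Q f" and x: "x \<in> vcarrier Q"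
    note c = precoalgebraD(3)[OF preQ] and xC = subsetD[OF QC x]
    have bf: "biform Q Q (\<lambda>a b. counit Q a * f b)" "biform Q Q (\<lambda>a b. counit Q b * f a)"
      using f c by (auto simp: biform_iff intro!: lform_mult_const lform_const_mult)
    have "sw Q x (\<lambda>a b. counit Q a * f b) = sw C x (\<lambda>a b. counit C (\<pi> a) * f (\<pi> b))"
      using swQ[OF bf(1) x] by simp
    also have "\<dots> = sw C x (\<lambda>a b. counit C a * f (\<pi> b))"
      by (rule sw_cong[OF pre]) (simp add: \<epsilon>\<pi>)
    also have "\<dots> = f x" using sw_counit(1)[OF C(1) lform_comp[OF \<pi>lmQ f] xC] \<pi>id[OF x] by simp
    finally show "sw Q x (\<lambda>a b. counit Q a * f b) = f x" .
    have "sw Q x (\<lambda>a b. counit Q b * f a) = sw C x (\<lambda>a b. counit C (\<pi> b) * f (\<pi> a))"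
      using swQ[OF bf(2) x] by simp
    also have "\<dots> = sw C x (\<lambda>a b. counit C b * f (\<pi> a))"
      by (rule sw_cong[OF pre]) (simp add: \<epsilon>\<pi>)
    also have "\<dots> = f x" using sw_counit(2)[OF C(1) lform_comp[OF \<pi>lmQ f] xC] \<pi>id[OF x] by simp
    finally show "sw Q x (\<lambda>a b. counit Q b * f a) = f x" .
  qed
  have lpQ: "linear_map Q V p" using C(2) QC unfolding linear_map_def Qs(1) by blast
  obtain F where F: "coalgebra_map Q C F" "\<And>x. x \<in> vcarrier Q \<Longrightarrow> p (F x) = p x"
    by (rule cofree_ex[OF cof coQ lpQ]) blast
  note lF = coalgebra_map_linear[OF F(1)]
  have "coalgebra_map C C (\<lambda>x. F (\<pi> x))"
  proof (rule coalgebra_mapI[OF pre pre linear_map_comp[OF \<pi>lmQ lF]])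
    fix x G assume x: "x \<in> vcarrier C" and G: "biform C C G"
    note bf = biform_comp[OF lF lF G]
    have "sw C (F (\<pi> x)) G = sw Q (\<pi> x) (\<lambda>a b. G (F a) (F b))"
      by (rule sw_coalgebra_map[OF preQ pre F(1) G \<pi>Q[OF x]])
    also have "\<dots> = sw C x (\<lambda>a b. G (F (\<pi> a)) (F (\<pi> b)))"
      using swQ[OF bf \<pi>Q[OF x]] swpi[OF bf x] by simp
    finally show "sw C (F (\<pi> x)) G = sw C x (\<lambda>a b. G (F (\<pi> a)) (F (\<pi> b)))" .
  next
    show "counit C (F (\<pi> x)) = counit C x" if "x \<in> vcarrier C" for x
      using F(1) \<pi>Q[OF that] \<epsilon>\<pi>[OF that] unfolding coalgebra_map_def by (metis Qs(3))
  qed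
  moreover have "coalgebra_map C C (\<lambda>x. x)"
    by (rule coalgebra_mapI[OF pre pre]) (simp_all add: linear_map_def)
  moreover have "p (F (\<pi> x)) = p x" if "x \<in> vcarrier C" for x
  proof -
    have Nx: "x - \<pi> x \<in> vcarrier C" using \<pi>d N(2) by blast
    have "p (x - \<pi> x + \<pi> x) = p (x - \<pi> x) + p (\<pi> x)"
      using C(2) Nx \<pi>C[OF that] unfolding linear_map_def by blast
    then show ?thesis using F(2)[OF \<pi>Q[OF that]] co(2)[OF \<pi>d] by simp
  qed
  ultimately have "F (\<pi> n) = n"
    using cofree_unique[OF cof C(1)] n N(2) by blast
  moreover have "F 0 = 0"
    using lF vs_zero[OF vQ] unfolding linear_map_def by (metis add_cancel_left_left add_0)
  ultimately show "n = 0" using \<pi>N[OF n] by simp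
qed

section \<open>Hopf algebras\<close>

named_theorems lf "linearity of scalar-valued expressions in one variable"

lemmas lform_const_mult [lf] lform_mult_const [lf]

locale hopf_alg =
  fixes H :: "('k::field, 'h::ring_1) hopf"
  assumes hopf: "hopf_algebra H"
begin

abbreviation S where "S \<equiv> antipode H"
abbreviation e where "e \<equiv> counit H"

lemma coH: "coalgebra H" and UNIV_H [simp]: "vcarrier H = UNIV"
  using hopf by (auto simp: hopf_algebra_def)

lemma preH: "precoalgebra H"
  by (rule coalgebra_precoalgebra[OF coH])

lemma vH: "is_vspace H"
  by (rule precoalgebraD(1)[OF preH])

lemmas coassocH = coassoc[OF coH]

lemma lf_counit [lf]: "lform H e"
  by (rule precoalgebraD(3)[OF preH])

lemma smult_mult: "smult H c (x * y) = smult H c x * y" "smult H c (x * y) = x * smult H c y"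
  using hopf unfolding hopf_algebra_def by blast+

lemma lf_mult [lf]: "lform H f \<Longrightarrow> lform H (\<lambda>x. f (x * c))" "lform H f \<Longrightarrow> lform H (\<lambda>x. f (c * x))"
  by (auto simp: lform_iff algebra_simps smult_mult(1)[symmetric] smult_mult(2)[symmetric])

lemma linear_S: "linear_map H H S"
  using hopf by (simp add: hopf_algebra_def)

lemma lf_S [lf]: "lform H f \<Longrightarrow> lform H (\<lambda>x. f (S x))"
  by (rule lform_comp[OF linear_S])

lemma lf_swH [lf]: "lform H (\<lambda>x. sw H x F)"
  by (rule lform_sw[OF preH])

lemma lf_swH_arg [lf]: "(\<And>a b. lform V (\<lambda>y. F y a b)) \<Longrightarrow> lform V (\<lambda>y. sw H x (F y))"
  by (rule lform_sw_arg[OF preH])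

lemma swH_cong: "(\<And>a b. F a b = G a b) \<Longrightarrow> sw H x F = sw H x G"
  by (rule sw_cong[OF preH])

lemma biform_H: "biform H H G \<longleftrightarrow> (\<forall>b. lform H (\<lambda>a. G a b)) \<and> (\<forall>a. lform H (G a))"
  by (auto simp: biform_iff)

lemma H_eqI: "(\<And>f. lform H f \<Longrightarrow> f x = f y) \<Longrightarrow> x = y"
  by (rule lform_eqI[OF vH]) auto

lemma lform_smult_H: "lform H f \<Longrightarrow> f (smult H c x) = c * f x"
  by (simp add: lform_iff)

lemma functional_H: "functional H f \<longleftrightarrow> lform H f"
  by (auto simp: functional_def lform_iff)

lemma antipode_left: "lform H f \<Longrightarrow> sw H x (\<lambda>a b. f (S a * b)) = e x * f 1"
  and antipode_right: "lform H f \<Longrightarrow> sw H x (\<lambda>a b. f (a * S b)) = e x * f 1"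
proof -
  assume f: "lform H f"
  have bf: "biform H H (\<lambda>a b. f (S a * b))" "biform H H (\<lambda>a b. f (a * S b))"
    unfolding biform_H by (intro conjI allI lf f)+
  have "f (sweedler H H x (\<lambda>a b. S a * b)) = sw H x (\<lambda>a b. f (S a * b))"
    "f (sweedler H H x (\<lambda>a b. a * S b)) = sw H x (\<lambda>a b. f (a * S b))"
    using f by (auto simp: functional_H intro!: functional_sweedler[OF preH _ _ bf(1)]
        functional_sweedler[OF preH _ _ bf(2)])
  then show "sw H x (\<lambda>a b. f (S a * b)) = e x * f 1" "sw H x (\<lambda>a b. f (a * S b)) = e x * f 1"
    using hopf lform_smult_H[OF f] by (auto simp: hopf_algebra_def)
qed

lemma comult_functional:
  assumes "biform H H G"
  obtains \<phi> where "functional (tensor H H) \<phi>" "\<And>a b. \<phi> (tens H H a b) = G a b"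
    "\<And>x. \<phi> (comult H x) = sw H x G"
proof -
  obtain \<phi> where \<phi>: "functional (tensor H H) \<phi>"
    "\<And>a b. a \<in> vcarrier H \<Longrightarrow> b \<in> vcarrier H \<Longrightarrow> \<phi> (tens H H a b) = G a b"
    "\<And>t. t \<in> vcarrier (tensor H H) \<Longrightarrow> \<phi> t = tform H H G t"
    by (rule functional_tensE[OF vH vH assms]) blast
  show ?thesis
    by (rule that[OF \<phi>(1)]) (simp_all add: \<phi> sw_biform[OF preH assms] precoalgebraD(4)[OF preH])
qed

lemma comult_mult:
  assumes "\<And>b. lform H (\<lambda>a. G a b)" "\<And>a. lform H (G a)"
  shows "sw H (x * y) G = sw H x (\<lambda>a b. sw H y (\<lambda>c d. G (a * c) (b * d)))"
proof -
  have "biform H H G" using assms by (simp add: biform_H)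
  then obtain \<phi> where \<phi>: "functional (tensor H H) \<phi>" "\<And>a b. \<phi> (tens H H a b) = G a b"
    "\<And>x. \<phi> (comult H x) = sw H x G"
    by (rule comult_functional) blast
  have "sw H (x * y) G = \<phi> (sweedler H (tensor H H) x (\<lambda>x1 x2.
        sweedler H (tensor H H) y (\<lambda>y1 y2. tens H H (x1 * y1) (x2 * y2))))"
    using hopf \<phi>(3)[of "x * y"] by (simp add: hopf_algebra_def)
  also have "\<dots> = sw H x (\<lambda>a b. sw H y (\<lambda>c d. G (a * c) (b * d)))"
    by (intro functional_sweedler[OF preH _ \<phi>(1)]) (simp_all add: biform_H \<phi>(2), (intro conjI allI lf assms)+)
  finally show ?thesis .
qed

lemma comult_1:
  assumes "\<And>b. lform H (\<lambda>a. G a b)" "\<And>a. lform H (G a)"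
  shows "sw H 1 G = G 1 1"
proof -
  have "biform H H G" using assms by (simp add: biform_H)
  then obtain \<phi> where \<phi>: "functional (tensor H H) \<phi>" "\<And>a b. \<phi> (tens H H a b) = G a b"
    "\<And>x. \<phi> (comult H x) = sw H x G"
    by (rule comult_functional) blast
  show ?thesis using hopf \<phi>(2)[of 1 1] \<phi>(3)[of 1] by (simp add: hopf_algebra_def)
qed

lemma counit_mult [simp]: "e (x * y) = e x * e y" and counit_1 [simp]: "e 1 = 1"
  using hopf by (auto simp: hopf_algebra_def)

lemma swH_counit:
  assumes "lform H f"
  shows "sw H x (\<lambda>a b. e a * f b) = f x" "sw H x (\<lambda>a b. e b * f a) = f x"
  using sw_counit[OF coH assms] by auto

section \<open>Compatibility of the antipode with counit, product and coproduct\<close>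

lemma counit_S [simp]: "e (S x) = e x"
proof -
  have "e (S x) = sw H x (\<lambda>a b. e b * e (S a))"
    by (rule swH_counit(2)[symmetric]) (intro lf)
  also have "\<dots> = sw H x (\<lambda>a b. e (S a * b))" by (simp add: mult.commute)
  also have "\<dots> = e x" using antipode_left[OF lf_counit] by simp
  finally show ?thesis .
qed

text \<open>Uniqueness of convolution inverses on H \<otimes> H: \<open>?Z\<close> is the
  convolution of \<open>S\<close> after the product, the product itself, and the map x \<otimes> y
  \<mapsto> S y * S x. Cancelling the last two factors leaves \<open>S (x * y)\<close>, cancelling
  the first two leaves \<open>S y * S x\<close>.\<close>

lemma S_mult: "S (x * y) = S y * S x"
proof (rule H_eqI)
  fix f assume f: "lform H f"
  let ?Z = "sw H x (\<lambda>a w. sw H w (\<lambda>b c. sw H y (\<lambda>d v. sw H v (\<lambda>g k.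
      f (S (a * d) * (b * g) * (S k * S c))))))"
  have "?Z = sw H x (\<lambda>a w. sw H w (\<lambda>b c. sw H y (\<lambda>d v. e v * f (S (a * d) * b * 1 * S c))))"
  proof (intro swH_cong)
    fix a w b c d v
    have "sw H v (\<lambda>g k. f (S (a * d) * b * (g * S k) * S c)) = e v * f (S (a * d) * b * 1 * S c)"
      by (rule antipode_right) (intro lf f)
    then show "sw H v (\<lambda>g k. f (S (a * d) * (b * g) * (S k * S c))) = e v * f (S (a * d) * b * 1 * S c)"
      by (simp add: mult.assoc)
  qed
  also have "\<dots> = sw H x (\<lambda>a w. sw H w (\<lambda>b c. f (S (a * y) * b * 1 * S c)))"
    by (intro swH_cong swH_counit(2)) (intro lf f)
  also have "\<dots> = sw H x (\<lambda>a w. sw H w (\<lambda>b c. f (S (a * y) * (b * S c))))"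
    by (simp add: mult.assoc)
  also have "\<dots> = sw H x (\<lambda>a w. e w * f (S (a * y) * 1))"
    by (rule swH_cong, rule antipode_right) (intro lf f)
  also have "\<dots> = sw H x (\<lambda>a w. e w * f (S (a * y)))" by simp
  also have "\<dots> = f (S (x * y))" by (rule swH_counit(2)) (intro lf f)
  finally have 1: "?Z = f (S (x * y))" .
  have "?Z = sw H x (\<lambda>u c. sw H u (\<lambda>a b. sw H y (\<lambda>r k. sw H r (\<lambda>d g.
      f (S (a * d) * (b * g) * (S k * S c))))))"
    by (simp add: coassocH)
  also have "\<dots> = sw H x (\<lambda>u c. sw H y (\<lambda>r k. sw H u (\<lambda>a b. sw H r (\<lambda>d g.
      f (S (a * d) * (b * g) * (S k * S c))))))"
    by (rule swH_cong, rule sw_swap)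
  also have "\<dots> = sw H x (\<lambda>u c. sw H y (\<lambda>r k. sw H (u * r) (\<lambda>s t. f (S s * t * (S k * S c)))))"
    by (rule swH_cong, rule swH_cong, rule comult_mult[symmetric]) (intro lf f)+
  also have "\<dots> = sw H x (\<lambda>u c. sw H y (\<lambda>r k. e (u * r) * f (1 * (S k * S c))))"
    by (rule swH_cong, rule swH_cong, rule antipode_left) (intro lf f)+
  also have "\<dots> = sw H x (\<lambda>u c. e u * sw H y (\<lambda>r k. e r * f (S k * S c)))"
    by (simp add: mult.assoc sw_const_mult)
  also have "\<dots> = sw H x (\<lambda>u c. e u * f (S y * S c))"
    by (rule swH_cong) (subst swH_counit(1), (intro lf f)+, simp)
  also have "\<dots> = f (S y * S x)" by (rule swH_counit(1)) (intro lf f)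
  finally show "f (S (x * y)) = f (S y * S x)" using 1 by simp
qed

text \<open>Again uniqueness of convolution inverses: the coproduct after \<open>S\<close>, and the
  flipped S \<otimes> S after the coproduct, both invert the coproduct among the maps from H to H
  \<otimes> H. \<open>?Z\<close> is the convolution of the three.\<close>

lemma comult_S:
  assumes G1: "\<And>b. lform H (\<lambda>a. G a b)" and G2: "\<And>a. lform H (G a)"
  shows "sw H (S x) G = sw H x (\<lambda>a b. G (S b) (S a))"
proof -
  let ?Z = "sw H x (\<lambda>a w. sw H w (\<lambda>b v. sw H v (\<lambda>c d. sw H (S a) (\<lambda>s t. sw H b (\<lambda>y z.
      G (s * y * S d) (t * z * S c))))))"
  have "?Z = sw H x (\<lambda>r v. sw H r (\<lambda>a b. sw H v (\<lambda>c d. sw H (S a) (\<lambda>s t. sw H b (\<lambda>y z.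
      G (s * y * S d) (t * z * S c))))))"
    by (simp add: coassocH)
  also have "\<dots> = sw H x (\<lambda>r v. sw H v (\<lambda>c d. sw H r (\<lambda>a b. sw H (S a) (\<lambda>s t. sw H b (\<lambda>y z.
      G (s * y * S d) (t * z * S c))))))"
    by (rule swH_cong, rule sw_swap)
  also have "\<dots> = sw H x (\<lambda>r v. sw H v (\<lambda>c d. sw H r (\<lambda>a b. sw H (S a * b) (\<lambda>s t. G (s * S d) (t * S c)))))"
    by (rule swH_cong, rule swH_cong, rule swH_cong, rule comult_mult[symmetric]) (intro lf G1 G2)+
  also have "\<dots> = sw H x (\<lambda>r v. sw H v (\<lambda>c d. e r * sw H 1 (\<lambda>s t. G (s * S d) (t * S c))))"
    by (rule swH_cong, rule swH_cong, rule antipode_left) (intro lf)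
  also have "\<dots> = sw H x (\<lambda>r v. sw H v (\<lambda>c d. e r * G (1 * S d) (1 * S c)))"
    by (rule swH_cong, rule swH_cong) (subst comult_1, (intro lf G1 G2)+, simp)
  also have "\<dots> = sw H x (\<lambda>r v. e r * sw H v (\<lambda>c d. G (S d) (S c)))"
    by (simp add: sw_const_mult)
  also have "\<dots> = sw H x (\<lambda>c d. G (S d) (S c))" by (rule swH_counit(1)) (intro lf)
  finally have 1: "?Z = sw H x (\<lambda>c d. G (S d) (S c))" .
  have inner: "sw H w (\<lambda>b v. sw H b (\<lambda>y z. sw H v (\<lambda>c d. G (s * y * S d) (t * z * S c)))) = e w * G s t"
    for w s t
  proof -
    have "sw H w (\<lambda>b v. sw H b (\<lambda>y z. sw H v (\<lambda>c d. G (s * y * S d) (t * z * S c)))) =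
      sw H w (\<lambda>y v. sw H v (\<lambda>r d. sw H r (\<lambda>z c. G (s * y * S d) (t * (z * S c)))))"
      by (simp add: coassocH mult.assoc)
    also have "\<dots> = sw H w (\<lambda>y v. sw H v (\<lambda>r d. e r * G (s * y * S d) (t * 1)))"
      by (rule swH_cong, rule swH_cong, rule antipode_right) (intro lf G1 G2)
    also have "\<dots> = sw H w (\<lambda>y v. G (s * y * S v) (t * 1))"
      by (rule swH_cong, rule swH_counit(1)) (intro lf G1 G2)
    also have "\<dots> = sw H w (\<lambda>y v. G (s * (y * S v)) t)" by (simp add: mult.assoc)
    also have "\<dots> = e w * G (s * 1) t" by (rule antipode_right) (intro lf G1 G2)
    finally show ?thesis by simp
  qed
  have "?Z = sw H x (\<lambda>a w. sw H w (\<lambda>b v. sw H (S a) (\<lambda>s t. sw H b (\<lambda>y z. sw H v (\<lambda>c d.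
      G (s * y * S d) (t * z * S c))))))"
    by (rule swH_cong, rule swH_cong, subst sw_swap, rule swH_cong, rule sw_swap)
  also have "\<dots> = sw H x (\<lambda>a w. sw H (S a) (\<lambda>s t. sw H w (\<lambda>b v. sw H b (\<lambda>y z. sw H v (\<lambda>c d.
      G (s * y * S d) (t * z * S c))))))"
    by (rule swH_cong, rule sw_swap)
  also have "\<dots> = sw H x (\<lambda>a w. e w * sw H (S a) G)"
    by (simp add: inner sw_const_mult)
  also have "\<dots> = sw H (S x) G" by (rule swH_counit(2)) (intro lf)
  finally show ?thesis using 1 by simp
qed

end

section \<open>Partial corepresentations\<close>

text \<open>
  \<open>E x = p x\<^sub>1 S(p x\<^sub>2)\<close> and \<open>q x = S(p x\<^sub>1) p x\<^sub>2\<close> package the two idempotent-like expressions; in terms of the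
  dual partial representation \<open>h \<mapsto> [h]\<close> they correspond to \<open>[h\<^sub>1][S h\<^sub>2]\<close> and \<open>[S h\<^sub>1][h\<^sub>2]\<close>.
\<close>

locale pcorep = hopf_alg H
  for H :: "('k::field, 'h::ring_1) hopf" +
  fixes D :: "('k, 'd::ab_group_add) coalg" and p :: "'d \<Rightarrow> 'h"
  assumes coD: "coalgebra D"
    and linear_p: "linear_map D H p"
    and counit_p: "x \<in> vcarrier D \<Longrightarrow> e (p x) = counit D x"
    and pc2: "biform H H G \<Longrightarrow> sw D x (\<lambda>a b. sw H (p a) (\<lambda>g h. G g (h * S (p b)))) =
      sw D x (\<lambda>a w. sw D w (\<lambda>b c. G (p a) (p b * S (p c))))"
    and pc3: "biform H H G \<Longrightarrow> sw D x (\<lambda>a b. sw H (p b) (\<lambda>g h. G (p a * S g) h)) =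
      sw D x (\<lambda>a w. sw D w (\<lambda>b c. G (p a * S (p b)) (p c)))"
begin

abbreviation "T \<equiv> sw D"
abbreviation "T3 x F \<equiv> T x (\<lambda>a w. T w (\<lambda>b c. F a b c))"
abbreviation "T4 x F \<equiv> T x (\<lambda>a w. T w (\<lambda>b v. T v (\<lambda>c d. F a b c d)))"
abbreviation "T5 x F \<equiv> T x (\<lambda>a w. T w (\<lambda>b v. T v (\<lambda>c u. T u (\<lambda>d f. F a b c d f))))"

lemma preD: "precoalgebra D"
  by (rule coalgebra_precoalgebra[OF coD])

lemma vD: "is_vspace D"
  by (rule precoalgebraD(1)[OF preD])

lemmas coassocD = coassoc[OF coD]

lemma lf_p [lf]: "lform H f \<Longrightarrow> lform D (\<lambda>x. f (p x))"
  by (rule lform_comp[OF linear_p])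

lemma lf_T [lf]: "lform D (\<lambda>x. T x F)"
  by (rule lform_sw[OF preD])

lemma lf_T_arg [lf]: "(\<And>a b. lform V (\<lambda>y. F y a b)) \<Longrightarrow> lform V (\<lambda>y. T x (F y))"
  by (rule lform_sw_arg[OF preD])

lemma T_cong: "(\<And>a b. a \<in> vcarrier D \<Longrightarrow> b \<in> vcarrier D \<Longrightarrow> F a b = G a b) \<Longrightarrow> T x F = T x G"
  by (rule sw_cong[OF preD])

lemma T_counit:
  assumes "lform D f" "x \<in> vcarrier D"
  shows "T x (\<lambda>a b. counit D a * f b) = f x" "T x (\<lambda>a b. counit D b * f a) = f x"
  by (rule sw_counit[OF coD assms])+

definition E where "E x = swv H D x (\<lambda>a b. p a * S (p b))"
definition q where "q x = swv H D x (\<lambda>a b. S (p a) * p b)"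

lemma E: "lform H f \<Longrightarrow> f (E x) = T x (\<lambda>a b. f (p a * S (p b)))"
  unfolding E_def by (rule lform_swv[OF preD vH]) auto

lemma q: "lform H f \<Longrightarrow> f (q x) = T x (\<lambda>a b. f (S (p a) * p b))"
  unfolding q_def by (rule lform_swv[OF preD vH]) auto

lemma lf_E [lf]: "lform H f \<Longrightarrow> lform D (\<lambda>x. f (E x))"
  by (simp add: E lf)

lemma lf_q [lf]: "lform H f \<Longrightarrow> lform D (\<lambda>x. f (q x))"
  by (simp add: q lf)

lemma counit_E: "x \<in> vcarrier D \<Longrightarrow> e (E x) = counit D x"
proof -
  assume x: "x \<in> vcarrier D"
  have "e (E x) = T x (\<lambda>a b. e (p a * S (p b)))" by (rule E[OF lf_counit])
  also have "\<dots> = T x (\<lambda>a b. counit D a * counit D b)"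
    by (rule T_cong) (simp add: counit_p)
  also have "\<dots> = counit D x" by (rule T_counit(1)[OF precoalgebraD(3)[OF preD] x])
  finally show ?thesis .
qed

section \<open>Consequences of the axioms in terms of \<open>E\<close> and \<open>q\<close>\<close>

lemma PR2:
  assumes "\<And>b. lform H (\<lambda>a. G a b)" "\<And>a. lform H (G a)"
  shows "T x (\<lambda>a b. sw H (p a) (\<lambda>g h. G g (h * S (p b)))) = T x (\<lambda>a u. G (p a) (E u))"
  using pc2[of G x] assms by (simp add: biform_H E)

text \<open>Coassociativity brings the first two legs of the axiom together, where they contract to
  \<open>E u\<close>.\<close>

lemma PR3:
  assumes "\<And>b. lform H (\<lambda>a. G a b)" "\<And>a. lform H (G a)"
  shows "T x (\<lambda>a b. sw H (p b) (\<lambda>g h. G (p a * S g) h)) = T x (\<lambda>u c. G (E u) (p c))"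
proof -
  have "T x (\<lambda>a b. sw H (p b) (\<lambda>g h. G (p a * S g) h)) = T x (\<lambda>u c. T u (\<lambda>a b. G (p a * S (p b)) (p c)))"
    using pc3[of G x] assms by (simp add: biform_H coassocD)
  also have "\<dots> = T x (\<lambda>u c. G (E u) (p c))"
    by (rule T_cong) (simp add: E[OF assms(1)])
  finally show ?thesis .
qed

text \<open>Multiplying the two tensor factors of \<open>PR3\<close> lets \<open>S g * h\<close>
  collapse by the antipode axiom. Dually this is
  \<open>[h\<^sub>1][S h\<^sub>2][h\<^sub>3] = [h]\<close>.\<close>

lemma E_p: "x \<in> vcarrier D \<Longrightarrow> lform H f \<Longrightarrow> T x (\<lambda>u a. f (E u * p a)) = f (p x)"
proof -
  assume x: "x \<in> vcarrier D" and f: "lform H f"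
  have "T x (\<lambda>u a. f (E u * p a)) = T x (\<lambda>a b. sw H (p b) (\<lambda>g h. f (p a * S g * h)))"
    by (rule PR3[symmetric]) (intro lf f)+
  also have "\<dots> = T x (\<lambda>a b. e (p b) * f (p a * 1))"
    unfolding mult.assoc by (rule T_cong, rule antipode_left) (intro lf f)
  also have "\<dots> = T x (\<lambda>a b. counit D b * f (p a))"
    by (rule T_cong) (simp add: counit_p)
  also have "\<dots> = f (p x)" by (rule T_counit(2)[OF _ x]) (intro lf f)
  finally show ?thesis .
qed

lemma S_E: "x \<in> vcarrier D \<Longrightarrow> lform H f \<Longrightarrow> T x (\<lambda>a u. f (S (p a) * E u)) = f (S (p x))"
proof -
  assume x: "x \<in> vcarrier D" and f: "lform H f"
  have "T x (\<lambda>a u. f (S (p a) * E u)) = T x (\<lambda>a b. sw H (p a) (\<lambda>g h. f (S g * (h * S (p b)))))"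
    by (rule PR2[symmetric]) (intro lf f)+
  also have "\<dots> = T x (\<lambda>a b. sw H (p a) (\<lambda>g h. f (S g * h * S (p b))))" by (simp add: mult.assoc)
  also have "\<dots> = T x (\<lambda>a b. e (p a) * f (1 * S (p b)))"
    by (rule T_cong, rule antipode_left) (intro lf f)
  also have "\<dots> = T x (\<lambda>a b. counit D a * f (S (p b)))"
    by (rule T_cong) (simp add: counit_p)
  also have "\<dots> = f (S (p x))" by (rule T_counit(1)[OF _ x]) (intro lf f)
  finally show ?thesis .
qed

text \<open>Both \<open>p a * q y\<close> and \<open>E u * p c\<close> are bracketings of the same
  triple product.\<close>

lemma p_q: "x \<in> vcarrier D \<Longrightarrow> lform H f \<Longrightarrow> T x (\<lambda>a y. f (p a * q y)) = f (p x)"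
proof -
  assume x: "x \<in> vcarrier D" and f: "lform H f"
  have "T x (\<lambda>a y. f (p a * q y)) = T x (\<lambda>a y. T y (\<lambda>b c. f (p a * (S (p b) * p c))))"
    by (rule T_cong, rule q) (intro lf f)
  also have "\<dots> = T x (\<lambda>u c. T u (\<lambda>a b. f (p a * S (p b) * p c)))"
    by (simp add: coassocD mult.assoc)
  also have "\<dots> = T x (\<lambda>u c. f (E u * p c))"
    by (rule T_cong, rule E[symmetric]) (intro lf f)
  finally show ?thesis using E_p[OF x f] by simp
qed

lemma q_S: "x \<in> vcarrier D \<Longrightarrow> lform H f \<Longrightarrow> T x (\<lambda>y a. f (q y * S (p a))) = f (S (p x))"
proof -
  assume x: "x \<in> vcarrier D" and f: "lform H f"
  have "T x (\<lambda>y c. f (q y * S (p c))) = T x (\<lambda>y c. T y (\<lambda>a b. f (S (p a) * p b * S (p c))))"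
    by (rule T_cong, rule q) (intro lf f)
  also have "\<dots> = T x (\<lambda>a w. T w (\<lambda>b c. f (S (p a) * (p b * S (p c)))))"
    by (simp add: coassocD mult.assoc)
  also have "\<dots> = T x (\<lambda>a u. f (S (p a) * E u))"
    by (rule T_cong, rule E[symmetric]) (intro lf f)
  finally show ?thesis using S_E[OF x f] by simp
qed

text \<open>The leg \<open>g\<close> is carried along untouched while \<open>PR2\<close> unfolds
  \<open>E u\<close> and the adjacent legs \<open>S h * t\<close> cancel. The coproduct of
  \<open>p a\<close> in \<open>H\<close> is thereby exchanged for that of \<open>D\<close>.\<close>

lemma S_E_comult:
  assumes G: "\<And>b. lform H (\<lambda>a. G a b)" "\<And>a. lform H (G a)"
  shows "T r (\<lambda>a u. sw H (p a) (\<lambda>g h. G g (S h * E u))) = T r (\<lambda>a b. G (p a) (S (p b)))"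
proof -
  have "T r (\<lambda>a u. sw H (p a) (\<lambda>g h. G g (S h * E u))) =
    T r (\<lambda>a b. sw H (p a) (\<lambda>s t. sw H s (\<lambda>g h. G g (S h * (t * S (p b))))))"
    by (rule PR2[symmetric]) (intro lf G)+
  also have "\<dots> = T r (\<lambda>a b. sw H (p a) (\<lambda>g y. sw H y (\<lambda>h t. G g (S h * t * S (p b)))))"
    by (simp add: coassocH mult.assoc)
  also have "\<dots> = T r (\<lambda>a b. sw H (p a) (\<lambda>g y. e y * G g (1 * S (p b))))"
    by (rule T_cong, rule swH_cong, rule antipode_left) (intro lf G)
  also have "\<dots> = T r (\<lambda>a b. G (p a) (1 * S (p b)))"
    by (rule T_cong, rule swH_counit(2)) (intro lf G)
  finally show ?thesis by simp
qed

text \<open>\<open>p\<close> is not assumed to preserve coproducts, but after multiplication by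
  \<open>E u\<close> the coproduct of \<open>p b\<close> in \<open>H\<close> may be exchanged for
  that of \<open>D\<close>: \<open>PR3\<close> unfolds \<open>E u\<close>, and the antipode cancels
  adjacent legs.\<close>

lemma E_p_comult:
  assumes G: "\<And>b. lform H (\<lambda>a. G a b)" "\<And>a. lform H (G a)"
  shows "T r (\<lambda>u b. sw H (p b) (\<lambda>g h. G (E u * g) h)) = T r (\<lambda>b c. G (p b) (p c))"
proof -
  have "T r (\<lambda>u b. sw H (p b) (\<lambda>g h. G (E u * g) h)) =
    T r (\<lambda>a b. sw H (p b) (\<lambda>s t. sw H t (\<lambda>g h. G (p a * S s * g) h)))"
    by (rule PR3[symmetric]) (intro lf G)+
  also have "\<dots> = T r (\<lambda>a b. sw H (p b) (\<lambda>y h. sw H y (\<lambda>s g. G (p a * (S s * g)) h)))"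
    by (simp add: coassocH mult.assoc)
  also have "\<dots> = T r (\<lambda>a b. sw H (p b) (\<lambda>y h. e y * G (p a * 1) h))"
    by (rule T_cong, rule swH_cong, rule antipode_left) (intro lf G)
  also have "\<dots> = T r (\<lambda>a b. G (p a * 1) (p b))"
    by (rule T_cong, rule swH_counit(1)) (intro lf G)
  finally show ?thesis by simp
qed

text \<open>The analogue of \<open>PR3\<close> for \<open>q\<close>, which is not among the axioms.
  Writing \<open>S (p c)\<close> as \<open>S (p c) * E u\<close> makes \<open>E_p_comult\<close>
  applicable, and \<open>q\<close> appears on regrouping.\<close>

lemma PR5:
  assumes G: "\<And>b. lform H (\<lambda>a. G a b)" "\<And>a. lform H (G a)"
  shows "T x (\<lambda>a b. sw H (p b) (\<lambda>g h. G (S (p a) * g) h)) = T x (\<lambda>y c. G (q y) (p c))"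
proof -
  have "T x (\<lambda>a b. sw H (p b) (\<lambda>g h. G (S (p a) * g) h)) =
    T x (\<lambda>r b. T r (\<lambda>c u. sw H (p b) (\<lambda>g h. G (S (p c) * E u * g) h)))"
    by (rule T_cong, rule S_E[symmetric], assumption) (intro lf G)
  also have "\<dots> = T x (\<lambda>c w. T w (\<lambda>u b. sw H (p b) (\<lambda>g h. G (S (p c) * (E u * g)) h)))"
    by (simp add: coassocD mult.assoc)
  also have "\<dots> = T x (\<lambda>c w. T w (\<lambda>b d. G (S (p c) * p b) (p d)))"
    by (rule T_cong, rule E_p_comult) (intro lf G)+
  also have "\<dots> = T x (\<lambda>y d. T y (\<lambda>c b. G (S (p c) * p b) (p d)))" by (rule coassocD[symmetric])
  also have "\<dots> = T x (\<lambda>y d. G (q y) (p d))"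
    by (rule T_cong, rule q[symmetric]) (intro lf G)
  finally show ?thesis .
qed

text \<open>Dual to \<open>[h] \<epsilon>\<^sub>k = \<epsilon>\<^bsub>h\<^sub>1k\<^esub> [h\<^sub>2]\<close>, where \<open>\<epsilon>\<^sub>k = [k\<^sub>1][S k\<^sub>2]\<close>.\<close>

lemma p_E:
  assumes G: "\<And>b. lform H (\<lambda>a. G a b)" "\<And>a. lform H (G a)"
  shows "T x (\<lambda>u c. sw H (E u) (\<lambda>g h. G (g * p c) h)) = T x (\<lambda>a u. G (p a) (E u))"
proof -
  have "T x (\<lambda>a u. G (p a) (E u)) = T x (\<lambda>a b. sw H (p a) (\<lambda>g h. G g (h * S (p b))))"
    by (rule PR2[symmetric]) (rule G)+
  \<comment> \<open>The counit is inserted in order to be expanded as \<open>S z * s\<close>: the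
    legs \<open>S z\<close> and \<open>S y\<close> then form the coproduct of \<open>S r\<close>, so
    that the coproduct of \<open>p a * S r\<close> appears, multiplied by \<open>s\<close>. This is
    the shape of \<open>PR3\<close>.\<close>
  also have "\<dots> = T x (\<lambda>a b. sw H (p a) (\<lambda>g h. sw H (p b) (\<lambda>y t. e t * G (g * 1) (h * S y))))"
    by (rule T_cong, rule swH_cong, subst swH_counit(2)) (intro lf G, simp)
  also have "\<dots> = T x (\<lambda>a b. sw H (p a) (\<lambda>g h. sw H (p b) (\<lambda>y t. sw H t (\<lambda>z s. G (g * (S z * s)) (h * S y)))))"
    by (rule T_cong, rule swH_cong, rule swH_cong, rule antipode_left[symmetric]) (intro lf G)
  also have "\<dots> = T x (\<lambda>a b. sw H (p a) (\<lambda>g h. sw H (p b) (\<lambda>r s. sw H r (\<lambda>y z. G (g * S z * s) (h * S y)))))"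
    by (simp add: coassocH mult.assoc)
  also have "\<dots> = T x (\<lambda>a b. sw H (p b) (\<lambda>r s. sw H (p a) (\<lambda>g h. sw H r (\<lambda>y z. G (g * S z * s) (h * S y)))))"
    by (rule T_cong, rule sw_swap)
  also have "\<dots> = T x (\<lambda>a b. sw H (p b) (\<lambda>r s. sw H (p a) (\<lambda>g h. sw H (S r) (\<lambda>y z. G (g * y * s) (h * z)))))"
    by (rule T_cong, rule swH_cong, rule swH_cong, rule comult_S[symmetric]) (intro lf G)+
  also have "\<dots> = T x (\<lambda>a b. sw H (p b) (\<lambda>r s. sw H (p a * S r) (\<lambda>g h. G (g * s) h)))"
    by (rule T_cong, rule swH_cong, rule comult_mult[symmetric]) (intro lf G)+
  also have "\<dots> = T x (\<lambda>u c. sw H (E u) (\<lambda>g h. G (g * p c) h))"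
    by (rule PR3) (intro lf G)+
  finally show ?thesis by simp
qed

text \<open>\<open>p_E\<close> moves \<open>p\<close> past \<open>E\<close> so that it meets
  \<open>q\<close>, and \<open>p_q\<close> absorbs the \<open>q\<close>. This is the identity of
  \<open>p_Eb_product\<close> seen through the projection of the cofree coalgebra.\<close>

lemma p_E_q:
  assumes G: "\<And>b. lform H (\<lambda>a. G a b)" "\<And>a. lform H (G a)"
  shows "T3 x (\<lambda>a u y. G (p a * q y) (E u)) = T x (\<lambda>a u. G (p a) (E u))"
proof -
  have "T3 x (\<lambda>a u y. G (p a * q y) (E u)) = T x (\<lambda>r y. T r (\<lambda>a u. G (p a * q y) (E u)))"
    by (simp add: coassocD)
  also have "\<dots> = T x (\<lambda>r y. T r (\<lambda>u b. sw H (E u) (\<lambda>g h. G (g * p b * q y) h)))"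
    by (rule T_cong, rule p_E[symmetric]) (intro lf G)+
  also have "\<dots> = T x (\<lambda>u z. T z (\<lambda>b y. sw H (E u) (\<lambda>g h. G (g * (p b * q y)) h)))"
    by (simp add: coassocD mult.assoc)
  also have "\<dots> = T x (\<lambda>u z. sw H (E u) (\<lambda>g h. G (g * p z) h))"
    by (rule T_cong, rule p_q, assumption) (intro lf G)
  also have "\<dots> = T x (\<lambda>a u. G (p a) (E u))" by (rule p_E) (rule G)+
  finally show ?thesis .
qed

text \<open>The gain is on the right, where only values of \<open>E\<close> occur, and
  \<open>E\<close> factors through \<open>Eb\<close>. So the coaction, once its second factor is
  projected to \<open>H\<close>, depends on \<open>x\<close> only through
  \<open>Eb x\<close>.\<close>

lemma p_E_S:
  assumes G: "\<And>b. lform H (\<lambda>a. G a b)" "\<And>a. lform H (G a)"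
  shows "T3 x (\<lambda>a u c. G (p a * S (p c)) (E u)) = T x (\<lambda>u v. sw H (E u) (\<lambda>g h. G (g * E v) h))"
proof -
  have "T3 x (\<lambda>a u c. G (p a * S (p c)) (E u)) = T x (\<lambda>r c. T r (\<lambda>a u. G (p a * S (p c)) (E u)))"
    by (simp add: coassocD)
  also have "\<dots> = T x (\<lambda>r c. T r (\<lambda>u b. sw H (E u) (\<lambda>g h. G (g * p b * S (p c)) h)))"
    by (rule T_cong, rule p_E[symmetric]) (intro lf G)+
  also have "\<dots> = T x (\<lambda>u z. T z (\<lambda>b c. sw H (E u) (\<lambda>g h. G (g * (p b * S (p c))) h)))"
    by (simp add: coassocD mult.assoc)
  also have "\<dots> = T x (\<lambda>u z. sw H (E u) (\<lambda>g h. G (g * E z) h))"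
    by (rule T_cong, rule E[symmetric]) (intro lf G)
  finally show ?thesis .
qed

text \<open>\<open>p_E\<close> read backwards puts \<open>S (r * p c)\<close> in front; since
  \<open>S\<close> reverses products, \<open>S r\<close> meets the leg \<open>g\<close> that it
  cancels.\<close>

lemma S_p_E:
  assumes G: "\<And>b. lform H (\<lambda>a. G a b)" "\<And>a. lform H (G a)"
  shows "T x (\<lambda>a u. sw H (E u) (\<lambda>g h. G (S (p a) * g) h)) = T x (\<lambda>u a. G (S (p a)) (E u))"
proof -
  have "T x (\<lambda>a u. sw H (E u) (\<lambda>g h. G (S (p a) * g) h)) =
    T x (\<lambda>u c. sw H (E u) (\<lambda>r s. sw H s (\<lambda>g h. G (S (r * p c) * g) h)))"
    by (rule p_E[symmetric]) (intro lf G)+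
  also have "\<dots> = T x (\<lambda>u c. sw H (E u) (\<lambda>y h. sw H y (\<lambda>r g. G (S (p c) * (S r * g)) h)))"
    by (simp add: coassocH mult.assoc S_mult)
  also have "\<dots> = T x (\<lambda>u c. sw H (E u) (\<lambda>y h. e y * G (S (p c) * 1) h))"
    by (rule T_cong, rule swH_cong, rule antipode_left) (intro lf G)
  also have "\<dots> = T x (\<lambda>u c. G (S (p c) * 1) (E u))"
    by (rule T_cong, rule swH_counit(1)) (intro lf G)
  finally show ?thesis by simp
qed

text \<open>The mirror image of \<open>p_E_q\<close>, and the identity of
  \<open>S_Eb_product\<close> after projection to \<open>H\<close>. Unfolding \<open>q\<close>
  exposes a \<open>p\<close>, which \<open>p_E\<close> carries past \<open>E\<close>;
  \<open>S_p_E\<close> and \<open>S_E\<close> remove what is left.\<close>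

lemma q_E_S:
  assumes G: "\<And>b. lform H (\<lambda>a. G a b)" "\<And>a. lform H (G a)"
  shows "T3 x (\<lambda>y u c. G (q y * S (p c)) (E u)) = T x (\<lambda>u a. G (S (p a)) (E u))"
proof -
  have "T3 x (\<lambda>y u c. G (q y * S (p c)) (E u)) =
    T x (\<lambda>y w. T y (\<lambda>a b. T w (\<lambda>u c. G (S (p a) * p b * S (p c)) (E u))))"
    by (rule T_cong, rule q) (intro lf G)
  also have "\<dots> = T x (\<lambda>a w. T w (\<lambda>r c. T r (\<lambda>b u. G (S (p a) * p b * S (p c)) (E u))))"
    by (simp add: coassocD)
  also have "\<dots> = T x (\<lambda>a w. T w (\<lambda>r c. T r (\<lambda>u b. sw H (E u) (\<lambda>g h. G (S (p a) * (g * p b) * S (p c)) h))))"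
    by (rule T_cong, rule T_cong, rule p_E[symmetric]) (intro lf G)+
  also have "\<dots> = T x (\<lambda>s w. T s (\<lambda>a u. T w (\<lambda>b c. sw H (E u) (\<lambda>g h. G (S (p a) * g * (p b * S (p c))) h))))"
    by (simp add: coassocD mult.assoc)
  also have "\<dots> = T x (\<lambda>s w. T s (\<lambda>a u. sw H (E u) (\<lambda>g h. G (S (p a) * g * E w) h)))"
    by (rule T_cong, rule T_cong, rule E[symmetric]) (intro lf G)
  also have "\<dots> = T x (\<lambda>s w. T s (\<lambda>u a. G (S (p a) * E w) (E u)))"
    by (rule T_cong, rule S_p_E) (intro lf G)+
  also have "\<dots> = T x (\<lambda>u z. T z (\<lambda>a w. G (S (p a) * E w) (E u)))" by (rule coassocD)
  also have "\<dots> = T x (\<lambda>u z. G (S (p z)) (E u))"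
    by (rule T_cong, rule S_E, assumption) (intro lf G)
  finally show ?thesis .
qed

end

section \<open>The base coalgebra\<close>

lemma lform_zero_span:
  assumes "is_vspace V" "lform V f" "X \<subseteq> vcarrier V" "\<And>x. x \<in> X \<Longrightarrow> f x = 0"
    "n \<in> module.span (smult V) X"
  shows "f n = 0"
proof -
  interpret vector_space "smult V" using assms by (simp add: is_vspace_def)
  from assms(5) have "n \<in> vcarrier V \<and> f n = 0"
  proof (induction rule: span_induct_alt)
    case base
    then show ?case using vs_zero[OF assms(1)] lform_0[OF assms(1,2)] by simp
  next
    case (step c x y)
    then have "x \<in> vcarrier V" using assms(3) by blast
    then show ?case using step assms(2,4) vs_add[OF assms(1)] vs_scale[OF assms(1)] by (simp add: lform_iff)
  qed
  then show ?thesis ..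
qed

text \<open>The three conditions pass from \<open>X\<close> to its span by linearity in
  \<open>n\<close>. A given biform is first replaced by \<open>\<phi> (tens C C a b)\<close>, which
  has the same values on the carrier and is linear in each variable for every value of the
  other.\<close>

lemma cofree_coideal_generators:
  fixes C :: "('k::field, 'c::ab_group_add) coalg"
  assumes cof: "cofree_coalgebra TYPE('c) V C p" and V: "is_vspace V"
    and X: "X \<subseteq> vcarrier C"
    and co: "\<And>n. n \<in> X \<Longrightarrow> counit C n = 0" "\<And>n f. n \<in> X \<Longrightarrow> lform V f \<Longrightarrow> f (p n) = 0"
    "\<And>n G. n \<in> X \<Longrightarrow> (\<And>b. lform C (\<lambda>a. G a b)) \<Longrightarrow> (\<And>a. lform C (G a)) \<Longrightarrow>
      (\<And>m y. m \<in> X \<Longrightarrow> y \<in> vcarrier C \<Longrightarrow> G m y = 0) \<Longrightarrow>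
      (\<And>m y. m \<in> X \<Longrightarrow> y \<in> vcarrier C \<Longrightarrow> G y m = 0) \<Longrightarrow> sw C n G = 0"
    and n: "n \<in> X"
  shows "n = 0"
proof -
  have C: "coalgebra C" "linear_map C V p" using cof by (auto simp: cofree_coalgebra_def)
  have pre: "precoalgebra C" by (rule coalgebra_precoalgebra[OF C(1)])
  note VC = precoalgebraD[OF pre]
  interpret vector_space "smult C" using VC(1) by (simp add: is_vspace_def)
  have sub: "span X \<subseteq> vcarrier C"
    using X VC(1) by (intro span_minimal) (auto simp: is_vspace_def)
  show ?thesis
  proof (rule cofree_coideal_zero[OF cof subspace_span sub])
    fix n assume n: "n \<in> span X"
    show "counit C n = 0" by (rule lform_zero_span[OF VC(1,3) X co(1) n])
    have "f (p n) = 0" if f: "lform V f" for f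
      by (rule lform_zero_span[OF VC(1) lform_comp[OF C(2) f] X co(2)[OF _ f] n])
    then show "p n = 0"
      by (intro lform_eqI[OF V linear_map_in[OF C(2) subsetD[OF sub n]] vs_zero[OF V]])
        (simp add: lform_0[OF V])
    fix G assume G: "biform C C G" and van: "\<And>m y. m \<in> span X \<Longrightarrow> y \<in> vcarrier C \<Longrightarrow> G m y = 0 \<and> G y m = 0"
    obtain \<phi> where \<phi>: "functional (tensor C C) \<phi>"
      "\<And>a b. a \<in> vcarrier C \<Longrightarrow> b \<in> vcarrier C \<Longrightarrow> \<phi> (tens C C a b) = G a b"
      by (rule functional_tensE[OF VC(1) VC(1) G]) blast
    let ?G = "\<lambda>a b. \<phi> (tens C C a b)"
    have G': "lform C (\<lambda>a. ?G a b)" "lform C (?G a)" for a b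
      using \<phi>(1) by (simp_all add: lform_iff functional_def tens_add_left tens_add_right
          tens_smult_left tens_smult_right)
    have "sw C m ?G = 0" if m: "m \<in> X" for m
    proof (rule co(3)[OF m G'])
      show "?G m y = 0" "?G y m = 0" if "m \<in> X" "y \<in> vcarrier C" for m y
        using van[OF span_base[OF that(1)] that(2)] \<phi>(2) that X by auto
    qed
    then have "sw C n ?G = 0" by (rule lform_zero_span[OF VC(1) lform_sw[OF pre] X _ n])
    moreover have "sw C n ?G = sw C n G" by (rule sw_cong[OF pre]) (rule \<phi>(2))
    ultimately show "sw C n G = 0" by simp
  qed (rule span_base[OF n])
qed

text \<open>Pairs of coordinate forms read off the coefficients of a tensor in a basis, so product
  forms already separate the points of V \<otimes> W. This matters because slicing a tensor by a
  form on one factor tests it against product forms only.\<close>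

lemma tensor_product_eqI:
  assumes "is_vspace V" "is_vspace W" "t \<in> vcarrier (tensor V W)" "t' \<in> vcarrier (tensor V W)"
    "\<And>f g. lform V f \<Longrightarrow> lform W g \<Longrightarrow> tform V W (\<lambda>a b. f a * g b) t = tform V W (\<lambda>a b. f a * g b) t'"
  shows "t = t'"
proof -
  interpret q: Vector_Spaces.linear fscale fscale "nform (smult V) (smult W)" by (rule linear_nform)
  obtain r where r: "Poly_Mapping.keys r \<subseteq> basis_of V \<times> basis_of W" "nform (smult V) (smult W) r = t - t'"
    using tensor_basis_rep[OF assms(1,2) vs_diff[OF is_vspace_tensor assms(3,4)]] by blast
  have keys: "Poly_Mapping.keys r \<subseteq> vcarrier V \<times> vcarrier W"
    using r(1) basis_of(1)[OF assms(1)] basis_of(1)[OF assms(2)] by blast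
  have "Poly_Mapping.lookup r (i, j) = 0" for i j
  proof (rule ccontr)
    assume nz: "Poly_Mapping.lookup r (i, j) \<noteq> 0"
    then have ij: "i \<in> basis_of V" "j \<in> basis_of W" using r(1) by (auto simp: in_keys_iff)
    define f where "f = lin_ext V (\<lambda>b. if b = i then 1 else 0)"
    define g where "g = lin_ext W (\<lambda>b. if b = j then 1 else 0)"
    have fg: "lform V f" "lform W g" unfolding f_def g_def by (intro lform_lin_ext assms)+
    then have bf: "biform V W (\<lambda>a b. f a * g b)"
      by (auto simp: biform_iff intro: lform_mult_const lform_const_mult)
    have "feval ground (\<lambda>a b. f a * g b) r = tform V W (\<lambda>a b. f a * g b) (t - t')"
      using tform_nform[OF assms(1,2) bf keys] r(2) by simp
    also have "\<dots> = 0"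
      using lform_diff[OF is_vspace_tensor lform_tform[OF assms(1,2) bf] assms(3,4)] assms(5)[OF fg] by simp
    finally have "feval ground (\<lambda>a b. f a * g b) r = 0" .
    moreover have "feval ground (\<lambda>a b. f a * g b) r =
        feval ground (\<lambda>a b. if (a, b) = (i, j) then 1 else 0) r"
      by (rule feval_cong) (use r(1) in \<open>auto simp: f_def g_def lin_ext_basis assms split: if_splits\<close>)
    moreover have "\<dots> = (\<Sum>k\<in>Poly_Mapping.keys r. if k = (i, j) then Poly_Mapping.lookup r k else 0)"
      unfolding feval_def by (intro sum.cong) (auto simp: ground_def split: if_splits)
    moreover have "\<dots> = Poly_Mapping.lookup r (i, j)" using nz by (simp add: in_keys_iff)
    ultimately show False using nz by simp
  qed
  then have "r = 0" by (intro poly_mapping_eqI) (auto simp: split_paired_all)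
  then show ?thesis using r(2) by (simp add: q.zero)
qed

text \<open>The kernel of a coalgebra map is a coideal, stated dually. Since \<open>L\<close>
  vanishes when one argument is in the kernel, it descends to a form \<open>L'\<close> on the image,
  and there it is evaluated at the coproduct of \<open>F x\<close>, which is 0.\<close>

lemma sw_vanish:
  fixes E :: "('k::field, 'c::ab_group_add) coalg"
  assumes "precoalgebra D" "precoalgebra E" "coalgebra_map D E F" "biform D D L"
    "\<And>a b. a \<in> vcarrier D \<Longrightarrow> b \<in> vcarrier D \<Longrightarrow> F a = 0 \<Longrightarrow> L a b = 0"
    "\<And>a b. a \<in> vcarrier D \<Longrightarrow> b \<in> vcarrier D \<Longrightarrow> F b = 0 \<Longrightarrow> L a b = 0"
    "x \<in> vcarrier D" "F x = 0"
  shows "sw D x L = 0"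
proof -
  let ?I = "restrict_to E (F ` vcarrier D)"
  note lF = coalgebra_map_linear[OF assms(3)] and VD = precoalgebraD(1)[OF assms(1)]
  have preI: "precoalgebra ?I"
    by (rule subcoalgebra_precoalgebra[OF assms(2) subcoalgebra_image[OF assms(1-3)]])
  have mapI: "coalgebra_map D ?I F"
    using assms(3)
    by (simp add: coalgebra_map_def linear_map_def sweedler_def tlift_def feval_def tens_cong[of ?I E ?I E])
  \<comment> \<open>A set-theoretic section suffices: \<open>L'\<close> is bilinear because two
    preimages of the same element differ by an element of the kernel.\<close>
  define \<sigma> where "\<sigma> u = (SOME a. a \<in> vcarrier D \<and> F a = u)" for u
  have \<sigma>: "\<sigma> (F a) \<in> vcarrier D" "F (\<sigma> (F a)) = F a" if "a \<in> vcarrier D" for a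
    using someI[of "\<lambda>b. b \<in> vcarrier D \<and> F b = F a" a] that unfolding \<sigma>_def by auto
  define L' where "L' u v = L (\<sigma> u) (\<sigma> v)" for u v
  have Fd: "F (a - b) = 0" if "a \<in> vcarrier D" "b \<in> vcarrier D" "F a = F b" for a b
  proof -
    have "F (a - b + b) = F (a - b) + F b"
      using lF vs_diff[OF VD that(1,2)] that(2) unfolding linear_map_def by blast
    then show ?thesis using that(3) by simp
  qed
  have eql: "L a b = L a' b" if "a \<in> vcarrier D" "a' \<in> vcarrier D" "b \<in> vcarrier D" "F a = F a'" for a a' b
    using assms(5)[OF vs_diff[OF VD that(1,2)] that(3) Fd[OF that(1,2,4)]]
      lform_diff[OF VD _ that(1,2), of "\<lambda>a. L a b"] assms(4) that(3) by (simp add: biform_iff)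
  have eqr: "L b a = L b a'" if "a \<in> vcarrier D" "a' \<in> vcarrier D" "b \<in> vcarrier D" "F a = F a'" for a a' b
    using assms(6)[OF that(3) vs_diff[OF VD that(1,2)] Fd[OF that(1,2,4)]]
      lform_diff[OF VD _ that(1,2), of "L b"] assms(4) that(3) by (simp add: biform_iff)
  have L': "L' (F a) (F b) = L a b" if "a \<in> vcarrier D" "b \<in> vcarrier D" for a b
    unfolding L'_def using eql[OF \<sigma>(1) _ \<sigma>(1) \<sigma>(2)] eqr[OF \<sigma>(1) _ _ \<sigma>(2)] that by metis
  have Fl: "F (a + b) = F a + F b" "F (smult D c a) = smult E c (F a)"
    if "a \<in> vcarrier D" "b \<in> vcarrier D" for a b c
    using lF that by (auto simp: linear_map_def)
  have l: "L (a + a') b = L a b + L a' b" "L (smult D c a) b = c * L a b"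
    "L b (a + a') = L b a + L b a'" "L b (smult D c a) = c * L b a"
    if "a \<in> vcarrier D" "a' \<in> vcarrier D" "b \<in> vcarrier D" for a a' b c
    using assms(4) that by (auto simp: biform_iff lform_iff)
  have bf: "biform ?I ?I L'"
    unfolding biform_iff lform_iff restrict_to_simps ball_simps
  proof (intro conjI ballI allI)
    fix a b y c assume ab: "a \<in> vcarrier D" "b \<in> vcarrier D" "y \<in> vcarrier D"
    note ab' = vs_add[OF VD ab(1,2)] vs_scale[OF VD ab(1), of c]
    show "L' (F y) (F a + F b) = L' (F y) (F a) + L' (F y) (F b)"
      using L'[OF ab(3) ab'(1)] ab by (simp add: L' l Fl)
    show "L' (F y) (smult E c (F a)) = c * L' (F y) (F a)"
      using L'[OF ab(3) ab'(2)] ab by (simp add: L' l Fl)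
    show "L' (F a + F b) (F y) = L' (F a) (F y) + L' (F b) (F y)"
      using L'[OF ab'(1) ab(3)] ab by (simp add: L' l Fl)
    show "L' (smult E c (F a)) (F y) = c * L' (F a) (F y)"
      using L'[OF ab'(2) ab(3)] ab by (simp add: L' l Fl)
  qed
  have "sw D x L = sw D x (\<lambda>a b. L' (F a) (F b))"
    by (rule sw_cong[OF assms(1)]) (simp add: L')
  also have "\<dots> = sw ?I (F x) L'"
    by (rule sw_coalgebra_map[OF assms(1) preI mapI bf assms(7), symmetric])
  also have "\<dots> = 0" using assms(8) lform_0[OF precoalgebraD(1)[OF preI] lform_sw[OF preI]] by simp
  finally show ?thesis .
qed

lemma sw_swap3: "sw E y (\<lambda>c d. sw D r (\<lambda>a w. sw D w (\<lambda>u z. F a u z c d))) =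
    sw D r (\<lambda>a w. sw D w (\<lambda>u z. sw E y (\<lambda>c d. F a u z c d)))"
  by (simp only: sw_swap[of E y D])

text \<open>\<open>D\<close> stands for H^par and \<open>C\<close> for the whole cofree coalgebra,
  with projection \<open>r\<close>; the base coalgebra is the image of \<open>Eb\<close> and will be
  called \<open>B\<close>. In the application \<open>r\<close> and \<open>p\<close> are the same
  map. They are kept apart because \<open>p\<close> enters through the axioms on \<open>D\<close>,
  and \<open>r\<close> through cofreeness.\<close>

locale base_coalg = pcorep H D p
  for H :: "('k::field, 'h::ring_1) hopf" and D :: "('k, 'd::ab_group_add) coalg" and p +
  fixes C :: "('k, 'c::ab_group_add) coalg" and r :: "'c \<Rightarrow> 'h" and Eb :: "'d \<Rightarrow> 'c"
  assumes cofree: "cofree_coalgebra TYPE('c) H C r"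
    and Eb_map: "coalgebra_map D C Eb"
    and r_Eb: "x \<in> vcarrier D \<Longrightarrow> r (Eb x) = E x"
begin

lemma coC: "coalgebra C" and linear_r: "linear_map C H r"
  using cofree by (auto simp: cofree_coalgebra_def)

lemma preC: "precoalgebra C"
  by (rule coalgebra_precoalgebra[OF coC])

lemma vC: "is_vspace C"
  by (rule precoalgebraD(1)[OF preC])

lemma linear_Eb: "linear_map D C Eb"
  by (rule coalgebra_map_linear[OF Eb_map])

lemma Eb_in: "x \<in> vcarrier D \<Longrightarrow> Eb x \<in> vcarrier C"
  by (rule linear_map_in[OF linear_Eb])

lemma counit_Eb: "x \<in> vcarrier D \<Longrightarrow> counit C (Eb x) = counit D x"
  using Eb_map by (simp add: coalgebra_map_def)

lemma lf_Eb [lf]: "lform C f \<Longrightarrow> lform D (\<lambda>x. f (Eb x))"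
  by (rule lform_comp[OF linear_Eb])

lemma lf_r [lf]: "lform H f \<Longrightarrow> lform C (\<lambda>x. f (r x))"
  by (rule lform_comp[OF linear_r])

lemma lf_swC [lf]: "lform C (\<lambda>x. sw C x F)"
  by (rule lform_sw[OF preC])

lemma lf_counitC [lf]: "lform C (counit C)"
  by (rule precoalgebraD(3)[OF preC])

lemma swC_Eb:
  assumes "x \<in> vcarrier D" "\<And>b. lform C (\<lambda>a. G a b)" "\<And>a. lform C (G a)"
  shows "sw C (Eb x) G = T x (\<lambda>a b. G (Eb a) (Eb b))"
  by (rule sw_coalgebra_map[OF preD preC Eb_map _ assms(1)]) (simp add: biform_iff assms)

section \<open>Slices in the cofree coalgebra and the coideal arguments\<close>

lemma scaled_Eb_in: "x \<in> vcarrier D \<Longrightarrow> smult C c (Eb x) \<in> vcarrier C"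
  by (intro vs_scale[OF vC] Eb_in)

lemma lform_scaled_Eb: "lform C g \<Longrightarrow> x \<in> vcarrier D \<Longrightarrow> g (smult C c (Eb x)) = c * g (Eb x)"
  by (simp add: lform_iff Eb_in)

lemma lform_swv2:
  assumes "lform C g"
  shows "g (swv C D x (\<lambda>a b. smult C (F a b) (Eb b))) = T x (\<lambda>a b. F a b * g (Eb b))"
    "g (swv C D x (\<lambda>a b. smult C (F a b) (Eb a))) = T x (\<lambda>a b. F a b * g (Eb a))"
    "g (swv C D x (\<lambda>a w. swv C D w (\<lambda>b c. smult C (F' a b c) (Eb b)))) = T3 x (\<lambda>a b c. F' a b c * g (Eb b))"
  by (subst lform_swv[OF preD vC _ assms],
      auto intro!: T_cong swv_in[OF preD vC] scaled_Eb_in simp: lform_scaled_Eb[OF assms] lform_swv[OF preD vC _ assms] scaled_Eb_in)+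

lemma swv2_in:
  "swv C D x (\<lambda>a b. smult C (F a b) (Eb b)) \<in> vcarrier C"
  "swv C D x (\<lambda>a b. smult C (F a b) (Eb a)) \<in> vcarrier C"
  "swv C D x (\<lambda>a w. swv C D w (\<lambda>b c. smult C (F' a b c) (Eb b))) \<in> vcarrier C"
  by (intro swv_in[OF preD vC] scaled_Eb_in; assumption)+

text \<open>Dual to \<open>[h] a = [h\<^sub>1] a [S h\<^sub>2] [h\<^sub>3]\<close>: the slices of the difference of the two sides span a coideal
  on which \<open>r\<close> vanishes.\<close>

lemma p_Eb_product:
  assumes "lform H f" "lform C g"
  shows "T x (\<lambda>a b. f (p a) * g (Eb b)) = T3 x (\<lambda>a b y. f (p a * q y) * g (Eb b))"
proof (cases "x \<in> vcarrier D")
  case True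
  \<comment> \<open>A slice of the difference: applying \<open>f\<close> to the leg in
    \<open>H\<close> leaves an element of the cofree coalgebra, and that is where a coideal can be
    formed.\<close>
  define th where "th f x = swv C D x (\<lambda>a b. smult C (f (p a)) (Eb b)) -
    swv C D x (\<lambda>a w. swv C D w (\<lambda>b y. smult C (f (p a * q y)) (Eb b)))" for f x
  have g_th: "g (th f x) = T x (\<lambda>a b. f (p a) * g (Eb b)) - T3 x (\<lambda>a b y. f (p a * q y) * g (Eb b))"
    if "lform C g" for f g x
    unfolding th_def lform_diff[OF vC that swv2_in(1) swv2_in(3)] lform_swv2[OF that] ..
  define X where "X = {th f x | f x. lform H f \<and> x \<in> vcarrier D}"
  have "th f x = 0"
  proof (rule cofree_coideal_generators[OF cofree vH])
    show "X \<subseteq> vcarrier C" unfolding X_def th_def by (auto intro!: vs_diff[OF vC] swv2_in)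
    show "th f x \<in> X" unfolding X_def using assms True by blast
  next
    fix n assume "n \<in> X"
    then obtain f x where f: "lform H f" and x: "x \<in> vcarrier D" and n: "n = th f x" unfolding X_def by blast
    have "T x (\<lambda>a b. f (p a) * counit C (Eb b)) = T x (\<lambda>a b. counit D b * f (p a))"
      by (rule T_cong) (simp add: counit_Eb)
    also have "\<dots> = f (p x)" by (rule T_counit(2)[OF _ x]) (intro lf f)
    finally have 1: "T x (\<lambda>a b. f (p a) * counit C (Eb b)) = f (p x)" .
    have "T3 x (\<lambda>a b y. f (p a * q y) * counit C (Eb b)) = T3 x (\<lambda>a b y. counit D b * f (p a * q y))"
      by (rule T_cong, rule T_cong) (simp add: counit_Eb)
    also have "\<dots> = T x (\<lambda>a y. f (p a * q y))"
      by (rule T_cong, rule T_counit(1)) (intro lf f)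
    also have "\<dots> = f (p x)" by (rule p_q[OF x f])
    finally show "counit C n = 0" using 1 by (simp add: n g_th lf_counitC)
    {
    fix h assume h: "lform H h"
    have "T x (\<lambda>a b. f (p a) * h (r (Eb b))) = T x (\<lambda>a b. f (p a) * h (E b))"
      by (rule T_cong) (simp add: r_Eb)
    also have "\<dots> = T3 x (\<lambda>a b y. f (p a * q y) * h (E b))"
      by (rule p_E_q[symmetric]) (intro lf f h)+
    also have "\<dots> = T3 x (\<lambda>a b y. f (p a * q y) * h (r (Eb b)))"
      by (rule T_cong, rule T_cong) (simp add: r_Eb)
    finally show "h (r n) = 0" by (simp add: n g_th[OF lf_r[OF h]])
    }
    fix G assume G: "\<And>b. lform C (\<lambda>a. G a b)" "\<And>a. lform C (G a)"
      and van: "\<And>m y. m \<in> X \<Longrightarrow> y \<in> vcarrier C \<Longrightarrow> G m y = 0"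
        "\<And>m y. m \<in> X \<Longrightarrow> y \<in> vcarrier C \<Longrightarrow> G y m = 0"
    \<comment> \<open>Vanishing of \<open>G\<close> when one argument lies in \<open>X\<close> says
      that the identity to be proved holds with \<open>G\<close> against a fixed \<open>y\<close> as
      its second form. This plays the role of the induction hypothesis.\<close>
    have V1: "T z (\<lambda>a b. f' (p a) * G (Eb b) y) = T3 z (\<lambda>a b s. f' (p a * q s) * G (Eb b) y)"
      and V2: "T z (\<lambda>a b. f' (p a) * G y (Eb b)) = T3 z (\<lambda>a b s. f' (p a * q s) * G y (Eb b))"
      if "lform H f'" "y \<in> vcarrier C" for f' y z
    proof -
      have *: "th f' z \<in> X" if "z \<in> vcarrier D" unfolding X_def using that \<open>lform H f'\<close> by blast
      show "T z (\<lambda>a b. f' (p a) * G (Eb b) y) = T3 z (\<lambda>a b s. f' (p a * q s) * G (Eb b) y)"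
        using van(1)[OF * that(2)] g_th[OF G(1), of f' z y] by (cases "z \<in> vcarrier D") (simp_all add: sw_notin)
      show "T z (\<lambda>a b. f' (p a) * G y (Eb b)) = T3 z (\<lambda>a b s. f' (p a * q s) * G y (Eb b))"
        using van(2)[OF * that(2)] g_th[OF G(2), of y f' z] by (cases "z \<in> vcarrier D") (simp_all add: sw_notin)
    qed
    \<comment> \<open>The coproduct of \<open>Eb b\<close> yields two factors. The hypothesis for
      the first one produces \<open>q z\<close>, which unfolds to \<open>S (p i) * p j\<close>; its
      right half \<open>p j\<close> then stands before the second factor, and the hypothesis applies
      once more.\<close>
    have "T x (\<lambda>a b. f (p a) * sw C (Eb b) G) = T x (\<lambda>a b. f (p a) * T b (\<lambda>u v. G (Eb u) (Eb v)))"
      by (rule T_cong) (simp add: swC_Eb G)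
    also have "\<dots> = T x (\<lambda>s v. T s (\<lambda>a u. f (p a) * G (Eb u) (Eb v)))"
      by (simp add: sw_const_mult[symmetric] coassocD)
    also have "\<dots> = T x (\<lambda>s v. T3 s (\<lambda>a u z. f (p a * q z) * G (Eb u) (Eb v)))"
      by (rule T_cong, rule V1[OF f Eb_in])
    also have "\<dots> = T3 x (\<lambda>a u s. T s (\<lambda>z v. f (p a * q z) * G (Eb u) (Eb v)))"
      by (simp add: coassocD)
    also have "\<dots> = T3 x (\<lambda>a u s. T s (\<lambda>z v. T z (\<lambda>i j. f (p a * (S (p i) * p j)) * G (Eb u) (Eb v))))"
      by (rule T_cong, rule T_cong, rule T_cong, rule q) (intro lf f)
    also have "\<dots> = T3 x (\<lambda>a u s. T s (\<lambda>i s'. T s' (\<lambda>j v. f (p a * S (p i) * p j) * G (Eb u) (Eb v))))"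
      by (simp add: coassocD mult.assoc)
    also have "\<dots> = T3 x (\<lambda>a u s. T s (\<lambda>i s'. T3 s' (\<lambda>j v y. f (p a * S (p i) * (p j * q y)) * G (Eb u) (Eb v))))"
      by (rule T_cong, rule T_cong, rule T_cong, rule V2[OF _ Eb_in]) (intro lf f)
    also have "\<dots> = T3 x (\<lambda>a u s. T s (\<lambda>z s'. T z (\<lambda>i j. T s' (\<lambda>v y. f (p a * (S (p i) * p j) * q y) * G (Eb u) (Eb v)))))"
      by (simp add: coassocD mult.assoc)
    also have "\<dots> = T3 x (\<lambda>a u s. T s (\<lambda>z s'. T s' (\<lambda>v y. f (p a * q z * q y) * G (Eb u) (Eb v))))"
      by (rule T_cong, rule T_cong, rule T_cong, rule q[symmetric]) (intro lf f)
    finally have A: "T x (\<lambda>a b. f (p a) * sw C (Eb b) G) =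
      T5 x (\<lambda>a u z v y. f (p a * q z * q y) * G (Eb u) (Eb v))" .
    \<comment> \<open>On this side the outer \<open>q y\<close> stays in place, and one application
      to the first factor gives the same fivefold sum.\<close>
    have "T3 x (\<lambda>a b y. f (p a * q y) * sw C (Eb b) G) =
      T3 x (\<lambda>a b y. f (p a * q y) * T b (\<lambda>u v. G (Eb u) (Eb v)))"
      by (rule T_cong, rule T_cong) (simp add: swC_Eb G)
    also have "\<dots> = T x (\<lambda>s t. T s (\<lambda>a u. T t (\<lambda>v y. f (p a * q y) * G (Eb u) (Eb v))))"
      by (simp add: sw_const_mult[symmetric] coassocD)
    also have "\<dots> = T x (\<lambda>s t. T t (\<lambda>v y. T s (\<lambda>a u. f (p a * q y) * G (Eb u) (Eb v))))"
      by (rule T_cong, rule sw_swap)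
    also have "\<dots> = T x (\<lambda>s t. T t (\<lambda>v y. T3 s (\<lambda>a u z. f (p a * q z * q y) * G (Eb u) (Eb v))))"
      by (rule T_cong, rule T_cong, rule V1[OF _ Eb_in]) (intro lf f)
    also have "\<dots> = T x (\<lambda>s t. T3 s (\<lambda>a u z. T t (\<lambda>v y. f (p a * q z * q y) * G (Eb u) (Eb v))))"
      by (rule T_cong, rule sw_swap3)
    also have "\<dots> = T5 x (\<lambda>a u z v y. f (p a * q z * q y) * G (Eb u) (Eb v))"
      by (simp add: coassocD)
    finally show "sw C n G = 0" using A by (simp add: n g_th[OF lf_swC])
  qed
  then show ?thesis using g_th[OF assms(2), of f x] lform_0[OF vC assms(2)] by simp
qed (simp add: sw_notin)

text \<open>Dual to \<open>a [S h] = [S h\<^sub>1] [h\<^sub>2] a [S h\<^sub>3]\<close>.\<close>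

lemma S_Eb_product:
  assumes "lform H f" "lform C g"
  shows "T x (\<lambda>b a. f (S (p a)) * g (Eb b)) = T3 x (\<lambda>y b a. f (q y * S (p a)) * g (Eb b))"
proof (cases "x \<in> vcarrier D")
  case True
  define th where "th f x = swv C D x (\<lambda>b a. smult C (f (S (p a))) (Eb b)) -
    swv C D x (\<lambda>y w. swv C D w (\<lambda>b a. smult C (f (q y * S (p a))) (Eb b)))" for f x
  have g_th: "g (th f x) = T x (\<lambda>b a. f (S (p a)) * g (Eb b)) - T3 x (\<lambda>y b a. f (q y * S (p a)) * g (Eb b))"
    if "lform C g" for f g x
    unfolding th_def lform_diff[OF vC that swv2_in(2) swv2_in(3)] lform_swv2[OF that] ..
  define X where "X = {th f x | f x. lform H f \<and> x \<in> vcarrier D}"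
  have "th f x = 0"
  proof (rule cofree_coideal_generators[OF cofree vH])
    show "X \<subseteq> vcarrier C" unfolding X_def th_def by (auto intro!: vs_diff[OF vC] swv2_in)
    show "th f x \<in> X" unfolding X_def using assms True by blast
  next
    fix n assume "n \<in> X"
    then obtain f x where f: "lform H f" and x: "x \<in> vcarrier D" and n: "n = th f x" unfolding X_def by blast
    have "T x (\<lambda>b a. f (S (p a)) * counit C (Eb b)) = T x (\<lambda>b a. counit D b * f (S (p a)))"
      by (rule T_cong) (simp add: counit_Eb)
    also have "\<dots> = f (S (p x))" by (rule T_counit(1)[OF _ x]) (intro lf f)
    finally have 1: "T x (\<lambda>b a. f (S (p a)) * counit C (Eb b)) = f (S (p x))" .
    have "T3 x (\<lambda>y b a. f (q y * S (p a)) * counit C (Eb b)) = T3 x (\<lambda>y b a. counit D b * f (q y * S (p a)))"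
      by (rule T_cong, rule T_cong) (simp add: counit_Eb)
    also have "\<dots> = T x (\<lambda>y a. f (q y * S (p a)))"
      by (rule T_cong, rule T_counit(1)) (intro lf f)
    also have "\<dots> = f (S (p x))" by (rule q_S[OF x f])
    finally show "counit C n = 0" using 1 by (simp add: n g_th lf_counitC)
    {
    fix h assume h: "lform H h"
    have "T x (\<lambda>b a. f (S (p a)) * h (r (Eb b))) = T x (\<lambda>b a. f (S (p a)) * h (E b))"
      by (rule T_cong) (simp add: r_Eb)
    also have "\<dots> = T3 x (\<lambda>y b a. f (q y * S (p a)) * h (E b))"
      by (rule q_E_S[symmetric]) (intro lf f h)+
    also have "\<dots> = T3 x (\<lambda>y b a. f (q y * S (p a)) * h (r (Eb b)))"
      by (rule T_cong, rule T_cong) (simp add: r_Eb)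
    finally show "h (r n) = 0" by (simp add: n g_th[OF lf_r[OF h]])
    }
    fix G assume G: "\<And>b. lform C (\<lambda>a. G a b)" "\<And>a. lform C (G a)"
      and van: "\<And>m y. m \<in> X \<Longrightarrow> y \<in> vcarrier C \<Longrightarrow> G m y = 0"
        "\<And>m y. m \<in> X \<Longrightarrow> y \<in> vcarrier C \<Longrightarrow> G y m = 0"
    have V1: "T z (\<lambda>b a. f' (S (p a)) * G (Eb b) y) = T3 z (\<lambda>s b a. f' (q s * S (p a)) * G (Eb b) y)"
      and V2: "T z (\<lambda>b a. f' (S (p a)) * G y (Eb b)) = T3 z (\<lambda>s b a. f' (q s * S (p a)) * G y (Eb b))"
      if "lform H f'" "y \<in> vcarrier C" for f' y z
    proof -
      have *: "th f' z \<in> X" if "z \<in> vcarrier D" unfolding X_def using that \<open>lform H f'\<close> by blast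
      show "T z (\<lambda>b a. f' (S (p a)) * G (Eb b) y) = T3 z (\<lambda>s b a. f' (q s * S (p a)) * G (Eb b) y)"
        using van(1)[OF * that(2)] g_th[OF G(1), of f' z y] by (cases "z \<in> vcarrier D") (simp_all add: sw_notin)
      show "T z (\<lambda>b a. f' (S (p a)) * G y (Eb b)) = T3 z (\<lambda>s b a. f' (q s * S (p a)) * G y (Eb b))"
        using van(2)[OF * that(2)] g_th[OF G(2), of y f' z] by (cases "z \<in> vcarrier D") (simp_all add: sw_notin)
    qed
    \<comment> \<open>Mirror order: the hypothesis for the second factor is used before the one for
      the first, because it is the left half \<open>S (p c)\<close> of the new \<open>q z\<close>
      that stands next to \<open>Eb u\<close>.\<close>
    have "T x (\<lambda>b a. f (S (p a)) * sw C (Eb b) G) = T x (\<lambda>b a. f (S (p a)) * T b (\<lambda>u v. G (Eb u) (Eb v)))"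
      by (rule T_cong) (simp add: swC_Eb G)
    also have "\<dots> = T x (\<lambda>u w. T w (\<lambda>v a. f (S (p a)) * G (Eb u) (Eb v)))"
      by (simp add: sw_const_mult[symmetric] coassocD)
    also have "\<dots> = T x (\<lambda>u w. T w (\<lambda>z s. T s (\<lambda>v a. f (q z * S (p a)) * G (Eb u) (Eb v))))"
      by (rule T_cong, rule V2[OF f Eb_in])
    also have "\<dots> = T x (\<lambda>u w. T w (\<lambda>z s. T z (\<lambda>c d. T s (\<lambda>v a. f (S (p c) * p d * S (p a)) * G (Eb u) (Eb v)))))"
      by (rule T_cong, rule T_cong, rule q) (intro lf f)
    also have "\<dots> = T x (\<lambda>k t. T k (\<lambda>u c. T3 t (\<lambda>d v a. f (S (p c) * (p d * S (p a))) * G (Eb u) (Eb v))))"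
      by (simp add: coassocD mult.assoc)
    also have "\<dots> = T x (\<lambda>k t. T3 t (\<lambda>d v a. T k (\<lambda>u c. f (S (p c) * (p d * S (p a))) * G (Eb u) (Eb v))))"
      by (rule T_cong, rule sw_swap3)
    also have "\<dots> = T x (\<lambda>k t. T3 t (\<lambda>d v a. T3 k (\<lambda>z u c. f (q z * S (p c) * (p d * S (p a))) * G (Eb u) (Eb v))))"
      by (rule T_cong, rule T_cong, rule T_cong, rule V1[OF _ Eb_in]) (intro lf f)
    also have "\<dots> = T x (\<lambda>k t. T3 k (\<lambda>z u c. T3 t (\<lambda>d v a. f (q z * S (p c) * (p d * S (p a))) * G (Eb u) (Eb v))))"
      by (rule T_cong, subst sw_swap3[symmetric], rule T_cong, rule sw_swap3[symmetric])
    also have "\<dots> = T3 x (\<lambda>z u w. T w (\<lambda>y s. T y (\<lambda>c d. T s (\<lambda>v a. f (q z * (S (p c) * p d) * S (p a)) * G (Eb u) (Eb v)))))"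
      by (simp add: coassocD mult.assoc)
    also have "\<dots> = T5 x (\<lambda>z u y v a. f (q z * q y * S (p a)) * G (Eb u) (Eb v))"
      by (rule T_cong, rule T_cong, rule T_cong, rule q[symmetric]) (intro lf f)
    finally have A: "T x (\<lambda>b a. f (S (p a)) * sw C (Eb b) G) =
      T5 x (\<lambda>z u y v a. f (q z * q y * S (p a)) * G (Eb u) (Eb v))" .
    have "T3 x (\<lambda>z b a. f (q z * S (p a)) * sw C (Eb b) G) =
      T3 x (\<lambda>z b a. f (q z * S (p a)) * T b (\<lambda>u v. G (Eb u) (Eb v)))"
      by (rule T_cong, rule T_cong) (simp add: swC_Eb G)
    also have "\<dots> = T3 x (\<lambda>z u s. T s (\<lambda>v a. f (q z * S (p a)) * G (Eb u) (Eb v)))"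
      by (simp add: sw_const_mult[symmetric] coassocD)
    also have "\<dots> = T3 x (\<lambda>z u s. T3 s (\<lambda>y v a. f (q z * (q y * S (p a))) * G (Eb u) (Eb v)))"
      by (rule T_cong, rule T_cong, rule V2[OF _ Eb_in]) (intro lf f)
    also have "\<dots> = T5 x (\<lambda>z u y v a. f (q z * q y * S (p a)) * G (Eb u) (Eb v))"
      by (simp add: mult.assoc)
    finally show "sw C n G = 0" using A by (simp add: n g_th[OF lf_swC])
  qed
  then show ?thesis using g_th[OF assms(2), of f x] lform_0[OF vC assms(2)] by simp
qed (simp add: sw_notin)

section \<open>From product forms to arbitrary bilinear forms\<close>

lemma tform_swv:
  assumes "\<And>b. lform H (\<lambda>a. B a b)" "\<And>a. lform C (B a)"
    "\<And>a b. a \<in> vcarrier D \<Longrightarrow> b \<in> vcarrier D \<Longrightarrow> t a b \<in> vcarrier (tensor H C)"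
  shows "tform H C B (swv (tensor H C) D x t) = T x (\<lambda>a b. tform H C B (t a b))"
proof -
  have "biform H C B" using assms by (simp add: biform_iff)
  from lform_swv[OF preD is_vspace_tensor assms(3) lform_tform[OF vH vC this]] show ?thesis .
qed

lemma tform_tens_HC:
  assumes "\<And>b. lform H (\<lambda>a. B a b)" "\<And>a. lform C (B a)" "b \<in> vcarrier C"
  shows "tform H C B (tens H C a b) = B a b"
  by (rule tform_tens[OF vH vC]) (use assms in \<open>simp_all add: biform_iff\<close>)

text \<open>Slices give the identity for products \<open>f a * g b\<close> of forms. Such products
  separate the tensors \<open>t\<close> and \<open>t'\<close> behind the two sides, so the identity
  holds for every bilinear \<open>B\<close>.\<close>

lemma p_Eb:
  assumes B: "\<And>b. lform H (\<lambda>a. B a b)" "\<And>a. lform C (B a)"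
  shows "T x (\<lambda>a b. B (p a) (Eb b)) = T3 x (\<lambda>a b y. B (p a * q y) (Eb b))"
proof -
  define t where "t = swv (tensor H C) D x (\<lambda>a b. tens H C (p a) (Eb b))"
  define t' where "t' = swv (tensor H C) D x (\<lambda>a w. swv (tensor H C) D w (\<lambda>b y. tens H C (p a * q y) (Eb b)))"
  have in1: "swv (tensor H C) D w (\<lambda>b y. tens H C (h y) (Eb b)) \<in> vcarrier (tensor H C)" for w h
    by (rule swv_in[OF preD is_vspace_tensor]) (simp add: tens_in_tensor Eb_in)
  have mem: "t \<in> vcarrier (tensor H C)" "t' \<in> vcarrier (tensor H C)"
    unfolding t_def t'_def by (rule swv_in[OF preD is_vspace_tensor], simp add: tens_in_tensor Eb_in in1)+
  have tB: "tform H C B t = T x (\<lambda>a b. B (p a) (Eb b))"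
    "tform H C B t' = T3 x (\<lambda>a b y. B (p a * q y) (Eb b))"
    if B: "\<And>b. lform H (\<lambda>a. B a b)" "\<And>a. lform C (B a)" for B
    unfolding t_def t'_def
    by (subst tform_swv[OF B], simp_all add: tens_in_tensor Eb_in in1 tform_swv[OF B],
        auto intro!: T_cong simp: tform_tens_HC[OF B] Eb_in tens_in_tensor tform_swv[OF B])
  have "t = t'"
    by (rule tensor_product_eqI[OF vH vC mem]) (simp add: tB p_Eb_product lf)
  then show ?thesis using tB[OF B] by simp
qed

lemma S_Eb:
  assumes B: "\<And>b. lform H (\<lambda>a. B a b)" "\<And>a. lform C (B a)"
  shows "T x (\<lambda>b a. B (S (p a)) (Eb b)) = T3 x (\<lambda>y b a. B (q y * S (p a)) (Eb b))"
proof -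
  define t where "t = swv (tensor H C) D x (\<lambda>b a. tens H C (S (p a)) (Eb b))"
  define t' where "t' = swv (tensor H C) D x (\<lambda>y w. swv (tensor H C) D w (\<lambda>b a. tens H C (q y * S (p a)) (Eb b)))"
  have in1: "swv (tensor H C) D w (\<lambda>b y. tens H C (h y) (Eb b)) \<in> vcarrier (tensor H C)" for w h
    by (rule swv_in[OF preD is_vspace_tensor]) (simp add: tens_in_tensor Eb_in)
  have mem: "t \<in> vcarrier (tensor H C)" "t' \<in> vcarrier (tensor H C)"
    unfolding t_def t'_def by (rule swv_in[OF preD is_vspace_tensor], simp add: tens_in_tensor Eb_in in1)+
  have tB: "tform H C B t = T x (\<lambda>b a. B (S (p a)) (Eb b))"
    "tform H C B t' = T3 x (\<lambda>y b a. B (q y * S (p a)) (Eb b))"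
    if B: "\<And>b. lform H (\<lambda>a. B a b)" "\<And>a. lform C (B a)" for B
    unfolding t_def t'_def
    by (subst tform_swv[OF B], simp_all add: tens_in_tensor Eb_in in1 tform_swv[OF B],
        auto intro!: T_cong simp: tform_tens_HC[OF B] Eb_in tens_in_tensor tform_swv[OF B])
  have "t = t'"
    by (rule tensor_product_eqI[OF vH vC mem]) (simp add: tB S_Eb_product lf)
  then show ?thesis using tB[OF B] by simp
qed

section \<open>The coaction on representatives, and its vanishing on the kernel of
  \<open>Eb\<close>\<close>

definition coact_lift :: "'d \<Rightarrow> ('h \<times> 'c \<Rightarrow>\<^sub>0 'k)" where
  "coact_lift x = swv (tensor H C) D x (\<lambda>a w. swv (tensor H C) D w (\<lambda>b c. tens H C (p a * S (p c)) (Eb b)))"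

lemma coact_lift_inner: "swv (tensor H C) D w (\<lambda>b c. tens H C (h c) (Eb b)) \<in> vcarrier (tensor H C)"
  by (rule swv_in[OF preD is_vspace_tensor]) (simp add: tens_in_tensor Eb_in)

lemma coact_lift_in: "coact_lift x \<in> vcarrier (tensor H C)"
  unfolding coact_lift_def by (rule swv_in[OF preD is_vspace_tensor]) (rule coact_lift_inner)

lemma functional_coact_lift:
  assumes "functional (tensor H C) f"
  shows "f (coact_lift x) = T3 x (\<lambda>a b c. f (tens H C (p a * S (p c)) (Eb b)))"
  unfolding coact_lift_def functional_swv[OF assms] ..

lemma tform_coact_lift:
  assumes B: "\<And>b. lform H (\<lambda>a. B a b)" "\<And>a. lform C (B a)"
  shows "tform H C B (coact_lift x) = T3 x (\<lambda>a b c. B (p a * S (p c)) (Eb b))"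
  unfolding coact_lift_def
  by (subst tform_swv[OF B], rule coact_lift_inner, rule T_cong, subst tform_swv[OF B],
      simp add: tens_in_tensor Eb_in, rule T_cong, simp add: tform_tens_HC[OF B] Eb_in)

text \<open>The coaction is well defined: the slices of \<open>p x\<^sub>1 S(p x\<^sub>3) \<otimes> Eb x\<^sub>2\<close> for \<open>x \<in> ker Eb\<close> span a coideal
  on which \<open>r\<close> vanishes.\<close>

lemma coact_product_zero:
  assumes "lform H f" "lform C g" "x \<in> vcarrier D" "Eb x = 0"
  shows "T3 x (\<lambda>a b c. f (p a * S (p c)) * g (Eb b)) = 0"
proof -
  define th where "th f x = swv C D x (\<lambda>a w. swv C D w (\<lambda>b c. smult C (f (p a * S (p c))) (Eb b)))" for f x
  have g_th: "g (th f x) = T3 x (\<lambda>a b c. f (p a * S (p c)) * g (Eb b))"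
    if "lform C g" for f g x
    unfolding th_def lform_swv2[OF that] ..
  define X where "X = {th f x | f x. lform H f \<and> x \<in> vcarrier D \<and> Eb x = 0}"
  have "th f x = 0"
  proof (rule cofree_coideal_generators[OF cofree vH])
    show "X \<subseteq> vcarrier C" unfolding X_def th_def by (auto intro!: swv2_in)
    show "th f x \<in> X" unfolding X_def using assms by blast
  next
    fix n assume "n \<in> X"
    then obtain f x where f: "lform H f" and x: "x \<in> vcarrier D" "Eb x = 0" and n: "n = th f x" unfolding X_def by blast
    have r0: "r 0 = 0" using linear_r vs_zero[OF vC] unfolding linear_map_def by (metis add_cancel_left_left add_0)
    have "T3 x (\<lambda>a b c. f (p a * S (p c)) * counit C (Eb b)) = T3 x (\<lambda>a b c. counit D b * f (p a * S (p c)))"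
      by (rule T_cong, rule T_cong) (simp add: counit_Eb)
    also have "\<dots> = T x (\<lambda>a c. f (p a * S (p c)))"
      by (rule T_cong, rule T_counit(1)) (intro lf f)
    also have "\<dots> = f (E x)" by (rule E[OF f, symmetric])
    also have "\<dots> = 0" using r_Eb[OF x(1)] x(2) r0 lform_0[OF vH f] by simp
    finally show "counit C n = 0" by (simp add: n g_th lf_counitC)
    {
    fix h assume h: "lform H h"
    have "T3 x (\<lambda>a b c. f (p a * S (p c)) * h (r (Eb b))) = T3 x (\<lambda>a b c. f (p a * S (p c)) * h (E b))"
      by (rule T_cong, rule T_cong) (simp add: r_Eb)
    \<comment> \<open>Only values of \<open>E\<close>, that is of \<open>r\<close> after
      \<open>Eb\<close>, are left; the sum can be taken over the coproduct of \<open>Eb x\<close>,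
      which is 0.\<close>
    also have "\<dots> = T x (\<lambda>u v. sw H (E u) (\<lambda>g k. f (g * E v) * h k))"
      by (rule p_E_S) (intro lf f h)+
    also have "\<dots> = T x (\<lambda>u v. sw H (r (Eb u)) (\<lambda>g k. f (g * r (Eb v)) * h k))"
      by (rule T_cong) (simp add: r_Eb)
    also have "\<dots> = sw C (Eb x) (\<lambda>u v. sw H (r u) (\<lambda>g k. f (g * r v) * h k))"
      by (rule swC_Eb[OF x(1), symmetric]) (intro lf f h)+
    also have "\<dots> = 0" using x(2) lform_0[OF vC lf_swC] by simp
    finally show "h (r n) = 0" by (simp add: n g_th[OF lf_r[OF h]])
    }
    fix G assume G: "\<And>b. lform C (\<lambda>a. G a b)" "\<And>a. lform C (G a)"
      and van: "\<And>m y. m \<in> X \<Longrightarrow> y \<in> vcarrier C \<Longrightarrow> G m y = 0"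
        "\<And>m y. m \<in> X \<Longrightarrow> y \<in> vcarrier C \<Longrightarrow> G y m = 0"
    have V1: "T3 z (\<lambda>a b c. f' (p a * S (p c)) * G (Eb b) y) = 0"
      and V2: "T3 z (\<lambda>a b c. f' (p a * S (p c)) * G y (Eb b)) = 0"
      if "lform H f'" "z \<in> vcarrier D" "Eb z = 0" "y \<in> vcarrier C" for f' y z
    proof -
      have *: "th f' z \<in> X" unfolding X_def using that by blast
      show "T3 z (\<lambda>a b c. f' (p a * S (p c)) * G (Eb b) y) = 0"
        using van(1)[OF * that(4)] g_th[OF G(1), of f' z y] by simp
      show "T3 z (\<lambda>a b c. f' (p a * S (p c)) * G y (Eb b)) = 0"
        using van(2)[OF * that(4)] g_th[OF G(2), of y f' z] by simp
    qed
    have "T3 x (\<lambda>a b c. f (p a * S (p c)) * sw C (Eb b) G) =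
      T3 x (\<lambda>a b c. f (p a * S (p c)) * T b (\<lambda>u v. G (Eb u) (Eb v)))"
      by (rule T_cong, rule T_cong) (simp add: swC_Eb G)
    also have "\<dots> = T x (\<lambda>s t. T s (\<lambda>a u. T t (\<lambda>v c. f (p a * S (p c)) * G (Eb u) (Eb v))))"
      by (simp add: sw_const_mult[symmetric] coassocD)
    \<comment> \<open>\<open>p_Eb\<close> inserts \<open>q y\<close> between the two factors;
      unfolded to \<open>S (p i) * p j\<close>, it lets the sum split at \<open>s\<close> and
      \<open>t\<close> into one copy of the coaction for each.\<close>
    also have "\<dots> = T x (\<lambda>s t. T3 s (\<lambda>a u y. T t (\<lambda>v c. f (p a * q y * S (p c)) * G (Eb u) (Eb v))))"
      by (rule T_cong, rule p_Eb) (intro lf f G)+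
    also have "\<dots> = T x (\<lambda>s t. T3 s (\<lambda>a u y. T y (\<lambda>i j. T t (\<lambda>v c. f (p a * (S (p i) * p j) * S (p c)) * G (Eb u) (Eb v)))))"
      by (rule T_cong, rule T_cong, rule T_cong, rule q) (intro lf f)
    also have "\<dots> = T x (\<lambda>s t. T3 s (\<lambda>a u i. T3 t (\<lambda>j v c. f (p a * S (p i) * (p j * S (p c))) * G (Eb u) (Eb v))))"
      by (simp add: coassocD mult.assoc)
    \<comment> \<open>With the other argument fixed, the expression in \<open>s\<close> is a slice
      paired with \<open>G\<close>, so it vanishes when \<open>Eb s = 0\<close> by the coideal
      hypothesis; likewise for \<open>t\<close>. Therefore it annihilates the coproduct of an
      element of the kernel.\<close>
    also have "\<dots> = 0"
    proof (rule sw_vanish[OF preD preC Eb_map _ _ _ x])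
      show "biform D D (\<lambda>s t. T3 s (\<lambda>a u i. T3 t (\<lambda>j v c. f (p a * S (p i) * (p j * S (p c))) * G (Eb u) (Eb v))))"
        unfolding biform_iff by (intro conjI ballI lf)
      fix s t assume st: "s \<in> vcarrier D" "t \<in> vcarrier D"
      show "T3 s (\<lambda>a u i. T3 t (\<lambda>j v c. f (p a * S (p i) * (p j * S (p c))) * G (Eb u) (Eb v))) = 0"
        if "Eb s = 0"
      proof -
        have "T3 s (\<lambda>a u i. T3 t (\<lambda>j v c. f (p a * S (p i) * (p j * S (p c))) * G (Eb u) (Eb v))) =
          T3 t (\<lambda>j v c. T3 s (\<lambda>a u i. f (p a * S (p i) * (p j * S (p c))) * G (Eb u) (Eb v)))"
          by (subst sw_swap3[symmetric], rule T_cong, rule sw_swap3[symmetric])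
        also have "\<dots> = T3 t (\<lambda>j v c. 0)"
          by (rule T_cong, rule T_cong, rule V1[OF _ st(1) that Eb_in]) (intro lf f)
        finally show ?thesis by (simp add: sw_0)
      qed
      show "T3 s (\<lambda>a u i. T3 t (\<lambda>j v c. f (p a * S (p i) * (p j * S (p c))) * G (Eb u) (Eb v))) = 0"
        if "Eb t = 0"
      proof -
        have "T3 s (\<lambda>a u i. T3 t (\<lambda>j v c. f (p a * S (p i) * (p j * S (p c))) * G (Eb u) (Eb v))) =
          T3 s (\<lambda>a u i. 0)"
          by (rule T_cong, rule T_cong, rule V2[OF _ st(2) that Eb_in]) (intro lf f)
        then show ?thesis by (simp add: sw_0)
      qed
    qed
    finally show "sw C n G = 0" by (simp add: n g_th[OF lf_swC])
  qed
  then show ?thesis using g_th[OF assms(2), of f x] lform_0[OF vC assms(2)] by simp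
qed

text \<open>The coideal argument yields vanishing under product forms, and these separate
  tensors.\<close>

lemma coact_lift_zero:
  assumes "x \<in> vcarrier D" "Eb x = 0"
  shows "coact_lift x = 0"
proof (rule tensor_product_eqI[OF vH vC coact_lift_in vs_zero[OF is_vspace_tensor]])
  fix f g assume fg: "lform H f" "lform C g"
  have bf: "biform H C (\<lambda>a b. f a * g b)" by (auto simp: biform_iff intro!: lf fg)
  have "tform H C (\<lambda>a b. f a * g b) (coact_lift x) = 0"
    by (subst tform_coact_lift) (simp_all add: coact_product_zero fg assms lf)
  then show "tform H C (\<lambda>a b. f a * g b) (coact_lift x) = tform H C (\<lambda>a b. f a * g b) 0"
    using lform_0[OF is_vspace_tensor lform_tform[OF vH vC bf]] by simp
qed

end

lemma functional_tens_lform: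
  assumes "functional (tensor U V) f"
  shows "lform U (\<lambda>a. f (tens U V a b))" "lform V (\<lambda>b. f (tens U V a b))"
  using assms by (simp_all add: lform_iff functional_def tens_add_left tens_add_right
      tens_smult_left tens_smult_right)

lemma functional_tens3_lform:
  assumes "functional (tensor U (tensor V W)) f"
  shows "lform U (\<lambda>a. f (tens U (tensor V W) a (tens V W b c)))"
    "lform V (\<lambda>b. f (tens U (tensor V W) a (tens V W b c)))"
    "lform W (\<lambda>c. f (tens U (tensor V W) a (tens V W b c)))"
  using functional_tens_lform(1)[OF assms] functional_tens_lform[OF functional_comp_tens_right[OF assms]]
  by blast+

section \<open>The coaction on the base coalgebra\<close>

context base_coalg
begin

declare lf_Eb [lf del]

abbreviation "B \<equiv> restrict_to C (Eb ` vcarrier D)"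

lemma subcoalgebra_B: "subcoalgebra (Eb ` vcarrier D) C"
  by (rule subcoalgebra_image[OF preD preC Eb_map])

lemma coB: "coalgebra B"
  by (rule subcoalgebra_coalgebra[OF coC subcoalgebra_B])

lemma preB: "precoalgebra B"
  by (rule coalgebra_precoalgebra[OF coB])

lemma vB: "is_vspace B"
  by (rule precoalgebraD(1)[OF preB])

lemma Eb_map_B: "coalgebra_map D B Eb"
  using Eb_map
  by (simp add: coalgebra_map_def linear_map_def sweedler_def tlift_def feval_def tens_cong[of B C B C])

lemma lf_EbB [lf]: "lform B f \<Longrightarrow> lform D (\<lambda>x. f (Eb x))"
  by (rule lform_comp[OF coalgebra_map_linear[OF Eb_map_B]])

lemma lf_swB [lf]: "lform B (\<lambda>x. sw B x F)"
  by (rule lform_sw[OF preB])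

lemma lf_swB_arg [lf]: "(\<And>a b. lform V (\<lambda>y. F y a b)) \<Longrightarrow> lform V (\<lambda>y. sw B x (F y))"
  by (rule lform_sw_arg[OF preB])

lemma lf_counitB [lf]: "lform B (counit C)"
  using precoalgebraD(3)[OF preB] by simp

lemma B_in: "x \<in> vcarrier D \<Longrightarrow> Eb x \<in> vcarrier B"
  by simp

lemma swB_Eb:
  assumes "x \<in> vcarrier D" "\<And>b. lform B (\<lambda>a. G a b)" "\<And>a. lform B (G a)"
  shows "sw B (Eb x) G = T x (\<lambda>a b. G (Eb a) (Eb b))"
  by (rule sw_coalgebra_map[OF preD preB Eb_map_B _ assms(1)]) (simp add: biform_iff assms)

text \<open>Turns forms on the base coalgebra into forms on the whole cofree coalgebra, for which
  \<open>p_Eb\<close> and \<open>S_Eb\<close> were proved, without changing them at the values of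
  \<open>Eb\<close>.\<close>

lemma B_retract:
  obtains P where "\<And>x. x \<in> vcarrier D \<Longrightarrow> P (Eb x) = Eb x" "\<And>f. lform B f \<Longrightarrow> lform C (\<lambda>x. f (P x))"
proof -
  obtain P where P: "\<And>x. P x \<in> vcarrier B" "\<And>x. x \<in> vcarrier B \<Longrightarrow> P x = x"
    "\<And>x y. P (x + y) = P x + P y" "\<And>c x. P (smult C c x) = smult C c (P x)"
    using ex_retraction[OF vB] by auto
  show ?thesis
  proof (rule that)
    show "P (Eb x) = Eb x" if "x \<in> vcarrier D" for x using P(2)[OF B_in[OF that]] .
    show "lform C (\<lambda>x. f (P x))" if "lform B f" for f
      using that P(1) unfolding lform_iff P(3,4) restrict_to_simps(2) by blast
  qed
qed

lemma p_EbB: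
  assumes G: "\<And>b. lform H (\<lambda>a. G a b)" "\<And>a. lform B (G a)"
  shows "T3 x (\<lambda>a b y. G (p a * q y) (Eb b)) = T x (\<lambda>a b. G (p a) (Eb b))"
proof -
  obtain P where P: "\<And>x. x \<in> vcarrier D \<Longrightarrow> P (Eb x) = Eb x" "\<And>f. lform B f \<Longrightarrow> lform C (\<lambda>x. f (P x))"
    by (rule B_retract) blast
  have "T3 x (\<lambda>a b y. G (p a * q y) (Eb b)) = T3 x (\<lambda>a b y. G (p a * q y) (P (Eb b)))"
    by (rule T_cong, rule T_cong) (simp add: P)
  also have "\<dots> = T x (\<lambda>a b. G (p a) (P (Eb b)))"
    by (rule p_Eb[symmetric]) (rule G P)+
  also have "\<dots> = T x (\<lambda>a b. G (p a) (Eb b))" by (rule T_cong) (simp add: P)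
  finally show ?thesis .
qed

lemma S_EbB:
  assumes G: "\<And>b. lform H (\<lambda>a. G a b)" "\<And>a. lform B (G a)"
  shows "T x (\<lambda>b a. G (S (p a)) (Eb b)) = T3 x (\<lambda>y b a. G (q y * S (p a)) (Eb b))"
proof -
  obtain P where P: "\<And>x. x \<in> vcarrier D \<Longrightarrow> P (Eb x) = Eb x" "\<And>f. lform B f \<Longrightarrow> lform C (\<lambda>x. f (P x))"
    by (rule B_retract) blast
  have "T x (\<lambda>b a. G (S (p a)) (Eb b)) = T x (\<lambda>b a. G (S (p a)) (P (Eb b)))"
    by (rule T_cong) (simp add: P)
  also have "\<dots> = T3 x (\<lambda>y b a. G (q y * S (p a)) (P (Eb b)))"
    by (rule S_Eb) (rule G P)+
  also have "\<dots> = T3 x (\<lambda>y b a. G (q y * S (p a)) (Eb b))"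
    by (rule T_cong, rule T_cong) (simp add: P)
  finally show ?thesis .
qed

text \<open>An arbitrary preimage under \<open>Eb\<close>; no linearity is asked of the choice, and
  \<open>coa_Eb\<close> shows that the coaction does not depend on it.\<close>

definition sec where "sec c = (SOME x. x \<in> vcarrier D \<and> Eb x = c)"

definition coa where "coa c = coact_lift (sec c)"

text \<open>The scalar counterpart of \<open>coact\<close>, in the spirit of \<open>sw\<close>: it
  is defined for every \<open>F\<close> through the chosen preimage, and is independent of that
  preimage when \<open>F\<close> is bilinear.\<close>

definition ct where "ct c F = T3 (sec c) (\<lambda>a b d. F (p a * S (p d)) (Eb b))"

lemma sec:
  assumes "c \<in> vcarrier B"
  shows "sec c \<in> vcarrier D" "Eb (sec c) = c"
proof -
  have "\<exists>x. x \<in> vcarrier D \<and> Eb x = c" using assms by auto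
  from someI_ex[OF this] show "sec c \<in> vcarrier D" "Eb (sec c) = c" unfolding sec_def by auto
qed

lemma functional_tensor_HB: "functional (tensor H B) f = functional (tensor H C) f"
  by (simp add: functional_def)

lemma tens_HB: "tens H B = tens H C"
  by (rule tens_cong) simp_all

lemma lform_coact_lift: "functional (tensor H B) f \<Longrightarrow> lform D (\<lambda>x. f (coact_lift x))"
  unfolding functional_tensor_HB by (simp add: functional_coact_lift lf)

text \<open>Two preimages of \<open>Eb x\<close> differ by an element of the kernel of
  \<open>Eb\<close>, where \<open>coact_lift\<close> vanishes.\<close>

lemma coa_Eb: "x \<in> vcarrier D \<Longrightarrow> coa (Eb x) = coact_lift x"
proof (rule functional_eqI[of "tensor H B"])
  fix f assume x: "x \<in> vcarrier D" and f: "functional (tensor H B) f"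
  note s = sec[OF B_in[OF x]]
  have d: "sec (Eb x) - x \<in> vcarrier D" by (rule vs_diff[OF vD s(1) x])
  have "Eb (sec (Eb x) - x + x) = Eb (sec (Eb x) - x) + Eb x"
    using linear_Eb d x unfolding linear_map_def by blast
  then have "Eb (sec (Eb x) - x) = 0" using s(2) by simp
  then have "f (coact_lift (sec (Eb x) - x)) = 0"
    using coact_lift_zero[OF d] lform_0[OF is_vspace_tensor functional_lform[OF f]] by simp
  then show "f (coa (Eb x)) = f (coact_lift x)"
    using lform_diff[OF vD lform_coact_lift[OF f] s(1) x] by (simp add: coa_def)
qed (simp add: vector_space_fscale)

lemma coact_lift_in_B: "coact_lift x \<in> vcarrier (tensor H B)"
  unfolding coact_lift_def swv_smult_cong[of "tensor H C" "tensor H B", simplified] tens_HB[symmetric]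
  by (intro swv_in[OF preD is_vspace_tensor] tens_in_tensor) simp_all

lemma coa_in: "coa c \<in> vcarrier (tensor H B)"
  by (simp add: coa_def coact_lift_in_B)

lemma functional_coa:
  assumes "functional (tensor H B) f"
  shows "f (coa c) = ct c (\<lambda>g d. f (tens H B g d))"
  using assms unfolding functional_tensor_HB coa_def ct_def tens_HB by (rule functional_coact_lift)

lemma tform_coa:
  assumes "\<And>b. lform H (\<lambda>a. F a b)" "\<And>a. lform B (F a)"
  shows "tform H B F (coa c) = ct c F"
proof -
  have bf: "biform H B F" using assms by (simp add: biform_iff)
  obtain f where f: "functional (tensor H B) f"
    "\<And>a b. a \<in> vcarrier H \<Longrightarrow> b \<in> vcarrier B \<Longrightarrow> f (tens H B a b) = F a b"
    "\<And>t. t \<in> vcarrier (tensor H B) \<Longrightarrow> f t = tform H B F t"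
    by (rule functional_tensE[OF vH vB bf]) blast
  have "tform H B F (coa c) = ct c (\<lambda>g d. f (tens H B g d))"
    using f(3)[OF coa_in] functional_coa[OF f(1)] by simp
  also have "\<dots> = ct c F"
    unfolding ct_def by (rule T_cong, rule T_cong, rule f(2)) simp_all
  finally show ?thesis .
qed

lemma ct_Eb:
  assumes "x \<in> vcarrier D" "\<And>b. lform H (\<lambda>a. F a b)" "\<And>a. lform B (F a)"
  shows "ct (Eb x) F = T3 x (\<lambda>a b d. F (p a * S (p d)) (Eb b))"
proof -
  have bf: "biform H B F" using assms by (simp add: biform_iff)
  obtain f where f: "functional (tensor H B) f"
    "\<And>a b. a \<in> vcarrier H \<Longrightarrow> b \<in> vcarrier B \<Longrightarrow> f (tens H B a b) = F a b"
    "\<And>t. t \<in> vcarrier (tensor H B) \<Longrightarrow> f t = tform H B F t"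
    by (rule functional_tensE[OF vH vB bf]) blast
  have "ct (Eb x) F = f (coact_lift x)"
    using tform_coa[OF assms(2,3), of "Eb x"] f(3)[OF coa_in] coa_Eb[OF assms(1)] by metis
  also have "\<dots> = T3 x (\<lambda>a b d. f (tens H B (p a * S (p d)) (Eb b)))"
    using f(1) unfolding functional_tensor_HB tens_HB by (rule functional_coact_lift)
  also have "\<dots> = T3 x (\<lambda>a b d. F (p a * S (p d)) (Eb b))"
    by (rule T_cong, rule T_cong, rule f(2)) simp_all
  finally show ?thesis .
qed

text \<open>\<open>sec\<close> need not be linear, but \<open>coa_Eb\<close> permits any preimage,
  and sums and multiples of values of \<open>Eb\<close> have linear ones.\<close>

lemma linear_coa: "linear_map B (tensor H B) coa"
proof (rule linear_mapI[OF vB is_vspace_tensor coa_in])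
  fix f assume f: "functional (tensor H B) f"
  note l = lform_coact_lift[OF f]
  show "lform B (\<lambda>c. f (coa c))"
    unfolding lform_iff restrict_to_simps ball_simps
  proof (intro conjI ballI allI)
    fix x y c assume xy: "x \<in> vcarrier D" "y \<in> vcarrier D"
    have "Eb x + Eb y = Eb (x + y)" "smult C c (Eb x) = Eb (smult D c x)"
      using linear_Eb xy by (simp_all add: linear_map_def)
    then show "f (coa (Eb x + Eb y)) = f (coa (Eb x)) + f (coa (Eb y))"
      "f (coa (smult C c (Eb x))) = c * f (coa (Eb x))"
      using l xy vs_add[OF vD xy] vs_scale[OF vD xy(1), of c] by (simp_all add: coa_Eb lform_iff)
  qed
qed

lemma lf_ct [lf]:
  assumes "\<And>b. lform H (\<lambda>a. F a b)" "\<And>a. lform B (F a)"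
  shows "lform B (\<lambda>c. ct c F)"
proof -
  have "biform H B F" using assms by (simp add: biform_iff)
  from lform_comp[OF linear_coa lform_tform[OF vH vB this]] show ?thesis
    by (simp add: tform_coa[OF assms])
qed

lemma lf_ct_arg [lf]: "(\<And>a b. lform V (\<lambda>y. F y a b)) \<Longrightarrow> lform V (\<lambda>y. ct c (F y))"
  unfolding ct_def by (intro lf)

text \<open>Turns the \<open>coact\<close> of the definitions into \<open>ct\<close>, as
  \<open>functional_sweedler\<close> turns \<open>sweedler\<close> into \<open>sw\<close>;
  bilinearity is asked of \<open>G\<close> and not of \<open>W\<close>.\<close>

lemma functional_coact:
  assumes "functional U f" "\<And>b. lform H (\<lambda>a. G a b)" "\<And>a. lform B (G a)"
    "\<And>g d. d \<in> vcarrier B \<Longrightarrow> f (W g d) = G g d"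
  shows "f (coact H B coa U c W) = ct c G"
  unfolding coact_def tform_coa[OF assms(2,3), symmetric]
  by (rule functional_tlift[OF vH vB assms(1) _ _ coa_in]) (simp_all add: biform_iff assms)

lemma functional_sweedler_B:
  assumes "functional U f" "\<And>b. lform B (\<lambda>a. G a b)" "\<And>a. lform B (G a)" "c \<in> vcarrier B"
    "\<And>a b. a \<in> vcarrier B \<Longrightarrow> b \<in> vcarrier B \<Longrightarrow> f (W a b) = G a b"
  shows "f (sweedler B U c W) = sw B c G"
  by (rule functional_sweedler[OF preB assms(4,1) _ assms(5)]) (simp_all add: biform_iff assms)

lemma functional_sweedler_H:
  assumes "functional U f" "\<And>b. lform H (\<lambda>a. G a b)" "\<And>a. lform H (G a)" "\<And>a b. f (W a b) = G a b"
  shows "f (sweedler H U h W) = sw H h G"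
  by (rule functional_sweedler[OF preH _ assms(1)]) (simp_all add: biform_iff assms)

text \<open>\<open>c\<^sup>[\<^sup>-\<^sup>1\<^sup>] \<epsilon>(c\<^sup>[\<^sup>0\<^sup>]) = E x\<close> for \<open>c = Eb x\<close>.\<close>

lemma ct_counit:
  assumes "lform H f"
  shows "T3 x (\<lambda>a b d. counit C (Eb b) * f (p a * S (p d))) = f (E x)"
proof -
  have "T3 x (\<lambda>a b d. counit C (Eb b) * f (p a * S (p d))) = T3 x (\<lambda>a b d. counit D b * f (p a * S (p d)))"
    by (rule T_cong, rule T_cong) (simp add: counit_Eb)
  also have "\<dots> = T x (\<lambda>a d. f (p a * S (p d)))"
    by (rule T_cong, rule T_counit(1)) (intro lf assms)
  also have "\<dots> = f (E x)" by (rule E[OF assms, symmetric])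
  finally show ?thesis .
qed

section \<open>The comodule coalgebra axioms evaluated on representatives\<close>

lemma coact_counit:
  assumes "lform B f" "x \<in> vcarrier D"
  shows "T3 x (\<lambda>a b d. e (p a * S (p d)) * f (Eb b)) = f (Eb x)"
proof -
  have "T3 x (\<lambda>a b d. e (p a * S (p d)) * f (Eb b)) =
    T3 x (\<lambda>a b d. counit D d * (counit D a * f (Eb b)))"
    by (rule T_cong, rule T_cong) (simp add: counit_p)
  also have "\<dots> = T x (\<lambda>a b. counit D a * f (Eb b))"
    by (rule T_cong, rule T_counit(2)) (intro lf assms)
  also have "\<dots> = f (Eb x)" by (rule T_counit(1)[OF _ assms(2)]) (intro lf assms)
  finally show ?thesis .
qed

text \<open>\<open>p_EbB\<close> allows a \<open>q y\<close> to be inserted behind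
  \<open>p a\<close> and \<open>Eb u\<close>; split as \<open>S (p i) * p j\<close>, it closes the
  first coaction and opens the second.\<close>

lemma coact_comult:
  assumes K: "\<And>c d. lform H (\<lambda>a. K a c d)" "\<And>a d. lform B (\<lambda>c. K a c d)" "\<And>a c. lform B (K a c)"
  shows "T3 x (\<lambda>a b c. T b (\<lambda>u v. K (p a * S (p c)) (Eb u) (Eb v))) =
    T x (\<lambda>s t. T3 s (\<lambda>a u i. T3 t (\<lambda>j v c. K (p a * S (p i) * (p j * S (p c))) (Eb u) (Eb v))))"
proof -
  have "T3 x (\<lambda>a b c. T b (\<lambda>u v. K (p a * S (p c)) (Eb u) (Eb v))) =
    T x (\<lambda>s t. T s (\<lambda>a u. T t (\<lambda>v c. K (p a * S (p c)) (Eb u) (Eb v))))"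
    by (simp add: coassocD)
  also have "\<dots> = T x (\<lambda>s t. T3 s (\<lambda>a u y. T t (\<lambda>v c. K (p a * q y * S (p c)) (Eb u) (Eb v))))"
    by (rule T_cong, rule p_EbB[symmetric]) (intro lf K)+
  also have "\<dots> = T x (\<lambda>s t. T3 s (\<lambda>a u y. T y (\<lambda>i j. T t (\<lambda>v c. K (p a * (S (p i) * p j) * S (p c)) (Eb u) (Eb v)))))"
    by (rule T_cong, rule T_cong, rule T_cong, rule q) (intro lf K)
  also have "\<dots> = T x (\<lambda>s t. T3 s (\<lambda>a u i. T3 t (\<lambda>j v c. K (p a * S (p i) * (p j * S (p c))) (Eb u) (Eb v))))"
    by (simp add: coassocD mult.assoc)
  finally show ?thesis .
qed

text \<open>Dual to \<open>[k] a [S(h k')] = [k] a [S k'] [S h]\<close> with \<open>k = k\<^sub>1\<close>, \<open>k' = k\<^sub>2\<close>.\<close>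

lemma p_Eb_comult_S:
  assumes K: "\<And>h c. lform H (\<lambda>g. K g h c)" "\<And>g c. lform H (\<lambda>h. K g h c)" "\<And>g h. lform B (K g h)"
  shows "T3 x (\<lambda>j v c. sw H (p c) (\<lambda>y z. K (S z) (p j * S y) (Eb v))) =
    T4 x (\<lambda>j v k c. K (S (p c)) (p j * S (p k)) (Eb v))"
proof -
  have "T3 x (\<lambda>j v c. sw H (p c) (\<lambda>y z. K (S z) (p j * S y) (Eb v))) =
    T x (\<lambda>s c. T s (\<lambda>j v. sw H (p c) (\<lambda>y z. K (S z) (p j * S y) (Eb v))))"
    by (simp add: coassocD)
  also have "\<dots> = T x (\<lambda>s c. T3 s (\<lambda>j v m. sw H (p c) (\<lambda>y z. K (S z) (p j * q m * S y) (Eb v))))"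
    by (rule T_cong, rule p_EbB[symmetric]) (intro lf K)+
  also have "\<dots> = T x (\<lambda>s c. T3 s (\<lambda>j v m. T m (\<lambda>k l. sw H (p c) (\<lambda>y z. K (S z) (p j * (S (p k) * p l) * S y) (Eb v)))))"
    by (rule T_cong, rule T_cong, rule T_cong, rule q) (intro lf K)
  also have "\<dots> = T x (\<lambda>j w. T w (\<lambda>v w'. T w' (\<lambda>k t. T t (\<lambda>l c. sw H (p c) (\<lambda>y z. K (S z) (p j * S (p k) * (p l * S y)) (Eb v))))))"
    by (simp add: coassocD mult.assoc)
  also have "\<dots> = T x (\<lambda>j w. T w (\<lambda>v w'. T w' (\<lambda>k t. T t (\<lambda>u c. K (S (p c)) (p j * S (p k) * E u) (Eb v)))))"
    by (rule T_cong, rule T_cong, rule T_cong, rule PR3) (intro lf K)+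
  also have "\<dots> = T x (\<lambda>j w. T w (\<lambda>v w'. T w' (\<lambda>s c. T s (\<lambda>k u. K (S (p c)) (p j * (S (p k) * E u)) (Eb v)))))"
    by (simp add: coassocD mult.assoc)
  also have "\<dots> = T4 x (\<lambda>j v k c. K (S (p c)) (p j * S (p k)) (Eb v))"
    by (rule T_cong, rule T_cong, rule T_cong, rule S_E, assumption) (intro lf K)
  finally show ?thesis .
qed

text \<open>The counterpart of \<open>p_Eb_comult_S\<close> with the coproduct taken at the left
  end: \<open>S_EbB\<close> inserts a \<open>q\<close>, \<open>PR2\<close> trades a leg of the split
  \<open>p a\<close> for \<open>E t\<close>, and \<open>E_p\<close> absorbs that
  \<open>E t\<close>.\<close>

lemma comult_p_Eb_S:
  assumes K: "\<And>h c. lform H (\<lambda>g. K g h c)" "\<And>g c. lform H (\<lambda>h. K g h c)" "\<And>g h. lform B (K g h)"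
  shows "T3 x (\<lambda>a u i. sw H (p a) (\<lambda>g h. K g (h * S (p i)) (Eb u))) =
    T4 x (\<lambda>a i u k. K (p a) (p i * S (p k)) (Eb u))"
proof -
  have "T3 x (\<lambda>a u i. sw H (p a) (\<lambda>g h. K g (h * S (p i)) (Eb u))) =
    T4 x (\<lambda>a m u i. sw H (p a) (\<lambda>g h. K g (h * (q m * S (p i))) (Eb u)))"
    by (rule T_cong, rule S_EbB) (intro lf K)+
  also have "\<dots> = T x (\<lambda>a w. T w (\<lambda>m w'. T m (\<lambda>k l. T w' (\<lambda>u i. sw H (p a) (\<lambda>g h. K g (h * (S (p k) * p l * S (p i))) (Eb u))))))"
    by (rule T_cong, rule T_cong, rule q) (intro lf K)
  also have "\<dots> = T x (\<lambda>s w. T s (\<lambda>a k. T3 w (\<lambda>l u i. sw H (p a) (\<lambda>g h. K g (h * S (p k) * (p l * S (p i))) (Eb u)))))"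
    by (simp add: coassocD mult.assoc)
  also have "\<dots> = T x (\<lambda>s w. T s (\<lambda>a k. sw H (p a) (\<lambda>g h. T3 w (\<lambda>l u i. K g (h * S (p k) * (p l * S (p i))) (Eb u)))))"
    by (rule T_cong, rule T_cong, rule sw_swap3[symmetric])
  also have "\<dots> = T x (\<lambda>s w. T s (\<lambda>a t. T3 w (\<lambda>l u i. K (p a) (E t * (p l * S (p i))) (Eb u))))"
    by (rule T_cong, rule PR2) (intro lf K)+
  also have "\<dots> = T x (\<lambda>a w. T w (\<lambda>s w'. T s (\<lambda>t l. T w' (\<lambda>u i. K (p a) (E t * p l * S (p i)) (Eb u)))))"
    by (simp add: coassocD mult.assoc)
  also have "\<dots> = T x (\<lambda>a w. T w (\<lambda>l w'. T w' (\<lambda>u i. K (p a) (p l * S (p i)) (Eb u))))"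
    by (rule T_cong, rule T_cong, rule E_p, assumption) (intro lf K)
  finally show ?thesis .
qed

text \<open>\<open>E_p_comult\<close> undoes the coproduct at the left end and
  \<open>p_Eb_comult_S\<close> the one at the right end; what remains is the iterated coaction of
  \<open>Eb x\<close>. The factor \<open>E s\<close> is the first coaction with its component in the
  base coalgebra removed by the counit.\<close>

lemma coact_coact_left:
  assumes K: "\<And>h c. lform H (\<lambda>g. K g h c)" "\<And>g c. lform H (\<lambda>h. K g h c)" "\<And>g h. lform B (K g h)"
  shows "T x (\<lambda>s t. T3 t (\<lambda>j v c. sw H (p j * S (p c)) (\<lambda>g h. K (E s * g) h (Eb v)))) =
    T5 x (\<lambda>a j v k c. K (p a * S (p c)) (p j * S (p k)) (Eb v))"
proof -
  have ex: "sw H (p j * S (p c)) (\<lambda>g h. K (t * g) h (Eb v)) =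
    sw H (p j) (\<lambda>g h. sw H (p c) (\<lambda>y z. K (t * g * S z) (h * S y) (Eb v)))" for j c t v
  proof -
    have "sw H (p j * S (p c)) (\<lambda>g h. K (t * g) h (Eb v)) =
      sw H (p j) (\<lambda>g h. sw H (S (p c)) (\<lambda>y z. K (t * (g * y)) (h * z) (Eb v)))"
      by (rule comult_mult) (intro lf K)+
    also have "\<dots> = sw H (p j) (\<lambda>g h. sw H (p c) (\<lambda>y z. K (t * (g * S z)) (h * S y) (Eb v)))"
      by (rule swH_cong, rule comult_S) (intro lf K)+
    finally show ?thesis by (simp add: mult.assoc)
  qed
  have "T x (\<lambda>s t. T3 t (\<lambda>j v c. sw H (p j * S (p c)) (\<lambda>g h. K (E s * g) h (Eb v)))) =
    T x (\<lambda>m w. T m (\<lambda>s j. T w (\<lambda>v c. sw H (p j) (\<lambda>g h. sw H (p c) (\<lambda>y z. K (E s * g * S z) (h * S y) (Eb v))))))"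
    by (simp add: ex coassocD)
  also have "\<dots> = T x (\<lambda>m w. T m (\<lambda>s j. sw H (p j) (\<lambda>g h. T w (\<lambda>v c. sw H (p c) (\<lambda>y z. K (E s * g * S z) (h * S y) (Eb v))))))"
    by (rule T_cong, rule T_cong, rule sw_swap)
  also have "\<dots> = T x (\<lambda>m w. T m (\<lambda>a j. T w (\<lambda>v c. sw H (p c) (\<lambda>y z. K (p a * S z) (p j * S y) (Eb v)))))"
    by (rule T_cong, rule E_p_comult) (intro lf K)+
  also have "\<dots> = T x (\<lambda>a w. T3 w (\<lambda>j v c. sw H (p c) (\<lambda>y z. K (p a * S z) (p j * S y) (Eb v))))"
    by (simp add: coassocD)
  also have "\<dots> = T5 x (\<lambda>a j v k c. K (p a * S (p c)) (p j * S (p k)) (Eb v))"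
    by (rule T_cong, rule p_Eb_comult_S) (intro lf K)+
  finally show ?thesis .
qed

text \<open>Here \<open>E t\<close> stands at the right end, so \<open>S_E_comult\<close> undoes the
  coproduct of \<open>p i\<close>, and then \<open>comult_p_Eb_S\<close> that of \<open>p a\<close>.
  The fivefold sum is the one of \<open>coact_coact_left\<close>, whence the symmetry of the
  coaction.\<close>

lemma coact_coact_right:
  assumes K: "\<And>h c. lform H (\<lambda>g. K g h c)" "\<And>g c. lform H (\<lambda>h. K g h c)" "\<And>g h. lform B (K g h)"
  shows "T x (\<lambda>s t. T3 s (\<lambda>a u i. sw H (p a * S (p i)) (\<lambda>g h. K (g * E t) h (Eb u)))) =
    T5 x (\<lambda>a j v k c. K (p a * S (p c)) (p j * S (p k)) (Eb v))"
proof -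
  have ex: "sw H (p a * S (p i)) (\<lambda>g h. K (g * t) h (Eb u)) =
    sw H (p i) (\<lambda>y z. sw H (p a) (\<lambda>g h. K (g * (S z * t)) (h * S y) (Eb u)))" for a i t u
  proof -
    have "sw H (p a * S (p i)) (\<lambda>g h. K (g * t) h (Eb u)) =
      sw H (p a) (\<lambda>g h. sw H (S (p i)) (\<lambda>y z. K (g * y * t) (h * z) (Eb u)))"
      by (rule comult_mult) (intro lf K)+
    also have "\<dots> = sw H (p a) (\<lambda>g h. sw H (p i) (\<lambda>y z. K (g * S z * t) (h * S y) (Eb u)))"
      by (rule swH_cong, rule comult_S) (intro lf K)+
    also have "\<dots> = sw H (p i) (\<lambda>y z. sw H (p a) (\<lambda>g h. K (g * S z * t) (h * S y) (Eb u)))"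
      by (rule sw_swap)
    finally show ?thesis by (simp add: mult.assoc)
  qed
  have "T x (\<lambda>s t. T3 s (\<lambda>a u i. sw H (p a * S (p i)) (\<lambda>g h. K (g * E t) h (Eb u)))) =
    T3 x (\<lambda>a u w. T w (\<lambda>i t. sw H (p i) (\<lambda>y z. sw H (p a) (\<lambda>g h. K (g * (S z * E t)) (h * S y) (Eb u)))))"
    by (simp add: ex coassocD)
  also have "\<dots> = T3 x (\<lambda>a u w. T w (\<lambda>i c. sw H (p a) (\<lambda>g h. K (g * S (p c)) (h * S (p i)) (Eb u))))"
    by (rule T_cong, rule T_cong, rule S_E_comult) (intro lf K)+
  also have "\<dots> = T x (\<lambda>s c. T3 s (\<lambda>a u i. sw H (p a) (\<lambda>g h. K (g * S (p c)) (h * S (p i)) (Eb u))))"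
    by (simp add: coassocD)
  also have "\<dots> = T x (\<lambda>s c. T4 s (\<lambda>a j v k. K (p a * S (p c)) (p j * S (p k)) (Eb v)))"
    by (rule T_cong, rule comult_p_Eb_S) (intro lf K)+
  finally show ?thesis by (simp add: coassocD)
qed

lemma symmetric_partial_comodule: "symmetric_partial_comodule_coalgebra H B coa"
  unfolding symmetric_partial_comodule_coalgebra_def
proof (intro conjI ballI coB linear_coa)
  fix c assume cB: "c \<in> vcarrier B"
  then obtain x where x: "x \<in> vcarrier D" "c = Eb x" by auto
  show "coact H B coa B c (\<lambda>g d. smult B (e g) d) = c"
  proof (rule functional_eqI[OF vs_vector_space[OF vB]])
    fix f assume f: "functional B f"
    note lf' = functional_lform[OF f]
    have "f (coact H B coa B c (\<lambda>g d. smult B (e g) d)) = ct c (\<lambda>g d. e g * f d)"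
      by (rule functional_coact[OF f]) (use f in \<open>simp_all add: functional_def lf lf' functional_lform[OF f]\<close>)
    also have "\<dots> = T3 x (\<lambda>a b d. e (p a * S (p d)) * f (Eb b))"
      unfolding x(2) by (rule ct_Eb[OF x(1)]) (intro lf lf')+
    also have "\<dots> = f c" unfolding x(2) by (rule coact_counit[OF lf' x(1)])
    finally show "f (coact H B coa B c (\<lambda>g d. smult B (e g) d)) = f c" .
  qed
  let ?U = "tensor H (tensor B B)"
  show "coact H B coa ?U c (\<lambda>g d. tens H (tensor B B) g (comult B d)) =
    sweedler B ?U c (\<lambda>c1 c2. coact H B coa ?U c1 (\<lambda>g1 d1. coact H B coa ?U c2 (\<lambda>g2 d2.
      tens H (tensor B B) (g1 * g2) (tens B B d1 d2))))"
  proof (rule functional_eqI[of ?U])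
    fix f assume f: "functional ?U f"
    define K where "K g c d = f (tens H (tensor B B) g (tens B B c d))" for g c d
    have K: "lform H (\<lambda>a. K a c d)" "lform B (\<lambda>c. K a c d)" "lform B (K a c)" for a c d
      unfolding K_def by (rule functional_tens3_lform[OF f])+
    have "f (coact H B coa ?U c (\<lambda>g d. tens H (tensor B B) g (comult B d))) = ct c (\<lambda>g d. sw B d (K g))"
      by (rule functional_coact[OF f])
        (intro lf K, intro lf K, simp only: sw_comult_functional[OF preB functional_comp_tens_right[OF f]] K_def[abs_def])
    also have "\<dots> = T3 x (\<lambda>a b d. sw B (Eb b) (K (p a * S (p d))))"
      unfolding x(2) by (rule ct_Eb[OF x(1)]) (intro lf K)+
    also have "\<dots> = T3 x (\<lambda>a b d. T b (\<lambda>u v. K (p a * S (p d)) (Eb u) (Eb v)))"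
      by (rule T_cong, rule T_cong, rule swB_Eb, assumption) (intro lf K)+
    also have "\<dots> = T x (\<lambda>s t. T3 s (\<lambda>a u i. T3 t (\<lambda>j v c. K (p a * S (p i) * (p j * S (p c))) (Eb u) (Eb v))))"
      by (rule coact_comult) (rule K)+
    also have "\<dots> = T x (\<lambda>s t. T3 s (\<lambda>a u i. ct (Eb t) (\<lambda>g2 d2. K (p a * S (p i) * g2) (Eb u) d2)))"
      by (rule T_cong, rule T_cong, rule T_cong, rule ct_Eb[symmetric], assumption) (intro lf K)+
    also have "\<dots> = T x (\<lambda>s t. ct (Eb s) (\<lambda>g1 d1. ct (Eb t) (\<lambda>g2 d2. K (g1 * g2) d1 d2)))"
      by (rule T_cong, rule ct_Eb[symmetric], assumption) (intro lf K)+
    also have "\<dots> = sw B c (\<lambda>s t. ct s (\<lambda>g1 d1. ct t (\<lambda>g2 d2. K (g1 * g2) d1 d2)))"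
      unfolding x(2) by (rule swB_Eb[OF x(1), symmetric]) (intro lf K)+
    also have "\<dots> = f (sweedler B ?U c (\<lambda>c1 c2. coact H B coa ?U c1 (\<lambda>g1 d1. coact H B coa ?U c2 (\<lambda>g2 d2.
      tens H (tensor B B) (g1 * g2) (tens B B d1 d2)))))"
      by (rule sym, rule functional_sweedler_B[OF f _ _ cB], (intro lf K)+,
          rule functional_coact[OF f], (intro lf K)+, rule functional_coact[OF f], (intro lf K)+) (simp add: K_def)
    finally show "f (coact H B coa ?U c (\<lambda>g d. tens H (tensor B B) g (comult B d))) = \<dots>" .
  qed (simp add: vector_space_fscale)
  let ?V = "tensor H (tensor H B)"
  \<comment> \<open>Both coassociativity axioms share this left-hand side: a fivefold sum in which
    the pair \<open>p j\<close>, \<open>S (p k)\<close> is nested inside the pair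
    \<open>p a\<close>, \<open>S (p c)\<close>, around \<open>Eb v\<close>.\<close>
  have lhs: "f (coact H B coa ?V c (\<lambda>g d. tens H (tensor H B) g (coa d))) =
    T5 x (\<lambda>a j v k c. f (tens H (tensor H B) (p a * S (p c)) (tens H B (p j * S (p k)) (Eb v))))"
    if f: "functional ?V f" for f
  proof -
    define K where "K g h d = f (tens H (tensor H B) g (tens H B h d))" for g h d
    have K: "lform H (\<lambda>a. K a c d)" "lform H (\<lambda>c. K a c d)" "lform B (K a c)" for a c d
      unfolding K_def by (rule functional_tens3_lform[OF f])+
    have "f (coact H B coa ?V c (\<lambda>g d. tens H (tensor H B) g (coa d))) = ct c (\<lambda>g d. ct d (K g))"
      by (rule functional_coact[OF f])
        (intro lf K, intro lf K, simp only: functional_coa[OF functional_comp_tens_right[OF f]] K_def[abs_def])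
    also have "\<dots> = T3 x (\<lambda>a b c. ct (Eb b) (K (p a * S (p c))))"
      unfolding x(2) by (rule ct_Eb[OF x(1)]) (intro lf K)+
    also have "\<dots> = T3 x (\<lambda>a b c. T3 b (\<lambda>j v k. K (p a * S (p c)) (p j * S (p k)) (Eb v)))"
      by (rule T_cong, rule T_cong, rule ct_Eb, assumption) (intro lf K)+
    finally show ?thesis by (simp add: coassocD K_def)
  qed
  show "coact H B coa ?V c (\<lambda>g d. tens H (tensor H B) g (coa d)) =
    sweedler B ?V c (\<lambda>c1 c2. coact H B coa ?V c1 (\<lambda>g d. coact H B coa ?V c2 (\<lambda>g' d'.
      sweedler H ?V g' (\<lambda>g1 g2. tens H (tensor H B) (smult H (counit B d) (g * g1)) (tens H B g2 d')))))"
    (is "?L = ?R")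
  proof (rule functional_eqI[of ?V])
    fix f assume f: "functional ?V f"
    define K where "K g h d = f (tens H (tensor H B) g (tens H B h d))" for g h d
    have K: "lform H (\<lambda>a. K a c d)" "lform H (\<lambda>c. K a c d)" "lform B (K a c)" for a c d
      unfolding K_def by (rule functional_tens3_lform[OF f])+
    have "f ?R = sw B c (\<lambda>c1 c2. ct c1 (\<lambda>g d. ct c2 (\<lambda>g' d'. sw H g' (\<lambda>g1 g2. counit C d * K (g * g1) g2 d'))))"
      by (rule functional_sweedler_B[OF f _ _ cB], (intro lf K)+,
          rule functional_coact[OF f], (intro lf K)+, rule functional_coact[OF f], (intro lf K)+,
          rule functional_sweedler_H[OF f], (intro lf K)+) (use f in \<open>simp add: K_def tens_smult_left functional_def\<close>)
    also have "\<dots> = T x (\<lambda>s t. ct (Eb s) (\<lambda>g d. ct (Eb t) (\<lambda>g' d'. sw H g' (\<lambda>g1 g2. counit C d * K (g * g1) g2 d'))))"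
      unfolding x(2) by (rule swB_Eb[OF x(1)]) (intro lf K)+
    also have "\<dots> = T x (\<lambda>s t. T3 s (\<lambda>a u i. ct (Eb t) (\<lambda>g' d'. sw H g' (\<lambda>g1 g2. counit C (Eb u) * K (p a * S (p i) * g1) g2 d'))))"
      by (rule T_cong, rule ct_Eb, assumption) (intro lf K)+
    also have "\<dots> = T x (\<lambda>s t. T3 s (\<lambda>a u i. T3 t (\<lambda>j v c. sw H (p j * S (p c)) (\<lambda>g1 g2. counit C (Eb u) * K (p a * S (p i) * g1) g2 (Eb v)))))"
      by (rule T_cong, rule T_cong, rule T_cong, rule ct_Eb, assumption) (intro lf K)+
    also have "\<dots> = T x (\<lambda>s t. T3 s (\<lambda>a u i. counit C (Eb u) * T3 t (\<lambda>j v c. sw H (p j * S (p c)) (\<lambda>g1 g2. K (p a * S (p i) * g1) g2 (Eb v)))))"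
      by (simp add: sw_const_mult)
    also have "\<dots> = T x (\<lambda>s t. T3 t (\<lambda>j v c. sw H (p j * S (p c)) (\<lambda>g1 g2. K (E s * g1) g2 (Eb v))))"
      by (rule T_cong, rule ct_counit) (intro lf K)
    also have "\<dots> = T5 x (\<lambda>a j v k c. K (p a * S (p c)) (p j * S (p k)) (Eb v))"
      by (rule coact_coact_left) (rule K)+
    finally show "f ?L = f ?R" unfolding lhs[OF f] K_def ..
  qed (simp add: vector_space_fscale)
  show "coact H B coa ?V c (\<lambda>g d. tens H (tensor H B) g (coa d)) =
    sweedler B ?V c (\<lambda>c1 c2. coact H B coa ?V c1 (\<lambda>g d. coact H B coa ?V c2 (\<lambda>g' d'.
      sweedler H ?V g (\<lambda>g1 g2. tens H (tensor H B) (smult H (counit B d') (g1 * g')) (tens H B g2 d)))))"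
    (is "?L = ?R")
  proof (rule functional_eqI[of ?V])
    fix f assume f: "functional ?V f"
    define K where "K g h d = f (tens H (tensor H B) g (tens H B h d))" for g h d
    have K: "lform H (\<lambda>a. K a c d)" "lform H (\<lambda>c. K a c d)" "lform B (K a c)" for a c d
      unfolding K_def by (rule functional_tens3_lform[OF f])+
    have "f ?R = sw B c (\<lambda>c1 c2. ct c1 (\<lambda>g d. ct c2 (\<lambda>g' d'. sw H g (\<lambda>g1 g2. counit C d' * K (g1 * g') g2 d))))"
      by (rule functional_sweedler_B[OF f _ _ cB], (intro lf K)+,
          rule functional_coact[OF f], (intro lf K)+, rule functional_coact[OF f], (intro lf K)+,
          rule functional_sweedler_H[OF f], (intro lf K)+) (use f in \<open>simp add: K_def tens_smult_left functional_def\<close>)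
    also have "\<dots> = T x (\<lambda>s t. ct (Eb s) (\<lambda>g d. ct (Eb t) (\<lambda>g' d'. sw H g (\<lambda>g1 g2. counit C d' * K (g1 * g') g2 d))))"
      unfolding x(2) by (rule swB_Eb[OF x(1)]) (intro lf K)+
    also have "\<dots> = T x (\<lambda>s t. T3 s (\<lambda>a u i. ct (Eb t) (\<lambda>g' d'. sw H (p a * S (p i)) (\<lambda>g1 g2. counit C d' * K (g1 * g') g2 (Eb u)))))"
      by (rule T_cong, rule ct_Eb, assumption) (intro lf K)+
    also have "\<dots> = T x (\<lambda>s t. T3 s (\<lambda>a u i. T3 t (\<lambda>j v c. sw H (p a * S (p i)) (\<lambda>g1 g2. counit C (Eb v) * K (g1 * (p j * S (p c))) g2 (Eb u)))))"
      by (rule T_cong, rule T_cong, rule T_cong, rule ct_Eb, assumption) (intro lf K)+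
    also have "\<dots> = T x (\<lambda>s t. T3 s (\<lambda>a u i. T3 t (\<lambda>j v c. counit C (Eb v) * sw H (p a * S (p i)) (\<lambda>g1 g2. K (g1 * (p j * S (p c))) g2 (Eb u)))))"
      by (simp add: sw_const_mult)
    also have "\<dots> = T x (\<lambda>s t. T3 s (\<lambda>a u i. sw H (p a * S (p i)) (\<lambda>g1 g2. K (g1 * E t) g2 (Eb u))))"
      by (rule T_cong, rule T_cong, rule T_cong, rule ct_counit) (intro lf K)
    also have "\<dots> = T5 x (\<lambda>a j v k c. K (p a * S (p c)) (p j * S (p k)) (Eb v))"
      by (rule coact_coact_right) (rule K)+
    finally show "f ?L = f ?R" unfolding lhs[OF f] K_def ..
  qed (simp add: vector_space_fscale)
qed

end

section \<open>The partial cosmash coproduct\<close>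

lemma functional_tens:
  assumes "functional (tensor U V) f"
  shows "functional U (\<lambda>a. f (tens U V a b))" "functional V (\<lambda>b. f (tens U V a b))"
  using assms by (simp_all add: functional_def tens_add_left tens_add_right
      tens_smult_left tens_smult_right)

lemma sw_swap4: "sw E y (\<lambda>c d. sw D r (\<lambda>a w. sw D w (\<lambda>b w'. sw D w' (\<lambda>u z. F a b u z c d)))) =
    sw D r (\<lambda>a w. sw D w (\<lambda>b w'. sw D w' (\<lambda>u z. sw E y (\<lambda>c d. F a b u z c d))))"
  by (simp only: sw_swap[of E y D])

context base_coalg
begin

lemma coa_sweedler3:
  assumes x: "x \<in> vcarrier D"
  shows "coa (Eb x) = sweedler3 D (tensor H B) x (\<lambda>x1 x2 x3. tens H B (p x1 * S (p x3)) (Eb x2))"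
proof (rule functional_eqI[of "tensor H B"])
  fix f assume f: "functional (tensor H B) f"
  note l = functional_tens_lform[OF f]
  have "f (sweedler3 D (tensor H B) x (\<lambda>x1 x2 x3. tens H B (p x1 * S (p x3)) (Eb x2))) =
    T3 x (\<lambda>a b c. f (tens H B (p a * S (p c)) (Eb b)))"
    unfolding sweedler3_def
    by (rule functional_sweedler[OF preD x f], unfold biform_iff, (intro conjI ballI lf l)+,
        rule functional_sweedler[OF preD _ f], assumption, unfold biform_iff, (intro conjI ballI lf l)+) (rule refl)
  also have "\<dots> = f (coact_lift x)"
    using functional_coact_lift[OF f[unfolded functional_tensor_HB], of x] by (simp add: tens_HB)
  finally show "f (coa (Eb x)) =
      f (sweedler3 D (tensor H B) x (\<lambda>x1 x2 x3. tens H B (p x1 * S (p x3)) (Eb x2)))"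
    by (simp add: coa_Eb x)
qed (simp add: vector_space_fscale)

text \<open>The generator in terms of a preimage of \<open>c\<close>: its coaction followed by the
  counit has contracted to \<open>E t\<close>. Unlike \<open>cosmash_gen\<close>, this is known to
  lie in the span for every \<open>c\<close> whatsoever, which frees the linearity rules from
  membership conditions.\<close>

definition cg :: "'c \<Rightarrow> 'h \<Rightarrow> ('c \<times> 'h \<Rightarrow>\<^sub>0 'k)" where
  "cg c h = swv (tensor B H) D (sec c) (\<lambda>s t. tens B H (Eb s) (E t * h))"

definition Rspace :: "('k, 'c \<times> 'h \<Rightarrow>\<^sub>0 'k) vspace" where
  "Rspace = \<lparr>vcarrier = module.span fscale {cosmash_gen H B coa c h | c h. c \<in> vcarrier B \<and> h \<in> vcarrier H},
    smult = fscale\<rparr>"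

lemma Rspace_simps [simp]: "smult Rspace = fscale"
  by (simp add: Rspace_def)

lemma vRspace: "is_vspace Rspace"
  by (simp add: is_vspace_def Rspace_def vector_space_fscale fs.subspace_span)

section \<open>Generators of the cosmash coproduct and forms on their span\<close>

lemma functional_gen:
  assumes f: "functional (tensor B H) f" and c: "c \<in> vcarrier B"
  shows "f (cosmash_gen H B coa c h) = sw B c (\<lambda>c1 c2. ct c2 (\<lambda>g d. counit C d * f (tens B H c1 (g * h))))"
proof -
  note l = functional_tens_lform[OF f]
  show ?thesis unfolding cosmash_gen_def
    by (rule functional_sweedler_B[OF f _ _ c], (intro lf l)+, rule functional_coact[OF f], (intro lf l)+)
      (use f in \<open>simp add: tens_smult_right functional_def\<close>)
qed

lemma functional_gen_Eb:
  assumes f: "functional (tensor B H) f" and x: "x \<in> vcarrier D"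
  shows "f (cosmash_gen H B coa (Eb x) h) = T x (\<lambda>s t. f (tens B H (Eb s) (E t * h)))"
proof -
  note l = functional_tens_lform[OF f]
  have "f (cosmash_gen H B coa (Eb x) h) = T x (\<lambda>s t. ct (Eb t) (\<lambda>g d. counit C d * f (tens B H (Eb s) (g * h))))"
    unfolding functional_gen[OF f B_in[OF x]] by (rule swB_Eb[OF x]) (intro lf l)+
  also have "\<dots> = T x (\<lambda>s t. T3 t (\<lambda>a b d. counit C (Eb b) * f (tens B H (Eb s) (p a * S (p d) * h))))"
    by (rule T_cong, rule ct_Eb, assumption) (intro lf l)+
  also have "\<dots> = T x (\<lambda>s t. f (tens B H (Eb s) (E t * h)))"
    by (rule T_cong, rule ct_counit) (intro lf l)
  finally show ?thesis .
qed

lemma cg_eq_gen: "c \<in> vcarrier B \<Longrightarrow> cg c h = cosmash_gen H B coa c h"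
proof (rule functional_eqI[of "tensor B H"])
  fix f assume c: "c \<in> vcarrier B" and f: "functional (tensor B H) f"
  show "f (cg c h) = f (cosmash_gen H B coa c h)"
    using functional_gen_Eb[OF f sec(1)[OF c], of h] unfolding sec(2)[OF c] cg_def
    by (simp add: functional_swv[OF f])
qed (simp add: vector_space_fscale)

lemma functional_cg_Eb:
  assumes "functional (tensor B H) f" "x \<in> vcarrier D"
  shows "f (cg (Eb x) h) = T x (\<lambda>s t. f (tens B H (Eb s) (E t * h)))"
  using functional_gen_Eb[OF assms] cg_eq_gen[OF B_in[OF assms(2)]] by simp

lemma cg_in: "cg c h \<in> vcarrier Rspace"
proof (cases "sec c \<in> vcarrier D")
  case True
  have "cg c h = cg (Eb (sec c)) h"
  proof (rule functional_eqI[of "tensor B H"])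
    fix f assume f: "functional (tensor B H) f"
    show "f (cg c h) = f (cg (Eb (sec c)) h)"
      unfolding functional_cg_Eb[OF f True] by (simp add: cg_def functional_swv[OF f])
  qed (simp add: vector_space_fscale)
  also have "\<dots> = cosmash_gen H B coa (Eb (sec c)) h" by (rule cg_eq_gen[OF B_in[OF True]])
  finally show ?thesis using B_in[OF True] by (auto simp: Rspace_def intro!: fs.span_base)
next
  case False
  have "cg c h = 0"
  proof (rule functional_eqI[of "tensor B H"])
    fix f assume f: "functional (tensor B H) f"
    show "f (cg c h) = f 0"
      using False lform_0[OF is_vspace_tensor functional_lform[OF f]]
      by (simp add: cg_def functional_swv[OF f] sw_notin)
  qed (simp add: vector_space_fscale)
  then show ?thesis using vs_zero[OF vRspace] by simp
qed

lemma Rspace_sub: "vcarrier Rspace \<subseteq> vcarrier (tensor B H)"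
proof -
  have "cosmash_gen H B coa c h \<in> vcarrier (tensor B H)" if "c \<in> vcarrier B" for c h
    unfolding cg_eq_gen[OF that, symmetric] cg_def
    by (intro swv_in[OF preD is_vspace_tensor] tens_in_tensor) simp_all
  moreover have "fs.subspace (vcarrier (tensor B H))"
    using is_vspace_tensor[of B H] by (simp add: is_vspace_def)
  ultimately show ?thesis
    unfolding Rspace_def vspace.select_convs by (intro fs.span_minimal) auto
qed

lemma functional_Rspace: "functional Rspace f \<longleftrightarrow> functional (tensor B H) f"
  by (simp add: functional_def)

lemma lf_cg_functional:
  assumes f: "functional (tensor B H) f"
  shows "lform B (\<lambda>c. f (cg c h))" "lform H (\<lambda>h. f (cg c h))"
proof -
  note l = functional_tens_lform[OF f]
  have "lform B (\<lambda>c. f (cosmash_gen H B coa c h)) \<longleftrightarrow>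
    lform B (\<lambda>c. sw B c (\<lambda>c1 c2. ct c2 (\<lambda>g d. counit C d * f (tens B H c1 (g * h)))))"
    by (rule lform_cong[OF vB]) (rule functional_gen[OF f])
  moreover have "lform B (\<lambda>c. f (cosmash_gen H B coa c h)) \<longleftrightarrow> lform B (\<lambda>c. f (cg c h))"
    by (rule lform_cong[OF vB]) (simp add: cg_eq_gen)
  ultimately show "lform B (\<lambda>c. f (cg c h))" by (simp add: lf)
  show "lform H (\<lambda>h. f (cg c h))"
    unfolding cg_def functional_swv[OF f] by (intro lf l)
qed

lemma lf_cg [lf]:
  assumes "lform Rspace f"
  shows "lform B (\<lambda>c. f (cg c h))" "lform H (\<lambda>h. f (cg c h))"
proof -
  obtain g where g: "functional Rspace g" "\<And>x. x \<in> vcarrier Rspace \<Longrightarrow> g x = f x"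
    by (rule functional_extend[OF vRspace assms]) blast
  show "lform B (\<lambda>c. f (cg c h))" "lform H (\<lambda>h. f (cg c h))"
    using lf_cg_functional[of g] g by (simp_all add: functional_Rspace cg_in)
qed

lemma lform_Rspace_eqI:
  assumes fg: "lform Rspace f" "lform Rspace g"
    "\<And>x h. x \<in> vcarrier D \<Longrightarrow> f (cg (Eb x) h) = g (cg (Eb x) h)"
    and w: "w \<in> vcarrier Rspace"
  shows "f w = g w"
proof -
  let ?X = "{cosmash_gen H B coa c h | c h. c \<in> vcarrier B \<and> h \<in> vcarrier H}"
  have "f w - g w = 0"
  proof (rule lform_zero_span[OF vRspace lform_minus[OF fg(1,2)]])
    show "?X \<subseteq> vcarrier Rspace" by (auto simp: Rspace_def intro: fs.span_base)
    show "w \<in> module.span (smult Rspace) ?X" using w by (simp add: Rspace_def)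
    fix x assume "x \<in> ?X"
    then obtain c h where x: "c \<in> vcarrier B" "x = cosmash_gen H B coa c h" by blast
    show "f x - g x = 0"
      using fg(3)[OF sec(1)[OF x(1)], of h] unfolding sec(2)[OF x(1)] cg_eq_gen[OF x(1)] x(2) by simp
  qed
  then show ?thesis by simp
qed

lemma tform_cg:
  assumes M: "\<And>b. lform B (\<lambda>a. M a b)" "\<And>a. lform H (M a)" and x: "x \<in> vcarrier D"
  shows "tform B H M (cg (Eb x) h) = T x (\<lambda>s t. M (Eb s) (E t * h))"
proof -
  have bf: "biform B H M" using M by (simp add: biform_iff)
  obtain f where f: "functional (tensor B H) f"
    "\<And>a b. a \<in> vcarrier B \<Longrightarrow> b \<in> vcarrier H \<Longrightarrow> f (tens B H a b) = M a b"
    "\<And>t. t \<in> vcarrier (tensor B H) \<Longrightarrow> f t = tform B H M t"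
    by (rule functional_tensE[OF vB vH bf]) blast
  have "tform B H M (cg (Eb x) h) = f (cg (Eb x) h)"
    by (rule f(3)[OF subsetD[OF Rspace_sub cg_in], symmetric])
  also have "\<dots> = T x (\<lambda>s t. M (Eb s) (E t * h))"
    unfolding functional_cg_Eb[OF f(1) x] by (rule T_cong, rule f(2)) simp_all
  finally show ?thesis .
qed

lemma lform_tform_Rspace:
  assumes "\<And>b. lform B (\<lambda>a. M a b)" "\<And>a. lform H (M a)"
  shows "lform Rspace (tform B H M)"
proof -
  have "biform B H M" using assms by (simp add: biform_iff)
  from lform_tform[OF vB vH this] show ?thesis
    using Rspace_sub unfolding lform_iff Rspace_simps smult_tensor by blast
qed

text \<open>The formula for the comultiplication makes sense on all of \<open>C \<otimes> H\<close>; \<open>theta N\<close> is its composition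
  with a four-linear form \<open>N\<close>.\<close>

definition theta where
  "theta N c h = sw B c (\<lambda>m n. ct n (\<lambda>g d. sw H h (\<lambda>h1 h2. N m (g * h1) d h2)))"

lemma theta_lf:
  assumes N: "\<And>k d l. lform B (\<lambda>c. N c k d l)" "\<And>c d l. lform H (\<lambda>k. N c k d l)"
    "\<And>c k l. lform B (\<lambda>d. N c k d l)" "\<And>c k d. lform H (N c k d)"
  shows "lform B (\<lambda>c. theta N c h)" "lform H (theta N c)"
  unfolding theta_def by (intro lf N)+

text \<open>At a generator the comultiplication formula becomes a sum of pairs of generators, which
  the right-hand side writes out; this is why the span is mapped into its own tensor square. On the
  left \<open>S_p_E\<close> removes the coproduct of \<open>E t\<close>, on the right
  \<open>E_p\<close> absorbs \<open>E n\<close> into \<open>p a\<close>, and the same fivefold sum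
  results.\<close>

lemma tform_theta_cg:
  assumes N: "\<And>k d l. lform B (\<lambda>c. N c k d l)" "\<And>c d l. lform H (\<lambda>k. N c k d l)"
    "\<And>c k l. lform B (\<lambda>d. N c k d l)" "\<And>c k d. lform H (N c k d)" and x: "x \<in> vcarrier D"
  shows "tform B H (theta N) (cg (Eb x) h) = T4 x (\<lambda>s a u c. sw H h (\<lambda>h1 h2. T s (\<lambda>m n. T u (\<lambda>i j.
      N (Eb m) (E n * (p a * S (p c) * h1)) (Eb i) (E j * h2)))))"
proof -
  have ex: "sw H (E t * h) (\<lambda>h1 h2. N m (k * h1) d h2) =
    sw H (E t) (\<lambda>y z. sw H h (\<lambda>h1 h2. N m (k * y * h1) d (z * h2)))" for t m k d
  proof -
    have "sw H (E t * h) (\<lambda>h1 h2. N m (k * h1) d h2) =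
      sw H (E t) (\<lambda>y z. sw H h (\<lambda>h1 h2. N m (k * (y * h1)) d (z * h2)))"
      by (rule comult_mult) (intro lf N)+
    then show ?thesis by (simp add: mult.assoc)
  qed
  have "tform B H (theta N) (cg (Eb x) h) = T x (\<lambda>s t. theta N (Eb s) (E t * h))"
    by (rule tform_cg[OF theta_lf x]) (rule N)+
  also have "\<dots> = T x (\<lambda>s t. T s (\<lambda>m n. ct (Eb n) (\<lambda>g d. sw H (E t * h) (\<lambda>h1 h2. N (Eb m) (g * h1) d h2))))"
    unfolding theta_def by (rule T_cong, rule swB_Eb, assumption) (intro lf N)+
  also have "\<dots> = T x (\<lambda>s t. T s (\<lambda>m n. T3 n (\<lambda>a u c. sw H (E t * h) (\<lambda>h1 h2. N (Eb m) (p a * S (p c) * h1) (Eb u) h2))))"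
    by (rule T_cong, rule T_cong, rule ct_Eb, assumption) (intro lf N)+
  also have "\<dots> = T x (\<lambda>s t. T s (\<lambda>m n. T3 n (\<lambda>a u c. sw H (E t) (\<lambda>y z. sw H h (\<lambda>h1 h2.
      N (Eb m) (p a * S (p c) * y * h1) (Eb u) (z * h2))))))"
    by (rule T_cong, rule T_cong, rule T_cong, rule T_cong, rule ex)
  also have "\<dots> = T x (\<lambda>m w. T w (\<lambda>a w'. T w' (\<lambda>u k. T k (\<lambda>c t. sw H (E t) (\<lambda>y z. sw H h (\<lambda>h1 h2.
      N (Eb m) (p a * (S (p c) * y) * h1) (Eb u) (z * h2)))))))"
    by (simp add: coassocD mult.assoc)
  also have "\<dots> = T x (\<lambda>m w. T w (\<lambda>a w'. T w' (\<lambda>u k. T k (\<lambda>t c. sw H h (\<lambda>h1 h2.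
      N (Eb m) (p a * S (p c) * h1) (Eb u) (E t * h2))))))"
    by (rule T_cong, rule T_cong, rule T_cong, rule S_p_E) (intro lf N)+
  finally have L: "tform B H (theta N) (cg (Eb x) h) = T5 x (\<lambda>m a u t c. sw H h (\<lambda>h1 h2.
      N (Eb m) (p a * S (p c) * h1) (Eb u) (E t * h2)))" .
  have "T4 x (\<lambda>s a u c. sw H h (\<lambda>h1 h2. T s (\<lambda>m n. T u (\<lambda>i j.
      N (Eb m) (E n * (p a * S (p c) * h1)) (Eb i) (E j * h2))))) =
    T4 x (\<lambda>s a u c. T s (\<lambda>m n. T u (\<lambda>i j. sw H h (\<lambda>h1 h2.
      N (Eb m) (E n * (p a * S (p c) * h1)) (Eb i) (E j * h2)))))"
    by (simp only: sw_swap[of H h D])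
  also have "\<dots> = T4 x (\<lambda>s a u c. T u (\<lambda>i j. T s (\<lambda>m n. sw H h (\<lambda>h1 h2.
      N (Eb m) (E n * (p a * S (p c) * h1)) (Eb i) (E j * h2)))))"
    by (rule T_cong, rule T_cong, rule T_cong, rule sw_swap)
  also have "\<dots> = T x (\<lambda>s w. T w (\<lambda>a w'. T w' (\<lambda>i w''. T w'' (\<lambda>j c. T s (\<lambda>m n. sw H h (\<lambda>h1 h2.
      N (Eb m) (E n * (p a * S (p c) * h1)) (Eb i) (E j * h2)))))))"
    by (simp add: coassocD)
  also have "\<dots> = T x (\<lambda>s w. T s (\<lambda>m n. T w (\<lambda>a w'. T w' (\<lambda>i w''. T w'' (\<lambda>j c. sw H h (\<lambda>h1 h2.
      N (Eb m) (E n * (p a * S (p c) * h1)) (Eb i) (E j * h2)))))))"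
    by (rule T_cong, rule sw_swap4[symmetric])
  also have "\<dots> = T x (\<lambda>m k. T k (\<lambda>s w'. T s (\<lambda>n a. T w' (\<lambda>i w''. T w'' (\<lambda>j c. sw H h (\<lambda>h1 h2.
      N (Eb m) (E n * p a * (S (p c) * h1)) (Eb i) (E j * h2)))))))"
    by (simp add: coassocD mult.assoc)
  also have "\<dots> = T x (\<lambda>m k. T k (\<lambda>s w'. T w' (\<lambda>i w''. T w'' (\<lambda>j c. sw H h (\<lambda>h1 h2.
      N (Eb m) (p s * (S (p c) * h1)) (Eb i) (E j * h2))))))"
    by (rule T_cong, rule T_cong, rule E_p, assumption) (intro lf N)
  finally show ?thesis using L by (simp add: mult.assoc)
qed

section \<open>The comultiplication on the span of the generators\<close>

definition nform4 where
  "nform4 f c k d l = f (tens (tensor B H) (tensor B H) (tens B H c k) (tens B H d l))"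

lemma nform4_lf:
  assumes "functional (tensor (tensor B H) (tensor B H)) f"
  shows "lform B (\<lambda>c. nform4 f c k d l)" "lform H (\<lambda>k. nform4 f c k d l)"
    "lform B (\<lambda>d. nform4 f c k d l)" "lform H (nform4 f c k d)"
  unfolding nform4_def[abs_def]
  by (rule functional_tens_lform[OF functional_tens(1)[OF assms]] functional_tens_lform[OF functional_tens(2)[OF assms]])+

text \<open>The prescribed value is linear in \<open>w\<close>, so the elements that have such a
  \<open>z\<close> form a subspace, and \<open>tform_theta_cg\<close> exhibits \<open>z\<close> for
  each generator. How \<open>w\<close> is written in terms of generators does not enter: functionals
  separate points, so \<open>w\<close> determines \<open>z\<close>.\<close>

lemma comult_exists:
  assumes "w \<in> vcarrier Rspace"
  shows "\<exists>z. z \<in> vcarrier (tensor Rspace Rspace) \<and>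
    (\<forall>f. functional (tensor (tensor B H) (tensor B H)) f \<longrightarrow> f z = tform B H (theta (nform4 f)) w)"
    (is "\<exists>z. ?P w z")
proof -
  let ?W = "tensor B H"
  have tW: "tens Rspace Rspace = tens ?W ?W" by (rule tens_cong) simp_all
  have sW: "swv (tensor Rspace Rspace) = swv (tensor ?W ?W)" by (rule swv_smult_cong) simp
  have lin: "lform Rspace (tform B H (theta (nform4 f)))" if "functional (tensor ?W ?W) f" for f
    by (rule lform_tform_Rspace[OF theta_lf]) (rule nform4_lf[OF that])+
  have gen: "\<exists>z. ?P (cosmash_gen H B coa c h) z" if "c \<in> vcarrier B" for c h
  proof -
    from that obtain x where x: "x \<in> vcarrier D" "c = Eb x" by auto
    define z where "z = swv (tensor Rspace Rspace) D x (\<lambda>s w. swv (tensor Rspace Rspace) D w (\<lambda>a w'.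
      swv (tensor Rspace Rspace) D w' (\<lambda>u c. swv (tensor Rspace Rspace) H h (\<lambda>h1 h2.
        tens Rspace Rspace (cg (Eb s) (p a * S (p c) * h1)) (cg (Eb u) h2)))))"
    have "z \<in> vcarrier (tensor Rspace Rspace)"
      unfolding z_def by (intro swv_in[OF preD is_vspace_tensor] swv_in[OF preH is_vspace_tensor] tens_in_tensor cg_in)
    moreover have "f z = tform B H (theta (nform4 f)) (cosmash_gen H B coa c h)" if f: "functional (tensor ?W ?W) f" for f
    proof -
      note ft = functional_tens[OF f]
      have "f z = T4 x (\<lambda>s a u c. sw H h (\<lambda>h1 h2. f (tens ?W ?W (cg (Eb s) (p a * S (p c) * h1)) (cg (Eb u) h2))))"
        unfolding z_def sW tW functional_swv[OF f] ..
      also have "\<dots> = T4 x (\<lambda>s a u c. sw H h (\<lambda>h1 h2. T s (\<lambda>m n. T u (\<lambda>i j.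
          nform4 f (Eb m) (E n * (p a * S (p c) * h1)) (Eb i) (E j * h2)))))"
        unfolding nform4_def
        by (rule T_cong, rule T_cong, rule T_cong, rule swH_cong, subst functional_cg_Eb[OF ft(1)], assumption,
            rule T_cong, rule functional_cg_Eb[OF ft(2)])
      also have "\<dots> = tform B H (theta (nform4 f)) (cg (Eb x) h)"
        by (rule tform_theta_cg[symmetric, OF _ _ _ _ x(1)]) (rule nform4_lf[OF f])+
      finally show ?thesis unfolding x(2) cg_eq_gen[OF B_in[OF x(1)]] .
    qed
    ultimately show ?thesis by blast
  qed
  from assms have "w \<in> fs.span {cosmash_gen H B coa c h | c h. c \<in> vcarrier B \<and> h \<in> vcarrier H}"
    by (simp add: Rspace_def)
  then have "w \<in> vcarrier Rspace \<and> (\<exists>z. ?P w z)"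
  proof (induction rule: fs.span_induct_alt)
    case base
    have "?P 0 0"
      by (simp add: vs_zero[OF is_vspace_tensor] lform_0[OF vRspace lin] lform_0[OF is_vspace_tensor functional_lform])
    then show ?case using vs_zero[OF vRspace] by blast
  next
    case (step k x y)
    then obtain z c h where z: "?P y z" and x: "x = cosmash_gen H B coa c h" "c \<in> vcarrier B" by blast
    obtain z' where z': "?P x z'" using gen[OF x(2)] x(1) by blast
    have xR: "x \<in> vcarrier Rspace" using cg_in[of c h] x cg_eq_gen by simp
    have kx: "fscale k x \<in> vcarrier Rspace" using vs_scale[OF vRspace xR, of k] by simp
    have "fscale k z' + z \<in> vcarrier (tensor Rspace Rspace)"
      using vs_add[OF is_vspace_tensor vs_scale[OF is_vspace_tensor], of z' Rspace Rspace z k] z z' by simp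
    moreover have "f (fscale k z' + z) = tform B H (theta (nform4 f)) (fscale k x + y)"
      if f: "functional (tensor ?W ?W) f" for f
    proof -
      have "f (fscale k z' + z) = k * f z' + f z" using f by (simp add: functional_def)
      moreover have "tform B H (theta (nform4 f)) (fscale k x + y) =
        k * tform B H (theta (nform4 f)) x + tform B H (theta (nform4 f)) y"
        using lin[OF f] kx xR step(2) by (simp add: lform_iff)
      ultimately show ?thesis using z z' f by simp
    qed
    ultimately have "?P (fscale k x + y) (fscale k z' + z)" by blast
    moreover have "fscale k x + y \<in> vcarrier Rspace" using vs_add[OF vRspace kx] step(2) by blast
    ultimately show ?case by blast
  qed
  then show ?thesis ..
qed

text \<open>The element chosen for the comultiplication is unique, because its values under all
  functionals are prescribed; these values are linear in the argument, and so is the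
  comultiplication.\<close>

definition R :: "('k, 'c \<times> 'h \<Rightarrow>\<^sub>0 'k) coalg" where
  "R = \<lparr>vcarrier = vcarrier Rspace, smult = fscale,
    comult = (\<lambda>r. SOME z. z \<in> vcarrier (tensor Rspace Rspace) \<and>
      (\<forall>f. functional (tensor (tensor B H) (tensor B H)) f \<longrightarrow> f z = tform B H (theta (nform4 f)) r)),
    counit = tform B H (\<lambda>c h. counit C c * e h)\<rparr>"

lemma R_simps [simp]: "vcarrier R = vcarrier Rspace" "smult R = fscale"
  "counit R = tform B H (\<lambda>c h. counit C c * e h)"
  by (simp_all add: R_def)

lemma lform_R: "lform R f \<longleftrightarrow> lform Rspace f"
  by (simp add: lform_iff)

lemma vR: "is_vspace R"
  using vRspace by (simp add: is_vspace_def)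

lemma tens_R: "tens R R = tens (tensor B H) (tensor B H)"
  by (rule tens_cong) simp_all

lemma tensor_R: "vcarrier (tensor R R) = vcarrier (tensor Rspace Rspace)"
  by (simp add: tensor_def tens_cong[of R Rspace R Rspace])

lemma functional_RR: "functional (tensor R R) f \<longleftrightarrow> functional (tensor (tensor B H) (tensor B H)) f"
  by (simp add: functional_def)

lemma comult_R:
  assumes "w \<in> vcarrier R"
  shows "comult R w \<in> vcarrier (tensor R R)"
    "functional (tensor R R) f \<Longrightarrow> f (comult R w) = tform B H (theta (nform4 f)) w"
  using someI_ex[OF comult_exists[of w]] assms by (auto simp: R_def tensor_R[unfolded R_def] functional_RR[unfolded R_def])

lemma preR: "precoalgebra R"
  unfolding precoalgebra_def
proof (intro conjI vR)
  show "lform R (counit R)" unfolding lform_R R_simps by (rule lform_tform_Rspace) (intro lf)+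
  show "linear_map R (tensor R R) (comult R)"
  proof (rule linear_mapI[OF vR is_vspace_tensor comult_R(1)])
    fix f assume f: "functional (tensor R R) f"
    have "lform R (tform B H (theta (nform4 f)))"
      unfolding lform_R by (rule lform_tform_Rspace[OF theta_lf]) (rule nform4_lf[OF f[unfolded functional_RR]])+
    then show "lform R (\<lambda>r. f (comult R r))"
      using lform_cong[OF vR, of "\<lambda>r. f (comult R r)"] comult_R(2)[OF _ f] by blast
  qed
qed

section \<open>The coalgebra axioms for the cosmash coproduct\<close>

lemma cg_in_R: "cg c h \<in> vcarrier R"
  by (simp add: cg_in)

lemma lf_cg_R [lf]:
  assumes "lform R f"
  shows "lform B (\<lambda>c. f (cg c h))" "lform H (\<lambda>h. f (cg c h))"
  using lf_cg assms lform_R by blast+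

lemma lf_swR [lf]: "lform R (\<lambda>x. sw R x F)"
  by (rule lform_sw[OF preR])

lemma lform_R_eqI:
  assumes "lform R f" "lform R g" "\<And>x h. x \<in> vcarrier D \<Longrightarrow> f (cg (Eb x) h) = g (cg (Eb x) h)" "w \<in> vcarrier R"
  shows "f w = g w"
  using lform_Rspace_eqI[of f g w] assms by (simp add: lform_R)

text \<open>The comultiplication formula with the coaction on the second leg of \<open>Eb x\<close>
  unfolded to \<open>p a * S (p c)\<close> and \<open>Eb u\<close>; all later computations in
  \<open>R\<close> start from this form.\<close>

lemma sw_R_cg:
  assumes F: "biform R R F" and x: "x \<in> vcarrier D"
  shows "sw R (cg (Eb x) h) F =
    T4 x (\<lambda>s a u c. sw H h (\<lambda>h1 h2. F (cg (Eb s) (p a * S (p c) * h1)) (cg (Eb u) h2)))"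
proof -
  obtain f where f: "functional (tensor R R) f"
    "\<And>a b. a \<in> vcarrier R \<Longrightarrow> b \<in> vcarrier R \<Longrightarrow> f (tens R R a b) = F a b"
    "\<And>t. t \<in> vcarrier (tensor R R) \<Longrightarrow> f t = tform R R F t"
    by (rule functional_tensE[OF vR vR F]) blast
  note f' = f(1)[unfolded functional_RR]
  note ft = functional_tens[OF f']
  have "sw R (cg (Eb x) h) F = f (comult R (cg (Eb x) h))"
    using sw_biform[OF preR F cg_in_R] f(3)[OF comult_R(1)[OF cg_in_R]] by simp
  also have "\<dots> = tform B H (theta (nform4 f)) (cg (Eb x) h)" by (rule comult_R(2)[OF cg_in_R f(1)])
  also have "\<dots> = T4 x (\<lambda>s a u c. sw H h (\<lambda>h1 h2. T s (\<lambda>m n. T u (\<lambda>i j.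
      nform4 f (Eb m) (E n * (p a * S (p c) * h1)) (Eb i) (E j * h2)))))"
    by (rule tform_theta_cg[OF _ _ _ _ x]) (rule nform4_lf[OF f'])+
  also have "\<dots> = T4 x (\<lambda>s a u c. sw H h (\<lambda>h1 h2. f (tens R R (cg (Eb s) (p a * S (p c) * h1)) (cg (Eb u) h2))))"
    unfolding nform4_def tens_R
    by (rule T_cong, rule T_cong, rule T_cong, rule swH_cong, subst functional_cg_Eb[OF ft(1)], assumption,
        rule T_cong, rule functional_cg_Eb[OF ft(2), symmetric])
  finally show ?thesis by (simp add: f(2) cg_in)
qed

text \<open>Coassociativity on generators, with the legs of \<open>h\<close> hidden in
  \<open>M\<close>. The difficulty is the coproduct of \<open>p a * S (p c)\<close> in
  \<open>H\<close>: \<open>PR5\<close> turns \<open>S (p j) * g\<close> into a \<open>q\<close>,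
  \<open>p_EbB\<close> removes it, and \<open>p_Eb_comult_S\<close> undoes the remaining coproduct
  of \<open>p c\<close>.\<close>

lemma cg_coassoc:
  assumes M: "\<And>k c2 l c3. lform B (\<lambda>c. M c k c2 l c3)" "\<And>c c2 l c3. lform H (\<lambda>k. M c k c2 l c3)"
    "\<And>c k l c3. lform B (\<lambda>c2. M c k c2 l c3)" "\<And>c k c2 c3. lform H (\<lambda>l. M c k c2 l c3)"
    "\<And>c k c2 l. lform B (M c k c2 l)"
  shows "T4 x (\<lambda>s a u c. T4 s (\<lambda>m i v j. sw H (p a * S (p c)) (\<lambda>y z. M (Eb m) (p i * S (p j) * y) (Eb v) z (Eb u)))) =
    T4 x (\<lambda>s a u c. T4 u (\<lambda>m i v j. M (Eb s) (p a * S (p c)) (Eb m) (p i * S (p j)) (Eb v)))"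
proof -
  have ex: "sw H (p a * S (p c)) (\<lambda>y z. M m (t * y) v z u) =
    sw H (p a) (\<lambda>g h. sw H (p c) (\<lambda>y z. M m (t * (g * S z)) v (h * S y) u))" for a c m t v u
  proof -
    have "sw H (p a * S (p c)) (\<lambda>y z. M m (t * y) v z u) =
      sw H (p a) (\<lambda>g h. sw H (S (p c)) (\<lambda>y z. M m (t * (g * y)) v (h * z) u))"
      by (rule comult_mult) (intro lf M)+
    also have "\<dots> = sw H (p a) (\<lambda>g h. sw H (p c) (\<lambda>y z. M m (t * (g * S z)) v (h * S y) u))"
      by (rule swH_cong, rule comult_S) (intro lf M)+
    finally show ?thesis .
  qed
  have "T4 x (\<lambda>s a u c. T4 s (\<lambda>m i v j. sw H (p a * S (p c)) (\<lambda>y z. M (Eb m) (p i * S (p j) * y) (Eb v) z (Eb u)))) =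
    T4 x (\<lambda>s a u c. T4 s (\<lambda>m i v j. sw H (p a) (\<lambda>g h. sw H (p c) (\<lambda>y z.
      M (Eb m) (p i * S (p j) * (g * S z)) (Eb v) (h * S y) (Eb u)))))"
    by (simp only: ex)
  also have "\<dots> = T x (\<lambda>s w. T4 s (\<lambda>m i v j. T w (\<lambda>a w'. T w' (\<lambda>u c. sw H (p a) (\<lambda>g h. sw H (p c) (\<lambda>y z.
      M (Eb m) (p i * S (p j) * (g * S z)) (Eb v) (h * S y) (Eb u)))))))"
  proof (rule T_cong)
    fix s w
    show "T3 w (\<lambda>a u c. T4 s (\<lambda>m i v j. sw H (p a) (\<lambda>g h. sw H (p c) (\<lambda>y z.
        M (Eb m) (p i * S (p j) * (g * S z)) (Eb v) (h * S y) (Eb u))))) =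
      T4 s (\<lambda>m i v j. T w (\<lambda>a w'. T w' (\<lambda>u c. sw H (p a) (\<lambda>g h. sw H (p c) (\<lambda>y z.
        M (Eb m) (p i * S (p j) * (g * S z)) (Eb v) (h * S y) (Eb u))))))"
      by (rule trans, rule T_cong, rule sw_swap4, rule sw_swap4)
  qed
  also have "\<dots> = T3 x (\<lambda>m i w. T w (\<lambda>v w'. T w' (\<lambda>n w3. T n (\<lambda>j a. T w3 (\<lambda>u c. sw H (p a) (\<lambda>g h. sw H (p c) (\<lambda>y z.
      M (Eb m) (p i * (S (p j) * g) * S z) (Eb v) (h * S y) (Eb u))))))))"
    by (simp add: coassocD mult.assoc)
  also have "\<dots> = T3 x (\<lambda>m i w. T w (\<lambda>v w'. T w' (\<lambda>n w3. T n (\<lambda>j a. sw H (p a) (\<lambda>g h. T w3 (\<lambda>u c. sw H (p c) (\<lambda>y z.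
      M (Eb m) (p i * (S (p j) * g) * S z) (Eb v) (h * S y) (Eb u))))))))"
    by (rule T_cong, rule T_cong, rule T_cong, rule T_cong, rule T_cong, rule sw_swap)
  also have "\<dots> = T3 x (\<lambda>m i w. T w (\<lambda>v w'. T w' (\<lambda>n w3. T n (\<lambda>y a. T w3 (\<lambda>u c. sw H (p c) (\<lambda>y' z.
      M (Eb m) (p i * q y * S z) (Eb v) (p a * S y') (Eb u)))))))"
    by (rule T_cong, rule T_cong, rule T_cong, rule T_cong, rule PR5) (intro lf M)+
  also have "\<dots> = T x (\<lambda>m w. T w (\<lambda>r w'. T3 r (\<lambda>i v y. T w' (\<lambda>a w3. T w3 (\<lambda>u c. sw H (p c) (\<lambda>y' z.
      M (Eb m) (p i * q y * S z) (Eb v) (p a * S y') (Eb u)))))))"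
    by (simp add: coassocD)
  also have "\<dots> = T x (\<lambda>m w. T w (\<lambda>r w'. T r (\<lambda>i v. T w' (\<lambda>a w3. T w3 (\<lambda>u c. sw H (p c) (\<lambda>y' z.
      M (Eb m) (p i * S z) (Eb v) (p a * S y') (Eb u)))))))"
    by (rule T_cong, rule T_cong, rule p_EbB) (intro lf M)+
  also have "\<dots> = T x (\<lambda>m w. T w (\<lambda>r w'. T r (\<lambda>i v. T4 w' (\<lambda>a u k c.
      M (Eb m) (p i * S (p c)) (Eb v) (p a * S (p k)) (Eb u)))))"
    by (rule T_cong, rule T_cong, rule T_cong, rule p_Eb_comult_S) (intro lf M)+
  also have "\<dots> = T4 x (\<lambda>s a u c. T4 u (\<lambda>m i v j. M (Eb s) (p a * S (p c)) (Eb m) (p i * S (p j)) (Eb v)))"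
    by (simp add: coassocD)
  finally show ?thesis .
qed

text \<open>Idempotency of \<open>E\<close> for the convolution product: unfolding the second factor
  leaves \<open>E n * p i\<close>, where \<open>E_p\<close> absorbs \<open>E n\<close>.\<close>

lemma E_E:
  assumes f: "lform H f"
  shows "T x (\<lambda>n t. f (E n * E t)) = f (E x)"
proof -
  have "T x (\<lambda>n t. f (E n * E t)) = T x (\<lambda>n t. T t (\<lambda>i j. f (E n * (p i * S (p j)))))"
    by (rule T_cong, rule E) (intro lf f)
  also have "\<dots> = T x (\<lambda>r j. T r (\<lambda>n i. f (E n * p i * S (p j))))"
    by (simp add: coassocD mult.assoc)
  also have "\<dots> = T x (\<lambda>i j. f (p i * S (p j)))"
    by (rule T_cong, rule E_p, assumption) (intro lf f)
  also have "\<dots> = f (E x)" by (rule E[OF f, symmetric])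
  finally show ?thesis .
qed

lemma counit_R_cg: "x \<in> vcarrier D \<Longrightarrow> counit R (cg (Eb x) h) = counit D x * e h"
proof -
  assume x: "x \<in> vcarrier D"
  have "counit R (cg (Eb x) h) = T x (\<lambda>s t. counit C (Eb s) * e (E t * h))"
    unfolding R_simps by (rule tform_cg[OF _ _ x]) (intro lf)+
  also have "\<dots> = T x (\<lambda>s t. counit D s * counit D t * e h)"
    by (rule T_cong) (simp add: counit_Eb counit_E)
  also have "\<dots> = counit D x * e h"
    by (simp add: sw_mult_const T_counit(1)[OF precoalgebraD(3)[OF preD] x])
  finally show ?thesis .
qed

text \<open>A generator already carries a factor \<open>E\<close>, so by \<open>E_E\<close> one more
  changes nothing. The right counit law ends in exactly this expression.\<close>

lemma cg_expand:
  assumes f: "lform R f" and x: "x \<in> vcarrier D"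
  shows "T x (\<lambda>s t. f (cg (Eb s) (E t * h))) = f (cg (Eb x) h)"
proof -
  obtain g where g: "functional R g" "\<And>r. r \<in> vcarrier R \<Longrightarrow> g r = f r"
    by (rule functional_extend[OF vR f]) blast
  have g': "functional (tensor B H) g" using g(1) by (simp add: functional_def)
  note l = functional_tens_lform[OF g']
  have "T x (\<lambda>s t. g (cg (Eb s) (E t * h))) = T x (\<lambda>s t. T s (\<lambda>m n. g (tens B H (Eb m) (E n * (E t * h)))))"
    by (rule T_cong) (simp add: functional_cg_Eb[OF g'])
  also have "\<dots> = T x (\<lambda>m w. T w (\<lambda>n t. g (tens B H (Eb m) (E n * E t * h))))"
    by (simp add: coassocD mult.assoc)
  also have "\<dots> = T x (\<lambda>m w. g (tens B H (Eb m) (E w * h)))"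
    by (rule T_cong, rule E_E) (intro lf l)
  also have "\<dots> = g (cg (Eb x) h)" by (rule functional_cg_Eb[OF g' x, symmetric])
  finally show ?thesis using g(2)[OF cg_in_R] by simp
qed

lemma coact_T_counit:
  assumes "lform H f"
  shows "T3 t (\<lambda>a u c. counit D u * f (p a * S (p c))) = f (E t)"
proof -
  have "T3 t (\<lambda>a u c. counit D u * f (p a * S (p c))) = T t (\<lambda>a c. f (p a * S (p c)))"
    by (rule T_cong, rule T_counit(1)) (intro lf assms)
  then show ?thesis by (simp add: E[OF assms])
qed

lemma coact_T_counit':
  assumes "lform D f" "t \<in> vcarrier D"
  shows "T3 t (\<lambda>a u c. e (p a) * e (p c) * f u) = f t"
proof -
  have "T3 t (\<lambda>a u c. e (p a) * e (p c) * f u) = T3 t (\<lambda>a u c. counit D c * (counit D a * f u))"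
    by (rule T_cong, rule T_cong) (simp add: counit_p)
  also have "\<dots> = T t (\<lambda>a u. counit D a * f u)"
    by (rule T_cong, rule T_counit(2)) (intro lf assms)
  also have "\<dots> = f t" by (rule T_counit(1)[OF assms])
  finally show ?thesis .
qed

lemma coR: "coalgebra R"
proof (rule coalgebraI[OF preR])
  fix F r assume F: "triform R R R F" and r: "r \<in> vcarrier R"
  note Fl = triformD[OF F]
  show "sw R r (\<lambda>v w. sw R v (\<lambda>a b. F a b w)) = sw R r (\<lambda>a w. sw R w (\<lambda>b v. F a b v))"
  proof (rule lform_R_eqI[OF _ _ _ r])
    show "lform R (\<lambda>r. sw R r (\<lambda>v w. sw R v (\<lambda>a b. F a b w)))"
      "lform R (\<lambda>r. sw R r (\<lambda>a w. sw R w (\<lambda>b v. F a b v)))" by (intro lf)+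
    fix x h assume x: "x \<in> vcarrier D"
    define P where "P c1 k c2 l c3 m = F (cg c1 k) (cg c2 l) (cg c3 m)" for c1 k c2 l c3 m
    have P: "lform B (\<lambda>c. P c k c2 l c3 m)" "lform H (\<lambda>k. P c k c2 l c3 m)"
      "lform B (\<lambda>c2. P c k c2 l c3 m)" "lform H (\<lambda>l. P c k c2 l c3 m)"
      "lform B (\<lambda>c3. P c k c2 l c3 m)" "lform H (P c k c2 l c3)" for c k c2 l c3 m
      unfolding P_def by (rule lf_cg_R Fl(1)[OF cg_in_R cg_in_R] Fl(2)[OF cg_in_R cg_in_R] Fl(3)[OF cg_in_R cg_in_R])+
    \<comment> \<open>\<open>M\<close> gathers the three legs of \<open>h\<close>, so that the
      remaining identity concerns the legs of \<open>x\<close> alone and is the one of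
      \<open>cg_coassoc\<close>.\<close>
    define M where "M c1 k c2 l c3 = sw H h (\<lambda>h1 h2. sw H h1 (\<lambda>k1 k2. P c1 (k * k1) c2 (l * k2) c3 h2))"
      for c1 k c2 l c3
    have M: "lform B (\<lambda>c. M c k c2 l c3)" "lform H (\<lambda>k. M c k c2 l c3)"
      "lform B (\<lambda>c2. M c k c2 l c3)" "lform H (\<lambda>l. M c k c2 l c3)"
      "lform B (M c k c2 l)" for c k c2 l c3
      unfolding M_def by (intro lf P)+
    have "sw R (cg (Eb x) h) (\<lambda>v w. sw R v (\<lambda>a b. F a b w)) =
      T4 x (\<lambda>s a u c. sw H h (\<lambda>h1 h2. sw R (cg (Eb s) (p a * S (p c) * h1)) (\<lambda>\<alpha> \<beta>. F \<alpha> \<beta> (cg (Eb u) h2))))"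
      by (rule sw_R_cg[OF biform_sw_left[OF preR] x]) (rule Fl(3))
    also have "\<dots> = T4 x (\<lambda>s a u c. sw H h (\<lambda>h1 h2. T4 s (\<lambda>m i v j. sw H (p a * S (p c) * h1) (\<lambda>k1 k2.
        P (Eb m) (p i * S (p j) * k1) (Eb v) k2 (Eb u) h2))))"
      unfolding P_def
      by (rule T_cong, rule T_cong, rule T_cong, rule swH_cong, rule sw_R_cg)
        (auto simp: biform_iff Fl(1) Fl(2) cg_in)
    also have "\<dots> = T4 x (\<lambda>s a u c. T4 s (\<lambda>m i v j. sw H h (\<lambda>h1 h2. sw H (p a * S (p c) * h1) (\<lambda>k1 k2.
        P (Eb m) (p i * S (p j) * k1) (Eb v) k2 (Eb u) h2))))"
      by (rule T_cong, rule T_cong, rule T_cong, rule sw_swap4)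
    also have "\<dots> = T4 x (\<lambda>s a u c. T4 s (\<lambda>m i v j. sw H h (\<lambda>h1 h2. sw H (p a * S (p c)) (\<lambda>y z. sw H h1 (\<lambda>k1 k2.
        P (Eb m) (p i * S (p j) * (y * k1)) (Eb v) (z * k2) (Eb u) h2)))))"
      by (rule T_cong, rule T_cong, rule T_cong, rule T_cong, rule T_cong, rule T_cong, rule swH_cong, rule comult_mult)
        (intro lf P)+
    also have "\<dots> = T4 x (\<lambda>s a u c. T4 s (\<lambda>m i v j. sw H (p a * S (p c)) (\<lambda>y z. sw H h (\<lambda>h1 h2. sw H h1 (\<lambda>k1 k2.
        P (Eb m) (p i * S (p j) * (y * k1)) (Eb v) (z * k2) (Eb u) h2)))))"
      by (rule T_cong, rule T_cong, rule T_cong, rule T_cong, rule T_cong, rule T_cong, rule sw_swap)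
    also have "\<dots> = T4 x (\<lambda>s a u c. T4 s (\<lambda>m i v j. sw H (p a * S (p c)) (\<lambda>y z.
        M (Eb m) (p i * S (p j) * y) (Eb v) z (Eb u))))"
      by (simp add: M_def mult.assoc)
    also have "\<dots> = T4 x (\<lambda>s a u c. T4 u (\<lambda>m i v j. M (Eb s) (p a * S (p c)) (Eb m) (p i * S (p j)) (Eb v)))"
      by (rule cg_coassoc) (rule M)+
    also have "\<dots> = T4 x (\<lambda>s a u c. T4 u (\<lambda>m i v j. sw H h (\<lambda>h1 h2. sw H h2 (\<lambda>k1 k2.
        P (Eb s) (p a * S (p c) * h1) (Eb m) (p i * S (p j) * k1) (Eb v) k2))))"
      by (simp add: M_def coassocH)
    also have "\<dots> = T4 x (\<lambda>s a u c. sw H h (\<lambda>h1 h2. T4 u (\<lambda>m i v j. sw H h2 (\<lambda>k1 k2.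
        P (Eb s) (p a * S (p c) * h1) (Eb m) (p i * S (p j) * k1) (Eb v) k2))))"
      by (rule T_cong, rule T_cong, rule T_cong, rule sw_swap4[symmetric])
    also have "\<dots> = T4 x (\<lambda>s a u c. sw H h (\<lambda>h1 h2. sw R (cg (Eb u) h2) (\<lambda>\<beta> \<gamma>. F (cg (Eb s) (p a * S (p c) * h1)) \<beta> \<gamma>)))"
      unfolding P_def
      by (rule T_cong, rule T_cong, rule T_cong, rule swH_cong, rule sw_R_cg[symmetric])
        (auto simp: Fl(4) cg_in)
    also have "\<dots> = sw R (cg (Eb x) h) (\<lambda>a w. sw R w (\<lambda>b v. F a b v))"
      by (rule sw_R_cg[OF biform_sw_right[OF preR] x, symmetric]) (rule Fl(1))
    finally show "sw R (cg (Eb x) h) (\<lambda>v w. sw R v (\<lambda>a b. F a b w)) =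
      sw R (cg (Eb x) h) (\<lambda>a w. sw R w (\<lambda>b v. F a b v))" .
  qed
next
  fix f r assume f: "lform R f" and r: "r \<in> vcarrier R"
  have cl: "lform R (counit R)" by (rule precoalgebraD(3)[OF preR])
  have bf: "biform R R (\<lambda>a b. counit R a * f b)" "biform R R (\<lambda>a b. counit R b * f a)"
    using f cl by (auto simp: biform_iff intro!: lform_mult_const lform_const_mult)
  show "sw R r (\<lambda>a b. counit R a * f b) = f r"
  proof (rule lform_R_eqI[OF lf_swR f _ r])
    fix x h assume x: "x \<in> vcarrier D"
    have "sw R (cg (Eb x) h) (\<lambda>a b. counit R a * f b) =
      T4 x (\<lambda>s a u c. sw H h (\<lambda>h1 h2. counit R (cg (Eb s) (p a * S (p c) * h1)) * f (cg (Eb u) h2)))"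
      by (rule sw_R_cg[OF bf(1) x])
    also have "\<dots> = T4 x (\<lambda>s a u c. sw H h (\<lambda>h1 h2. counit D s * (e (p a) * e (p c) * (e h1 * f (cg (Eb u) h2)))))"
      by (rule T_cong, rule T_cong, rule T_cong, rule swH_cong)
        (simp only: counit_R_cg counit_mult counit_S mult.assoc)
    also have "\<dots> = T x (\<lambda>s w. counit D s * T3 w (\<lambda>a u c. e (p a) * e (p c) * sw H h (\<lambda>h1 h2. e h1 * f (cg (Eb u) h2))))"
      by (simp only: sw_const_mult)
    also have "\<dots> = T x (\<lambda>s w. counit D s * T3 w (\<lambda>a u c. e (p a) * e (p c) * f (cg (Eb u) h)))"
      by (subst swH_counit(1), (intro lf f)+) (rule refl)
    also have "\<dots> = T x (\<lambda>s w. counit D s * f (cg (Eb w) h))"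
      by (rule T_cong, subst coact_T_counit', (intro lf f)+, assumption) (rule refl)
    also have "\<dots> = f (cg (Eb x) h)" by (rule T_counit(1)[OF _ x]) (intro lf f)
    finally show "sw R (cg (Eb x) h) (\<lambda>a b. counit R a * f b) = f (cg (Eb x) h)" .
  qed
  show "sw R r (\<lambda>a b. counit R b * f a) = f r"
  proof (rule lform_R_eqI[OF lf_swR f _ r])
    fix x h assume x: "x \<in> vcarrier D"
    have "sw R (cg (Eb x) h) (\<lambda>a b. counit R b * f a) =
      T4 x (\<lambda>s a u c. sw H h (\<lambda>h1 h2. counit R (cg (Eb u) h2) * f (cg (Eb s) (p a * S (p c) * h1))))"
      by (rule sw_R_cg[OF bf(2) x])
    also have "\<dots> = T4 x (\<lambda>s a u c. sw H h (\<lambda>h1 h2. counit D u * (e h2 * f (cg (Eb s) (p a * S (p c) * h1)))))"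
      by (rule T_cong, rule T_cong, rule T_cong, rule swH_cong) (simp only: counit_R_cg mult.assoc)
    also have "\<dots> = T4 x (\<lambda>s a u c. counit D u * sw H h (\<lambda>h1 h2. e h2 * f (cg (Eb s) (p a * S (p c) * h1))))"
      by (simp only: sw_const_mult)
    also have "\<dots> = T4 x (\<lambda>s a u c. counit D u * f (cg (Eb s) (p a * S (p c) * h)))"
      by (subst swH_counit(2), (intro lf f)+) (rule refl)
    also have "\<dots> = T x (\<lambda>s t. f (cg (Eb s) (E t * h)))"
      by (rule T_cong, rule coact_T_counit) (intro lf f)
    also have "\<dots> = f (cg (Eb x) h)" by (rule cg_expand[OF f x])
    finally show "sw R (cg (Eb x) h) (\<lambda>a b. counit R b * f a) = f (cg (Eb x) h)" .
  qed
qed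

lemma is_cosmash: "is_partial_cosmash_coproduct H B coa R"
  unfolding is_partial_cosmash_coproduct_def
proof (intro conjI ballI coR)
  show "smult R = smult (tensor B H)" by simp
  show "vcarrier R = module.span (smult (tensor B H)) {cosmash_gen H B coa c h | c h. c \<in> vcarrier B \<and> h \<in> vcarrier H}"
    by (simp add: Rspace_def)
  fix c h assume c: "c \<in> vcarrier B" and h: "h \<in> vcarrier H"
  then obtain x where x: "x \<in> vcarrier D" "c = Eb x" by auto
  show "counit R (cosmash_gen H B coa c h) = counit B c * counit H h"
    using counit_R_cg[OF x(1), of h] cg_eq_gen[OF c, of h] counit_Eb[OF x(1)] x(2) by simp
  show "comult R (cosmash_gen H B coa c h) =
          sweedler B (tensor R R) c (\<lambda>c1 c2.
            coact H B coa (tensor R R) c2 (\<lambda>g d.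
              sweedler H (tensor R R) h (\<lambda>h1 h2.
                tens R R (cosmash_gen H B coa c1 (g * h1)) (cosmash_gen H B coa d h2))))" (is "_ = ?Z")
  proof (rule functional_eqI[of "tensor R R"])
    fix f assume f: "functional (tensor R R) f"
    define F where "F a b = f (tens R R a b)" for a b
    have F: "lform R (\<lambda>a. F a b)" "lform R (F a)" for a b
      unfolding F_def by (rule functional_tens_lform[OF f])+
    have bf: "biform R R F" using F by (simp add: biform_iff)
    have "f ?Z = sw B c (\<lambda>c1 c2. ct c2 (\<lambda>g d. sw H h (\<lambda>h1 h2. F (cg c1 (g * h1)) (cg d h2))))"
      by (rule functional_sweedler_B[OF f _ _ c], (intro lf F)+,
          rule functional_coact[OF f], (intro lf F)+, rule functional_sweedler_H[OF f], (intro lf F)+)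
        (simp add: F_def cg_eq_gen)
    also have "\<dots> = T x (\<lambda>s t. ct (Eb t) (\<lambda>g d. sw H h (\<lambda>h1 h2. F (cg (Eb s) (g * h1)) (cg d h2))))"
      unfolding x(2) by (rule swB_Eb[OF x(1)]) (intro lf F)+
    also have "\<dots> = T x (\<lambda>s t. T3 t (\<lambda>a u c. sw H h (\<lambda>h1 h2. F (cg (Eb s) (p a * S (p c) * h1)) (cg (Eb u) h2))))"
      by (rule T_cong, rule ct_Eb, assumption) (intro lf F)+
    also have "\<dots> = sw R (cg c h) F" unfolding x(2) by (rule sw_R_cg[OF bf x(1), symmetric])
    also have "\<dots> = f (comult R (cg c h))"
      unfolding F_def by (rule sw_comult_functional[OF preR f cg_in_R, symmetric])
    finally show "f (comult R (cosmash_gen H B coa c h)) = f ?Z" by (simp add: cg_eq_gen[OF c])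
  qed (simp add: vector_space_fscale)
qed

end

section \<open>The isomorphism\<close>

text \<open>Both sides of the axioms are linear in the point, so the pointwise form passes to sums of subcoalgebras.\<close>

definition pc_at :: "('k::field, 'h::ring_1) hopf \<Rightarrow> ('k, 'd::ab_group_add) coalg \<Rightarrow> ('d \<Rightarrow> 'h) \<Rightarrow> 'd \<Rightarrow> bool" where
  "pc_at H D \<omega> x \<longleftrightarrow> counit H (\<omega> x) = counit D x \<and> (\<forall>G. biform H H G \<longrightarrow>
    sw D x (\<lambda>a b. sw H (\<omega> a) (\<lambda>g h. G g (h * antipode H (\<omega> b)))) =
      sw D x (\<lambda>a w. sw D w (\<lambda>b c. G (\<omega> a) (\<omega> b * antipode H (\<omega> c)))) \<and>
    sw D x (\<lambda>a b. sw H (\<omega> b) (\<lambda>g h. G (\<omega> a * antipode H g) h)) =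
      sw D x (\<lambda>a w. sw D w (\<lambda>b c. G (\<omega> a * antipode H (\<omega> b)) (\<omega> c))))"

context hopf_alg
begin

lemma pc_biforms:
  assumes D: "precoalgebra D" and \<omega>: "linear_map D H \<omega>" and G: "biform H H G"
  shows "biform D D (\<lambda>a b. sw H (\<omega> a) (\<lambda>g h. G g (h * S (\<omega> b))))"
    "biform D D (\<lambda>a w. sw D w (\<lambda>b c. G (\<omega> a) (\<omega> b * S (\<omega> c))))"
    "biform D D (\<lambda>b c. G y (\<omega> b * S (\<omega> c)))"
    "biform D D (\<lambda>a b. sw H (\<omega> b) (\<lambda>g h. G (\<omega> a * S g) h))"
    "biform D D (\<lambda>a w. sw D w (\<lambda>b c. G (\<omega> a * S (\<omega> b)) (\<omega> c)))"
    "biform D D (\<lambda>b c. G (y * S (\<omega> b)) (\<omega> c))"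
    "biform H H (\<lambda>g h. G g (h * y))" "biform H H (\<lambda>g h. G (y * S g) h)"
proof -
  have l\<omega>: "lform H f \<Longrightarrow> lform D (\<lambda>x. f (\<omega> x))" for f by (rule lform_comp[OF \<omega>])
  have lD: "lform D (\<lambda>x. sw D x F)" for F by (rule lform_sw[OF D])
  have lDa: "(\<And>a b. lform D (\<lambda>y. F y a b)) \<Longrightarrow> lform D (\<lambda>y. sw D x (F y))"
    for F x by (rule lform_sw_arg[OF D])
  have G': "lform H (\<lambda>a. G a b)" "lform H (G a)" for a b using G by (simp_all add: biform_H)
  show "biform D D (\<lambda>a b. sw H (\<omega> a) (\<lambda>g h. G g (h * S (\<omega> b))))"
    "biform D D (\<lambda>a w. sw D w (\<lambda>b c. G (\<omega> a) (\<omega> b * S (\<omega> c))))"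
    "biform D D (\<lambda>b c. G y (\<omega> b * S (\<omega> c)))"
    "biform D D (\<lambda>a b. sw H (\<omega> b) (\<lambda>g h. G (\<omega> a * S g) h))"
    "biform D D (\<lambda>a w. sw D w (\<lambda>b c. G (\<omega> a * S (\<omega> b)) (\<omega> c)))"
    "biform D D (\<lambda>b c. G (y * S (\<omega> b)) (\<omega> c))"
    "biform H H (\<lambda>g h. G g (h * y))" "biform H H (\<lambda>g h. G (y * S g) h)"
    unfolding biform_iff by (intro conjI ballI lD lDa l\<omega> lf G')+
qed

text \<open>The equations in H \<otimes> H are replaced by their values under bilinear forms, and
  the quantifier over points is isolated. In this shape the axioms can be moved between a coalgebra,
  its subcoalgebras and its images.\<close>

lemma partial_corepresentation_iff:
  assumes D: "precoalgebra D" and \<omega>: "linear_map D H \<omega>"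
  shows "partial_corepresentation H D \<omega> \<longleftrightarrow> (\<forall>x\<in>vcarrier D. pc_at H D \<omega> x)"
proof -
  let ?U = "tensor H H"
  have ev: "f (sweedler D ?U x (\<lambda>c1 c2. sweedler H ?U (\<omega> c1) (\<lambda>g1 g2. tens H H g1 (g2 * S (\<omega> c2))))) =
      sw D x (\<lambda>a b. sw H (\<omega> a) (\<lambda>g h. f (tens H H g (h * S (\<omega> b)))))"
    "f (sweedler3 D ?U x (\<lambda>c1 c2 c3. tens H H (\<omega> c1) (\<omega> c2 * S (\<omega> c3)))) =
      sw D x (\<lambda>a w. sw D w (\<lambda>b c. f (tens H H (\<omega> a) (\<omega> b * S (\<omega> c)))))"
    "f (sweedler D ?U x (\<lambda>c1 c2. sweedler H ?U (\<omega> c2) (\<lambda>g1 g2. tens H H (\<omega> c1 * S g1) g2))) =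
      sw D x (\<lambda>a b. sw H (\<omega> b) (\<lambda>g h. f (tens H H (\<omega> a * S g) h)))"
    "f (sweedler3 D ?U x (\<lambda>c1 c2 c3. tens H H (\<omega> c1 * S (\<omega> c2)) (\<omega> c3))) =
      sw D x (\<lambda>a w. sw D w (\<lambda>b c. f (tens H H (\<omega> a * S (\<omega> b)) (\<omega> c))))"
    if f: "functional ?U f" and x: "x \<in> vcarrier D" for f x
  proof -
    note l = pc_biforms[OF D \<omega> biform_functional_tens[OF f]]
    show "f (sweedler D ?U x (\<lambda>c1 c2. sweedler H ?U (\<omega> c1) (\<lambda>g1 g2. tens H H g1 (g2 * S (\<omega> c2))))) =
      sw D x (\<lambda>a b. sw H (\<omega> a) (\<lambda>g h. f (tens H H g (h * S (\<omega> b)))))"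
      by (intro functional_sweedler[OF D x f l(1)] functional_sweedler[OF preH _ f l(7)]) simp_all
    show "f (sweedler D ?U x (\<lambda>c1 c2. sweedler H ?U (\<omega> c2) (\<lambda>g1 g2. tens H H (\<omega> c1 * S g1) g2))) =
      sw D x (\<lambda>a b. sw H (\<omega> b) (\<lambda>g h. f (tens H H (\<omega> a * S g) h)))"
      by (intro functional_sweedler[OF D x f l(4)] functional_sweedler[OF preH _ f l(8)]) simp_all
    show "f (sweedler3 D ?U x (\<lambda>c1 c2 c3. tens H H (\<omega> c1) (\<omega> c2 * S (\<omega> c3)))) =
      sw D x (\<lambda>a w. sw D w (\<lambda>b c. f (tens H H (\<omega> a) (\<omega> b * S (\<omega> c)))))"
      unfolding sweedler3_def
      by (intro functional_sweedler[OF D x f l(2)] functional_sweedler[OF D _ f l(3)]) simp_all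
    show "f (sweedler3 D ?U x (\<lambda>c1 c2 c3. tens H H (\<omega> c1 * S (\<omega> c2)) (\<omega> c3))) =
      sw D x (\<lambda>a w. sw D w (\<lambda>b c. f (tens H H (\<omega> a * S (\<omega> b)) (\<omega> c))))"
      unfolding sweedler3_def
      by (intro functional_sweedler[OF D x f l(5)] functional_sweedler[OF D _ f l(6)]) simp_all
  qed
  show ?thesis
  proof
    assume pc: "partial_corepresentation H D \<omega>"
    show "\<forall>x\<in>vcarrier D. pc_at H D \<omega> x"
      unfolding pc_at_def
    proof (intro ballI conjI allI impI)
      fix x assume x: "x \<in> vcarrier D"
      show "e (\<omega> x) = counit D x" using pc x by (simp add: partial_corepresentation_def)
      fix G assume G: "biform H H G"
      obtain f where f: "functional ?U f"
        "\<And>a b. a \<in> vcarrier H \<Longrightarrow> b \<in> vcarrier H \<Longrightarrow> f (tens H H a b) = G a b"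
        by (rule functional_tensE[OF vH vH G]) blast
      have fG: "f (tens H H a b) = G a b" for a b using f(2) by simp
      have "sweedler D ?U x (\<lambda>c1 c2. sweedler H ?U (\<omega> c1) (\<lambda>g1 g2. tens H H g1 (g2 * S (\<omega> c2)))) =
        sweedler3 D ?U x (\<lambda>c1 c2 c3. tens H H (\<omega> c1) (\<omega> c2 * S (\<omega> c3)))"
        "sweedler D ?U x (\<lambda>c1 c2. sweedler H ?U (\<omega> c2) (\<lambda>g1 g2. tens H H (\<omega> c1 * S g1) g2)) =
        sweedler3 D ?U x (\<lambda>c1 c2 c3. tens H H (\<omega> c1 * S (\<omega> c2)) (\<omega> c3))"
        using pc x by (simp_all add: partial_corepresentation_def)
      from arg_cong[OF this(1), of f] arg_cong[OF this(2), of f]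
      show "sw D x (\<lambda>a b. sw H (\<omega> a) (\<lambda>g h. G g (h * S (\<omega> b)))) =
          sw D x (\<lambda>a w. sw D w (\<lambda>b c. G (\<omega> a) (\<omega> b * S (\<omega> c))))"
        "sw D x (\<lambda>a b. sw H (\<omega> b) (\<lambda>g h. G (\<omega> a * S g) h)) =
          sw D x (\<lambda>a w. sw D w (\<lambda>b c. G (\<omega> a * S (\<omega> b)) (\<omega> c)))"
        unfolding ev[OF f(1) x] fG .
    qed
  next
    assume pc: "\<forall>x\<in>vcarrier D. pc_at H D \<omega> x"
    show "partial_corepresentation H D \<omega>"
      unfolding partial_corepresentation_def
    proof (intro conjI ballI \<omega>)
      fix x assume x: "x \<in> vcarrier D"
      note pcx = pc[rule_format, OF x, unfolded pc_at_def]
      show "e (\<omega> x) = counit D x" using pcx by blast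
      show "sweedler D ?U x (\<lambda>c1 c2. sweedler H ?U (\<omega> c1) (\<lambda>g1 g2. tens H H g1 (g2 * S (\<omega> c2)))) =
        sweedler3 D ?U x (\<lambda>c1 c2 c3. tens H H (\<omega> c1) (\<omega> c2 * S (\<omega> c3)))"
      proof (rule functional_eqI[of ?U])
        fix f assume f: "functional ?U f"
        show "f (sweedler D ?U x (\<lambda>c1 c2. sweedler H ?U (\<omega> c1) (\<lambda>g1 g2. tens H H g1 (g2 * S (\<omega> c2))))) =
          f (sweedler3 D ?U x (\<lambda>c1 c2 c3. tens H H (\<omega> c1) (\<omega> c2 * S (\<omega> c3))))"
          unfolding ev[OF f x] using pcx biform_functional_tens[OF f] by blast
      qed (simp add: vector_space_fscale)
      show "sweedler D ?U x (\<lambda>c1 c2. sweedler H ?U (\<omega> c2) (\<lambda>g1 g2. tens H H (\<omega> c1 * S g1) g2)) =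
        sweedler3 D ?U x (\<lambda>c1 c2 c3. tens H H (\<omega> c1 * S (\<omega> c2)) (\<omega> c3))"
      proof (rule functional_eqI[of ?U])
        fix f assume f: "functional ?U f"
        show "f (sweedler D ?U x (\<lambda>c1 c2. sweedler H ?U (\<omega> c2) (\<lambda>g1 g2. tens H H (\<omega> c1 * S g1) g2))) =
          f (sweedler3 D ?U x (\<lambda>c1 c2 c3. tens H H (\<omega> c1 * S (\<omega> c2)) (\<omega> c3)))"
          unfolding ev[OF f x] using pcx biform_functional_tens[OF f] by blast
      qed (simp add: vector_space_fscale)
    qed
  qed
qed

end

text \<open>What is used of H^par: partial corepresentations on test coalgebras in the type of the
  cosmash coproduct lift to it, and an endomorphism over \<open>p\<close> is the identity.
  Cofreeness for the same type makes coalgebra maps from the cosmash coproduct into \<open>C\<close>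
  unique over \<open>r\<close>.\<close>

locale universal_pcorep = base_coalg H D p C r Eb
  for H :: "('k::field, 'h::ring_1) hopf" and D :: "('k, 'd::ab_group_add) coalg" and p
    and C :: "('k, 'c::ab_group_add) coalg" and r Eb +
  assumes univ_ex: "\<And>(Q :: ('k, 'c \<times> 'h \<Rightarrow>\<^sub>0 'k) coalg) \<omega>. coalgebra Q \<Longrightarrow> partial_corepresentation H Q \<omega> \<Longrightarrow>
      \<exists>F. coalgebra_map Q D F \<and> (\<forall>y\<in>vcarrier Q. p (F y) = \<omega> y)"
    and univ_id: "\<And>F x. coalgebra_map D D F \<Longrightarrow> (\<And>x. x \<in> vcarrier D \<Longrightarrow> p (F x) = p x) \<Longrightarrow>
      x \<in> vcarrier D \<Longrightarrow> F x = x"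
    and cofree_R: "cofree_coalgebra TYPE('c \<times> 'h \<Rightarrow>\<^sub>0 'k) H C r"
begin

text \<open>On pure tensors this is c \<otimes> h \<mapsto> \<epsilon>(c) h. On a generator the
  counit removes the first leg of \<open>Eb x\<close> and leaves \<open>E x * h\<close>, that is
  \<open>r (Eb x) * h\<close>.\<close>

definition psi where "psi w = tlift B H H (\<lambda>c h. smult H (counit C c) h) w"

lemma R_sub: "w \<in> vcarrier R \<Longrightarrow> w \<in> vcarrier (tensor B H)"
  using Rspace_sub by auto

lemma psi:
  assumes f: "lform H f" and w: "w \<in> vcarrier R"
  shows "f (psi w) = tform B H (\<lambda>c h. counit C c * f h) w"
  unfolding psi_def
  by (rule functional_tlift[OF vB vH _ _ _ R_sub[OF w]])
    (simp_all add: functional_H f biform_iff lf lform_smult_H[OF f])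

lemma lf_psi [lf]: "lform H f \<Longrightarrow> lform R (\<lambda>w. f (psi w))"
proof -
  assume f: "lform H f"
  have "lform R (tform B H (\<lambda>c h. counit C c * f h))"
    unfolding lform_R by (rule lform_tform_Rspace) (intro lf f)+
  then show ?thesis
    using lform_cong[OF vR, of "\<lambda>w. f (psi w)"] psi[OF f] by blast
qed

lemma linear_psi: "linear_map R H psi"
  by (rule linear_mapI[OF vR vH]) (simp_all add: functional_H lf_psi)

lemma psi_cg: "x \<in> vcarrier D \<Longrightarrow> psi (cg (Eb x) h) = E x * h"
proof (rule H_eqI)
  fix f assume x: "x \<in> vcarrier D" and f: "lform H f"
  have "f (psi (cg (Eb x) h)) = T x (\<lambda>s t. counit C (Eb s) * f (E t * h))"
    unfolding psi[OF f cg_in_R] by (rule tform_cg[OF _ _ x]) (intro lf f)+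
  also have "\<dots> = T x (\<lambda>s t. counit D s * f (E t * h))"
    by (rule T_cong) (simp add: counit_Eb)
  also have "\<dots> = f (E x * h)" by (rule T_counit(1)[OF _ x]) (intro lf f)
  finally show "f (psi (cg (Eb x) h)) = f (E x * h)" .
qed

section \<open>Verification that \<open>psi\<close> is a partial corepresentation\<close>

lemma lf_R_arg [lf]: "(\<And>a b. lform V (\<lambda>y. F y a b)) \<Longrightarrow> lform V (\<lambda>y. sw R x (F y))"
  by (rule lform_sw_arg[OF preR])

text \<open>The factor \<open>E s\<close> that \<open>psi\<close> produces in the first leg stands
  directly before \<open>p a\<close>, and \<open>E_p\<close> absorbs it.\<close>

lemma sw_psi:
  assumes G: "\<And>b. lform H (\<lambda>a. G a b)" "\<And>a. lform H (G a)" and x: "x \<in> vcarrier D"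
  shows "sw R (cg (Eb x) h) (\<lambda>a b. G (psi a) (psi b)) =
    T3 x (\<lambda>a u c. sw H h (\<lambda>h1 h2. G (p a * S (p c) * h1) (E u * h2)))"
proof -
  have bf: "biform R R (\<lambda>a b. G (psi a) (psi b))"
    unfolding biform_iff by (intro conjI ballI lf G)
  have "sw R (cg (Eb x) h) (\<lambda>a b. G (psi a) (psi b)) =
    T4 x (\<lambda>s a u c. sw H h (\<lambda>h1 h2. G (psi (cg (Eb s) (p a * S (p c) * h1))) (psi (cg (Eb u) h2))))"
    by (rule sw_R_cg[OF bf x])
  also have "\<dots> = T4 x (\<lambda>s a u c. sw H h (\<lambda>h1 h2. G (E s * (p a * S (p c) * h1)) (E u * h2)))"
    by (rule T_cong, rule T_cong, rule T_cong, rule swH_cong) (simp add: psi_cg)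
  also have "\<dots> = T x (\<lambda>m w. T m (\<lambda>s a. T w (\<lambda>u c. sw H h (\<lambda>h1 h2. G (E s * p a * (S (p c) * h1)) (E u * h2)))))"
    by (simp add: coassocD mult.assoc)
  also have "\<dots> = T x (\<lambda>a w. T w (\<lambda>u c. sw H h (\<lambda>h1 h2. G (p a * (S (p c) * h1)) (E u * h2))))"
    by (rule T_cong, rule E_p, assumption) (intro lf G)
  finally show ?thesis by (simp add: mult.assoc)
qed

text \<open>The analogue of \<open>E\<close> for \<open>psi\<close> in place of \<open>p\<close>:
  the legs of \<open>h\<close> cancel, and \<open>E u\<close> is absorbed by \<open>p c\<close>
  inside \<open>S\<close>. Besides its use for the axioms, this identifies the composite of
  \<open>Eb\<close> with a lift of \<open>psi\<close>.\<close>

lemma psi_S_psi: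
  assumes f: "lform H f" and x: "x \<in> vcarrier D"
  shows "sw R (cg (Eb x) h) (\<lambda>a b. f (psi a * S (psi b))) = f (E x) * e h"
proof -
  have hh: "sw H h (\<lambda>h1 h2. f (k * h1 * S (l * h2))) = e h * f (k * S l)" for k l
  proof -
    have "sw H h (\<lambda>h1 h2. f (k * h1 * S (l * h2))) = sw H h (\<lambda>h1 h2. f (k * (h1 * S h2) * S l))"
      by (simp add: S_mult mult.assoc)
    also have "\<dots> = e h * f (k * 1 * S l)" by (rule antipode_right) (intro lf f)
    finally show ?thesis by simp
  qed
  have "sw R (cg (Eb x) h) (\<lambda>a b. f (psi a * S (psi b))) =
    T3 x (\<lambda>a u c. sw H h (\<lambda>h1 h2. f (p a * S (p c) * h1 * S (E u * h2))))"
    by (rule sw_psi[OF _ _ x]) (intro lf f)+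
  also have "\<dots> = e h * T x (\<lambda>a w. T w (\<lambda>u c. f (p a * S (E u * p c))))"
    by (simp only: hh sw_const_mult) (simp add: S_mult mult.assoc)
  also have "T x (\<lambda>a w. T w (\<lambda>u c. f (p a * S (E u * p c)))) = T x (\<lambda>a w. f (p a * S (p w)))"
    by (rule T_cong, rule E_p, assumption) (intro lf f)
  also have "\<dots> = f (E x)" by (rule E[OF f, symmetric])
  finally show ?thesis by (simp add: mult.commute)
qed

lemma psi_counit: "w \<in> vcarrier R \<Longrightarrow> e (psi w) = counit R w"
  by (rule lform_R_eqI[of "\<lambda>w. e (psi w)" "counit R"])
    (auto simp del: R_simps simp: psi_cg counit_R_cg counit_E intro: lf precoalgebraD(3)[OF preR])

text \<open>Both sides reduce to the sum of \<open>p a * S (p c) * h \<otimes> E u\<close>. On the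
  left \<open>E_p_comult\<close> and \<open>PR2\<close> undo the coproducts in \<open>H\<close>; on
  the right \<open>psi_S_psi\<close> contracts the last two legs.\<close>

lemma psi_pc2:
  assumes G: "\<And>b. lform H (\<lambda>a. G a b)" "\<And>a. lform H (G a)" and x: "x \<in> vcarrier D"
  shows "sw R (cg (Eb x) h) (\<lambda>a b. sw H (psi a) (\<lambda>g k. G g (k * S (psi b)))) =
    sw R (cg (Eb x) h) (\<lambda>a w. sw R w (\<lambda>b c. G (psi a) (psi b * S (psi c))))"
proof -
  have ex: "sw H h (\<lambda>h1 h2. sw H (p a * S (p c) * h1) (\<lambda>g k. G g (k * S (l * h2)))) =
    sw H (p c) (\<lambda>y z. sw H (p a) (\<lambda>g k. G (g * S z * h) (k * S (l * y))))" for a c l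
  proof -
    have "sw H h (\<lambda>h1 h2. sw H (p a * S (p c) * h1) (\<lambda>g k. G g (k * S (l * h2)))) =
      sw H h (\<lambda>h1 h2. sw H (p a * S (p c)) (\<lambda>g k. sw H h1 (\<lambda>k1 k2. G (g * k1) (k * k2 * S (l * h2)))))"
      by (rule swH_cong, rule comult_mult) (intro lf G)+
    also have "\<dots> = sw H (p a * S (p c)) (\<lambda>g k. sw H h (\<lambda>h1 h2. sw H h1 (\<lambda>k1 k2. G (g * k1) (k * k2 * S (l * h2)))))"
      by (rule sw_swap)
    also have "\<dots> = sw H (p a * S (p c)) (\<lambda>g k. sw H h (\<lambda>k1 w. sw H w (\<lambda>k2 h2. G (g * k1) (k * (k2 * S h2) * S l))))"
      by (simp add: coassocH S_mult mult.assoc)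
    also have "\<dots> = sw H (p a * S (p c)) (\<lambda>g k. sw H h (\<lambda>k1 w. e w * G (g * k1) (k * 1 * S l)))"
      by (rule swH_cong, rule swH_cong, rule antipode_right) (intro lf G)
    also have "\<dots> = sw H (p a * S (p c)) (\<lambda>g k. G (g * h) (k * 1 * S l))"
      by (rule swH_cong, rule swH_counit(2)) (intro lf G)
    also have "\<dots> = sw H (p a) (\<lambda>g k. sw H (S (p c)) (\<lambda>y z. G (g * y * h) (k * z * 1 * S l)))"
      by (rule comult_mult) (intro lf G)+
    also have "\<dots> = sw H (p a) (\<lambda>g k. sw H (p c) (\<lambda>y z. G (g * S z * h) (k * S y * 1 * S l)))"
      by (rule swH_cong, rule comult_S) (intro lf G)+
    also have "\<dots> = sw H (p c) (\<lambda>y z. sw H (p a) (\<lambda>g k. G (g * S z * h) (k * S y * 1 * S l)))"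
      by (rule sw_swap)
    finally show ?thesis by (simp add: S_mult mult.assoc)
  qed
  have "sw R (cg (Eb x) h) (\<lambda>a b. sw H (psi a) (\<lambda>g k. G g (k * S (psi b)))) =
    T3 x (\<lambda>a u c. sw H h (\<lambda>h1 h2. sw H (p a * S (p c) * h1) (\<lambda>g k. G g (k * S (E u * h2)))))"
    by (rule sw_psi[OF _ _ x]) (intro lf G)+
  also have "\<dots> = T3 x (\<lambda>a u c. sw H (p c) (\<lambda>y z. sw H (p a) (\<lambda>g k. G (g * S z * h) (k * S (E u * y)))))"
    by (simp add: ex)
  also have "\<dots> = T3 x (\<lambda>a b c. sw H (p a) (\<lambda>g k. G (g * S (p c) * h) (k * S (p b))))"
    by (rule T_cong, rule E_p_comult) (intro lf G)+
  also have "\<dots> = T x (\<lambda>s c. T s (\<lambda>a b. sw H (p a) (\<lambda>g k. G (g * S (p c) * h) (k * S (p b)))))"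
    by (simp add: coassocD)
  also have "\<dots> = T x (\<lambda>s c. T s (\<lambda>a u. G (p a * S (p c) * h) (E u)))"
    by (rule T_cong, rule PR2) (intro lf G)+
  finally have L: "sw R (cg (Eb x) h) (\<lambda>a b. sw H (psi a) (\<lambda>g k. G g (k * S (psi b)))) =
    T3 x (\<lambda>a u c. G (p a * S (p c) * h) (E u))" by (simp add: coassocD)
  have bf: "biform R R (\<lambda>a w. sw R w (\<lambda>b c. G (psi a) (psi b * S (psi c))))"
    unfolding biform_iff by (intro conjI ballI lf G)
  have "sw R (cg (Eb x) h) (\<lambda>a w. sw R w (\<lambda>b c. G (psi a) (psi b * S (psi c)))) =
    T4 x (\<lambda>s a u c. sw H h (\<lambda>h1 h2. sw R (cg (Eb u) h2) (\<lambda>b c'. G (psi (cg (Eb s) (p a * S (p c) * h1))) (psi b * S (psi c')))))"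
    by (rule sw_R_cg[OF bf x])
  also have "\<dots> = T4 x (\<lambda>s a u c. sw H h (\<lambda>h1 h2. G (psi (cg (Eb s) (p a * S (p c) * h1))) (E u) * e h2))"
    by (rule T_cong, rule T_cong, rule T_cong, rule swH_cong, rule psi_S_psi) (intro lf G)
  also have "\<dots> = T4 x (\<lambda>s a u c. sw H h (\<lambda>h1 h2. e h2 * G (E s * p a * (S (p c) * h1)) (E u)))"
    by (rule T_cong, rule T_cong, rule T_cong, rule swH_cong) (simp add: psi_cg mult.assoc mult.commute)
  also have "\<dots> = T4 x (\<lambda>s a u c. G (E s * p a * (S (p c) * h)) (E u))"
    by (rule T_cong, rule T_cong, rule T_cong, rule swH_counit(2)) (intro lf G)
  also have "\<dots> = T x (\<lambda>m w. T m (\<lambda>s a. T w (\<lambda>u c. G (E s * p a * (S (p c) * h)) (E u))))"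
    by (simp add: coassocD)
  also have "\<dots> = T x (\<lambda>a w. T w (\<lambda>u c. G (p a * (S (p c) * h)) (E u)))"
    by (rule T_cong, rule E_p, assumption) (intro lf G)
  finally show ?thesis using L by (simp add: mult.assoc)
qed

text \<open>Both sides reduce to the sum of \<open>E s \<otimes> E u * h\<close>. On the left
  \<open>p_E\<close> undoes the coproduct of \<open>E u\<close>; on the right coassociativity brings
  the first two legs together for \<open>psi_S_psi\<close>.\<close>

lemma psi_pc3:
  assumes G: "\<And>b. lform H (\<lambda>a. G a b)" "\<And>a. lform H (G a)" and x: "x \<in> vcarrier D"
  shows "sw R (cg (Eb x) h) (\<lambda>a b. sw H (psi b) (\<lambda>g k. G (psi a * S g) k)) =
    sw R (cg (Eb x) h) (\<lambda>a w. sw R w (\<lambda>b c. G (psi a * S (psi b)) (psi c)))"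
proof -
  have ex: "sw H h (\<lambda>h1 h2. sw H (l * h2) (\<lambda>g k. G (m * h1 * S g) k)) =
    sw H l (\<lambda>y z. G (m * S y) (z * h))" for l m
  proof -
    have "sw H h (\<lambda>h1 h2. sw H (l * h2) (\<lambda>g k. G (m * h1 * S g) k)) =
      sw H h (\<lambda>h1 h2. sw H l (\<lambda>y z. sw H h2 (\<lambda>k1 k2. G (m * h1 * S (y * k1)) (z * k2))))"
      by (rule swH_cong, rule comult_mult) (intro lf G)+
    also have "\<dots> = sw H l (\<lambda>y z. sw H h (\<lambda>h1 h2. sw H h2 (\<lambda>k1 k2. G (m * h1 * S (y * k1)) (z * k2))))"
      by (rule sw_swap)
    also have "\<dots> = sw H l (\<lambda>y z. sw H h (\<lambda>w k2. sw H w (\<lambda>h1 k1. G (m * (h1 * S k1) * S y) (z * k2))))"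
      by (simp add: coassocH S_mult mult.assoc)
    also have "\<dots> = sw H l (\<lambda>y z. sw H h (\<lambda>w k2. e w * G (m * 1 * S y) (z * k2)))"
      by (rule swH_cong, rule swH_cong, rule antipode_right) (intro lf G)
    also have "\<dots> = sw H l (\<lambda>y z. G (m * 1 * S y) (z * h))"
      by (rule swH_cong, rule swH_counit(1)) (intro lf G)
    finally show ?thesis by simp
  qed
  have "sw R (cg (Eb x) h) (\<lambda>a b. sw H (psi b) (\<lambda>g k. G (psi a * S g) k)) =
    T3 x (\<lambda>a u c. sw H h (\<lambda>h1 h2. sw H (E u * h2) (\<lambda>g k. G (p a * S (p c) * h1 * S g) k)))"
    by (rule sw_psi[OF _ _ x]) (intro lf G)+
  also have "\<dots> = T3 x (\<lambda>a u c. sw H (E u) (\<lambda>y z. G (p a * S (y * p c)) (z * h)))"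
    by (simp only: ex) (simp add: S_mult mult.assoc)
  also have "\<dots> = T3 x (\<lambda>a c u. G (p a * S (p c)) (E u * h))"
    by (rule T_cong, rule p_E) (intro lf G)+
  also have "\<dots> = T x (\<lambda>s u. T s (\<lambda>a c. G (p a * S (p c)) (E u * h)))" by (simp add: coassocD)
  also have "\<dots> = T x (\<lambda>s u. G (E s) (E u * h))"
    by (rule T_cong, rule E[symmetric]) (intro lf G)
  finally have L: "sw R (cg (Eb x) h) (\<lambda>a b. sw H (psi b) (\<lambda>g k. G (psi a * S g) k)) =
    T x (\<lambda>s u. G (E s) (E u * h))" .
  have bf: "biform R R (\<lambda>v c. sw R v (\<lambda>a b. G (psi a * S (psi b)) (psi c)))"
    unfolding biform_iff by (intro conjI ballI lf G)
  have "sw R (cg (Eb x) h) (\<lambda>a w. sw R w (\<lambda>b c. G (psi a * S (psi b)) (psi c))) =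
    sw R (cg (Eb x) h) (\<lambda>v c. sw R v (\<lambda>a b. G (psi a * S (psi b)) (psi c)))"
    by (rule coassoc[OF coR, symmetric])
  also have "\<dots> = T4 x (\<lambda>s a u c. sw H h (\<lambda>h1 h2. sw R (cg (Eb s) (p a * S (p c) * h1)) (\<lambda>a b. G (psi a * S (psi b)) (psi (cg (Eb u) h2)))))"
    by (rule sw_R_cg[OF bf x])
  also have "\<dots> = T4 x (\<lambda>s a u c. sw H h (\<lambda>h1 h2. G (E s) (psi (cg (Eb u) h2)) * e (p a * S (p c) * h1)))"
    by (rule T_cong, rule T_cong, rule T_cong, rule swH_cong, rule psi_S_psi) (intro lf G)
  also have "\<dots> = T4 x (\<lambda>s a u c. e (p a) * e (p c) * sw H h (\<lambda>h1 h2. e h1 * G (E s) (E u * h2)))"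
    unfolding sw_const_mult[symmetric]
    by (rule T_cong, rule T_cong, rule T_cong, rule swH_cong) (simp add: psi_cg)
  also have "\<dots> = T4 x (\<lambda>s a u c. e (p a) * e (p c) * G (E s) (E u * h))"
    by (subst swH_counit(1), (intro lf G)+) (rule refl)
  also have "\<dots> = T x (\<lambda>s u. G (E s) (E u * h))"
    by (rule T_cong, rule coact_T_counit', (intro lf G)+)
  finally show ?thesis using L by simp
qed

lemma psi_corep: "partial_corepresentation H R psi"
  unfolding partial_corepresentation_iff[OF preR linear_psi] pc_at_def
proof (intro ballI conjI allI impI)
  fix w assume w: "w \<in> vcarrier R"
  show "e (psi w) = counit R w" by (rule psi_counit[OF w])
  fix G assume "biform H H G"
  then have G: "\<And>b. lform H (\<lambda>a. G a b)" "\<And>a. lform H (G a)" by (simp_all add: biform_H)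
  show "sw R w (\<lambda>a b. sw H (psi a) (\<lambda>g k. G g (k * S (psi b)))) =
    sw R w (\<lambda>a w. sw R w (\<lambda>b c. G (psi a) (psi b * S (psi c))))"
    by (rule lform_R_eqI[OF lf_swR lf_swR _ w]) (rule psi_pc2[OF G])
  show "sw R w (\<lambda>a b. sw H (psi b) (\<lambda>g k. G (psi a * S g) k)) =
    sw R w (\<lambda>a w. sw R w (\<lambda>b c. G (psi a * S (psi b)) (psi c)))"
    by (rule lform_R_eqI[OF lf_swR lf_swR _ w]) (rule psi_pc3[OF G])
qed

text \<open>The projection c \<otimes> h \<mapsto> \<epsilon>(h) c. It will turn out to be
  \<open>Eb\<close> composed with the lift of \<open>psi\<close>, so together with
  \<open>psi\<close> it recovers both tensor factors.\<close>

definition J where "J w = tlift B H B (\<lambda>c h. smult C (e h) c) w"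

lemma linear_J: "linear_map R B J"
proof -
  have "bilinear_map B H B (\<lambda>c h. smult C (e h) c)"
  proof -
    interpret vector_space "smult C" using vC by (simp add: is_vspace_def)
    have "e (x + y) = e x + e y" "e (smult H c x) = c * e x" for x y c
      using lf_counit by (simp_all add: lform_iff)
    moreover have "smult C k c \<in> vcarrier B" if "c \<in> vcarrier B" for k c
      using vs_scale[OF vB that] by simp
    ultimately show ?thesis unfolding bilinear_map_def linear_map_def restrict_to_simps(2)
      by (auto simp del: restrict_to_simps(1) simp: scale_left_distrib scale_right_distrib mult.commute)
  qed
  from linear_map_tlift[OF vB vH vB this] show ?thesis
    unfolding linear_map_def J_def[abs_def] using R_sub R_simps(2) smult_tensor by (metis (no_types, lifting))
qed

lemma lf_J [lf]: "lform B f \<Longrightarrow> lform R (\<lambda>w. f (J w))"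
  by (rule lform_comp[OF linear_J])

lemma J_cg:
  assumes f: "lform B f" and x: "x \<in> vcarrier D"
  shows "f (J (cg (Eb x) h)) = e h * f (Eb x)"
proof -
  obtain g where g: "functional B g" "\<And>y. y \<in> vcarrier B \<Longrightarrow> g y = f y"
    by (rule functional_extend[OF vB f]) blast
  note lg = functional_lform[OF g(1)]
  have "g (J (cg (Eb x) h)) = tform B H (\<lambda>c h. e h * g c) (cg (Eb x) h)"
    unfolding J_def
    by (rule functional_tlift[OF vB vH g(1) _ _ R_sub[OF cg_in_R]])
      (use g(1) in \<open>simp_all add: biform_iff lf lg functional_def\<close>)
  also have "\<dots> = T x (\<lambda>s t. e (E t * h) * g (Eb s))"
    by (rule tform_cg[OF _ _ x]) (intro lf lg)+
  also have "\<dots> = T x (\<lambda>s t. counit D t * (e h * g (Eb s)))"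
    by (rule T_cong) (simp add: counit_E)
  also have "\<dots> = e h * g (Eb x)" by (rule T_counit(2)[OF _ x]) (intro lf lg)
  finally show ?thesis using g(2)[OF linear_map_in[OF linear_J cg_in_R]] g(2)[OF B_in[OF x]] by simp
qed

lemma lform_C_B: "lform C f \<Longrightarrow> lform B f"
  by (rule lform_mono[OF _ subcoalgebra_subset[OF subcoalgebra_B]])

lemma J_map: "coalgebra_map R C J"
proof (rule coalgebra_mapI[OF preR preC])
  show lin: "linear_map R C J"
    using linear_J subcoalgebra_subset[OF subcoalgebra_B] unfolding linear_map_def restrict_to_simps by blast
  fix w assume w: "w \<in> vcarrier R"
  have lR: "lform R (\<lambda>w. f (J w))" if "lform C f" for f
    by (rule lform_comp[OF lin that])
  show "counit C (J w) = counit R w"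
  proof (rule lform_R_eqI[OF lR[OF lf_counitC] precoalgebraD(3)[OF preR] _ w])
    show "counit C (J (cg (Eb x) h)) = counit R (cg (Eb x) h)" if "x \<in> vcarrier D" for x h
      using J_cg[OF lf_counitB that, of h] counit_R_cg[OF that, of h] counit_Eb[OF that] by simp
  qed
  fix G assume "biform C C G"
  then have "biform B B G" by (rule biform_mono[OF _ subcoalgebra_subset[OF subcoalgebra_B]])
  note G = this and GC = \<open>biform C C G\<close>
  have JB: "J v \<in> vcarrier B" if "v \<in> vcarrier R" for v by (rule linear_map_in[OF linear_J that])
  have bf: "biform R R (\<lambda>a b. G (J a) (J b))" by (rule biform_comp[OF linear_J linear_J G])
  show "sw C (J w) G = sw R w (\<lambda>a b. G (J a) (J b))"
  proof (rule lform_R_eqI[OF lR[OF lf_swC] lf_swR _ w])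
    fix x h assume x: "x \<in> vcarrier D"
    have GE: "lform B (\<lambda>y. G y (Eb u))" "lform B (G (Eb u))" "lform B (\<lambda>y. G y (J v))"
      if "u \<in> vcarrier D" "v \<in> vcarrier R" for u v
      using G B_in[OF that(1)] JB[OF that(2)] unfolding biform_iff by blast+
    have GJ: "G (J (cg (Eb s) k)) (J (cg (Eb u) l)) = e k * (e l * G (Eb s) (Eb u))"
      if "s \<in> vcarrier D" "u \<in> vcarrier D" for s k u l
      using J_cg[OF GE(3)[OF that(2) cg_in_R] that(1)] J_cg[OF GE(2)[OF that(1) cg_in_R] that(2)] by simp
    have lG: "lform D (\<lambda>u. G (Eb s) (Eb u))" if "s \<in> vcarrier D" for s
      by (rule lf_EbB[OF GE(2)[OF that cg_in_R]])
    have "sw R (cg (Eb x) h) (\<lambda>a b. G (J a) (J b)) =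
      T4 x (\<lambda>s a u c. sw H h (\<lambda>h1 h2. G (J (cg (Eb s) (p a * S (p c) * h1))) (J (cg (Eb u) h2))))"
      by (rule sw_R_cg[OF bf x])
    also have "\<dots> = T4 x (\<lambda>s a u c. sw H h (\<lambda>h1 h2. e (p a) * e (p c) * G (Eb s) (Eb u) * (e h1 * e h2)))"
      by (rule T_cong, rule T_cong, rule T_cong, rule swH_cong) (simp add: GJ)
    also have "\<dots> = T4 x (\<lambda>s a u c. e (p a) * e (p c) * G (Eb s) (Eb u) * e h)"
      by (simp only: sw_const_mult swH_counit(1)[OF lf_counit])
    also have "\<dots> = T x (\<lambda>s t. T3 t (\<lambda>a u c. e (p a) * e (p c) * G (Eb s) (Eb u))) * e h"
      by (simp only: sw_mult_const)
    also have "T x (\<lambda>s t. T3 t (\<lambda>a u c. e (p a) * e (p c) * G (Eb s) (Eb u))) = T x (\<lambda>s t. G (Eb s) (Eb t))"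
      by (rule T_cong, rule coact_T_counit'[OF lG])
    also have "\<dots> = sw C (Eb x) G"
      by (rule sw_coalgebra_map[OF preD preC Eb_map GC x, symmetric])
    finally show "sw C (J (cg (Eb x) h)) G = sw R (cg (Eb x) h) (\<lambda>a b. G (J a) (J b))"
      using J_cg[OF lform_C_B[OF lf_swC] x, of h G] by (simp add: mult.commute)
  qed
qed

text \<open>As an element of the tensor product this is the sum of
  \<open>Eb s \<otimes> p t\<close>, since \<open>E_p\<close> absorbs the factor \<open>E\<close> of
  each generator. Written with generators it visibly lies in the cosmash coproduct.\<close>

definition Phi where "Phi x = swv R D x (\<lambda>s t. cg (Eb s) (p t))"

lemma Phi_in: "Phi x \<in> vcarrier R"
  unfolding Phi_def by (rule swv_in[OF preD vR cg_in_R])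

lemma lform_Phi: "lform R f \<Longrightarrow> f (Phi x) = T x (\<lambda>s t. f (cg (Eb s) (p t)))"
  unfolding Phi_def by (rule lform_swv[OF preD vR cg_in_R])

lemma functional_Phi:
  assumes f: "functional (tensor B H) f"
  shows "f (Phi x) = T x (\<lambda>s t. f (tens B H (Eb s) (p t)))"
proof -
  note l = functional_tens_lform[OF f]
  have fR: "functional R f" using f by (simp add: functional_def)
  have "f (Phi x) = T x (\<lambda>s t. f (cg (Eb s) (p t)))" by (rule lform_Phi[OF functional_lform[OF fR]])
  also have "\<dots> = T x (\<lambda>s t. T s (\<lambda>m n. f (tens B H (Eb m) (E n * p t))))"
    by (rule T_cong, rule functional_cg_Eb[OF f])
  also have "\<dots> = T x (\<lambda>m w. T w (\<lambda>n t. f (tens B H (Eb m) (E n * p t))))" by (rule coassocD)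
  also have "\<dots> = T x (\<lambda>m w. f (tens B H (Eb m) (p w)))"
    by (rule T_cong, rule E_p, assumption) (intro lf l)
  finally show ?thesis .
qed

section \<open>\<open>Phi\<close> as a coalgebra map, and its inverse\<close>

lemma lf_Phi: "lform R f \<Longrightarrow> lform D (\<lambda>x. f (Phi x))"
  by (simp add: lform_Phi lf)

text \<open>In the coproduct of \<open>Phi x\<close> the leg \<open>S (p c)\<close> meets the
  coproduct of \<open>p t\<close>; \<open>PR5\<close> turns the two into a \<open>q y\<close>, which
  \<open>p_EbB\<close> discards. Four consecutive legs of \<open>x\<close> remain, already in the
  right order.\<close>

lemma Phi_map: "coalgebra_map D R Phi"
proof (rule coalgebra_mapI[OF preD preR])
  show "linear_map D R Phi"
    by (rule linear_mapI[OF vD vR Phi_in]) (rule lf_Phi[OF functional_lform])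
  fix x assume x: "x \<in> vcarrier D"
  have "counit R (Phi x) = T x (\<lambda>s t. counit R (cg (Eb s) (p t)))"
    by (rule lform_Phi[OF precoalgebraD(3)[OF preR]])
  also have "\<dots> = T x (\<lambda>s t. counit D s * counit D t)"
    by (rule T_cong) (simp only: counit_R_cg counit_p)
  also have "\<dots> = counit D x" by (rule T_counit(1)[OF precoalgebraD(3)[OF preD] x])
  finally show "counit R (Phi x) = counit D x" .
  fix M assume bM: "biform R R M"
  have M: "lform R (\<lambda>a. M a (cg c h))" "lform R (M (cg c h))" "lform R (\<lambda>a. M a (Phi y))" for c h y
    using bM cg_in_R Phi_in unfolding biform_iff by blast+
  have "sw R (Phi x) M = T x (\<lambda>s t. sw R (cg (Eb s) (p t)) M)" by (rule lform_Phi[OF lf_swR])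
  also have "\<dots> = T x (\<lambda>s t. T4 s (\<lambda>m a u c. sw H (p t) (\<lambda>h1 h2. M (cg (Eb m) (p a * S (p c) * h1)) (cg (Eb u) h2))))"
    by (rule T_cong, rule sw_R_cg[OF bM])
  also have "\<dots> = T x (\<lambda>m w. T w (\<lambda>a w'. T w' (\<lambda>u k. T k (\<lambda>c t. sw H (p t) (\<lambda>h1 h2.
      M (cg (Eb m) (p a * (S (p c) * h1))) (cg (Eb u) h2))))))"
    by (simp add: coassocD mult.assoc)
  also have "\<dots> = T x (\<lambda>m w. T w (\<lambda>a w'. T w' (\<lambda>u k. T k (\<lambda>y t. M (cg (Eb m) (p a * q y)) (cg (Eb u) (p t))))))"
    by (rule T_cong, rule T_cong, rule T_cong, rule PR5) (intro lf M)+
  also have "\<dots> = T x (\<lambda>m w. T w (\<lambda>s t. T3 s (\<lambda>a u y. M (cg (Eb m) (p a * q y)) (cg (Eb u) (p t)))))"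
    by (simp add: coassocD)
  also have "\<dots> = T x (\<lambda>m w. T w (\<lambda>s t. T s (\<lambda>a u. M (cg (Eb m) (p a)) (cg (Eb u) (p t)))))"
    by (rule T_cong, rule T_cong, rule p_EbB) (intro lf M)+
  also have "\<dots> = T x (\<lambda>a b. T a (\<lambda>m n. T b (\<lambda>u t. M (cg (Eb m) (p n)) (cg (Eb u) (p t)))))"
    by (simp add: coassocD)
  also have "\<dots> = T x (\<lambda>a b. M (Phi a) (Phi b))"
    by (simp add: lform_Phi[OF M(3)] lform_Phi[OF M(2)])
  finally show "sw R (Phi x) M = T x (\<lambda>a b. M (Phi a) (Phi b))" .
qed

lemma Phi_bij: "bij_betw Phi (vcarrier D) (vcarrier R)"
proof -
  obtain F where F: "coalgebra_map R D F" "\<And>w. w \<in> vcarrier R \<Longrightarrow> p (F w) = psi w"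
    using univ_ex[OF coR psi_corep] by blast
  have FD: "F w \<in> vcarrier D" if "w \<in> vcarrier R" for w by (rule coalgebra_map_in[OF F(1) that])
  \<comment> \<open>Rigidity of \<open>D\<close> decides: the composite lies over \<open>p\<close>,
    because \<open>psi (Phi x) = p x\<close> by \<open>E_p\<close>.\<close>
  have "F (Phi x) = x" if x: "x \<in> vcarrier D" for x
  proof (rule univ_id[OF _ _ x])
    show "coalgebra_map D D (\<lambda>x. F (Phi x))" by (rule coalgebra_map_comp[OF preD preR preD Phi_map F(1)])
    fix x assume x: "x \<in> vcarrier D"
    have "psi (Phi x) = p x"
    proof (rule H_eqI)
      fix f assume f: "lform H f"
      have "f (psi (Phi x)) = T x (\<lambda>s t. f (psi (cg (Eb s) (p t))))" by (rule lform_Phi[OF lf_psi[OF f]])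
      also have "\<dots> = T x (\<lambda>s t. f (E s * p t))" by (rule T_cong) (simp add: psi_cg)
      also have "\<dots> = f (p x)" by (rule E_p[OF x f])
      finally show "f (psi (Phi x)) = f (p x)" .
    qed
    then show "p (F (Phi x)) = p x" using F(2)[OF Phi_in] by simp
  qed
  \<comment> \<open>Both are coalgebra maps from \<open>R\<close> into the cofree coalgebra, so
    comparing projections is enough; for either map the projection is the sum of
    \<open>psi a * S (psi b)\<close> over the coproduct of \<open>w\<close>.\<close>
  moreover have EbF: "Eb (F w) = J w" if w: "w \<in> vcarrier R" for w
  proof (rule cofree_unique[OF cofree_R coR coalgebra_map_comp[OF preR preD preC F(1) Eb_map] J_map _ w])
    fix w assume w: "w \<in> vcarrier R"
    show "r (Eb (F w)) = r (J w)"
    proof (rule H_eqI)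
      fix f assume f: "lform H f"
      have lr: "lform B (\<lambda>c. f (r c))" by (rule lform_C_B) (intro lf f)
      have bf: "biform D D (\<lambda>a b. f (p a * S (p b)))" unfolding biform_iff by (intro conjI ballI lf f)
      have "f (r (Eb (F w))) = T (F w) (\<lambda>a b. f (p a * S (p b)))"
        using r_Eb[OF FD[OF w]] E[OF f] by simp
      also have "\<dots> = sw R w (\<lambda>a b. f (p (F a) * S (p (F b))))"
        by (rule sw_coalgebra_map[OF preR preD F(1) bf w])
      also have "\<dots> = sw R w (\<lambda>a b. f (psi a * S (psi b)))"
        by (rule sw_cong[OF preR]) (simp only: F(2))
      also have "\<dots> = f (r (J w))"
        by (rule lform_R_eqI[OF lf_swR lf_J[OF lr] _ w]) (simp add: psi_S_psi f J_cg[OF lr] r_Eb mult.commute)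
      finally show "f (r (Eb (F w))) = f (r (J w))" .
    qed
  qed
  \<comment> \<open>\<open>Phi (F w)\<close> is the sum of \<open>Eb (F a) \<otimes> p (F b)\<close>
    over the coproduct of \<open>w\<close>, hence of \<open>J a \<otimes> psi b\<close>; on
    generators the counit laws reduce this to \<open>w\<close>.\<close>
  have "Phi (F w) = w" if w: "w \<in> vcarrier R" for w
  proof (rule functional_eqI[of "tensor B H"])
    fix f assume f: "functional (tensor B H) f"
    have fR: "functional R f" using f by (simp add: functional_def)
    define K where "K c h = f (tens B H c h)" for c h
    have K: "lform B (\<lambda>c. K c h)" "lform H (K c)" for c h
      unfolding K_def by (rule functional_tens_lform[OF f])+
    have bfD: "biform D D (\<lambda>a b. K (Eb a) (p b))" unfolding biform_iff by (intro conjI ballI lf K)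
    have bfR: "biform R R (\<lambda>a b. K (J a) (psi b))" unfolding biform_iff by (intro conjI ballI lf K)
    have "f (Phi (F w)) = T (F w) (\<lambda>a b. K (Eb a) (p b))" unfolding functional_Phi[OF f] K_def ..
    also have "\<dots> = sw R w (\<lambda>a b. K (Eb (F a)) (p (F b)))"
      by (rule sw_coalgebra_map[OF preR preD F(1) bfD w])
    also have "\<dots> = sw R w (\<lambda>a b. K (J a) (psi b))"
      by (rule sw_cong[OF preR]) (simp only: EbF F(2))
    also have "\<dots> = f w"
    proof (rule lform_R_eqI[OF lf_swR functional_lform[OF fR] _ w])
      fix x h assume x: "x \<in> vcarrier D"
      have "sw R (cg (Eb x) h) (\<lambda>a b. K (J a) (psi b)) =
        T4 x (\<lambda>s a u c. sw H h (\<lambda>h1 h2. K (J (cg (Eb s) (p a * S (p c) * h1))) (psi (cg (Eb u) h2))))"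
        by (rule sw_R_cg[OF bfR x])
      also have "\<dots> = T4 x (\<lambda>s a u c. sw H h (\<lambda>h1 h2. e (p a) * e (p c) * (e h1 * K (Eb s) (E u * h2))))"
        by (rule T_cong, rule T_cong, rule T_cong, rule swH_cong) (simp add: J_cg[OF K(1)] psi_cg)
      also have "\<dots> = T4 x (\<lambda>s a u c. e (p a) * e (p c) * sw H h (\<lambda>h1 h2. e h1 * K (Eb s) (E u * h2)))"
        by (simp only: sw_const_mult)
      also have "\<dots> = T4 x (\<lambda>s a u c. e (p a) * e (p c) * K (Eb s) (E u * h))"
        by (subst swH_counit(1), (intro lf K)+) (rule refl)
      also have "\<dots> = T x (\<lambda>s t. K (Eb s) (E t * h))"
        by (rule T_cong, rule coact_T_counit', (intro lf K)+)
      also have "\<dots> = f (cg (Eb x) h)" unfolding K_def by (rule functional_cg_Eb[OF f x, symmetric])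
      finally show "sw R (cg (Eb x) h) (\<lambda>a b. K (J a) (psi b)) = f (cg (Eb x) h)" .
    qed
    finally show "f (Phi (F w)) = f w" .
  qed (simp add: vector_space_fscale)
  ultimately show ?thesis
    using FD Phi_in by (intro bij_betw_byWitness[where f' = F]) blast+
qed

lemma isomorphic_R: "coalgebra_isomorphic D R"
  unfolding coalgebra_isomorphic_def using coD coR Phi_map Phi_bij by blast

end

section \<open>The universal coalgebra\<close>

context hopf_alg
begin

text \<open>The expressions in \<open>pc_at\<close> are iterated sums of biforms, for which
  \<open>sw_restrict\<close> identifies sums taken in the subcoalgebra with those taken in
  \<open>D\<close>.\<close>

lemma pc_at_restrict:
  assumes D: "precoalgebra D" and \<omega>: "linear_map D H \<omega>" and X: "subcoalgebra X D" and x: "x \<in> X"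
  shows "pc_at H (restrict_to D X) \<omega> x \<longleftrightarrow> pc_at H D \<omega> x"
proof -
  note swX = sw_restrict[OF D X _ x] and preX = subcoalgebra_precoalgebra[OF D X]
  have nest: "sw (restrict_to D X) x (\<lambda>a w. sw (restrict_to D X) w (F a)) = sw D x (\<lambda>a w. sw D w (F a))"
    if "biform D D (\<lambda>a w. sw D w (F a))" "\<And>a. biform D D (F a)" for F
  proof -
    have "sw (restrict_to D X) x (\<lambda>a w. sw (restrict_to D X) w (F a)) =
      sw (restrict_to D X) x (\<lambda>a w. sw D w (F a))"
      by (rule sw_cong[OF preX], rule sw_restrict[OF D X that(2)]) simp
    also have "\<dots> = sw D x (\<lambda>a w. sw D w (F a))" by (rule swX[OF that(1)])
    finally show ?thesis .
  qed
  have eqs: "sw (restrict_to D X) x (\<lambda>a b. sw H (\<omega> a) (\<lambda>g h. G g (h * S (\<omega> b)))) =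
      sw D x (\<lambda>a b. sw H (\<omega> a) (\<lambda>g h. G g (h * S (\<omega> b))))"
    "sw (restrict_to D X) x (\<lambda>a w. sw (restrict_to D X) w (\<lambda>b c. G (\<omega> a) (\<omega> b * S (\<omega> c)))) =
      sw D x (\<lambda>a w. sw D w (\<lambda>b c. G (\<omega> a) (\<omega> b * S (\<omega> c))))"
    "sw (restrict_to D X) x (\<lambda>a b. sw H (\<omega> b) (\<lambda>g h. G (\<omega> a * S g) h)) =
      sw D x (\<lambda>a b. sw H (\<omega> b) (\<lambda>g h. G (\<omega> a * S g) h))"
    "sw (restrict_to D X) x (\<lambda>a w. sw (restrict_to D X) w (\<lambda>b c. G (\<omega> a * S (\<omega> b)) (\<omega> c))) =
      sw D x (\<lambda>a w. sw D w (\<lambda>b c. G (\<omega> a * S (\<omega> b)) (\<omega> c)))"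
    if G: "biform H H G" for G
  proof -
    note b = pc_biforms[OF D \<omega> G]
    show "sw (restrict_to D X) x (\<lambda>a b. sw H (\<omega> a) (\<lambda>g h. G g (h * S (\<omega> b)))) =
      sw D x (\<lambda>a b. sw H (\<omega> a) (\<lambda>g h. G g (h * S (\<omega> b))))" by (rule swX[OF b(1)])
    show "sw (restrict_to D X) x (\<lambda>a w. sw (restrict_to D X) w (\<lambda>b c. G (\<omega> a) (\<omega> b * S (\<omega> c)))) =
      sw D x (\<lambda>a w. sw D w (\<lambda>b c. G (\<omega> a) (\<omega> b * S (\<omega> c))))" by (rule nest[OF b(2,3)])
    show "sw (restrict_to D X) x (\<lambda>a b. sw H (\<omega> b) (\<lambda>g h. G (\<omega> a * S g) h)) =
      sw D x (\<lambda>a b. sw H (\<omega> b) (\<lambda>g h. G (\<omega> a * S g) h))" by (rule swX[OF b(4)])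
    show "sw (restrict_to D X) x (\<lambda>a w. sw (restrict_to D X) w (\<lambda>b c. G (\<omega> a * S (\<omega> b)) (\<omega> c))) =
      sw D x (\<lambda>a w. sw D w (\<lambda>b c. G (\<omega> a * S (\<omega> b)) (\<omega> c)))" by (rule nest[OF b(5,6)])
  qed
  show ?thesis
    unfolding pc_at_def restrict_to_simps
  proof (intro conj_cong refl all_cong1 imp_cong)
    fix G assume G: "biform H H G"
    show "(sw (restrict_to D X) x (\<lambda>a b. sw H (\<omega> a) (\<lambda>g h. G g (h * S (\<omega> b)))) =
        sw (restrict_to D X) x (\<lambda>a w. sw (restrict_to D X) w (\<lambda>b c. G (\<omega> a) (\<omega> b * S (\<omega> c))))) =
      (sw D x (\<lambda>a b. sw H (\<omega> a) (\<lambda>g h. G g (h * S (\<omega> b)))) =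
        sw D x (\<lambda>a w. sw D w (\<lambda>b c. G (\<omega> a) (\<omega> b * S (\<omega> c)))))"
      unfolding eqs[OF G] ..
    show "(sw (restrict_to D X) x (\<lambda>a b. sw H (\<omega> b) (\<lambda>g h. G (\<omega> a * S g) h)) =
        sw (restrict_to D X) x (\<lambda>a w. sw (restrict_to D X) w (\<lambda>b c. G (\<omega> a * S (\<omega> b)) (\<omega> c)))) =
      (sw D x (\<lambda>a b. sw H (\<omega> b) (\<lambda>g h. G (\<omega> a * S g) h)) =
        sw D x (\<lambda>a w. sw D w (\<lambda>b c. G (\<omega> a * S (\<omega> b)) (\<omega> c))))"
      unfolding eqs[OF G] ..
  qed
qed

lemma pc_at_span:
  assumes D: "precoalgebra D" and \<omega>: "linear_map D H \<omega>" and X: "X \<subseteq> vcarrier D"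
    and pc: "\<And>x. x \<in> X \<Longrightarrow> pc_at H D \<omega> x" and x: "x \<in> module.span (smult D) X"
  shows "pc_at H D \<omega> x"
proof -
  have eq: "f x = g x" if "lform D f" "lform D g" "\<And>x. x \<in> X \<Longrightarrow> f x = g x" for f g
    using lform_zero_span[OF precoalgebraD(1)[OF D] lform_minus[OF that(1,2)] X _ x] that(3) by simp
  have "e (\<omega> x) = counit D x"
    by (rule eq[OF lform_comp[OF \<omega> lf_counit] precoalgebraD(3)[OF D]]) (use pc in \<open>simp add: pc_at_def\<close>)
  moreover have "sw D x F = sw D x F'" if "\<And>x. x \<in> X \<Longrightarrow> sw D x F = sw D x F'" for F F'
    by (rule eq[OF lform_sw[OF D] lform_sw[OF D] that])
  ultimately show ?thesis using pc unfolding pc_at_def by blast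
qed

text \<open>Pulling bilinear forms back along \<open>F\<close> turns the identities at
  \<open>F x\<close> into those at \<open>x\<close>. Consequently the image of a lift of a partial
  corepresentation is one of the subcoalgebras whose sum is \<open>Hpar\<close>.\<close>

lemma pc_at_coalgebra_map:
  assumes Q: "precoalgebra Q" and D: "precoalgebra D" and F: "coalgebra_map Q D F"
    and p: "linear_map D H p" and pF: "\<And>x. x \<in> vcarrier Q \<Longrightarrow> p (F x) = \<omega> x"
    and pc: "pc_at H Q \<omega> x" and x: "x \<in> vcarrier Q"
  shows "pc_at H D p (F x)"
  unfolding pc_at_def
proof (intro conjI allI impI)
  show "e (p (F x)) = counit D (F x)"
    using pc F x by (simp add: pF pc_at_def coalgebra_map_def)
  fix G assume G: "biform H H G"
  note b = pc_biforms[OF D p G] and m = sw_coalgebra_map[OF Q D F]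
  have "sw D (F x) (\<lambda>a b. sw H (p a) (\<lambda>g h. G g (h * S (p b)))) =
    sw Q x (\<lambda>a b. sw H (p (F a)) (\<lambda>g h. G g (h * S (p (F b)))))" by (rule m[OF b(1) x])
  also have "\<dots> = sw Q x (\<lambda>a b. sw H (\<omega> a) (\<lambda>g h. G g (h * S (\<omega> b))))"
    by (rule sw_cong[OF Q]) (simp add: pF)
  also have "\<dots> = sw Q x (\<lambda>a w. sw Q w (\<lambda>b c. G (\<omega> a) (\<omega> b * S (\<omega> c))))"
    using pc G by (simp add: pc_at_def)
  also have "\<dots> = sw Q x (\<lambda>a w. sw Q w (\<lambda>b c. G (p (F a)) (p (F b) * S (p (F c)))))"
    by (rule sw_cong[OF Q], rule sw_cong[OF Q]) (simp add: pF)
  also have "\<dots> = sw Q x (\<lambda>a w. sw D (F w) (\<lambda>b c. G (p (F a)) (p b * S (p c))))"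
    by (rule sw_cong[OF Q], rule m[OF b(3), symmetric])
  also have "\<dots> = sw D (F x) (\<lambda>a w. sw D w (\<lambda>b c. G (p a) (p b * S (p c))))"
    by (rule m[OF b(2) x, symmetric])
  finally show "sw D (F x) (\<lambda>a b. sw H (p a) (\<lambda>g h. G g (h * S (p b)))) =
    sw D (F x) (\<lambda>a w. sw D w (\<lambda>b c. G (p a) (p b * S (p c))))" .
  have "sw D (F x) (\<lambda>a b. sw H (p b) (\<lambda>g h. G (p a * S g) h)) =
    sw Q x (\<lambda>a b. sw H (p (F b)) (\<lambda>g h. G (p (F a) * S g) h))" by (rule m[OF b(4) x])
  also have "\<dots> = sw Q x (\<lambda>a b. sw H (\<omega> b) (\<lambda>g h. G (\<omega> a * S g) h))"
    by (rule sw_cong[OF Q]) (simp add: pF)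
  also have "\<dots> = sw Q x (\<lambda>a w. sw Q w (\<lambda>b c. G (\<omega> a * S (\<omega> b)) (\<omega> c)))"
    using pc G by (simp add: pc_at_def)
  also have "\<dots> = sw Q x (\<lambda>a w. sw Q w (\<lambda>b c. G (p (F a) * S (p (F b))) (p (F c))))"
    by (rule sw_cong[OF Q], rule sw_cong[OF Q]) (simp add: pF)
  also have "\<dots> = sw Q x (\<lambda>a w. sw D (F w) (\<lambda>b c. G (p (F a) * S (p b)) (p c)))"
    by (rule sw_cong[OF Q], rule m[OF b(6), symmetric])
  also have "\<dots> = sw D (F x) (\<lambda>a w. sw D w (\<lambda>b c. G (p a * S (p b)) (p c)))"
    by (rule m[OF b(5) x, symmetric])
  finally show "sw D (F x) (\<lambda>a b. sw H (p b) (\<lambda>g h. G (p a * S g) h)) =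
    sw D (F x) (\<lambda>a w. sw D w (\<lambda>b c. G (p a * S (p b)) (p c)))" .
qed

end

lemma coalgebra_map_restrict:
  assumes "coalgebra_map D E F" "\<And>x. x \<in> vcarrier D \<Longrightarrow> F x \<in> X"
  shows "coalgebra_map D (restrict_to E X) F"
  using assms
  by (simp add: coalgebra_map_def linear_map_def sweedler_def tlift_def feval_def
      tens_cong[of "restrict_to E X" E "restrict_to E X" E])

lemma coalgebra_map_subset:
  assumes "coalgebra_map D (restrict_to E X) F" "X \<subseteq> vcarrier E"
  shows "coalgebra_map D E F"
  using assms
  by (auto simp: coalgebra_map_def linear_map_def sweedler_def tlift_def feval_def
      tens_cong[of "restrict_to E X" E "restrict_to E X" E])

text \<open>It remains to recognise \<open>Hpar\<close>, with \<open>p\<close> and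
  \<open>Ebar\<close>, as an instance of \<open>universal_pcorep\<close>; the coaction and the
  coalgebra asked for are then \<open>coa\<close> and \<open>R\<close>.\<close>

theorem theorem5p17:
  fixes H :: "('k::field, 'h::ring_1) hopf"
    and CH :: "('k, 'c::ab_group_add) coalg"
    and p :: "'c \<Rightarrow> 'h"
  assumes "hopf_algebra H"
    and "bij (antipode H)"
    and "cofree_coalgebra TYPE('c) H CH p"
    and "cofree_coalgebra TYPE('c \<times> 'h \<Rightarrow>\<^sub>0 'k) H CH p"
  shows "\<exists>coa R.
    (\<forall>x\<in>vcarrier (Hpar H CH p).
       coa (Ebar H CH p x) =
         sweedler3 (Hpar H CH p) (tensor H (base_coalgebra H CH p)) x (\<lambda>x1 x2 x3.
           tens H (base_coalgebra H CH p) (p x1 * antipode H (p x3)) (Ebar H CH p x2))) \<and>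
    symmetric_partial_comodule_coalgebra H (base_coalgebra H CH p) coa \<and>
    is_partial_cosmash_coproduct H (base_coalgebra H CH p) coa R \<and>
    coalgebra_isomorphic (Hpar H CH p) R"
proof -
  interpret hopf_alg H by unfold_locales (rule assms(1))
  note cof = assms(3)
  have co: "coalgebra CH" and linp: "linear_map CH H p" using cof by (auto simp: cofree_coalgebra_def)
  have pre: "precoalgebra CH" by (rule coalgebra_precoalgebra[OF co])
  interpret V: vector_space "smult CH" using precoalgebraD(1)[OF pre] by (simp add: is_vspace_def)
  define \<X> where "\<X> = {X. subcoalgebra X CH \<and> partial_corepresentation H (restrict_to CH X) p}"
  define P where "P = V.span (\<Union>\<X>)"
  define D where "D = Hpar H CH p"
  have D: "D = restrict_to CH P" by (simp add: D_def Hpar_def P_def \<X>_def)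
  have DP: "vcarrier D = P" by (simp add: D)
  have sub: "subcoalgebra P CH"
    unfolding P_def by (rule subcoalgebra_span_Union[OF pre]) (simp add: \<X>_def)
  note PC = subcoalgebra_subset[OF sub]
  have linX: "linear_map (restrict_to CH X) H p" if "X \<subseteq> vcarrier CH" for X
    using linp that unfolding linear_map_def restrict_to_simps by blast
  have coD: "coalgebra D" unfolding D by (rule subcoalgebra_coalgebra[OF co sub])
  have preD: "precoalgebra D" by (rule coalgebra_precoalgebra[OF coD])
  have pcX: "X \<in> \<X>" if X: "subcoalgebra X CH" "\<And>x. x \<in> X \<Longrightarrow> pc_at H CH p x" for X
    unfolding \<X>_def using X
    by (simp add: partial_corepresentation_iff[OF subcoalgebra_precoalgebra[OF pre X(1)] linX[OF subcoalgebra_subset[OF X(1)]]]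
        pc_at_restrict[OF pre linp X(1)])
  have "pc_at H CH p x" if "x \<in> \<Union>\<X>" for x
  proof -
    from that obtain X where X: "subcoalgebra X CH" "partial_corepresentation H (restrict_to CH X) p" "x \<in> X"
      by (auto simp: \<X>_def)
    then show ?thesis
      using partial_corepresentation_iff[OF subcoalgebra_precoalgebra[OF pre X(1)] linX[OF subcoalgebra_subset[OF X(1)]]]
        pc_at_restrict[OF pre linp X(1,3)] by simp
  qed
  moreover have "\<Union>\<X> \<subseteq> vcarrier CH" by (auto simp: \<X>_def subcoalgebra_def)
  \<comment> \<open>The axioms hold on each summand and are linear in the point, so the restriction
    of \<open>p\<close> to the whole sum is again a partial corepresentation.\<close>
  ultimately have "pc_at H CH p x" if "x \<in> P" for x
    using pc_at_span[OF pre linp, of "\<Union>\<X>"] that unfolding P_def by blast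
  then have pcD: "pc_at H D p x" if "x \<in> vcarrier D" for x
    using pc_at_restrict[OF pre linp sub, of x] that by (simp add: D)
  interpret pcorep H D p
  proof unfold_locales
    show "coalgebra D" by (rule coD)
    show "linear_map D H p" unfolding D by (rule linX[OF PC])
    show "e (p x) = counit D x" if "x \<in> vcarrier D" for x using pcD[OF that] by (simp add: pc_at_def)
    show "sw D x (\<lambda>a b. sw H (p a) (\<lambda>g h. G g (h * S (p b)))) =
      sw D x (\<lambda>a w. sw D w (\<lambda>b c. G (p a) (p b * S (p c))))" if "biform H H G" for G x
      using pcD[of x] that by (cases "x \<in> vcarrier D") (simp_all add: pc_at_def sw_notin)
    show "sw D x (\<lambda>a b. sw H (p b) (\<lambda>g h. G (p a * S g) h)) =
      sw D x (\<lambda>a w. sw D w (\<lambda>b c. G (p a * S (p b)) (p c)))" if "biform H H G" for G x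
      using pcD[of x] that by (cases "x \<in> vcarrier D") (simp_all add: pc_at_def sw_notin)
  qed
  define Eb where "Eb = Ebar H CH p"
  have E_map: "E_map H CH p x = E x" if x: "x \<in> vcarrier D" for x
  proof (rule H_eqI)
    fix f assume f: "lform H f"
    have "biform D D (\<lambda>a b. f (p a * S (p b)))" unfolding biform_iff by (intro conjI ballI lf f)
    then show "f (E_map H CH p x) = f (E x)"
      unfolding E_map_def D_def[symmetric] E[OF f]
      by (intro functional_sweedler[OF preD x]) (simp_all add: functional_H f)
  qed
  have linE: "linear_map D H E"
    by (rule linear_mapI[OF vD vH]) (simp_all add: functional_H lf_E)
  have "linear_map D H (E_map H CH p)"
    using linE by (simp add: linear_map_def E_map vs_add[OF vD] vs_scale[OF vD])
  \<comment> \<open>Unique existence among maps extensional on \<open>D\<close> justifies the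
    description operator in \<open>Ebar\<close>, so that \<open>Ebar\<close> has its defining
    properties.\<close>
  then have "\<exists>!F. coalgebra_map D CH F \<and> (\<forall>x\<in>vcarrier D. p (F x) = E_map H CH p x) \<and>
      F \<in> extensional (vcarrier D)"
    using cof coD unfolding cofree_coalgebra_def by blast
  from theI'[OF this] have Eb: "coalgebra_map D CH Eb" "\<And>x. x \<in> vcarrier D \<Longrightarrow> p (Eb x) = E x"
    unfolding Eb_def Ebar_def D_def[symmetric] using E_map by auto
  interpret universal_pcorep H D p CH p Eb
  proof unfold_locales
    show "cofree_coalgebra TYPE('c) H CH p" by (rule cof)
    show "cofree_coalgebra TYPE('c \<times> 'h \<Rightarrow>\<^sub>0 'k) H CH p" by (rule assms(4))
    show "coalgebra_map D CH Eb" by (rule Eb(1))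
    show "p (Eb x) = E x" if "x \<in> vcarrier D" for x by (rule Eb(2)[OF that])
    show "\<exists>F. coalgebra_map Q D F \<and> (\<forall>y\<in>vcarrier Q. p (F y) = \<omega> y)"
      if Q: "coalgebra Q" "partial_corepresentation H Q \<omega>" for Q :: "('k, 'c \<times> 'h \<Rightarrow>\<^sub>0 'k) coalg" and \<omega>
    proof -
      have lin: "linear_map Q H \<omega>" using Q(2) by (simp add: partial_corepresentation_def)
      note preQ = coalgebra_precoalgebra[OF Q(1)]
      obtain F where F: "coalgebra_map Q CH F" "\<And>y. y \<in> vcarrier Q \<Longrightarrow> p (F y) = \<omega> y"
        by (rule cofree_ex[OF assms(4) Q(1) lin]) blast
      \<comment> \<open>The lift into the cofree coalgebra has as its image one of the subcoalgebras
        summed up in \<open>Hpar\<close>, so it may be regarded as a map into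
        \<open>D\<close>.\<close>
      have "F ` vcarrier Q \<in> \<X>"
      proof (rule pcX[OF subcoalgebra_image[OF preQ pre F(1)]])
        fix y assume "y \<in> F ` vcarrier Q"
        then show "pc_at H CH p y"
          using pc_at_coalgebra_map[OF preQ pre F(1) linp F(2)] Q(2)
            partial_corepresentation_iff[OF preQ lin] by blast
      qed
      then have "F y \<in> P" if "y \<in> vcarrier Q" for y
        unfolding P_def using that by (intro V.span_base) blast
      then have "coalgebra_map Q D F" unfolding D by (rule coalgebra_map_restrict[OF F(1)])
      then show ?thesis using F(2) by blast
    qed
    \<comment> \<open>An endomorphism over \<open>p\<close> and the identity are compared as maps
      into the cofree coalgebra, where the projection determines them.\<close>
    show "F x = x" if F: "coalgebra_map D D F" "\<And>x. x \<in> vcarrier D \<Longrightarrow> p (F x) = p x" and x: "x \<in> vcarrier D" for F x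
    proof (rule cofree_unique[OF cof coD _ _ F(2) x])
      show "coalgebra_map D CH F" using F(1) PC unfolding D by (rule coalgebra_map_subset)
      have "coalgebra_map D D (\<lambda>x. x)" by (rule coalgebra_mapI[OF preD preD]) (simp_all add: linear_map_def)
      then show "coalgebra_map D CH (\<lambda>x. x)" using PC unfolding D by (rule coalgebra_map_subset)
    qed
  qed
  have base: "base_coalgebra H CH p = B" by (simp add: base_coalgebra_def D_def Eb_def)
  show ?thesis
    unfolding base unfolding D_def[symmetric] Eb_def[symmetric]
    using coa_sweedler3 symmetric_partial_comodule is_cosmash isomorphic_R by blast
qed

end
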